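(* Let $p$ be a prime number, let $F$ be either a field of characteristic $p$ or a local ring with finite residue field of characteristic $p$, let $q$ be a prime number different from $p$, and let $G$ be a finite $(p,q)$-Dress group with non-trivial $p$-core $O_p(G)$. Then $\mathrm{Prim}_F(G)$ is trivial.
   Context: For a finite group $G$, the Burnside ring $\mathrm{B}(G)$ has one generator $[X]$ for every finite $G$-set $X$, relations $[X]+[Y]=[X\sqcup Y]$, and product $[X][Y]=[X\times Y]$; additively it is free abelian on the classes $[G/H]$, $H$ running over conjugacy classes of subgroups of $G$. A subgroup $H\le G$ written as an element of $\mathrm{B}(G)$ denotes $[G/H]$. For a commutative ring $F$, the representation ring $\mathrm{R}_F(G)$ has a generator $[M]$ for every finitely generated $F[G]$-module $M$, relations $[M]+[N]=[O]$ whenever $M\oplus N\cong O$, and product given by $\otimes_F$. $\mathrm{K}_F(G)$ is the kernel of the ring homomorphism $\mathrm{B}(G)\to\mathrm{R}_F(G)$, $[X]\mapsto[F[X]]$; its elements are called relations over $F$. For $H\le G$, induction $\mathrm{K}_F(H)\to \mathrm{K}_F(G)$ sends $\sum_{U\le H} n_U U$ to $\sum n_U U$. For $N\trianglelefteq G$ with quotient map $\pi:G\to G/N$, inflation $\mathrm{K}_F(G/N)\to \mathrm{K}_F(G)$ sends $\sum n_{\bar U}\bar U$ to $\sum n_{\bar U}\pi^{-1}(\bar U)$. A relation is imprimitive if it comes, by inflation followed by induction, from a proper subquotient of $G$. $\mathrm{Prim}_F(G)$ is the quotient of $\mathrm{K}_F(G)$ by the subgroup generated by all imprimitive relations, i.e.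 by those induced from proper subgroups of $G$ and those inflated from quotients $G/N$ with $N\ne 1$. A finite group is $q$-quasi-elementary if it has a normal cyclic subgroup of $q$-power index; it is a $(p,q)$-Dress group if it has a normal $p$-subgroup with $q$-quasi-elementary quotient. The $p$-core $O_p(G)$ is the intersection of all Sylow $p$-subgroups of $G$. *)

theory Defs
  imports
    "HOL-Algebra.Elementary_Groups"
    "HOL-Algebra.Free_Abelian_Groups"
    "HOL-Algebra.Group_Action"
    "HOL-Algebra.Multiplicative_Group"
    "HOL-Algebra.QuotRing"
    "HOL-Computational_Algebra.Primes"
begin

section \<open>Grothendieck rings\<close>

text \<open>
  The ring with a generator \<open>[X]\<close> for every \<open>X \<in> S\<close>, with a relation \<open>[X] + [Y] = [Z]\<close> whenever
  \<open>is_sum X Y Z\<close>, with product induced by \<open>[X] [Y] = [pr X Y]\<close>, and with unit \<open>[u]\<close>. It is the free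
  abelian group on \<open>S\<close>, with the biadditive extension of \<open>pr\<close>, modulo the subgroup generated by
  the relations. The product is not associative or commutative before one passes to the quotient;
  \<^const>\<open>FactRing\<close> is used for its construction, which makes sense for every record.
\<close>

definition free_ring :: "'x set \<Rightarrow> ('x \<Rightarrow> 'x \<Rightarrow> 'x) \<Rightarrow> 'x \<Rightarrow> ('x \<Rightarrow>\<^sub>0 int) ring" where
  "free_ring S pr u =
     \<lparr>carrier = carrier (free_Abelian_group S),
      monoid.mult = (\<lambda>a b. frag_extend (\<lambda>X. frag_extend (\<lambda>Y. frag_of (pr X Y)) b) a),
      one = frag_of u, zero = 0, add = (+)\<rparr>"

definition sum_relations :: "'x set \<Rightarrow> ('x \<Rightarrow> 'x \<Rightarrow> 'x \<Rightarrow> bool) \<Rightarrow> ('x \<Rightarrow>\<^sub>0 int) set" where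
  "sum_relations S is_sum =
     generate (free_Abelian_group S)
       {frag_of X + frag_of Y - frag_of Z | X Y Z.
          X \<in> S \<and> Y \<in> S \<and> Z \<in> S \<and> is_sum X Y Z}"

definition grothendieck_ring ::
  "'x set \<Rightarrow> ('x \<Rightarrow> 'x \<Rightarrow> 'x \<Rightarrow> bool) \<Rightarrow> ('x \<Rightarrow> 'x \<Rightarrow> 'x) \<Rightarrow> 'x \<Rightarrow> ('x \<Rightarrow>\<^sub>0 int) set ring" where
  "grothendieck_ring S is_sum pr u = free_ring S pr u Quot sum_relations S is_sum"


section \<open>Finite $G$-sets and the Burnside ring\<close>

text \<open>A \<open>G\<close>-set is a pair \<open>(E, \<phi>)\<close> with \<open>group_action G E \<phi>\<close>; in particular each \<open>\<phi> g\<close> with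
  \<open>g \<in> carrier G\<close> is extensional on \<open>E\<close>.\<close>

type_synonym ('g, 'x) gset = "'x set \<times> ('g \<Rightarrow> 'x \<Rightarrow> 'x)"

definition gset_iso :: "('g, 'b) monoid_scheme \<Rightarrow> ('g, 'x) gset \<Rightarrow> ('g, 'y) gset \<Rightarrow> bool" where
  "gset_iso G X Y \<longleftrightarrow> (\<exists>f. bij_betw f (fst X) (fst Y) \<and>
     (\<forall>g\<in>carrier G. \<forall>x\<in>fst X. f (snd X g x) = snd Y g (f x)))"

definition gset_sum :: "('g, 'x) gset \<Rightarrow> ('g, 'y) gset \<Rightarrow> ('g, 'x + 'y) gset" where
  "gset_sum X Y = (fst X <+> fst Y,
     \<lambda>g. restrict (map_sum (snd X g) (snd Y g)) (fst X <+> fst Y))"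

definition gset_prod :: "('g, 'x) gset \<Rightarrow> ('g, 'y) gset \<Rightarrow> ('g, 'x \<times> 'y) gset" where
  "gset_prod X Y = (fst X \<times> fst Y,
     \<lambda>g. restrict (map_prod (snd X g) (snd Y g)) (fst X \<times> fst Y))"

definition gset_point :: "('g, nat) gset" where
  "gset_point = ({0}, \<lambda>g. restrict id {0})"

definition coset_gset :: "('g, 'b) monoid_scheme \<Rightarrow> 'g set \<Rightarrow> ('g, 'g set) gset" where
  "coset_gset G U = ((\<lambda>x. x <#\<^bsub>G\<^esub> U) ` carrier G,
     \<lambda>g. restrict (\<lambda>A. g <#\<^bsub>G\<^esub> A) ((\<lambda>x. x <#\<^bsub>G\<^esub> U) ` carrier G))"

text \<open>To have a set of generators, finite \<open>G\<close>-sets are taken on sets of natural numbers. A finite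
  \<open>G\<close>-set of any type is isomorphic to such a \<open>G\<close>-set, see \<open>gset_model\<close> below.\<close>

definition finite_gsets :: "('g, 'b) monoid_scheme \<Rightarrow> ('g, nat) gset set" where
  "finite_gsets G = {(E, \<phi>). finite E \<and> group_action G E \<phi>}"

definition gset_rep :: "('g, 'b) monoid_scheme \<Rightarrow> ('g, 'x) gset \<Rightarrow> ('g, nat) gset" where
  "gset_rep G X = (SOME Y. Y \<in> finite_gsets G \<and> gset_iso G X Y)"

lemma group_actionI:
  assumes "group G"
    and ext: "\<And>g. g \<in> carrier G \<Longrightarrow> \<phi> g \<in> extensional E"
    and cl: "\<And>g x. g \<in> carrier G \<Longrightarrow> x \<in> E \<Longrightarrow> \<phi> g x \<in> E"
    and one: "\<And>x. x \<in> E \<Longrightarrow> \<phi> \<one>\<^bsub>G\<^esub> x = x"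
    and mul: "\<And>g h x. g \<in> carrier G \<Longrightarrow> h \<in> carrier G \<Longrightarrow> x \<in> E \<Longrightarrow>
      \<phi> (g \<otimes>\<^bsub>G\<^esub> h) x = \<phi> g (\<phi> h x)"
  shows "group_action G E \<phi>"
proof -
  interpret group G by fact
  have bij: "\<phi> g \<in> Bij E" if g: "g \<in> carrier G" for g
  proof -
    have "bij_betw (\<phi> g) E E"
      by (rule bij_betw_byWitness[where f' = "\<phi> (inv\<^bsub>G\<^esub> g)"])
        (use g cl in \<open>auto simp flip: mul simp: one\<close>)
    with ext[OF g] show ?thesis by (simp add: Bij_def)
  qed
  have "\<phi> (g \<otimes>\<^bsub>G\<^esub> h) = compose E (\<phi> g) (\<phi> h)" if "g \<in> carrier G" "h \<in> carrier G" for g h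
    by (rule extensionalityI[where A = E]) (use that ext mul in \<open>auto simp: compose_eq\<close>)
  then have "\<phi> \<in> hom G (BijGroup E)"
    using bij by (auto simp: hom_def BijGroup_def)
  then show ?thesis
    unfolding group_action_def group_hom_def group_hom_axioms_def
    by (simp add: group_BijGroup)
qed

lemma group_action_closed:
  assumes "group_action G E \<phi>" "g \<in> carrier G" "x \<in> E"
  shows "\<phi> g x \<in> E"
  using group_action.element_image[OF assms refl] .

lemma group_action_transport:
  assumes act: "group_action G E \<phi>" and f: "bij_betw f E D"
  shows "group_action G D (\<lambda>g. restrict (\<lambda>y. f (\<phi> g (inv_into E f y))) D)"
proof -
  interpret group_action G E \<phi> by fact
  have G: "group G" using group_hom group_hom.axioms(1) by blast
  interpret G: group G by fact
  have i: "y \<in> D \<Longrightarrow> inv_into E f y \<in> E" for y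
    using f by (metis bij_betw_imp_surj_on inv_into_into)
  have fc: "x \<in> E \<Longrightarrow> f x \<in> D" for x
    using f by (meson bij_betwE)
  have fi: "y \<in> D \<Longrightarrow> f (inv_into E f y) = y" for y
    using f by (simp add: bij_betw_inv_into_right)
  have if': "x \<in> E \<Longrightarrow> inv_into E f (f x) = x" for x
    using f by (simp add: bij_betw_inv_into_left)
  note cl = group_action_closed[OF act]
  show ?thesis
  proof (rule group_actionI[OF G])
    fix x assume x: "x \<in> D"
    have "\<phi> \<one>\<^bsub>G\<^esub> (inv_into E f x) = inv_into E f x"
      using id_eq_one i[OF x] by (metis restrict_apply')
    then show "restrict (\<lambda>y. f (\<phi> \<one>\<^bsub>G\<^esub> (inv_into E f y))) D x = x" using x fi by simp
  next
    fix g h x assume "g \<in> carrier G" "h \<in> carrier G" "x \<in> D"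
    then show "restrict (\<lambda>y. f (\<phi> (g \<otimes>\<^bsub>G\<^esub> h) (inv_into E f y))) D x =
      restrict (\<lambda>y. f (\<phi> g (inv_into E f y))) D (restrict (\<lambda>y. f (\<phi> h (inv_into E f y))) D x)"
      by (simp add: fc cl i if' composition_rule)
  qed (use fc cl i in auto)
qed

lemma gset_model:
  assumes "finite (fst X)" and act: "group_action G (fst X) (snd X)"
  shows "\<exists>Y\<in>finite_gsets G. gset_iso G X Y"
proof -
  obtain f :: "_ \<Rightarrow> nat" where f: "inj_on f (fst X)"
    using finite_imp_inj_to_nat_seg[OF assms(1)] by auto
  define D where "D = f ` fst X"
  have b: "bij_betw f (fst X) D" using f by (simp add: D_def bij_betw_def)
  have "gset_iso G X (D, \<lambda>g. restrict (\<lambda>y. f (snd X g (inv_into (fst X) f y))) D)"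
    unfolding gset_iso_def using b f group_action_closed[OF act]
    by (intro exI[of _ f]) (auto simp: D_def)
  moreover have "finite D" using assms(1) by (simp add: D_def)
  ultimately show ?thesis
    using group_action_transport[OF act b] by (auto simp: finite_gsets_def)
qed

lemma coset_gset_action:
  assumes G: "group G" and U: "subgroup U G"
  shows "group_action G (fst (coset_gset G U)) (snd (coset_gset G U))"
proof -
  interpret group G by fact
  have s: "U \<subseteq> carrier G" by (rule subgroup.subset[OF U])
  show ?thesis
    unfolding coset_gset_def fst_conv snd_conv
    by (rule group_actionI[OF G]) (auto simp: lcos_m_assoc[OF s] m_assoc)
qed

definition is_gset_sum ::
  "('g, 'b) monoid_scheme \<Rightarrow> ('g, nat) gset \<Rightarrow> ('g, nat) gset \<Rightarrow> ('g, nat) gset \<Rightarrow> bool" where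
  "is_gset_sum G X Y Z \<longleftrightarrow> gset_iso G (gset_sum X Y) Z"

definition burnside_ring :: "('g, 'b) monoid_scheme \<Rightarrow> (('g, nat) gset \<Rightarrow>\<^sub>0 int) set ring" where
  "burnside_ring G =
     grothendieck_ring (finite_gsets G) (is_gset_sum G)
       (\<lambda>X Y. gset_rep G (gset_prod X Y)) gset_point"

definition burnside_class ::
  "('g, 'b) monoid_scheme \<Rightarrow> (('g, nat) gset \<Rightarrow>\<^sub>0 int) \<Rightarrow> (('g, nat) gset \<Rightarrow>\<^sub>0 int) set" where
  "burnside_class G c =
     sum_relations (finite_gsets G) (is_gset_sum G) #>\<^bsub>free_Abelian_group (finite_gsets G)\<^esub> c"

text \<open>Formal integral combinations \<open>\<Sum> n\<^sub>U U\<close> of subgroups, and the elements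
  \<open>\<Sum> n\<^sub>U [G/U]\<close> of the Burnside ring that they denote.\<close>

definition subgroup_combs :: "('g, 'b) monoid_scheme \<Rightarrow> ('g set \<Rightarrow>\<^sub>0 int) set" where
  "subgroup_combs G = carrier (free_Abelian_group {U. subgroup U G})"

definition burnside_elem ::
  "('g, 'b) monoid_scheme \<Rightarrow> ('g set \<Rightarrow>\<^sub>0 int) \<Rightarrow> (('g, nat) gset \<Rightarrow>\<^sub>0 int) set" where
  "burnside_elem G n =
     burnside_class G (frag_extend (\<lambda>U. frag_of (gset_rep G (coset_gset G U))) n)"


section \<open>Finitely generated $F[G]$-modules and the representation ring\<close>

text \<open>An \<open>F[G]\<close>-module is an \<open>F\<close>-module with an \<open>F\<close>-linear action of \<open>G\<close>. The fields
  \<^const>\<open>monoid.mult\<close> and \<^const>\<open>one\<close>, which module records inherit from rings, have no meaning here.\<close>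

type_synonym ('f, 'g, 'm) gmodule = "('f, 'm) module \<times> ('g \<Rightarrow> 'm \<Rightarrow> 'm)"

definition is_gmodule ::
  "('f, 'c) ring_scheme \<Rightarrow> ('g, 'b) monoid_scheme \<Rightarrow> ('f, 'g, 'm) gmodule \<Rightarrow> bool" where
  "is_gmodule F G V \<longleftrightarrow> (case V of (M, \<rho>) \<Rightarrow>
     module F M \<and> group_action G (carrier M) \<rho> \<and>
     (\<forall>g\<in>carrier G. \<forall>x\<in>carrier M. \<forall>y\<in>carrier M. \<rho> g (x \<oplus>\<^bsub>M\<^esub> y) = \<rho> g x \<oplus>\<^bsub>M\<^esub> \<rho> g y) \<and>
     (\<forall>g\<in>carrier G. \<forall>a\<in>carrier F. \<forall>x\<in>carrier M. \<rho> g (a \<odot>\<^bsub>M\<^esub> x) = a \<odot>\<^bsub>M\<^esub> \<rho> g x))"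

definition fg_gmodule ::
  "('f, 'c) ring_scheme \<Rightarrow> ('g, 'b) monoid_scheme \<Rightarrow> ('f, 'g, 'm) gmodule \<Rightarrow> bool" where
  "fg_gmodule F G V \<longleftrightarrow> (case V of (M, \<rho>) \<Rightarrow>
     \<exists>B. finite B \<and> B \<subseteq> carrier M \<and>
       (\<forall>K. submodule K F M \<and> (\<forall>g\<in>carrier G. \<forall>x\<in>K. \<rho> g x \<in> K) \<and> B \<subseteq> K \<longrightarrow> K = carrier M))"

definition gmodule_iso ::
  "('f, 'c) ring_scheme \<Rightarrow> ('g, 'b) monoid_scheme \<Rightarrow>
   ('f, 'g, 'm) gmodule \<Rightarrow> ('f, 'g, 'n) gmodule \<Rightarrow> bool" where
  "gmodule_iso F G V W \<longleftrightarrow> (case V of (M, \<rho>) \<Rightarrow> case W of (N, \<sigma>) \<Rightarrow>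
     \<exists>f. bij_betw f (carrier M) (carrier N) \<and>
       (\<forall>x\<in>carrier M. \<forall>y\<in>carrier M. f (x \<oplus>\<^bsub>M\<^esub> y) = f x \<oplus>\<^bsub>N\<^esub> f y) \<and>
       (\<forall>a\<in>carrier F. \<forall>x\<in>carrier M. f (a \<odot>\<^bsub>M\<^esub> x) = a \<odot>\<^bsub>N\<^esub> f x) \<and>
       (\<forall>g\<in>carrier G. \<forall>x\<in>carrier M. f (\<rho> g x) = \<sigma> g (f x)))"

definition gmodule_sum ::
  "('f, 'g, 'm) gmodule \<Rightarrow> ('f, 'g, 'n) gmodule \<Rightarrow> ('f, 'g, 'm \<times> 'n) gmodule" where
  "gmodule_sum V W = (case V of (M, \<rho>) \<Rightarrow> case W of (N, \<sigma>) \<Rightarrow>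
     (\<lparr>carrier = carrier M \<times> carrier N, monoid.mult = undefined, one = undefined,
       zero = (\<zero>\<^bsub>M\<^esub>, \<zero>\<^bsub>N\<^esub>),
       add = (\<lambda>(x, y) (x', y'). (x \<oplus>\<^bsub>M\<^esub> x', y \<oplus>\<^bsub>N\<^esub> y')),
       smult = (\<lambda>a (x, y). (a \<odot>\<^bsub>M\<^esub> x, a \<odot>\<^bsub>N\<^esub> y))\<rparr>,
      \<lambda>g. restrict (map_prod (\<rho> g) (\<sigma> g)) (carrier M \<times> carrier N)))"

definition free_module :: "('f, 'c) ring_scheme \<Rightarrow> 'x set \<Rightarrow> ('f, 'x \<Rightarrow> 'f) module" where
  "free_module F E =
     \<lparr>carrier = {f. range f \<subseteq> carrier F \<and> (\<forall>x. x \<notin> E \<longrightarrow> f x = \<zero>\<^bsub>F\<^esub>) \<and> finite {x. f x \<noteq> \<zero>\<^bsub>F\<^esub>}},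
      monoid.mult = undefined, one = undefined,
      zero = (\<lambda>x. \<zero>\<^bsub>F\<^esub>), add = (\<lambda>f h x. f x \<oplus>\<^bsub>F\<^esub> h x), smult = (\<lambda>a f x. a \<otimes>\<^bsub>F\<^esub> f x)\<rparr>"

text \<open>The permutation module \<open>F[X]\<close>: as \<open>f\<close> stands for \<open>\<Sum> f(x) x\<close>, one has
  \<open>(g f)(x) = f (g\<^sup>-\<^sup>1 x)\<close>.\<close>

definition perm_module ::
  "('f, 'c) ring_scheme \<Rightarrow> ('g, 'b) monoid_scheme \<Rightarrow> ('g, 'x) gset \<Rightarrow> ('f, 'g, 'x \<Rightarrow> 'f) gmodule"
  where
  "perm_module F G X =
     (free_module F (fst X),
      \<lambda>g. restrict (\<lambda>f x. if x \<in> fst X then f (snd X (inv\<^bsub>G\<^esub> g) x) else \<zero>\<^bsub>F\<^esub>)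
        (carrier (free_module F (fst X))))"

text \<open>\<open>M \<otimes>\<^sub>F N\<close> with the diagonal action: the free module \<open>F[M \<times> N]\<close> modulo the submodule
  generated by the bilinearity relations.\<close>

definition basis_vec :: "('f, 'c) ring_scheme \<Rightarrow> 'x \<Rightarrow> 'x \<Rightarrow> 'f" where
  "basis_vec F x = (\<lambda>y. if y = x then \<one>\<^bsub>F\<^esub> else \<zero>\<^bsub>F\<^esub>)"

definition bilinear_relations ::
  "('f, 'c) ring_scheme \<Rightarrow> ('f, 'm) module \<Rightarrow> ('f, 'n) module \<Rightarrow> ('m \<times> 'n \<Rightarrow> 'f) set" where
  "bilinear_relations F M N = (let P = free_module F (carrier M \<times> carrier N) in
     {basis_vec F (x \<oplus>\<^bsub>M\<^esub> x', y) \<ominus>\<^bsub>P\<^esub> (basis_vec F (x, y) \<oplus>\<^bsub>P\<^esub> basis_vec F (x', y)) | x x' y.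
        x \<in> carrier M \<and> x' \<in> carrier M \<and> y \<in> carrier N} \<union>
     {basis_vec F (x, y \<oplus>\<^bsub>N\<^esub> y') \<ominus>\<^bsub>P\<^esub> (basis_vec F (x, y) \<oplus>\<^bsub>P\<^esub> basis_vec F (x, y')) | x y y'.
        x \<in> carrier M \<and> y \<in> carrier N \<and> y' \<in> carrier N} \<union>
     {basis_vec F (a \<odot>\<^bsub>M\<^esub> x, y) \<ominus>\<^bsub>P\<^esub> (a \<odot>\<^bsub>P\<^esub> basis_vec F (x, y)) | a x y.
        a \<in> carrier F \<and> x \<in> carrier M \<and> y \<in> carrier N} \<union>
     {basis_vec F (x, a \<odot>\<^bsub>N\<^esub> y) \<ominus>\<^bsub>P\<^esub> (a \<odot>\<^bsub>P\<^esub> basis_vec F (x, y)) | a x y.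
        a \<in> carrier F \<and> x \<in> carrier M \<and> y \<in> carrier N})"

definition gmodule_quot ::
  "('f, 'g, 'm) gmodule \<Rightarrow> 'm set \<Rightarrow> ('f, 'g, 'm set) gmodule" where
  "gmodule_quot V K = (case V of (M, \<rho>) \<Rightarrow>
     (\<lparr>carrier = a_rcosets\<^bsub>M\<^esub> K, monoid.mult = undefined, one = undefined,
       zero = K, add = set_add M, smult = (\<lambda>a A. \<Union>x\<in>A. K +>\<^bsub>M\<^esub> (a \<odot>\<^bsub>M\<^esub> x))\<rparr>,
      \<lambda>g. restrict (\<lambda>A. \<Union>x\<in>A. K +>\<^bsub>M\<^esub> \<rho> g x) (a_rcosets\<^bsub>M\<^esub> K)))"

definition gmodule_tensor ::
  "('f, 'c) ring_scheme \<Rightarrow> ('g, 'b) monoid_scheme \<Rightarrow>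
   ('f, 'g, 'm) gmodule \<Rightarrow> ('f, 'g, 'n) gmodule \<Rightarrow> ('f, 'g, ('m \<times> 'n \<Rightarrow> 'f) set) gmodule" where
  "gmodule_tensor F G V W = (case V of (M, \<rho>) \<Rightarrow> case W of (N, \<sigma>) \<Rightarrow>
     gmodule_quot (perm_module F G (gset_prod (carrier M, \<rho>) (carrier N, \<sigma>)))
       (\<Inter>{K. submodule K F (free_module F (carrier M \<times> carrier N)) \<and>
            bilinear_relations F M N \<subseteq> K}))"

text \<open>To have a set of generators, modules are taken on sets of functions \<open>nat \<Rightarrow> 'f\<close>. For a
  finite group \<open>G\<close>, a finitely generated \<open>F[G]\<close>-module of any type is
  isomorphic to such a module: it is a quotient of some \<open>F\<^sup>n\<close>, hence is in bijection with a set of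
  representatives in \<open>F\<^sup>n\<close>, to which its structure can be transported (\<open>gmodule_model\<close> below).\<close>

definition fg_gmodules ::
  "('f, 'c) ring_scheme \<Rightarrow> ('g, 'b) monoid_scheme \<Rightarrow> ('f, 'g, nat \<Rightarrow> 'f) gmodule set" where
  "fg_gmodules F G = {V. is_gmodule F G V \<and> fg_gmodule F G V}"

definition gmodule_rep ::
  "('f, 'c) ring_scheme \<Rightarrow> ('g, 'b) monoid_scheme \<Rightarrow>
   ('f, 'g, 'm) gmodule \<Rightarrow> ('f, 'g, nat \<Rightarrow> 'f) gmodule" where
  "gmodule_rep F G V = (SOME W. W \<in> fg_gmodules F G \<and> gmodule_iso F G V W)"

lemma perm_module_gmodule:
  assumes F: "cring F" and act: "group_action G (fst X) (snd X)"
  shows "is_gmodule F G (perm_module F G X)"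
proof -
  interpret F: cring F by fact
  interpret group_action G "fst X" "snd X" by fact
  have G: "group G" using group_hom group_hom.axioms(1) by blast
  interpret G: group G by fact
  note cl = group_action_closed[OF act]
  let ?C = "carrier (free_module F (fst X))"
  have fin2: "finite {x. a x \<oplus>\<^bsub>F\<^esub> b x \<noteq> \<zero>\<^bsub>F\<^esub>}"
    if "finite {x. a x \<noteq> \<zero>\<^bsub>F\<^esub>}" "finite {x. b x \<noteq> \<zero>\<^bsub>F\<^esub>}" for a b
    by (rule finite_subset[OF _ finite_UnI[OF that]]) auto
  have ab: "abelian_group (free_module F (fst X))"
  proof (rule abelian_groupI)
    fix a assume a: "a \<in> ?C"
    show "\<exists>b\<in>?C. b \<oplus>\<^bsub>free_module F (fst X)\<^esub> a = \<zero>\<^bsub>free_module F (fst X)\<^esub>"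
      by (rule bexI[of _ "\<lambda>x. \<ominus>\<^bsub>F\<^esub> a x"])
        (use a in \<open>auto simp: free_module_def F.l_neg subset_eq elim!: rev_finite_subset\<close>)
  qed (auto simp: free_module_def subset_eq fun_eq_iff F.a_ac fin2)
  have mod: "module F (free_module F (fst X))"
    by (rule moduleI[OF F ab])
      (auto simp: free_module_def subset_eq fun_eq_iff F.l_distr F.r_distr F.m_assoc
        elim!: rev_finite_subset)
  have pc: "(\<lambda>x. if x \<in> fst X then f (snd X (inv\<^bsub>G\<^esub> g) x) else \<zero>\<^bsub>F\<^esub>) \<in> ?C"
    if g: "g \<in> carrier G" and f: "f \<in> ?C" for g f
  proof -
    have "{x. x \<in> fst X \<and> f (snd X (inv\<^bsub>G\<^esub> g) x) \<noteq> \<zero>\<^bsub>F\<^esub>} \<subseteq> snd X g ` {x. f x \<noteq> \<zero>\<^bsub>F\<^esub>}"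
    proof
      fix x assume x: "x \<in> {x. x \<in> fst X \<and> f (snd X (inv\<^bsub>G\<^esub> g) x) \<noteq> \<zero>\<^bsub>F\<^esub>}"
      have "snd X g (snd X (inv\<^bsub>G\<^esub> g) x) = x"
        using x g by (metis (mono_tags, lifting) G.inv_closed G.r_inv composition_rule id_eq_one mem_Collect_eq restrict_apply')
      then show "x \<in> snd X g ` {x. f x \<noteq> \<zero>\<^bsub>F\<^esub>}"
        using x by (metis (mono_tags, lifting) image_eqI mem_Collect_eq)
    qed
    moreover have "finite {x. f x \<noteq> \<zero>\<^bsub>F\<^esub>}" using f by (simp add: free_module_def)
    ultimately have "finite {x. x \<in> fst X \<and> f (snd X (inv\<^bsub>G\<^esub> g) x) \<noteq> \<zero>\<^bsub>F\<^esub>}"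
      using finite_surj by blast
    then show ?thesis
      using f by (auto simp: free_module_def subset_eq elim!: rev_finite_subset)
  qed
  have gact: "group_action G ?C (snd (perm_module F G X))"
  proof (rule group_actionI[OF G])
    fix f assume f: "f \<in> ?C"
    show "snd (perm_module F G X) \<one>\<^bsub>G\<^esub> f = f"
    proof
      fix x show "snd (perm_module F G X) \<one>\<^bsub>G\<^esub> f x = f x"
        using f fun_cong[OF id_eq_one, of x]
        by (cases "x \<in> fst X") (auto simp: perm_module_def free_module_def)
    qed
  next
    fix g h f assume *: "g \<in> carrier G" "h \<in> carrier G" "f \<in> ?C"
    show "snd (perm_module F G X) (g \<otimes>\<^bsub>G\<^esub> h) f = snd (perm_module F G X) g (snd (perm_module F G X) h f)"
      using * pc by (auto simp: perm_module_def fun_eq_iff G.inv_mult_group composition_rule cl)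
  qed (use pc in \<open>auto simp: perm_module_def\<close>)
  show ?thesis
    unfolding is_gmodule_def perm_module_def prod.case
  proof (intro conjI ballI)
    show "group_action G ?C (\<lambda>g. restrict (\<lambda>f x. if x \<in> fst X then f (snd X (inv\<^bsub>G\<^esub> g) x) else \<zero>\<^bsub>F\<^esub>) ?C)"
      using gact by (simp add: perm_module_def)
  next
    interpret P: module F "free_module F (fst X)" by fact
    fix g x y assume *: "g \<in> carrier G" "x \<in> ?C" "y \<in> ?C"
    have "x \<oplus>\<^bsub>free_module F (fst X)\<^esub> y \<in> ?C" using * by simp
    then show "restrict (\<lambda>f x. if x \<in> fst X then f (snd X (inv\<^bsub>G\<^esub> g) x) else \<zero>\<^bsub>F\<^esub>) ?C (x \<oplus>\<^bsub>free_module F (fst X)\<^esub> y) = 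
       restrict (\<lambda>f x. if x \<in> fst X then f (snd X (inv\<^bsub>G\<^esub> g) x) else \<zero>\<^bsub>F\<^esub>) ?C x \<oplus>\<^bsub>free_module F (fst X)\<^esub>
       restrict (\<lambda>f x. if x \<in> fst X then f (snd X (inv\<^bsub>G\<^esub> g) x) else \<zero>\<^bsub>F\<^esub>) ?C y"
      using * by (auto simp: fun_eq_iff) (auto simp: free_module_def)
  next
    interpret P: module F "free_module F (fst X)" by fact
    fix g a x assume *: "g \<in> carrier G" "a \<in> carrier F" "x \<in> ?C"
    have "a \<odot>\<^bsub>free_module F (fst X)\<^esub> x \<in> ?C" using * by simp
    then show "restrict (\<lambda>f x. if x \<in> fst X then f (snd X (inv\<^bsub>G\<^esub> g) x) else \<zero>\<^bsub>F\<^esub>) ?C (a \<odot>\<^bsub>free_module F (fst X)\<^esub> x) = 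
       a \<odot>\<^bsub>free_module F (fst X)\<^esub> restrict (\<lambda>f x. if x \<in> fst X then f (snd X (inv\<^bsub>G\<^esub> g) x) else \<zero>\<^bsub>F\<^esub>) ?C x"
      using * by (auto simp: fun_eq_iff) (auto simp: free_module_def)
  qed (rule mod)
qed


lemma perm_module_fg:
  assumes F: "cring F" and act: "group_action G (fst X) (snd X)" and fin: "finite (fst X)"
  shows "fg_gmodule F G (perm_module F G X)"
proof -
  interpret F: cring F by fact
  let ?P = "free_module F (fst X)"
  interpret P: module F ?P
    using perm_module_gmodule[OF F act] by (simp add: is_gmodule_def perm_module_def)
  have b: "basis_vec F x \<in> carrier ?P" if "x \<in> fst X" for x
    using that by (auto simp: basis_vec_def free_module_def)
  have "carrier ?P \<subseteq> K" if K: "submodule K F ?P" and B: "basis_vec F ` fst X \<subseteq> K" for K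
  proof -
    have sg: "subgroup K (add_monoid ?P)" using K by (rule submodule.axioms)
    have "finite S \<Longrightarrow> f \<in> carrier ?P \<Longrightarrow> {x. f x \<noteq> \<zero>\<^bsub>F\<^esub>} \<subseteq> S \<Longrightarrow> S \<subseteq> fst X \<Longrightarrow> f \<in> K" for f S
    proof (induction S arbitrary: f rule: finite_induct)
      case empty
      then have "f = \<zero>\<^bsub>?P\<^esub>" by (auto simp: free_module_def)
      then show ?case using subgroup.one_closed[OF sg] by simp
    next
      case (insert x S)
      define h where "h = f(x := \<zero>\<^bsub>F\<^esub>)"
      have fx: "f x \<in> carrier F" using insert.prems by (auto simp: free_module_def)
      have "h \<in> K"
      proof (rule insert.IH)
        show "h \<in> carrier ?P"
          using insert.prems by (auto simp: free_module_def h_def elim!: rev_finite_subset)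
      qed (use insert.prems in \<open>auto simp: h_def\<close>)
      moreover have "f x \<odot>\<^bsub>?P\<^esub> basis_vec F x \<in> K"
        using submodule.smult_closed[OF K fx] B insert.prems by auto
      ultimately have "h \<oplus>\<^bsub>?P\<^esub> (f x \<odot>\<^bsub>?P\<^esub> basis_vec F x) \<in> K"
        using subgroup.m_closed[OF sg] by simp
      also have "h \<oplus>\<^bsub>?P\<^esub> (f x \<odot>\<^bsub>?P\<^esub> basis_vec F x) = f"
        using insert.prems(1) fx
        by (auto simp: h_def fun_eq_iff free_module_def basis_vec_def subset_eq)
      finally show ?case .
    qed
    note supp = this
    show ?thesis
    proof
      fix f assume f: "f \<in> carrier ?P"
      show "f \<in> K" by (rule supp[OF fin f]) (use f in \<open>auto simp: free_module_def\<close>)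
    qed
  qed
  moreover have "K \<subseteq> carrier ?P" if "submodule K F ?P" for K
    using subgroup.subset[OF submodule.axioms(1)[OF that]] by simp
  ultimately show ?thesis
    unfolding fg_gmodule_def perm_module_def prod.case
    using fin b by (intro exI[of _ "basis_vec F ` fst X"] conjI allI impI subset_antisym) auto
qed

lemma gmodule_transport:
  fixes M :: "('f, 'm) module" and \<rho> :: "'g \<Rightarrow> 'm \<Rightarrow> 'm" and f :: "'m \<Rightarrow> 'n"
  assumes V: "is_gmodule F G (M, \<rho>)" and fg: "fg_gmodule F G (M, \<rho>)" and f: "bij_betw f (carrier M) D"
  shows "\<exists>W :: ('f, 'g, 'n) gmodule. is_gmodule F G W \<and> fg_gmodule F G W \<and> gmodule_iso F G (M, \<rho>) W"
proof -
  have mod: "module F M" and act: "group_action G (carrier M) \<rho>"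
    and add: "\<And>g x y. g \<in> carrier G \<Longrightarrow> x \<in> carrier M \<Longrightarrow> y \<in> carrier M \<Longrightarrow>
        \<rho> g (x \<oplus>\<^bsub>M\<^esub> y) = \<rho> g x \<oplus>\<^bsub>M\<^esub> \<rho> g y"
    and smul: "\<And>g a x. g \<in> carrier G \<Longrightarrow> a \<in> carrier F \<Longrightarrow> x \<in> carrier M \<Longrightarrow>
        \<rho> g (a \<odot>\<^bsub>M\<^esub> x) = a \<odot>\<^bsub>M\<^esub> \<rho> g x"
    using V by (auto simp: is_gmodule_def)
  interpret M: module F M by fact
  note cl = group_action_closed[OF act]
  define i where "i = inv_into (carrier M) f"
  have i: "y \<in> D \<Longrightarrow> i y \<in> carrier M" for y
    unfolding i_def using f by (metis bij_betw_imp_surj_on inv_into_into)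
  have fc: "x \<in> carrier M \<Longrightarrow> f x \<in> D" for x
    using f by (meson bij_betwE)
  have fi: "y \<in> D \<Longrightarrow> f (i y) = y" for y
    unfolding i_def using f by (simp add: bij_betw_inv_into_right)
  have if': "x \<in> carrier M \<Longrightarrow> i (f x) = x" for x
    unfolding i_def using f by (simp add: bij_betw_inv_into_left)
  define N :: "('f, 'n) module" where
    "N = \<lparr>carrier = D, monoid.mult = undefined, one = undefined, zero = f \<zero>\<^bsub>M\<^esub>,
      add = (\<lambda>x y. f (i x \<oplus>\<^bsub>M\<^esub> i y)), smult = (\<lambda>a x. f (a \<odot>\<^bsub>M\<^esub> i x))\<rparr>"
  define \<sigma> where "\<sigma> = (\<lambda>g. restrict (\<lambda>y. f (\<rho> g (i y))) D)"
  have N: "carrier N = D" "\<zero>\<^bsub>N\<^esub> = f \<zero>\<^bsub>M\<^esub>" "x \<oplus>\<^bsub>N\<^esub> y = f (i x \<oplus>\<^bsub>M\<^esub> i y)"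
    "a \<odot>\<^bsub>N\<^esub> x = f (a \<odot>\<^bsub>M\<^esub> i x)" for x y a
    by (simp_all add: N_def)
  have ab: "abelian_group N"
  proof (rule abelian_groupI)
    fix x assume x: "x \<in> carrier N"
    show "\<exists>y\<in>carrier N. y \<oplus>\<^bsub>N\<^esub> x = \<zero>\<^bsub>N\<^esub>"
      by (rule bexI[of _ "f (\<ominus>\<^bsub>M\<^esub> i x)"]) (use x i fc in \<open>simp_all add: N if' M.l_neg\<close>)
  qed (simp_all add: N i fc fi if' M.M.a_ac)
  have modN: "module F N"
    by (rule moduleI[OF M.R.is_cring ab])
      (simp_all add: N i fc fi if' M.smult_l_distr M.smult_r_distr M.smult_assoc1)
  have iso: "gmodule_iso F G (M, \<rho>) (N, \<sigma>)"
    unfolding gmodule_iso_def prod.case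
    by (intro exI[of _ f]) (use f in \<open>simp add: N \<sigma>_def if' fc\<close>)
  have "is_gmodule F G (N, \<sigma>)"
    unfolding is_gmodule_def prod.case
    using modN group_action_transport[OF act f]
    by (simp add: N \<sigma>_def i fc fi if' add smul cl flip: i_def)
  moreover have "fg_gmodule F G (N, \<sigma>)"
  proof -
    obtain B where B: "finite B" "B \<subseteq> carrier M" and gen:
      "\<And>K. submodule K F M \<Longrightarrow> \<forall>g\<in>carrier G. \<forall>x\<in>K. \<rho> g x \<in> K \<Longrightarrow> B \<subseteq> K \<Longrightarrow> K = carrier M"
      using fg by (auto simp: fg_gmodule_def)
    have "K = D" if K: "submodule K F N" and st: "\<forall>g\<in>carrier G. \<forall>x\<in>K. \<sigma> g x \<in> K" and BK: "f ` B \<subseteq> K" for K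
    proof -
      have sg: "subgroup K (add_monoid N)" using K by (rule submodule.axioms)
      have KD: "K \<subseteq> D" using subgroup.subset[OF sg] by (simp add: N)
      have K0: "f \<zero>\<^bsub>M\<^esub> \<in> K" using subgroup.one_closed[OF sg] by (simp add: N)
      have Ka: "x \<in> K \<Longrightarrow> y \<in> K \<Longrightarrow> f (i x \<oplus>\<^bsub>M\<^esub> i y) \<in> K" for x y
        using subgroup.m_closed[OF sg, of x y] by (simp add: N)
      have Ks: "a \<in> carrier F \<Longrightarrow> x \<in> K \<Longrightarrow> f (a \<odot>\<^bsub>M\<^esub> i x) \<in> K" for a x
        using submodule.smult_closed[OF K, of a x] by (simp add: N)
      have "{x \<in> carrier M. f x \<in> K} = carrier M"
      proof (rule gen)
        show "submodule {x \<in> carrier M. f x \<in> K} F M"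
        proof (rule M.submoduleI)
          fix a assume a: "a \<in> {x \<in> carrier M. f x \<in> K}"
          then have "f ((\<ominus>\<^bsub>F\<^esub> \<one>\<^bsub>F\<^esub>) \<odot>\<^bsub>M\<^esub> a) \<in> K"
            using Ks[of "\<ominus>\<^bsub>F\<^esub> \<one>\<^bsub>F\<^esub>" "f a"] by (simp add: if')
          then show "\<ominus>\<^bsub>M\<^esub> a \<in> {x \<in> carrier M. f x \<in> K}"
            using a by (simp add: M.smult_l_minus)
        next
          fix a b assume "a \<in> {x \<in> carrier M. f x \<in> K}" "b \<in> {x \<in> carrier M. f x \<in> K}"
          then show "a \<oplus>\<^bsub>M\<^esub> b \<in> {x \<in> carrier M. f x \<in> K}"
            using Ka[of "f a" "f b"] by (simp add: if')
        next
          fix a x assume "a \<in> carrier F" "x \<in> {x \<in> carrier M. f x \<in> K}"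
          then show "a \<odot>\<^bsub>M\<^esub> x \<in> {x \<in> carrier M. f x \<in> K}"
            using Ks[of a "f x"] by (simp add: if')
        qed (use K0 in auto)
        show "\<forall>g\<in>carrier G. \<forall>x\<in>{x \<in> carrier M. f x \<in> K}. \<rho> g x \<in> {x \<in> carrier M. f x \<in> K}"
        proof safe
          fix g x assume *: "g \<in> carrier G" "x \<in> carrier M" "f x \<in> K"
          show "\<rho> g x \<in> carrier M" using * cl by simp
          show "f (\<rho> g x) \<in> K" using bspec[OF bspec[OF st *(1)] *(3)] * by (simp add: \<sigma>_def if' fc)
        qed
        show "B \<subseteq> {x \<in> carrier M. f x \<in> K}" using B BK by auto
      qed
      then show "K = D" using KD fi i by (metis (mono_tags, lifting) mem_Collect_eq subsetI subset_antisym)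
    qed
    then show ?thesis
      unfolding fg_gmodule_def prod.case using B fc
      by (intro exI[of _ "f ` B"]) (auto simp: N)
  qed
  ultimately show ?thesis using iso by blast
qed

lemma fg_gmodule_inj:
  fixes M :: "('f, 'm) module"
  assumes finG: "finite (carrier G)" and V: "is_gmodule F G (M, \<rho>)" and fg: "fg_gmodule F G (M, \<rho>)"
  shows "\<exists>f :: 'm \<Rightarrow> nat \<Rightarrow> 'f. inj_on f (carrier M)"
proof -
  have mod: "module F M" and act: "group_action G (carrier M) \<rho>"
    and add: "\<And>g x y. g \<in> carrier G \<Longrightarrow> x \<in> carrier M \<Longrightarrow> y \<in> carrier M \<Longrightarrow>
        \<rho> g (x \<oplus>\<^bsub>M\<^esub> y) = \<rho> g x \<oplus>\<^bsub>M\<^esub> \<rho> g y"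
    and smul: "\<And>g a x. g \<in> carrier G \<Longrightarrow> a \<in> carrier F \<Longrightarrow> x \<in> carrier M \<Longrightarrow>
        \<rho> g (a \<odot>\<^bsub>M\<^esub> x) = a \<odot>\<^bsub>M\<^esub> \<rho> g x"
    using V by (auto simp: is_gmodule_def)
  interpret M: module F M by fact
  interpret A: group_action G "carrier M" \<rho> by fact
  interpret G: group G using A.group_hom group_hom.axioms(1) by blast
  note cl = group_action_closed[OF act]
  obtain B where B: "finite B" "B \<subseteq> carrier M" and gen:
    "\<And>K. submodule K F M \<Longrightarrow> \<forall>g\<in>carrier G. \<forall>x\<in>K. \<rho> g x \<in> K \<Longrightarrow> B \<subseteq> K \<Longrightarrow> K = carrier M"
    using fg by (auto simp: fg_gmodule_def)
  define T where "T = (\<lambda>(g, b). \<rho> g b) ` (carrier G \<times> B)"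
  have finT: "finite T" using finG B by (simp add: T_def)
  have TM: "T \<subseteq> carrier M" using B cl by (auto simp: T_def)
  have one: "\<rho> \<one>\<^bsub>G\<^esub> b = b" if "b \<in> carrier M" for b
    using A.id_eq_one that by (metis restrict_apply')
  have BT: "B \<subseteq> T"
  proof
    fix b assume "b \<in> B"
    then show "b \<in> T" unfolding T_def using B one[of b] by (intro image_eqI[of _ _ "(\<one>\<^bsub>G\<^esub>, b)"]) auto
  qed
  have inj: "inj_on (\<rho> h) T" if h: "h \<in> carrier G" for h
    using A.inj_prop[OF h] TM inj_on_subset by blast
  have \<rho>T: "\<rho> h ` T = T" if h: "h \<in> carrier G" for h
  proof (rule endo_inj_surj[OF finT _ inj[OF h]])
    show "\<rho> h ` T \<subseteq> T"
    proof safe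
      fix t assume "t \<in> T"
      then obtain g b where gb: "g \<in> carrier G" "b \<in> B" "t = \<rho> g b" by (auto simp: T_def)
      then have "\<rho> h t = \<rho> (h \<otimes>\<^bsub>G\<^esub> g) b" using A.composition_rule h B by auto
      then show "\<rho> h t \<in> T" using gb h unfolding T_def by (intro image_eqI[of _ _ "(h \<otimes>\<^bsub>G\<^esub> g, b)"]) auto
    qed
  qed
  define s where "s c = finsum M (\<lambda>t. c t \<odot>\<^bsub>M\<^esub> t) T" for c
  define C where "C = (T \<rightarrow> carrier F)"
  have sM: "s c \<in> carrier M" if "c \<in> C" for c
    unfolding s_def by (rule M.M.finsum_closed) (use that TM in \<open>auto simp: C_def\<close>)
  have sadd: "s (\<lambda>t. c t \<oplus>\<^bsub>F\<^esub> d t) = s c \<oplus>\<^bsub>M\<^esub> s d" if c: "c \<in> C" "d \<in> C" for c d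
  proof -
    have "s (\<lambda>t. c t \<oplus>\<^bsub>F\<^esub> d t) = finsum M (\<lambda>t. c t \<odot>\<^bsub>M\<^esub> t \<oplus>\<^bsub>M\<^esub> d t \<odot>\<^bsub>M\<^esub> t) T"
      unfolding s_def by (rule M.M.finsum_cong') (use c TM in \<open>auto simp: C_def Pi_iff subset_eq M.smult_l_distr\<close>)
    also have "\<dots> = s c \<oplus>\<^bsub>M\<^esub> s d"
      unfolding s_def by (rule M.M.finsum_addf) (use c TM in \<open>auto simp: C_def Pi_iff subset_eq\<close>)
    finally show ?thesis .
  qed
  have ssmul: "s (\<lambda>t. a \<otimes>\<^bsub>F\<^esub> c t) = a \<odot>\<^bsub>M\<^esub> s c" if c: "a \<in> carrier F" "c \<in> C" for a c
  proof -
    have "a \<odot>\<^bsub>M\<^esub> s c = finsum M (\<lambda>t. a \<odot>\<^bsub>M\<^esub> (c t \<odot>\<^bsub>M\<^esub> t)) T"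
      unfolding s_def by (rule M.finsum_smult_ldistr) (use c TM finT in \<open>auto simp: C_def Pi_iff subset_eq\<close>)
    also have "\<dots> = s (\<lambda>t. a \<otimes>\<^bsub>F\<^esub> c t)"
      unfolding s_def by (rule M.M.finsum_cong') (use c TM in \<open>auto simp: C_def Pi_iff subset_eq M.smult_assoc1\<close>)
    finally show ?thesis by simp
  qed
  have \<rho>0: "\<rho> h \<zero>\<^bsub>M\<^esub> = \<zero>\<^bsub>M\<^esub>" if h: "h \<in> carrier G" for h
    using smul[OF h M.R.zero_closed M.M.zero_closed] cl[OF h M.M.zero_closed] by simp
  have \<rho>sum: "\<rho> h (finsum M u S) = finsum M (\<lambda>t. \<rho> h (u t)) S"
    if h: "h \<in> carrier G" and "finite S" "u \<in> S \<rightarrow> carrier M" for h u and S :: "'m set"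
    using that(2,3)
  proof (induction S)
    case empty
    then show ?case by (simp add: \<rho>0 h)
  next
    case (insert x S)
    have "(\<lambda>t. \<rho> h (u t)) \<in> S \<rightarrow> carrier M" using insert cl h by (auto simp: Pi_iff)
    then show ?case using insert cl h by (simp add: add Pi_iff)
  qed
  have s\<rho>: "\<exists>d\<in>C. \<rho> h (s c) = s d" if h: "h \<in> carrier G" and c: "c \<in> C" for h c
  proof -
    define d where "d = (\<lambda>t. c (inv_into T (\<rho> h) t))"
    have dC: "d \<in> C" using c \<rho>T[OF h] inv_into_into[of _ "\<rho> h" T] by (auto simp: C_def d_def Pi_iff)
    have "s d = finsum M (\<lambda>t. d t \<odot>\<^bsub>M\<^esub> t) (\<rho> h ` T)" by (simp add: s_def \<rho>T h)
    also have "\<dots> = finsum M (\<lambda>t. d (\<rho> h t) \<odot>\<^bsub>M\<^esub> \<rho> h t) T"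
      by (rule M.M.finsum_reindex) (use dC TM inj h \<rho>T in \<open>auto simp: C_def Pi_iff subset_eq\<close>)
    also have "\<dots> = finsum M (\<lambda>t. \<rho> h (c t \<odot>\<^bsub>M\<^esub> t)) T"
      by (rule M.M.finsum_cong')
        (use c TM cl h in \<open>auto simp: C_def Pi_iff subset_eq d_def inv_into_f_f[OF inj[OF h]] smul\<close>)
    also have "\<dots> = \<rho> h (s c)"
      unfolding s_def by (rule \<rho>sum[symmetric]) (use h finT c TM in \<open>auto simp: C_def Pi_iff subset_eq\<close>)
    finally show ?thesis using dC by (intro bexI[of _ d]) simp_all
  qed
  have "s ` C = carrier M"
  proof (rule gen)
    show "submodule (s ` C) F M"
    proof (rule M.submoduleI)
      have "s (\<lambda>_. \<zero>\<^bsub>F\<^esub>) = finsum M (\<lambda>_. \<zero>\<^bsub>M\<^esub>) T"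
        unfolding s_def by (rule M.M.finsum_cong') (use TM in auto)
      then show "\<zero>\<^bsub>M\<^esub> \<in> s ` C"
        by (intro image_eqI[of _ _ "\<lambda>_. \<zero>\<^bsub>F\<^esub>"]) (auto simp: C_def)
    next
      fix a assume "a \<in> s ` C"
      then obtain c where c: "c \<in> C" "a = s c" by auto
      have "\<ominus>\<^bsub>M\<^esub> a = s (\<lambda>t. (\<ominus>\<^bsub>F\<^esub> \<one>\<^bsub>F\<^esub>) \<otimes>\<^bsub>F\<^esub> c t)"
        using c sM by (simp add: ssmul M.smult_l_minus)
      then show "\<ominus>\<^bsub>M\<^esub> a \<in> s ` C" using c by (auto simp: C_def Pi_iff)
    next
      fix a b assume "a \<in> s ` C" "b \<in> s ` C"
      then obtain c d where c: "c \<in> C" "a = s c" "d \<in> C" "b = s d" by auto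
      then show "a \<oplus>\<^bsub>M\<^esub> b \<in> s ` C"
        by (intro image_eqI[of _ _ "\<lambda>t. c t \<oplus>\<^bsub>F\<^esub> d t"]) (simp_all add: sadd, auto simp: C_def Pi_iff)
    next
      fix a x assume "a \<in> carrier F" "x \<in> s ` C"
      then obtain c where c: "a \<in> carrier F" "c \<in> C" "x = s c" by auto
      then show "a \<odot>\<^bsub>M\<^esub> x \<in> s ` C"
        by (intro image_eqI[of _ _ "\<lambda>t. a \<otimes>\<^bsub>F\<^esub> c t"]) (simp_all add: ssmul, auto simp: C_def Pi_iff)
    qed (use sM in auto)
    show "\<forall>g\<in>carrier G. \<forall>x\<in>s ` C. \<rho> g x \<in> s ` C" using s\<rho> by fastforce
    show "B \<subseteq> s ` C"
    proof
      fix b assume b: "b \<in> B"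
      define c where "c = (\<lambda>t. if b = t then \<one>\<^bsub>F\<^esub> else \<zero>\<^bsub>F\<^esub>)"
      have "s c = finsum M (\<lambda>t. if b = t then t else \<zero>\<^bsub>M\<^esub>) T"
        unfolding s_def by (rule M.M.finsum_cong') (use TM in \<open>auto simp: c_def\<close>)
      also have "\<dots> = b"
        using M.M.finsum_singleton[of b T "\<lambda>t. t"] b BT finT TM by auto
      finally show "b \<in> s ` C" by (intro image_eqI[of _ _ c]) (auto simp: C_def c_def)
    qed
  qed
  then have "\<forall>x\<in>carrier M. \<exists>c\<in>C. s c = x" by (metis (no_types, lifting) imageE)
  then obtain c where c: "\<And>x. x \<in> carrier M \<Longrightarrow> c x \<in> C \<and> s (c x) = x" by metis
  obtain e :: "'m \<Rightarrow> nat" where e: "inj_on e T"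
    using finite_imp_inj_to_nat_seg[OF finT] by blast
  have "inj_on (\<lambda>x n. c x (inv_into T e n)) (carrier M)"
  proof (rule inj_onI)
    fix x y assume x: "x \<in> carrier M" and y: "y \<in> carrier M"
      and eq: "(\<lambda>n. c x (inv_into T e n)) = (\<lambda>n. c y (inv_into T e n))"
    have "c x t = c y t" if "t \<in> T" for t
      using fun_cong[OF eq, of "e t"] that e by simp
    then have "s (c x) = s (c y)"
      unfolding s_def using c[OF y] TM by (intro M.M.finsum_cong') (auto simp: C_def Pi_iff subset_eq)
    then show "x = y" using c x y by metis
  qed
  then show ?thesis by blast
qed

lemma gmodule_model:
  fixes V :: "('f, 'g, 'm) gmodule"
  assumes "finite (carrier G)" and "is_gmodule F G V" and "fg_gmodule F G V"
  shows "\<exists>W\<in>fg_gmodules F G. gmodule_iso F G V W"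
proof -
  obtain M \<rho> where V: "V = (M, \<rho>)" by (cases V)
  obtain f :: "'m \<Rightarrow> nat \<Rightarrow> 'f" where "inj_on f (carrier M)"
    using fg_gmodule_inj[of G F M \<rho>] assms V by blast
  then have "bij_betw f (carrier M) (f ` carrier M)" by (rule inj_on_imp_bij_betw)
  from gmodule_transport[OF _ _ this] show ?thesis
    using assms V unfolding fg_gmodules_def by blast
qed

definition is_gmodule_sum ::
  "('f, 'c) ring_scheme \<Rightarrow> ('g, 'b) monoid_scheme \<Rightarrow> ('f, 'g, nat \<Rightarrow> 'f) gmodule \<Rightarrow>
   ('f, 'g, nat \<Rightarrow> 'f) gmodule \<Rightarrow> ('f, 'g, nat \<Rightarrow> 'f) gmodule \<Rightarrow> bool" where
  "is_gmodule_sum F G V W Z \<longleftrightarrow> gmodule_iso F G (gmodule_sum V W) Z"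

definition representation_ring ::
  "('f, 'c) ring_scheme \<Rightarrow> ('g, 'b) monoid_scheme \<Rightarrow>
   (('f, 'g, nat \<Rightarrow> 'f) gmodule \<Rightarrow>\<^sub>0 int) set ring" where
  "representation_ring F G =
     grothendieck_ring (fg_gmodules F G) (is_gmodule_sum F G)
       (\<lambda>V W. gmodule_rep F G (gmodule_tensor F G V W)) (perm_module F G gset_point)"

definition representation_class ::
  "('f, 'c) ring_scheme \<Rightarrow> ('g, 'b) monoid_scheme \<Rightarrow>
   (('f, 'g, nat \<Rightarrow> 'f) gmodule \<Rightarrow>\<^sub>0 int) \<Rightarrow> (('f, 'g, nat \<Rightarrow> 'f) gmodule \<Rightarrow>\<^sub>0 int) set" where
  "representation_class F G c =
     sum_relations (fg_gmodules F G) (is_gmodule_sum F G)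
       #>\<^bsub>free_Abelian_group (fg_gmodules F G)\<^esub> c"


section \<open>Relations, induction, inflation, and the primitive quotient\<close>

text \<open>The homomorphism \<open>[X] \<mapsto> [F[X]]\<close>. Elements of the Burnside ring are cosets; all their members
  have the same image, so that the union is a single coset (likewise in \<^const>\<open>rcoset_mult\<close>).\<close>

definition linearisation ::
  "('f, 'c) ring_scheme \<Rightarrow> ('g, 'b) monoid_scheme \<Rightarrow> (('g, nat) gset \<Rightarrow>\<^sub>0 int) set \<Rightarrow>
   (('f, 'g, nat \<Rightarrow> 'f) gmodule \<Rightarrow>\<^sub>0 int) set" where
  "linearisation F G A =
     (\<Union>c\<in>A. representation_class F G (frag_extend (\<lambda>X. frag_of (perm_module F G X)) c))"

definition brauer_relations ::
  "('f, 'c) ring_scheme \<Rightarrow> ('g, 'b) monoid_scheme \<Rightarrow> (('g, nat) gset \<Rightarrow>\<^sub>0 int) set set" where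
  "brauer_relations F G = a_kernel (burnside_ring G) (representation_ring F G) (linearisation F G)"

text \<open>Every element of a Burnside ring is of the form \<open>\<Sum> n\<^sub>U [H/U]\<close>. In the next two definitions
  the value does not depend on the choice of \<open>n\<close>, which is determined up to conjugacy of
  the \<open>U\<close>.\<close>

definition induction ::
  "('g, 'b) monoid_scheme \<Rightarrow> 'g set \<Rightarrow> (('g, nat) gset \<Rightarrow>\<^sub>0 int) set \<Rightarrow>
   (('g, nat) gset \<Rightarrow>\<^sub>0 int) set" where
  "induction G H x = (let L = G\<lparr>carrier := H\<rparr> in
     burnside_elem G (SOME n. n \<in> subgroup_combs L \<and> burnside_elem L n = x))"

definition inflation ::
  "('g, 'b) monoid_scheme \<Rightarrow> 'g set \<Rightarrow> (('g set, nat) gset \<Rightarrow>\<^sub>0 int) set \<Rightarrow>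
   (('g, nat) gset \<Rightarrow>\<^sub>0 int) set" where
  "inflation G N x =
     burnside_elem G (frag_extend (\<lambda>U. frag_of {g \<in> carrier G. N #>\<^bsub>G\<^esub> g \<in> U})
       (SOME n. n \<in> subgroup_combs (G Mod N) \<and> burnside_elem (G Mod N) n = x))"

definition imprimitive ::
  "('f, 'c) ring_scheme \<Rightarrow> ('g, 'b) monoid_scheme \<Rightarrow> (('g, nat) gset \<Rightarrow>\<^sub>0 int) set \<Rightarrow> bool" where
  "imprimitive F G x \<longleftrightarrow>
     (\<exists>H N. subgroup H G \<and> N \<lhd> G\<lparr>carrier := H\<rparr> \<and> (H \<noteq> carrier G \<or> N \<noteq> {\<one>\<^bsub>G\<^esub>}) \<and>
       (\<exists>y\<in>brauer_relations F (G\<lparr>carrier := H\<rparr> Mod N).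
          x = induction G H (inflation (G\<lparr>carrier := H\<rparr>) N y)))"

definition relation_group ::
  "('f, 'c) ring_scheme \<Rightarrow> ('g, 'b) monoid_scheme \<Rightarrow> (('g, nat) gset \<Rightarrow>\<^sub>0 int) set monoid" where
  "relation_group F G =
     \<lparr>carrier = brauer_relations F G, monoid.mult = add (burnside_ring G), one = zero (burnside_ring G)\<rparr>"

definition prim_group ::
  "('f, 'c) ring_scheme \<Rightarrow> ('g, 'b) monoid_scheme \<Rightarrow> (('g, nat) gset \<Rightarrow>\<^sub>0 int) set set monoid" where
  "prim_group F G = relation_group F G Mod generate (relation_group F G) {x. imprimitive F G x}"


section \<open>Conditions on groups and rings\<close>

definition quasi_elementary :: "nat \<Rightarrow> ('g, 'b) monoid_scheme \<Rightarrow> bool" where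
  "quasi_elementary q G \<longleftrightarrow> group G \<and> finite (carrier G) \<and>
     (\<exists>C. C \<lhd> G \<and> cyclic_group (G\<lparr>carrier := C\<rparr>) \<and> (\<exists>k. card (rcosets\<^bsub>G\<^esub> C) = q ^ k))"

definition dress_group :: "nat \<Rightarrow> nat \<Rightarrow> ('g, 'b) monoid_scheme \<Rightarrow> bool" where
  "dress_group p q G \<longleftrightarrow> group G \<and> finite (carrier G) \<and>
     (\<exists>P. P \<lhd> G \<and> (\<exists>k. card P = p ^ k) \<and> quasi_elementary q (G Mod P))"

definition sylow_subgroups :: "nat \<Rightarrow> ('g, 'b) monoid_scheme \<Rightarrow> 'g set set" where
  "sylow_subgroups p G = {P. subgroup P G \<and> card P = p ^ multiplicity p (order G)}"

definition p_core :: "nat \<Rightarrow> ('g, 'b) monoid_scheme \<Rightarrow> 'g set" where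
  "p_core p G = \<Inter>(sylow_subgroups p G)"

text \<open>The additive order of \<open>1\<close>, which is \<open>0\<close> if no positive multiple of \<open>1\<close> vanishes.\<close>

definition ring_char :: "('f, 'c) ring_scheme \<Rightarrow> nat" where
  "ring_char F = group.ord (add_monoid F) \<one>\<^bsub>F\<^esub>"

definition local_ring :: "('f, 'c) ring_scheme \<Rightarrow> bool" where
  "local_ring F \<longleftrightarrow> cring F \<and> (\<exists>!m. maximalideal m F)"

definition residue_field :: "('f, 'c) ring_scheme \<Rightarrow> 'f set ring" where
  "residue_field F = F Quot (THE m. maximalideal m F)"

end

theory Submission
 imports Defs "HOL-Number_Theory.Cong" "HOL-Algebra.Sylow"
begin

text \<open>Let \<open>P\<close> be the normal Sylow \<open>p\<close>-subgroup and \<open>I\<close> the span of the imprimitive relations. For every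
 relation \<open>c\<close> and every prime \<open>l\<close>, some multiple of \<open>c\<close> prime to \<open>l\<close> lies in \<open>I\<close>. As \<open>[G/U] \<cdot> c = Ind Res c\<close> is
 in \<open>I\<close> for \<open>U < G\<close>, work modulo proper \<open>[G/U]\<close>. If \<open>l \<noteq> p\<close>, a product of factors \<open>k - [G/U]\<close>, \<open>k\<close> prime to
 \<open>l\<close>, has mark zero at all \<open>D\<close> not containing \<open>P\<close>, so it kills the difference of \<open>c\<close> and the inflation of its
 \<open>P\<close>-fixed points. If \<open>l = p\<close>, either \<open>G/P\<close> is cyclic and all marks of \<open>c\<close> vanish, or \<open>G/P\<close> has a relation
 \<open>r[1] - (proper terms)\<close> with \<open>r\<close> prime to \<open>p\<close>. Two facts on marks are used: a relation has mark zero at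
 extensions of cyclic groups by \<open>p\<close>-groups, since ranks of trivial parts agree; conversely, for \<open>p'\<close>-groups,
 vanishing at cyclic subgroups suffices, by lifting isomorphisms from the prime field.\<close>

text \<open>The representation ring knows only direct sums and \<open>F\<close> may be any local
  ring, so characters, composition factors and unique decomposition are not at hand; a relation can
  be tested only by integer functions of modules that are additive on direct sums. The one used is
  the rank of the image of the invariants in the coinvariants modulo \<open>m\<close>: an orbit sum
  becomes the orbit length times a point, so exactly the orbits of length prime to \<open>p\<close>
  survive. In the other direction, an isomorphism over the prime field is given by a matrix of
  natural numbers, which acts over every \<open>F\<close>; an inverse modulo \<open>p\<close>
  suffices, because matrices congruent to the identity modulo \<open>m\<close> are invertible.
  Products in the Burnside ring are never formed: marks determine an element, so a product is any
  combination with the right marks. The prime \<open>l = p\<close> needs its own argument: if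
  \<open>G\<close> is a \<open>p\<close>-group, all marks of a proper \<open>[G/U]\<close> are
  divisible by \<open>p\<close>, and no factor \<open>k - [G/U]\<close> with \<open>k\<close> prime
  to \<open>p\<close> can vanish anywhere.\<close>

abbreviation supp :: "('a \<Rightarrow>\<^sub>0 'b::zero) \<Rightarrow> 'a set" where
 "supp \<equiv> Poly_Mapping.keys"

abbreviation subgrp :: "('g, 'b) monoid_scheme \<Rightarrow> 'g set \<Rightarrow> ('g, 'b) monoid_scheme" where
 "subgrp G H \<equiv> G\<lparr>carrier := H\<rparr>"

section \<open>Formal combinations and Grothendieck groups\<close>

text \<open>The linear extension of \<open>w\<close> to the free abelian group. Marks, ranks and
  orbit counts all enter the proof as functionals of this kind.\<close>

definition frag_val :: "('x \<Rightarrow> int) \<Rightarrow> ('x \<Rightarrow>\<^sub>0 int) \<Rightarrow> int" where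
 "frag_val w c = (\<Sum>x\<in>supp c. Poly_Mapping.lookup c x * w x)"

text \<open>The integers are regarded as the free abelian group on \<open>()\<close>, so that
  linearity of \<open>frag_val\<close> is inherited from \<open>frag_extend\<close>.\<close>

lemma frag_val_eq_lookup:
 "frag_val w c = Poly_Mapping.lookup (frag_extend (\<lambda>x. frag_cmul (w x) (frag_of ())) c) ()"
 by (simp add: frag_val_def frag_extend_def lookup_sum)

lemma frag_val_0 [simp]: "frag_val w 0 = 0"
 by (simp add: frag_val_def)

lemma frag_val_of [simp]: "frag_val w (frag_of x) = w x"
 by (simp add: frag_val_eq_lookup)

lemma frag_val_add [simp]: "frag_val w (a + b) = frag_val w a + frag_val w b"
 by (simp add: frag_val_eq_lookup frag_extend_add lookup_add)

lemma frag_val_uminus [simp]: "frag_val w (- a) = - frag_val w a"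
 by (simp add: frag_val_eq_lookup frag_extend_minus)

lemma frag_val_diff [simp]: "frag_val w (a - b) = frag_val w a - frag_val w b"
 by (simp add: frag_val_eq_lookup frag_extend_diff lookup_minus)

lemma frag_val_cmul [simp]: "frag_val w (frag_cmul k a) = k * frag_val w a"
 by (simp add: frag_val_eq_lookup frag_extend_cmul)

lemma frag_val_cong:
 "(\<And>x. x \<in> supp c \<Longrightarrow> v x = w x) \<Longrightarrow> frag_val v c = frag_val w c"
 by (simp add: frag_val_def)

lemma frag_val_extend: "frag_val w (frag_extend f c) = frag_val (\<lambda>x. frag_val w (f x)) c"
proof -
 have "supp c \<subseteq> UNIV" by simp
 then show ?thesis
  by (induction c rule: frag_induction) (simp_all add: frag_extend_diff)
qed

lemma frag_val_distrib_left: "frag_val (\<lambda>x. k * w x) c = k * frag_val w c"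
 by (simp add: frag_val_def sum_distrib_left algebra_simps)

lemma frag_val_sum: "frag_val (\<lambda>x. \<Sum>i\<in>I. w i x) c = (\<Sum>i\<in>I. frag_val (w i) c)"
 unfolding frag_val_def by (subst sum.swap) (simp add: sum_distrib_left)

lemma keys_frag_extend_of:
 "(\<And>x. x \<in> supp c \<Longrightarrow> f x \<in> S) \<Longrightarrow>
  supp (frag_extend (\<lambda>x. frag_of (f x)) c) \<subseteq> S"
 using keys_frag_extend[of "\<lambda>x. frag_of (f x)" c] by (auto simp: keys_frag_of)

lemma keys_diff_le: "supp a \<subseteq> S \<Longrightarrow> supp b \<subseteq> S \<Longrightarrow> supp (a - b) \<subseteq> S"
 using keys_diff[of a b] by blast

lemma keys_add_le: "supp a \<subseteq> S \<Longrightarrow> supp b \<subseteq> S \<Longrightarrow> supp (a + b) \<subseteq> S"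
 using keys_add[of a b] by blast

lemma keys_cmul_le: "supp a \<subseteq> S \<Longrightarrow> supp (frag_cmul k a) \<subseteq> S"
 using keys_cmul[of k a] by blast

section \<open>The subgroup of defining relations and its universal property\<close>

lemma sum_relations_subgroup: "subgroup (sum_relations S R) (free_Abelian_group S)"
proof -
 have "supp (frag_of X + frag_of Y - frag_of Z) \<subseteq> S"
  if "X \<in> S" "Y \<in> S" "Z \<in> S" for X Y Z
  using that by (intro keys_diff_le keys_add_le) (auto simp: keys_frag_of)
 then show ?thesis
  unfolding sum_relations_def
  by (intro group.generate_is_subgroup[OF group_free_Abelian_group] subsetI)
   (simp only: carrier_free_Abelian_group_iff mem_Collect_eq, metis)
qed

lemma sum_relations_keys: "c \<in> sum_relations S R \<Longrightarrow> supp c \<subseteq> S"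
 using subgroup.subset[OF sum_relations_subgroup[of S R]] by (metis carrier_free_Abelian_group_iff subsetD)

lemma sum_relations_0: "0 \<in> sum_relations S R"
 using subgroup.one_closed[OF sum_relations_subgroup] by auto

lemma sum_relations_add: "a \<in> sum_relations S R \<Longrightarrow> b \<in> sum_relations S R \<Longrightarrow> a + b \<in> sum_relations S R"
 using subgroup.m_closed[OF sum_relations_subgroup, of a] by auto

lemma sum_relations_uminus: "a \<in> sum_relations S R \<Longrightarrow> - a \<in> sum_relations S R"
 using subgroup.m_inv_closed[OF sum_relations_subgroup, of a S R] sum_relations_keys[of a S R] by auto

lemma sum_relations_diff: "a \<in> sum_relations S R \<Longrightarrow> b \<in> sum_relations S R \<Longrightarrow> a - b \<in> sum_relations S R"
 using sum_relations_add[of a S R "- b"] sum_relations_uminus[of b S R] by auto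

lemma sum_relations_gen:
 "\<lbrakk>X \<in> S; Y \<in> S; Z \<in> S; R X Y Z\<rbrakk> \<Longrightarrow> frag_of X + frag_of Y - frag_of Z \<in> sum_relations S R"
 unfolding sum_relations_def by (rule generate.incl) blast

lemma sum_relations_induct [consumes 1, case_names zero gen add uminus]:
 assumes "c \<in> sum_relations S R"
  and "P 0"
  and "\<And>X Y Z. \<lbrakk>X \<in> S; Y \<in> S; Z \<in> S; R X Y Z\<rbrakk> \<Longrightarrow> P (frag_of X + frag_of Y - frag_of Z)"
  and "\<And>a b. \<lbrakk>P a; P b\<rbrakk> \<Longrightarrow> P (a + b)"
  and "\<And>a. P a \<Longrightarrow> P (- a)"
 shows "P c"
proof -
 have k: "supp (frag_of X + frag_of Y - frag_of Z) \<subseteq> S"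
  if "X \<in> S" "Y \<in> S" "Z \<in> S" for X Y Z
  using that by (intro keys_diff_le keys_add_le) (auto simp: keys_frag_of)
 show ?thesis
  using assms(1) unfolding sum_relations_def
 proof (induction c rule: generate.induct)
  \<comment> \<open>The inverse is that of \<open>free_Abelian_group S\<close>, which is negation
    only for elements supported in \<open>S\<close>; hence the support bound
    \<open>k\<close>.\<close>
  case (inv h)
  then obtain X Y Z where h: "h = frag_of X + frag_of Y - frag_of Z" "X \<in> S" "Y \<in> S" "Z \<in> S" "R X Y Z"
   by blast
  show ?case using assms(5)[OF assms(3)[OF h(2-5)]] h(1) k[OF h(2-4)] by simp
 qed (use assms in auto)
qed

text \<open>Universal property of the Grothendieck group: a map of generators that sends each
  defining relation to a relation of the target sends all relations to relations. It serves
  linearisation, pull-back along homomorphisms and induction of modules.\<close>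

lemma sum_relations_extend:
 assumes "c \<in> sum_relations S R"
  and "\<And>X Y Z. \<lbrakk>X \<in> S; Y \<in> S; Z \<in> S; R X Y Z\<rbrakk> \<Longrightarrow> f X + f Y - f Z \<in> sum_relations S' R'"
 shows "frag_extend f c \<in> sum_relations S' R'"
 using assms(1)
 by (induction rule: sum_relations_induct)
  (simp_all add: sum_relations_0 frag_extend_add frag_extend_diff frag_extend_minus
   assms(2) sum_relations_add sum_relations_uminus)

text \<open>The same with the integers as target: an additive function of generators is an invariant
  of classes. It is applied to fixed-point numbers and to trivial ranks.\<close>

lemma sum_relations_val:
 assumes "c \<in> sum_relations S R"
  and "\<And>X Y Z. \<lbrakk>X \<in> S; Y \<in> S; Z \<in> S; R X Y Z\<rbrakk> \<Longrightarrow> w X + w Y = w Z"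
 shows "frag_val w c = 0"
 using assms(1) by (induction rule: sum_relations_induct) (simp_all add: assms(2))

lemma sum_relations_cmul: "a \<in> sum_relations S R \<Longrightarrow> frag_cmul k a \<in> sum_relations S R"
proof (induction k rule: int_induct[where k = 0])
 case (step1 i)
 then show ?case by (simp add: frag_cmul_distrib sum_relations_add)
next
 case (step2 i)
 then show ?case by (simp add: frag_cmul_diff_distrib sum_relations_diff)
qed (simp add: sum_relations_0)

lemma sum_relations_swap: "a - b \<in> sum_relations S R \<Longrightarrow> b - a \<in> sum_relations S R"
 using sum_relations_uminus[of "a - b" S R] by simp

lemma sum_relations_trans:
 "a - b \<in> sum_relations S R \<Longrightarrow> b - c \<in> sum_relations S R \<Longrightarrow> a - c \<in> sum_relations S R"
 using sum_relations_add[of "a - b" S R "b - c"] by simp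

text \<open>Allows each generator of a combination to be replaced by an isomorphic one.\<close>

lemma sum_relations_extend_cong:
 assumes "supp c \<subseteq> T"
  and "\<And>X. X \<in> T \<Longrightarrow> f X - g X \<in> sum_relations S R"
 shows "frag_extend f c - frag_extend g c \<in> sum_relations S R"
proof (rule free_Abelian_group_induct[OF assms(1)])
 fix x y assume "frag_extend f x - frag_extend g x \<in> sum_relations S R"
  "frag_extend f y - frag_extend g y \<in> sum_relations S R"
 from sum_relations_diff[OF this]
 show "frag_extend f (x - y) - frag_extend g (x - y) \<in> sum_relations S R"
  by (simp add: frag_extend_diff algebra_simps)
qed (simp_all add: assms(2) sum_relations_0)

section \<open>Elements of the Grothendieck group as cosets\<close>

abbreviation grothendieck_coset ::
 "'x set \<Rightarrow> ('x \<Rightarrow> 'x \<Rightarrow> 'x \<Rightarrow> bool) \<Rightarrow> ('x \<Rightarrow>\<^sub>0 int) \<Rightarrow> ('x \<Rightarrow>\<^sub>0 int) set" where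
 "grothendieck_coset S R c \<equiv> sum_relations S R #>\<^bsub>free_Abelian_group S\<^esub> c"

lemma grothendieck_coset_eq: "grothendieck_coset S R c = {d. d - c \<in> sum_relations S R}"
proof -
 have "grothendieck_coset S R c = (\<lambda>h. h + c) ` sum_relations S R" by (auto simp: r_coset_def)
 also have "\<dots> = {d. d - c \<in> sum_relations S R}"
  by (auto intro: image_eqI[of _ _ "_ - c"])
 finally show ?thesis .
qed

lemma grothendieck_coset_eq_iff:
 "grothendieck_coset S R c = grothendieck_coset S R d \<longleftrightarrow> c - d \<in> sum_relations S R"
proof
 assume "grothendieck_coset S R c = grothendieck_coset S R d"
 moreover have "c \<in> grothendieck_coset S R c" by (simp add: grothendieck_coset_eq sum_relations_0)
 ultimately show "c - d \<in> sum_relations S R" by (simp add: grothendieck_coset_eq)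
next
 assume "c - d \<in> sum_relations S R"
 then show "grothendieck_coset S R c = grothendieck_coset S R d"
  unfolding grothendieck_coset_eq using sum_relations_trans sum_relations_swap by blast
qed

lemma carrier_grothendieck_ring:
 "carrier (grothendieck_ring S R pr u) = grothendieck_coset S R ` {c. supp c \<subseteq> S}"
proof -
 have "carrier (grothendieck_ring S R pr u) =
  (\<Union>a\<in>{c. supp c \<subseteq> S}. {\<Union>h\<in>sum_relations S R. {h + a}})"
  unfolding grothendieck_ring_def FactRing_def A_RCOSETS_def RCOSETS_def free_ring_def r_coset_def
  by (simp add: free_Abelian_group_def)
 then show ?thesis unfolding r_coset_def by auto
qed

lemma zero_grothendieck_ring: "\<zero>\<^bsub>grothendieck_ring S R pr u\<^esub> = sum_relations S R"
 by (simp add: grothendieck_ring_def FactRing_def)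

lemma add_grothendieck_ring:
 "grothendieck_coset S R c \<oplus>\<^bsub>grothendieck_ring S R pr u\<^esub> grothendieck_coset S R d =
  grothendieck_coset S R (c + d)"
proof -
 have "grothendieck_coset S R c \<oplus>\<^bsub>grothendieck_ring S R pr u\<^esub> grothendieck_coset S R d =
  {h + k | h k. h \<in> grothendieck_coset S R c \<and> k \<in> grothendieck_coset S R d}"
  by (auto simp: grothendieck_ring_def FactRing_def set_add_def set_mult_def free_ring_def)
 also have "\<dots> = grothendieck_coset S R (c + d)"
  unfolding grothendieck_coset_eq
 proof safe
  fix h k assume "h - c \<in> sum_relations S R" "k - d \<in> sum_relations S R"
  from sum_relations_add[OF this] show "h + k - (c + d) \<in> sum_relations S R"
   by (simp add: algebra_simps)
 next
  fix x assume x: "x - (c + d) \<in> sum_relations S R"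
  show "\<exists>h k. x = h + k \<and> h \<in> {d. d - c \<in> sum_relations S R} \<and> k \<in> {da. da - d \<in> sum_relations S R}"
   by (rule exI[of _ "x - d"], rule exI[of _ d]) (use x in \<open>simp add: sum_relations_0 algebra_simps\<close>)
 qed
 finally show ?thesis .
qed

lemma sum_relations_eq_coset: "sum_relations S R = grothendieck_coset S R 0"
 by (simp add: grothendieck_coset_eq)

section \<open>Marks of finite $G$-sets\<close>

lemma group_action_group: "group_action G E \<phi> \<Longrightarrow> group G"
 using group_action.group_hom group_hom.axioms(1) by blast

lemma group_action_one: "group_action G E \<phi> \<Longrightarrow> x \<in> E \<Longrightarrow> \<phi> \<one>\<^bsub>G\<^esub> x = x"
 using group_action.id_eq_one by (metis restrict_apply')

lemma group_action_mult:
 "\<lbrakk>group_action G E \<phi>; g \<in> carrier G; h \<in> carrier G; x \<in> E\<rbrakk> \<Longrightarrow> \<phi> (g \<otimes>\<^bsub>G\<^esub> h) x = \<phi> g (\<phi> h x)"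
 using group_action.composition_rule by metis

lemma group_action_inv:
 assumes "group_action G E \<phi>" "g \<in> carrier G" "x \<in> E"
 shows "\<phi> (inv\<^bsub>G\<^esub> g) (\<phi> g x) = x" "\<phi> g (\<phi> (inv\<^bsub>G\<^esub> g) x) = x"
proof -
 interpret group G by (rule group_action_group[OF assms(1)])
 show "\<phi> (inv\<^bsub>G\<^esub> g) (\<phi> g x) = x" "\<phi> g (\<phi> (inv\<^bsub>G\<^esub> g) x) = x"
  using group_action_mult[OF assms(1), of "inv\<^bsub>G\<^esub> g" g x] group_action_mult[OF assms(1), of g "inv\<^bsub>G\<^esub> g" x]
   group_action_one[OF assms(1)] assms by auto
qed

lemma group_action_extensional: "group_action G E \<phi> \<Longrightarrow> g \<in> carrier G \<Longrightarrow> \<phi> g \<in> extensional E"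
 using group_action.bij_prop0 by (fastforce simp: Bij_def)

lemma group_action_sub:
 assumes act: "group_action G E \<phi>" and "D \<subseteq> E" and cl: "\<And>g x. g \<in> carrier G \<Longrightarrow> x \<in> D \<Longrightarrow> \<phi> g x \<in> D"
 shows "group_action G D (\<lambda>g. restrict (\<phi> g) D)"
 by (rule group_actionI[OF group_action_group[OF act]])
  (use assms group_action_one[OF act] group_action_mult[OF act] group.is_monoid[OF group_action_group[OF act]]
   in \<open>auto simp: subset_iff monoid.m_closed\<close>)

lemma group_action_pull:
 assumes act: "group_action H E \<phi>" and G: "group G" and t: "t \<in> hom G H"
 shows "group_action G E (\<lambda>g. \<phi> (t g))"
proof (rule group_actionI[OF G])
 interpret group_hom G H t
  using G group_action_group[OF act] t by (simp add: group_hom_def group_hom_axioms_def)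
 show "\<phi> (t \<one>\<^bsub>G\<^esub>) x = x" if "x \<in> E" for x using group_action_one[OF act that] by simp
 show "\<phi> (t (g \<otimes>\<^bsub>G\<^esub> h)) x = \<phi> (t g) (\<phi> (t h) x)"
  if "g \<in> carrier G" "h \<in> carrier G" "x \<in> E" for g h x
  using that group_action_mult[OF act] by simp
qed (use t group_action_extensional[OF act] group_action_closed[OF act] in \<open>auto simp: hom_def Pi_iff\<close>)

lemma bij_betw_case_sum:
 assumes h: "bij_betw h A B" and k: "bij_betw k C D" and d: "B \<inter> D = {}"
 shows "bij_betw (case_sum h k) (A <+> C) (B \<union> D)"
proof -
 have i: "inj_on h A" "inj_on k C" and e: "h ` A = B" "k ` C = D"
  using h k by (simp_all add: bij_betw_def)
 have n: "h a \<noteq> k c" if "a \<in> A" "c \<in> C" for a c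
  using that e d by blast
 have "inj_on (case_sum h k) (A <+> C)"
 proof (rule inj_onI)
  fix u v assume "u \<in> A <+> C" "v \<in> A <+> C" "case_sum h k u = case_sum h k v"
  then show "u = v"
   using n n[symmetric] inj_onD[OF i(1)] inj_onD[OF i(2)] by (cases u; cases v) auto
 qed
 moreover have "case_sum h k ` (A <+> C) = B \<union> D"
  using e by (simp add: Plus_def image_Un image_image)
 ultimately show ?thesis by (simp add: bij_betw_def)
qed

text \<open>\<open>D\<close> may be any set: later it is a subgroup, a singleton \<open>{g}\<close>,
  or \<open>insert d Q\<close> for a subgroup \<open>Q\<close>. For an action, the fixed points are
  those of the subgroup that \<open>D\<close> generates.\<close>

definition fixed_points :: "('g, 'x) gset \<Rightarrow> 'g set \<Rightarrow> 'x set" where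
 "fixed_points X D = {x \<in> fst X. \<forall>g\<in>D. snd X g x = x}"

text \<open>Burnside's mark at \<open>D\<close>, on representatives in the free group.\<close>

definition mark :: "'g set \<Rightarrow> (('g, 'x) gset \<Rightarrow>\<^sub>0 int) \<Rightarrow> int" where
 "mark D c = frag_val (\<lambda>X. int (card (fixed_points X D))) c"

lemma mark_simps [simp]:
 "mark D 0 = 0" "mark D (a + b) = mark D a + mark D b" "mark D (a - b) = mark D a - mark D b"
 "mark D (- a) = - mark D a" "mark D (frag_cmul k a) = k * mark D a"
 "mark D (frag_of X) = int (card (fixed_points X D))"
 by (simp_all add: mark_def)

section \<open>Isomorphisms of G-sets and additivity of fixed-point numbers\<close>

lemma gset_iso_refl: "gset_iso G X X"
 unfolding gset_iso_def by (intro exI[of _ id]) auto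

lemma gset_iso_trans: "gset_iso G X Y \<Longrightarrow> gset_iso G Y Z \<Longrightarrow> gset_iso G X Z"
 unfolding gset_iso_def
proof (elim exE conjE)
 fix f h assume f: "bij_betw f (fst X) (fst Y)" "\<forall>g\<in>carrier G. \<forall>x\<in>fst X. f (snd X g x) = snd Y g (f x)"
  and h: "bij_betw h (fst Y) (fst Z)" "\<forall>g\<in>carrier G. \<forall>x\<in>fst Y. h (snd Y g x) = snd Z g (h x)"
 show "\<exists>f. bij_betw f (fst X) (fst Z) \<and> (\<forall>g\<in>carrier G. \<forall>x\<in>fst X. f (snd X g x) = snd Z g (f x))"
  using bij_betw_trans[OF f(1) h(1)] f h bij_betwE[OF f(1)] by (intro exI[of _ "h \<circ> f"]) auto
qed

lemma gset_iso_sym: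
 assumes X: "group_action G (fst X) (snd X)" and iso: "gset_iso G X Y"
 shows "gset_iso G Y X"
proof -
 obtain f where f: "bij_betw f (fst X) (fst Y)" "\<And>g x. g \<in> carrier G \<Longrightarrow> x \<in> fst X \<Longrightarrow> f (snd X g x) = snd Y g (f x)"
  using iso by (auto simp: gset_iso_def)
 have "inv_into (fst X) f (snd Y g y) = snd X g (inv_into (fst X) f y)"
  if g: "g \<in> carrier G" and y: "y \<in> fst Y" for g y
 proof -
  have i: "inv_into (fst X) f y \<in> fst X" "f (inv_into (fst X) f y) = y"
   using f(1) y by (auto simp: bij_betw_def inv_into_into f_inv_into_f)
  have "f (snd X g (inv_into (fst X) f y)) = snd Y g y" using f(2)[OF g i(1)] i by simp
  then show ?thesis using group_action_closed[OF X g i(1)] f(1)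
   by (metis bij_betw_inv_into_left)
 qed
 then show ?thesis
  unfolding gset_iso_def using bij_betw_inv_into[OF f(1)] by blast
qed

lemma card_fixed_points_iso:
 assumes X: "group_action G (fst X) (snd X)" and iso: "gset_iso G X Y" and D: "D \<subseteq> carrier G"
 shows "card (fixed_points X D) = card (fixed_points Y D)"
proof -
 obtain f where f: "bij_betw f (fst X) (fst Y)" "\<And>g x. g \<in> carrier G \<Longrightarrow> x \<in> fst X \<Longrightarrow> f (snd X g x) = snd Y g (f x)"
  using iso by (auto simp: gset_iso_def)
 have e: "f (snd X g x) = f x \<longleftrightarrow> snd X g x = x" if "x \<in> fst X" "g \<in> D" for x g
  using f(1) group_action_closed[OF X, of g x] that D by (auto simp: bij_betw_def inj_on_def)
 have "f ` fixed_points X D = fixed_points Y D"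
 proof
  show "f ` fixed_points X D \<subseteq> fixed_points Y D"
   using f bij_betwE[OF f(1)] D by (fastforce simp: fixed_points_def subset_eq)
  show "fixed_points Y D \<subseteq> f ` fixed_points X D"
  proof
   fix y assume y: "y \<in> fixed_points Y D"
   then obtain x where x: "x \<in> fst X" "y = f x"
    using f(1) by (auto simp: fixed_points_def bij_betw_def)
   then have "x \<in> fixed_points X D"
    using y e f(2) D by (auto simp: fixed_points_def subset_eq)
   then show "y \<in> f ` fixed_points X D" using x by blast
  qed
 qed
 moreover have "inj_on f (fixed_points X D)"
  using f(1) by (auto simp: bij_betw_def fixed_points_def intro: inj_on_subset)
 ultimately show ?thesis by (metis card_image)
qed

lemma finite_gsetsD: "X \<in> finite_gsets G \<Longrightarrow> finite (fst X)" "X \<in> finite_gsets G \<Longrightarrow> group_action G (fst X) (snd X)"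
 by (auto simp: finite_gsets_def)

lemma gset_rep:
 assumes "finite (fst X)" "group_action G (fst X) (snd X)"
 shows "gset_rep G X \<in> finite_gsets G" "gset_iso G X (gset_rep G X)"
 using someI_ex[of "\<lambda>Y. Y \<in> finite_gsets G \<and> gset_iso G X Y"] gset_model[OF assms]
 unfolding gset_rep_def by blast+

lemma gset_sum_action:
 assumes X: "group_action G (fst X) (snd X)" and Y: "group_action G (fst Y) (snd Y)"
 shows "group_action G (fst (gset_sum X Y)) (snd (gset_sum X Y))"
 unfolding gset_sum_def fst_conv snd_conv
 by (rule group_actionI[OF group_action_group[OF X]])
  (auto simp: group_action_closed[OF X] group_action_closed[OF Y] group_action_one[OF X]
   group_action_one[OF Y] group_action_mult[OF X] group_action_mult[OF Y] Plus_def)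

lemma card_fixed_points_sum:
 assumes "finite (fst X)" "finite (fst Y)"
 shows "card (fixed_points (gset_sum X Y) D) = card (fixed_points X D) + card (fixed_points Y D)"
proof -
 have "fixed_points (gset_sum X Y) D = fixed_points X D <+> fixed_points Y D"
  by (auto simp: fixed_points_def gset_sum_def)
 then show ?thesis using assms by (simp add: card_Plus fixed_points_def)
qed

lemma gset_prod_action:
 assumes X: "group_action G (fst X) (snd X)" and Y: "group_action G (fst Y) (snd Y)"
 shows "group_action G (fst (gset_prod X Y)) (snd (gset_prod X Y))"
 unfolding gset_prod_def fst_conv snd_conv
 by (rule group_actionI[OF group_action_group[OF X]])
  (auto simp: group_action_closed[OF X] group_action_closed[OF Y] group_action_one[OF X]
   group_action_one[OF Y] group_action_mult[OF X] group_action_mult[OF Y])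

section \<open>Relations of the Burnside ring and decomposition into transitive G-sets\<close>

abbreviation burnside_relations :: "('g, 'b) monoid_scheme \<Rightarrow> (('g, nat) gset \<Rightarrow>\<^sub>0 int) set" where
 "burnside_relations G \<equiv> sum_relations (finite_gsets G) (is_gset_sum G)"

lemma mark_burnside_relations:
 assumes "c \<in> burnside_relations G" and D: "D \<subseteq> carrier G"
 shows "mark D c = 0"
 unfolding mark_def using assms(1)
proof (rule sum_relations_val)
 fix X Y Z assume *: "X \<in> finite_gsets G" "Y \<in> finite_gsets G" "Z \<in> finite_gsets G" "is_gset_sum G X Y Z"
 note f = finite_gsetsD[OF *(1)] finite_gsetsD[OF *(2)]
 have "card (fixed_points (gset_sum X Y) D) = card (fixed_points Z D)"
  by (rule card_fixed_points_iso[OF gset_sum_action]) (use f * D in \<open>auto simp: is_gset_sum_def\<close>)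
 then show "int (card (fixed_points X D)) + int (card (fixed_points Y D)) = int (card (fixed_points Z D))"
  using f by (simp add: card_fixed_points_sum)
qed

lemma finite_gsets_empty: "group G \<Longrightarrow> ({}, \<lambda>g. restrict id {}) \<in> finite_gsets G"
 by (auto simp: finite_gsets_def intro!: group_actionI)

text \<open>The generating relations concern disjoint unions only. Isomorphic sets get the same
  class by subtracting the relations \<open>X + {} = X\<close> and
  \<open>X + {} = Y\<close>.\<close>

lemma burnside_relations_iso:
 assumes X: "X \<in> finite_gsets G" and Y: "Y \<in> finite_gsets G" and iso: "gset_iso G X Y"
 shows "frag_of X - frag_of Y \<in> burnside_relations G"
proof -
 let ?E = "({}, \<lambda>g. restrict id {}) :: ('a, nat) gset"
 have E: "?E \<in> finite_gsets G" by (rule finite_gsets_empty[OF group_action_group[OF finite_gsetsD(2)[OF X]]])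
 have e: "gset_iso G (gset_sum X ?E) X"
  unfolding gset_iso_def gset_sum_def
  by (rule exI[of _ "case_sum id id"])
   (use group_action_closed[OF finite_gsetsD(2)[OF X]] in \<open>auto simp: bij_betw_def inj_on_def Plus_def image_image\<close>)
 have "frag_of X + frag_of ?E - frag_of X \<in> burnside_relations G"
  by (rule sum_relations_gen) (use X E e in \<open>auto simp: is_gset_sum_def\<close>)
 moreover have "frag_of X + frag_of ?E - frag_of Y \<in> burnside_relations G"
  by (rule sum_relations_gen) (use X Y E gset_iso_trans[OF e iso] in \<open>auto simp: is_gset_sum_def\<close>)
 ultimately show ?thesis using sum_relations_diff by fastforce
qed

text \<open>The representative in the free group of which \<open>burnside_elem\<close> is the class;
  almost all computations take place on this level.\<close>

definition coset_comb :: "('g, 'b) monoid_scheme \<Rightarrow> ('g set \<Rightarrow>\<^sub>0 int) \<Rightarrow> (('g, nat) gset \<Rightarrow>\<^sub>0 int)" where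
 "coset_comb G n = frag_extend (\<lambda>U. frag_of (gset_rep G (coset_gset G U))) n"

lemma burnside_elem_coset_comb: "burnside_elem G n = burnside_class G (coset_comb G n)"
 by (simp add: burnside_elem_def coset_comb_def)

lemma subgroup_combs_iff: "n \<in> subgroup_combs G \<longleftrightarrow> supp n \<subseteq> {U. subgroup U G}"
 by (simp add: subgroup_combs_def)

lemma subgroup_combs_closed:
 "a \<in> subgroup_combs G \<Longrightarrow> b \<in> subgroup_combs G \<Longrightarrow> a + b \<in> subgroup_combs G"
 "a \<in> subgroup_combs G \<Longrightarrow> b \<in> subgroup_combs G \<Longrightarrow> a - b \<in> subgroup_combs G"
 "a \<in> subgroup_combs G \<Longrightarrow> frag_cmul k a \<in> subgroup_combs G"
 "frag_of U \<in> subgroup_combs G \<longleftrightarrow> subgroup U G"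
 "0 \<in> subgroup_combs G"
 unfolding subgroup_combs_iff by (simp_all add: keys_add_le keys_diff_le keys_cmul_le keys_frag_of)

lemma coset_comb_simps [simp]:
 "coset_comb G 0 = 0" "coset_comb G (a + b) = coset_comb G a + coset_comb G b"
 "coset_comb G (a - b) = coset_comb G a - coset_comb G b"
 "coset_comb G (frag_cmul k a) = frag_cmul k (coset_comb G a)"
 "coset_comb G (frag_of U) = frag_of (gset_rep G (coset_gset G U))"
 by (simp_all add: coset_comb_def frag_extend_add frag_extend_diff frag_extend_cmul)

context
 fixes G :: "('g, 'b) monoid_scheme" (structure)
 assumes G: "group G" and finG: "finite (carrier G)"
begin

interpretation group G by (rule G)

lemma coset_gset_finite: "finite (fst (coset_gset G U))"
 using finG by (simp add: coset_gset_def)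

lemma coset_rep:
 assumes "subgroup U G"
 shows "gset_rep G (coset_gset G U) \<in> finite_gsets G" "gset_iso G (coset_gset G U) (gset_rep G (coset_gset G U))"
 using gset_rep[OF coset_gset_finite coset_gset_action[OF G assms]] by auto

lemma coset_comb_keys: "n \<in> subgroup_combs G \<Longrightarrow> supp (coset_comb G n) \<subseteq> finite_gsets G"
 unfolding coset_comb_def by (rule keys_frag_extend_of) (use coset_rep in \<open>auto simp: subgroup_combs_iff\<close>)

text \<open>The orbit-stabiliser theorem as an isomorphism of G-sets, not merely as an equation
  between cardinalities.\<close>

lemma orbit_iso_coset:
 assumes act: "group_action G E \<phi>" and x: "x \<in> E"
 defines "D \<equiv> (\<lambda>g. \<phi> g x) ` carrier G" and "U \<equiv> {g \<in> carrier G. \<phi> g x = x}"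
 shows "subgroup U G" and "gset_iso G (coset_gset G U) (D, \<lambda>g. restrict (\<phi> g) D)"
proof -
 note cl = group_action_closed[OF act] and mu = group_action_mult[OF act]
  and on = group_action_one[OF act] and iv = group_action_inv[OF act]
 show U: "subgroup U G"
 proof (rule subgroupI)
  show "inv a \<in> U" if "a \<in> U" for a using that iv(1)[of a x] x by (simp add: U_def)
  show "a \<otimes> b \<in> U" if "a \<in> U" "b \<in> U" for a b using that mu[of a b x] x by (simp add: U_def)
  have "\<one> \<in> U" using on[OF x] by (simp add: U_def)
  then show "U \<noteq> {}" by blast
 qed (auto simp: U_def)
 have Us: "U \<subseteq> carrier G" by (auto simp: U_def)
 \<comment> \<open>The map \<open>g \<mapsto> \<phi> g x\<close> is constant on left cosets of the
   stabiliser, so the image of a coset is a singleton.\<close>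
 define f where "f = (\<lambda>A. the_elem ((\<lambda>g. \<phi> g x) ` A))"
 have f: "f (g <#\<^bsub>G\<^esub> U) = \<phi> g x" if g: "g \<in> carrier G" for g
 proof -
  have "(\<lambda>g. \<phi> g x) ` (g <#\<^bsub>G\<^esub> U) = {\<phi> g x}"
   using subgroup.one_closed[OF U] g by (force simp: l_coset_def U_def mu[OF g _ x] image_iff)
  then show ?thesis by (simp add: f_def)
 qed
 have inj: "g <#\<^bsub>G\<^esub> U = h <#\<^bsub>G\<^esub> U" if gh: "g \<in> carrier G" "h \<in> carrier G" "\<phi> g x = \<phi> h x" for g h
 proof -
  have "inv h \<otimes> g \<in> U"
   using gh mu[of "inv h" g x] iv(1)[of h x] x by (simp add: U_def)
  moreover have "h \<otimes> (inv h \<otimes> g) = g" using gh by (simp add: m_assoc[symmetric])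
  ultimately have "g \<in> h <#\<^bsub>G\<^esub> U" unfolding l_coset_def by (metis UN_I insertI1)
  then show ?thesis using l_repr_independence[OF _ gh(2) U] by metis
 qed
 show "gset_iso G (coset_gset G U) (D, \<lambda>g. restrict (\<phi> g) D)"
  unfolding gset_iso_def coset_gset_def fst_conv snd_conv
 proof (intro exI[of _ f] conjI ballI)
  show "bij_betw f ((\<lambda>x. x <#\<^bsub>G\<^esub> U) ` carrier G) D"
   unfolding bij_betw_def
  proof
   show "inj_on f ((\<lambda>x. x <#\<^bsub>G\<^esub> U) ` carrier G)"
   proof (rule inj_onI)
    fix A B assume "A \<in> (\<lambda>x. x <#\<^bsub>G\<^esub> U) ` carrier G" "B \<in> (\<lambda>x. x <#\<^bsub>G\<^esub> U) ` carrier G" "f A = f B"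
    then obtain g h where "g \<in> carrier G" "A = g <#\<^bsub>G\<^esub> U" "h \<in> carrier G" "B = h <#\<^bsub>G\<^esub> U" "f A = f B"
     by blast
    then show "A = B" using inj[of g h] f by metis
   qed
   show "f ` (\<lambda>x. x <#\<^bsub>G\<^esub> U) ` carrier G = D"
    unfolding D_def image_image by (rule image_cong) (simp_all add: f)
  qed
  fix g A assume g: "g \<in> carrier G" and "A \<in> (\<lambda>x. x <#\<^bsub>G\<^esub> U) ` carrier G"
  then obtain h where h: "h \<in> carrier G" "A = h <#\<^bsub>G\<^esub> U" by auto
  then show "f (restrict ((<#\<^bsub>G\<^esub>) g) ((\<lambda>x. x <#\<^bsub>G\<^esub> U) ` carrier G) A) = restrict (\<phi> g) D (f A)"
   using g by (auto simp: f lcos_m_assoc[OF Us] D_def mu x)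
 qed
qed

text \<open>Split off one orbit, which is a coset space, and use induction on the number of
  points.\<close>

lemma gset_decompose:
 assumes "X \<in> finite_gsets G"
 shows "\<exists>n\<in>subgroup_combs G. frag_of X - coset_comb G n \<in> burnside_relations G"
 using assms
proof (induction "card (fst X)" arbitrary: X rule: less_induct)
 case less
 note fin = finite_gsetsD(1)[OF less.prems] and act = finite_gsetsD(2)[OF less.prems]
 obtain E \<phi> where X: "X = (E, \<phi>)" by (cases X)
 have act: "group_action G E \<phi>" and fin: "finite E" using act fin X by auto
 note cl = group_action_closed[OF act] and mu = group_action_mult[OF act]
 show ?case
 proof (cases "E = {}")
  case True
  \<comment> \<open>For the empty set, \<open>X + X = X\<close> shows that its class is
    zero.\<close>
  have "gset_iso G (gset_sum X X) X" unfolding gset_iso_def gset_sum_def using True X by (auto simp: bij_betw_def)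
  then have "frag_of X + frag_of X - frag_of X \<in> burnside_relations G"
   by (intro sum_relations_gen less.prems) (auto simp: is_gset_sum_def)
  then show ?thesis by (intro bexI[of _ 0]) (simp_all add: subgroup_combs_closed)
 next
  case False
  then obtain x where x: "x \<in> E" by auto
  define D where "D = (\<lambda>g. \<phi> g x) ` carrier G"
  define U where "U = {g \<in> carrier G. \<phi> g x = x}"
  have xD: "x \<in> D" unfolding D_def using group_action_one[OF act x] by (metis image_eqI one_closed)
  have DE: "D \<subseteq> E" using cl x by (auto simp: D_def)
  have Dc: "\<phi> g y \<in> D" if g: "g \<in> carrier G" and y: "y \<in> D" for g y
  proof -
   obtain h where h: "h \<in> carrier G" "y = \<phi> h x" using y by (auto simp: D_def)
   then have "\<phi> g y = \<phi> (g \<otimes> h) x" using mu[OF g h(1) x] by simp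
   then show ?thesis using g h(1) by (auto simp: D_def)
  qed
  have Ec: "\<phi> g y \<in> E - D" if g: "g \<in> carrier G" and y: "y \<in> E - D" for g y
   using Dc[of "inv g" "\<phi> g y"] group_action_inv(1)[OF act g, of y] cl g y by auto
  have U: "subgroup U G" and iD: "gset_iso G (coset_gset G U) (D, \<lambda>g. restrict (\<phi> g) D)"
   using orbit_iso_coset[OF act x] by (simp_all add: D_def U_def)
  define Y where "Y = (E - D, \<lambda>g. restrict (\<phi> g) (E - D))"
  have Y: "Y \<in> finite_gsets G"
   unfolding Y_def finite_gsets_def using group_action_sub[OF act, of "E - D"] Ec fin by auto
  let ?Z = "gset_rep G (coset_gset G U)"
  have Z: "?Z \<in> finite_gsets G" by (rule coset_rep[OF U])
  have iZ: "gset_iso G ?Z (D, \<lambda>g. restrict (\<phi> g) D)"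
   by (rule gset_iso_trans[OF gset_iso_sym[OF _ coset_rep(2)[OF U]] iD]) (rule coset_gset_action[OF G U])
  then obtain h where h: "bij_betw h (fst ?Z) D"
   "\<And>g z. g \<in> carrier G \<Longrightarrow> z \<in> fst ?Z \<Longrightarrow> h (snd ?Z g z) = restrict (\<phi> g) D (h z)"
   by (auto simp: gset_iso_def)
  have "gset_iso G (gset_sum ?Z Y) X"
   unfolding gset_iso_def
  proof (intro exI[of _ "case_sum h id"] conjI ballI)
   have "bij_betw (case_sum h id) (fst ?Z <+> (E - D)) (D \<union> (E - D))"
    by (rule bij_betw_case_sum[OF h(1) bij_betw_id]) auto
   moreover have "D \<union> (E - D) = E" using DE by blast
   ultimately show "bij_betw (case_sum h id) (fst (gset_sum ?Z Y)) (fst X)"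
    by (simp add: gset_sum_def Y_def X)
   fix g z assume g: "g \<in> carrier G" and z: "z \<in> fst (gset_sum ?Z Y)"
   show "case_sum h id (snd (gset_sum ?Z Y) g z) = snd X g (case_sum h id z)"
   proof (cases z)
    case (Inl a)
    then have a: "a \<in> fst ?Z" using z by (auto simp: gset_sum_def)
    then show ?thesis using h(2)[OF g a] bij_betwE[OF h(1)] Inl z by (simp add: gset_sum_def X)
   next
    case (Inr b)
    then have "b \<in> E - D" using z by (auto simp: gset_sum_def Y_def)
    then show ?thesis using Inr z by (auto simp: gset_sum_def Y_def X)
   qed
  qed
  then have 1: "frag_of ?Z + frag_of Y - frag_of X \<in> burnside_relations G"
   by (intro sum_relations_gen Z Y less.prems) (simp add: is_gset_sum_def)
  have "card (fst Y) < card (fst X)"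
   using fin x xD by (auto simp: Y_def X intro!: psubset_card_mono)
  from less.hyps[OF this Y] obtain n where n: "n \<in> subgroup_combs G"
   "frag_of Y - coset_comb G n \<in> burnside_relations G" by auto
  have "frag_of X - coset_comb G (frag_of U + n) =
   (frag_of Y - coset_comb G n) - (frag_of ?Z + frag_of Y - frag_of X)" by simp
  also have "\<dots> \<in> burnside_relations G" by (rule sum_relations_diff[OF n(2) 1])
  finally show ?thesis using n(1) U
   by (intro bexI[of _ "frag_of U + n"]) (simp_all add: subgroup_combs_closed)
 qed
qed

lemma burnside_decompose:
 assumes "supp c \<subseteq> finite_gsets G"
 shows "\<exists>n\<in>subgroup_combs G. c - coset_comb G n \<in> burnside_relations G"
proof (rule free_Abelian_group_induct[OF assms])
 show "\<exists>n\<in>subgroup_combs G. 0 - coset_comb G n \<in> burnside_relations G"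
  by (intro bexI[of _ 0]) (simp_all add: subgroup_combs_closed sum_relations_0)
 fix x y
 assume "\<exists>n\<in>subgroup_combs G. x - coset_comb G n \<in> burnside_relations G"
  "\<exists>n\<in>subgroup_combs G. y - coset_comb G n \<in> burnside_relations G"
 then obtain n m where n: "n \<in> subgroup_combs G" "x - coset_comb G n \<in> burnside_relations G"
  "m \<in> subgroup_combs G" "y - coset_comb G m \<in> burnside_relations G" by auto
 have "x - y - coset_comb G (n - m) \<in> burnside_relations G"
  using sum_relations_diff[OF n(2,4)] by (simp add: algebra_simps)
 then show "\<exists>n\<in>subgroup_combs G. x - y - coset_comb G n \<in> burnside_relations G"
  using n by (intro bexI[of _ "n - m"] subgroup_combs_closed) simp_all
qed (rule gset_decompose)

end

text \<open>Consists of the \<open>g\<close> for which the point \<open>gU\<close> of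
  \<open>G/U\<close> is fixed by \<open>D\<close>. With \<open>D = U\<close> a finite subgroup this
  is the normaliser of \<open>U\<close>.\<close>

definition conj_into :: "('g, 'b) monoid_scheme \<Rightarrow> 'g set \<Rightarrow> 'g set \<Rightarrow> 'g set" where
 "conj_into G D U = {g \<in> carrier G. \<forall>d\<in>D. inv\<^bsub>G\<^esub> g \<otimes>\<^bsub>G\<^esub> d \<otimes>\<^bsub>G\<^esub> g \<in> U}"

abbreviation coset_mark :: "('g, 'b) monoid_scheme \<Rightarrow> 'g set \<Rightarrow> 'g set \<Rightarrow> int" where
 "coset_mark G D U \<equiv> int (card (fixed_points (coset_gset G U) D))"

text \<open>Restriction when \<open>t\<close> is an inclusion, inflation when \<open>t\<close> is a
  quotient map.\<close>

definition gset_pull :: "('h \<Rightarrow> 'g) \<Rightarrow> ('g, 'x) gset \<Rightarrow> ('h, 'x) gset" where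
 "gset_pull t X = (fst X, \<lambda>g. snd X (t g))"

definition frag_pull :: "('h \<Rightarrow> 'g) \<Rightarrow> (('g, 'x) gset \<Rightarrow>\<^sub>0 int) \<Rightarrow> (('h, 'x) gset \<Rightarrow>\<^sub>0 int)" where
 "frag_pull t c = frag_extend (\<lambda>X. frag_of (gset_pull t X)) c"

lemma fixed_points_pull: "fixed_points (gset_pull t X) D = fixed_points X (t ` D)"
 by (auto simp: fixed_points_def gset_pull_def)

lemma mark_pull: "mark D (frag_pull t c) = mark (t ` D) c"
 by (simp only: mark_def frag_pull_def frag_val_extend frag_val_of fixed_points_pull)

lemma gset_pull_finite:
 "\<lbrakk>X \<in> finite_gsets H; group G; t \<in> hom G H\<rbrakk> \<Longrightarrow> gset_pull t X \<in> finite_gsets G"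
 by (auto simp: finite_gsets_def gset_pull_def intro: group_action_pull)

lemma frag_pull_keys:
 "\<lbrakk>supp c \<subseteq> finite_gsets H; group G; t \<in> hom G H\<rbrakk>
  \<Longrightarrow> supp (frag_pull t c) \<subseteq> finite_gsets G"
 unfolding frag_pull_def by (rule keys_frag_extend_of) (auto intro: gset_pull_finite)

lemma finite_gsets_subgroup:
 assumes "group G" "subgroup H G" "X \<in> finite_gsets G"
 shows "X \<in> finite_gsets (subgrp G H)"
proof -
 have "(\<lambda>g. g) \<in> hom (subgrp G H) G"
  using subgroup.subset[OF assms(2)] by (auto simp: hom_def)
 from gset_pull_finite[OF assms(3) group.subgroup_imp_group[OF assms(1,2)] this]
 show ?thesis by (simp add: gset_pull_def)
qed

section \<open>Fixed points on coset spaces and the table of marks\<close>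

context
 fixes G :: "('g, 'b) monoid_scheme" (structure)
 assumes G: "group G" and finG: "finite (carrier G)"
begin

interpretation group G by (rule G)

lemma l_coset_eq_iff:
 assumes U: "subgroup U G" and g: "g \<in> carrier G" "h \<in> carrier G"
 shows "h <#\<^bsub>G\<^esub> U = g <#\<^bsub>G\<^esub> U \<longleftrightarrow> inv g \<otimes> h \<in> U"
proof
 assume "h <#\<^bsub>G\<^esub> U = g <#\<^bsub>G\<^esub> U"
 moreover have "h \<in> h <#\<^bsub>G\<^esub> U"
  using g subgroup.one_closed[OF U] by (force simp: l_coset_def)
 ultimately obtain u where u: "u \<in> U" "h = g \<otimes> u" by (auto simp: l_coset_def)
 then have "u \<in> carrier G" using subgroup.subset[OF U] by auto
 then have "inv g \<otimes> h = u" using g u by (simp add: m_assoc[symmetric])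
 then show "inv g \<otimes> h \<in> U" using u by simp
next
 assume "inv g \<otimes> h \<in> U"
 moreover have "g \<otimes> (inv g \<otimes> h) = h" using g by (simp add: m_assoc[symmetric])
 ultimately have "h \<in> g <#\<^bsub>G\<^esub> U" unfolding l_coset_def by (metis UN_I insertI1)
 then show "h <#\<^bsub>G\<^esub> U = g <#\<^bsub>G\<^esub> U" using l_repr_independence[OF _ g(1) U] by metis
qed

lemma card_l_coset:
 assumes U: "subgroup U G" and g: "g \<in> carrier G"
 shows "card (g <#\<^bsub>G\<^esub> U) = card U"
proof -
 have "g <#\<^bsub>G\<^esub> U = (\<lambda>u. g \<otimes> u) ` U" by (auto simp: l_coset_def)
 moreover have "inj_on (\<lambda>u. g \<otimes> u) U"
  using g subgroup.subset[OF U] by (auto simp: inj_on_def subset_iff)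
 ultimately show ?thesis by (simp add: card_image)
qed

lemma fixed_points_coset:
 assumes U: "subgroup U G" and D: "D \<subseteq> carrier G"
 shows "fixed_points (coset_gset G U) D = (\<lambda>g. g <#\<^bsub>G\<^esub> U) ` conj_into G D U"
proof -
 have e: "(\<forall>d\<in>D. snd (coset_gset G U) d (g <#\<^bsub>G\<^esub> U) = g <#\<^bsub>G\<^esub> U) \<longleftrightarrow> g \<in> conj_into G D U"
  if g: "g \<in> carrier G" for g
 proof -
  have "snd (coset_gset G U) d (g <#\<^bsub>G\<^esub> U) = g <#\<^bsub>G\<^esub> U \<longleftrightarrow> inv g \<otimes> d \<otimes> g \<in> U" if d: "d \<in> D" for d
  proof -
   have dG: "d \<in> carrier G" using d D by auto
   have "snd (coset_gset G U) d (g <#\<^bsub>G\<^esub> U) = (d \<otimes> g) <#\<^bsub>G\<^esub> U"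
    using g dG by (auto simp: coset_gset_def lcos_m_assoc[OF subgroup.subset[OF U]])
   then show ?thesis using l_coset_eq_iff[OF U g, of "d \<otimes> g"] dG g by (simp add: m_assoc)
  qed
  then show ?thesis using g by (auto simp: conj_into_def)
 qed
 have f: "fst (coset_gset G U) = (\<lambda>g. g <#\<^bsub>G\<^esub> U) ` carrier G" by (simp add: coset_gset_def)
 show ?thesis unfolding fixed_points_def f using e by (auto simp: conj_into_def)
qed

text \<open>\<open>conj_into G D U\<close> is the disjoint union of the left cosets of
  \<open>U\<close> that are fixed by \<open>D\<close>. In this multiplied form, marks can be
  compared by counting group elements.\<close>

lemma card_fixed_points_coset:
 assumes U: "subgroup U G" and D: "D \<subseteq> carrier G"
 shows "card U * card (fixed_points (coset_gset G U) D) = card (conj_into G D U)"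
proof -
 let ?C = "fixed_points (coset_gset G U) D"
 note C = fixed_points_coset[OF assms]
 have sub: "conj_into G D U \<subseteq> carrier G" by (auto simp: conj_into_def)
 have Us: "U \<subseteq> carrier G" by (rule subgroup.subset[OF U])
 have Un: "\<Union>?C = conj_into G D U"
 proof
  show "conj_into G D U \<subseteq> \<Union>?C"
  proof
   fix g assume g: "g \<in> conj_into G D U"
   then have "g \<in> g <#\<^bsub>G\<^esub> U"
    using sub subgroup.one_closed[OF U] by (force simp: l_coset_def)
   then show "g \<in> \<Union>?C" unfolding C using g by blast
  qed
  show "\<Union>?C \<subseteq> conj_into G D U"
  proof
   fix h assume "h \<in> \<Union>?C"
   then obtain g u where g: "g \<in> conj_into G D U" "u \<in> U" "h = g \<otimes> u"
    unfolding C by (auto simp: l_coset_def)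
   have gG: "g \<in> carrier G" "u \<in> carrier G" using g sub Us by auto
   have "inv h \<otimes> d \<otimes> h \<in> U" if d: "d \<in> D" for d
   proof -
    have dG: "d \<in> carrier G" using d D by auto
    have "inv h \<otimes> d \<otimes> h = inv u \<otimes> (inv g \<otimes> d \<otimes> g) \<otimes> u"
     using g(3) gG dG by (simp add: inv_mult_group m_assoc)
    moreover have "inv g \<otimes> d \<otimes> g \<in> U" using g(1) d by (simp add: conj_into_def)
    ultimately show ?thesis
     using g(2) subgroup.m_closed[OF U] subgroup.m_inv_closed[OF U] by simp
   qed
   then show "h \<in> conj_into G D U" using gG g(3) by (simp add: conj_into_def)
  qed
 qed
 have fC: "finite ?C" using coset_gset_finite[OF G finG, of U] by (simp add: fixed_points_def)
 have "card U * card ?C = card (\<Union>?C)"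
 proof (rule card_partition[OF fC])
  show "finite (\<Union>?C)" unfolding Un using finG sub finite_subset by blast
  fix A B assume A: "A \<in> ?C" and B: "B \<in> ?C" and ne: "A \<noteq> B"
  from A B obtain g h where g: "g \<in> carrier G" "A = g <#\<^bsub>G\<^esub> U" "h \<in> carrier G" "B = h <#\<^bsub>G\<^esub> U"
   unfolding C using sub by auto
  show "A \<inter> B = {}"
  proof (rule ccontr)
   assume "A \<inter> B \<noteq> {}"
   then obtain x where x: "x \<in> g <#\<^bsub>G\<^esub> U" "x \<in> h <#\<^bsub>G\<^esub> U" using g by auto
   then have "g <#\<^bsub>G\<^esub> U = h <#\<^bsub>G\<^esub> U"
    using l_repr_independence[OF x(1) g(1) U] l_repr_independence[OF x(2) g(3) U] by simp
   then show False using ne g by simp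
  qed
 next
  fix A assume "A \<in> ?C"
  then show "card A = card U" unfolding C using sub card_l_coset[OF U] by auto
 qed
 then show ?thesis by (simp add: Un)
qed

lemma mark_coset_comb:
 assumes n: "n \<in> subgroup_combs G" and D: "D \<subseteq> carrier G"
 shows "mark D (coset_comb G n) = frag_val (coset_mark G D) n"
proof -
 have "card (fixed_points (gset_rep G (coset_gset G U)) D) = card (fixed_points (coset_gset G U) D)"
  if "subgroup U G" for U
  using card_fixed_points_iso[OF coset_gset_action[OF G that] coset_rep(2)[OF G finG that] D] by simp
 then show ?thesis
  unfolding coset_comb_def mark_def frag_val_extend frag_val_of
  using n by (intro frag_val_cong) (auto simp: subgroup_combs_iff)
qed

text \<open>If \<open>V\<close> fixes \<open>gU\<close>, then \<open>V\<close> lies in the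
  stabiliser of \<open>gU\<close>, and conjugation by \<open>g\<close> embeds that stabiliser in
  \<open>U\<close>. The bound on cardinalities makes \<open>V\<close> the whole stabiliser, and the
  orbit of \<open>gU\<close> is all of \<open>G/U\<close>.\<close>

lemma coset_iso_of_fixed_point:
 assumes U: "subgroup U G" and V: "subgroup V G" and le: "card U \<le> card V"
  and fp: "fixed_points (coset_gset G U) V \<noteq> {}"
 shows "gset_iso G (coset_gset G V) (coset_gset G U)"
proof -
 let ?X = "coset_gset G U"
 obtain g where g: "g \<in> carrier G" and gV: "\<forall>d\<in>V. inv g \<otimes> d \<otimes> g \<in> U"
  using fp fixed_points_coset[OF U subgroup.subset[OF V]] by (auto simp: conj_into_def)
 define x where "x = g <#\<^bsub>G\<^esub> U"
 have x: "x \<in> fst ?X" using g by (simp add: coset_gset_def x_def)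
 note act = coset_gset_action[OF G U]
 define S where "S = {h \<in> carrier G. snd ?X h x = x}"
 have Us: "U \<subseteq> carrier G" by (rule subgroup.subset[OF U])
 have h: "snd ?X h x = (h \<otimes> g) <#\<^bsub>G\<^esub> U" if "h \<in> carrier G" for h
  using that g by (auto simp: coset_gset_def x_def lcos_m_assoc[OF Us])
 have S: "h \<in> S \<longleftrightarrow> h \<in> carrier G \<and> inv g \<otimes> h \<otimes> g \<in> U" for h
  using h[of h] l_coset_eq_iff[OF U g, of "h \<otimes> g"] g by (auto simp: S_def x_def m_assoc)
 have VS: "V \<subseteq> S" using gV subgroup.subset[OF V] S by auto
 have "inj_on (\<lambda>h. inv g \<otimes> h \<otimes> g) S" using g by (auto simp: inj_on_def S)
 then have "card S \<le> card U"
  using card_inj_on_le[of _ S U] S finite_subset[OF Us finG] by (auto simp: image_subset_iff)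
 moreover have "finite S" using finG by (simp add: S_def)
 ultimately have "V = S" using VS le by (metis card_seteq le_trans)
 moreover have "(\<lambda>h. snd ?X h x) ` carrier G = fst ?X"
 proof
  show "(\<lambda>h. snd ?X h x) ` carrier G \<subseteq> fst ?X" using group_action_closed[OF act _ x] by auto
  show "fst ?X \<subseteq> (\<lambda>h. snd ?X h x) ` carrier G"
  proof
   fix y assume "y \<in> fst ?X"
   then obtain k where k: "k \<in> carrier G" "y = k <#\<^bsub>G\<^esub> U" by (auto simp: coset_gset_def)
   then have "y = snd ?X (k \<otimes> inv g) x" using h[of "k \<otimes> inv g"] g by (simp add: m_assoc)
   then show "y \<in> (\<lambda>h. snd ?X h x) ` carrier G" using k g by auto
  qed
 qed
 ultimately have "gset_iso G (coset_gset G V) (fst ?X, \<lambda>h. restrict (snd ?X h) (fst ?X))"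
  using orbit_iso_coset(2)[OF G finG act x] by (simp add: S_def)
 then obtain f where f: "bij_betw f (fst (coset_gset G V)) (fst ?X)"
  "\<And>g x. g \<in> carrier G \<Longrightarrow> x \<in> fst (coset_gset G V) \<Longrightarrow>
   f (snd (coset_gset G V) g x) = restrict (snd ?X g) (fst ?X) (f x)"
  by (auto simp: gset_iso_def)
 then show ?thesis
  unfolding gset_iso_def using bij_betwE[OF f(1)] by (intro exI[of _ f]) simp
qed

text \<open>The table of marks is triangular with nonzero diagonal.\<close>

lemma burnside_relations_iff:
 assumes c: "supp c \<subseteq> finite_gsets G"
 shows "c \<in> burnside_relations G \<longleftrightarrow> (\<forall>D. subgroup D G \<longrightarrow> mark D c = 0)"
proof (intro iffI allI impI)
 fix D assume "c \<in> burnside_relations G" "subgroup D G"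
 then show "mark D c = 0" using mark_burnside_relations subgroup.subset by blast
next
 assume z: "\<forall>D. subgroup D G \<longrightarrow> mark D c = 0"
 obtain n where n: "n \<in> subgroup_combs G" and cn: "c - coset_comb G n \<in> burnside_relations G"
  using burnside_decompose[OF G finG c] by blast
 \<comment> \<open>The combination is rewritten with one subgroup for each isomorphism class of
   coset spaces. Only then do vanishing marks force vanishing coefficients, since conjugate
   subgroups have the same marks.\<close>
 define eqv where "eqv = (\<lambda>U V. subgroup V G \<and> gset_iso G (coset_gset G U) (coset_gset G V))"
 define r where "r = (\<lambda>U. SOME V. eqv U V)"
 have r: "eqv U (r U)" if "subgroup U G" for U
  unfolding r_def by (rule someI[of _ U]) (simp add: eqv_def that gset_iso_refl)
 have r_eq: "r U = r V" if "subgroup U G" "eqv U V" for U V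
 proof -
  have "gset_iso G (coset_gset G V) (coset_gset G U)"
   using gset_iso_sym[OF coset_gset_action[OF G that(1)], of "coset_gset G V"] that(2)
   unfolding eqv_def by blast
  then have "eqv U = eqv V" using that(2) gset_iso_trans unfolding eqv_def by blast
  then show ?thesis by (simp add: r_def)
 qed
 define m where "m = frag_extend (\<lambda>U. frag_of (r U)) n"
 have mk: "supp m \<subseteq> r ` {U. subgroup U G}"
  unfolding m_def by (rule keys_frag_extend_of) (use n in \<open>auto simp: subgroup_combs_iff\<close>)
 have mc: "m \<in> subgroup_combs G" using mk r by (auto simp: subgroup_combs_iff eqv_def)
 have nm: "coset_comb G n - coset_comb G m \<in> burnside_relations G"
 proof -
  have "coset_comb G m = frag_extend (\<lambda>U. frag_of (gset_rep G (coset_gset G (r U)))) n"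
  proof -
   have "coset_comb G (frag_extend (\<lambda>U. frag_of (r U)) n) =
    frag_extend (\<lambda>U. frag_of (gset_rep G (coset_gset G (r U)))) n"
    by (rule free_Abelian_group_induct[of n UNIV]) (simp_all add: frag_extend_diff)
   then show ?thesis by (simp add: m_def)
  qed
  moreover have "frag_of (gset_rep G (coset_gset G U)) - frag_of (gset_rep G (coset_gset G (r U)))
   \<in> burnside_relations G" if U: "U \<in> {U. subgroup U G}" for U
  proof (rule burnside_relations_iso)
   have rU: "subgroup (r U) G" "gset_iso G (coset_gset G U) (coset_gset G (r U))"
    using r[of U] U by (auto simp: eqv_def)
   have U: "subgroup U G" using U by simp
   show "gset_rep G (coset_gset G U) \<in> finite_gsets G" "gset_rep G (coset_gset G (r U)) \<in> finite_gsets G"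
    using coset_rep[OF G finG] U rU by auto
   show "gset_iso G (gset_rep G (coset_gset G U)) (gset_rep G (coset_gset G (r U)))"
    using gset_iso_trans[OF gset_iso_sym[OF coset_gset_action[OF G U] coset_rep(2)[OF G finG U]]
      gset_iso_trans[OF rU(2) coset_rep(2)[OF G finG rU(1)]]] .
  qed
  ultimately show ?thesis unfolding coset_comb_def[of _ n]
   using sum_relations_extend_cong[of n "{U. subgroup U G}"
     "\<lambda>U. frag_of (gset_rep G (coset_gset G U))" "\<lambda>U. frag_of (gset_rep G (coset_gset G (r U)))"] n
   by (simp add: subgroup_combs_iff)
 qed
 have mz: "mark D (coset_comb G m) = 0" if D: "subgroup D G" for D
  using z D mark_burnside_relations[OF cn subgroup.subset[OF D]]
   mark_burnside_relations[OF nm subgroup.subset[OF D]] by simp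
 \<comment> \<open>At a \<open>V\<close> of largest order in the support, no other chosen
   \<open>G/U\<close> has a \<open>V\<close>-fixed point, so the mark at \<open>V\<close> is the
   coefficient of \<open>V\<close> times a positive number.\<close>
 have "m = 0"
 proof (rule ccontr)
  assume "m \<noteq> 0"
  then have ne: "supp m \<noteq> {}" by simp
  obtain V where V: "V \<in> supp m" and Vm: "\<And>U. U \<in> supp m \<Longrightarrow> card U \<le> card V"
   using Max_in[of "card ` supp m"] Max_ge[of "card ` supp m"] ne by fastforce
  have sub: "subgroup U G" if "U \<in> supp m" for U using mc that by (auto simp: subgroup_combs_iff)
  have z0: "coset_mark G V U = 0" if U: "U \<in> supp m" "U \<noteq> V" for U
  proof (rule ccontr)
   assume "coset_mark G V U \<noteq> 0"
   then have "fixed_points (coset_gset G U) V \<noteq> {}" by auto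
   then have "gset_iso G (coset_gset G V) (coset_gset G U)"
    using coset_iso_of_fixed_point sub U V Vm by blast
   then have "r V = r U" using r_eq[of V U] sub U V by (simp add: eqv_def)
   moreover have "r W = W" if W: "W \<in> supp m" for W
   proof -
    obtain W0 where "subgroup W0 G" "W = r W0" using mk W by auto
    then show ?thesis using r_eq[of W0 W] r[of W0] by simp
   qed
   ultimately show False using U V by metis
  qed
  have "frag_val (coset_mark G V) m = Poly_Mapping.lookup m V * coset_mark G V V"
   unfolding frag_val_def using V z0 by (subst sum.remove[OF finite_keys V]) (simp add: sum.neutral)
  moreover have "frag_val (coset_mark G V) m = 0"
   using mz[OF sub[OF V]] mark_coset_comb[OF mc subgroup.subset[OF sub[OF V]]] by simp
  moreover have "card (conj_into G V V) \<noteq> 0"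
  proof -
   have "\<one> \<in> conj_into G V V" using subgroup.subset[OF sub[OF V]] by (auto simp: conj_into_def)
   moreover have "finite (conj_into G V V)" using finG by (simp add: conj_into_def)
   ultimately show ?thesis by auto
  qed
  then have "coset_mark G V V \<noteq> 0"
   using card_fixed_points_coset[OF sub[OF V] subgroup.subset[OF sub[OF V]]] by (metis mult_is_0 of_nat_eq_0_iff)
  ultimately show False using V by (simp add: in_keys_iff)
 qed
 then show "c \<in> burnside_relations G"
  using sum_relations_trans[OF cn nm] by simp
qed

text \<open>The action of \<open>g\<close> carries the fixed points of \<open>g^-1 D g\<close>
  bijectively to those of \<open>D\<close>.\<close>

lemma mark_conj:
 assumes c: "supp c \<subseteq> finite_gsets G" and g: "g \<in> carrier G" and D: "D \<subseteq> carrier G"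
 shows "mark ((\<lambda>d. inv g \<otimes> d \<otimes> g) ` D) c = mark D c"
 unfolding mark_def
proof (rule frag_val_cong)
 fix X assume "X \<in> supp c"
 then have act: "group_action G (fst X) (snd X)" using c finite_gsetsD(2) by blast
 note cl = group_action_closed[OF act] and mu = group_action_mult[OF act] and iv = group_action_inv[OF act g]
 let ?A = "fixed_points X ((\<lambda>d. inv g \<otimes> d \<otimes> g) ` D)" and ?B = "fixed_points X D"
 have e: "snd X (inv g \<otimes> d \<otimes> g) x = snd X (inv g) (snd X d (snd X g x))" if "d \<in> D" "x \<in> fst X" for d x
  using that D g mu cl by (simp add: subset_iff)
 have k1: "snd X g x \<in> ?B" if x: "x \<in> ?A" for x
 proof -
  have "snd X d (snd X g x) = snd X g x" if d: "d \<in> D" for d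
  proof -
   have xX: "x \<in> fst X" and fx: "snd X (inv g) (snd X d (snd X g x)) = x"
    using x d e[OF d, of x] by (auto simp: fixed_points_def)
   have "snd X d (snd X g x) \<in> fst X" using cl g d D xX by auto
   then show ?thesis using iv(2)[of "snd X d (snd X g x)"] fx by simp
  qed
  then show ?thesis using x cl g by (auto simp: fixed_points_def)
 qed
 have k2: "snd X (inv g) y \<in> ?A" if y: "y \<in> ?B" for y
  using y e iv cl g by (auto simp: fixed_points_def)
 have "bij_betw (snd X g) ?A ?B"
  by (rule bij_betw_byWitness[where f' = "snd X (inv g)"])
   (use k1 k2 iv in \<open>auto simp: fixed_points_def\<close>)
 then show "int (card ?A) = int (card ?B)" by (simp add: bij_betw_same_card)
qed

end

section \<open>Marks of induced elements\<close>

context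
 fixes G :: "('g, 'b) monoid_scheme" (structure)
 assumes G: "group G" and finG: "finite (carrier G)"
begin

interpretation group G by (rule G)

text \<open>Double counting: multiplied by \<open>card U\<close>, the left side counts pairs
  \<open>(x, h)\<close> with \<open>x^-1 D x\<close> inside \<open>U\<close> and \<open>h\<close> in
  \<open>H\<close>. The substitution \<open>g = x h^-1\<close> turns them into the pairs counted on
  the right. The factor \<open>card H\<close> removes the need for coset representatives.\<close>

lemma coset_mark_induced:
 assumes H: "subgroup H G" and U: "subgroup U (subgrp G H)" and D: "D \<subseteq> carrier G"
 shows "int (card H) * coset_mark G D U =
  (\<Sum>g\<in>conj_into G D H. coset_mark (subgrp G H) ((\<lambda>d. inv g \<otimes> d \<otimes> g) ` D) U)"
proof -
 let ?H = "subgrp G H" and ?c = "\<lambda>g. (\<lambda>d. inv g \<otimes> d \<otimes> g) ` D"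
 have Hs: "H \<subseteq> carrier G" by (rule subgroup.subset[OF H])
 have gH: "group ?H" by (rule subgroup_imp_group[OF H])
 have UG: "subgroup U G" by (rule incl_subgroup[OF H U])
 have UH: "U \<subseteq> H" using subgroup.subset[OF U] by simp
 have finH: "finite H" using Hs finG finite_subset by blast
 have fin: "finite (conj_into G D S)" for S using finG by (simp add: conj_into_def)
 have cU: "0 < card U" using subgroup.one_closed[OF UG] finite_subset[OF UH finH] card_gt_0_iff by blast
 have inv: "inv\<^bsub>?H\<^esub> h = inv h" if "h \<in> H" for h using m_inv_consistent[OF H that] .
 have cc: "inv (g \<otimes> h) \<otimes> d \<otimes> (g \<otimes> h) = inv h \<otimes> (inv g \<otimes> d \<otimes> g) \<otimes> h"
  if "g \<in> carrier G" "h \<in> carrier G" "d \<in> carrier G" for g h d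
  using that by (simp add: inv_mult_group m_assoc)
 have "card H * card (conj_into G D U) = card (conj_into G D U \<times> H)"
  by (simp add: card_cartesian_product)
 also have "\<dots> = card (SIGMA g:conj_into G D H. conj_into ?H (?c g) U)"
 proof (rule bij_betw_same_card)
  show "bij_betw (\<lambda>(x, h). (x \<otimes> inv h, h)) (conj_into G D U \<times> H)
   (SIGMA g:conj_into G D H. conj_into ?H (?c g) U)"
  proof (rule bij_betw_byWitness[where f' = "\<lambda>(g, h). (g \<otimes> h, h)"])
   show "\<forall>a\<in>conj_into G D U \<times> H. (\<lambda>(g, h). (g \<otimes> h, h)) ((\<lambda>(x, h). (x \<otimes> inv h, h)) a) = a"
    using Hs by (auto simp: conj_into_def m_assoc subset_iff)
   show "\<forall>a\<in>(SIGMA g:conj_into G D H. conj_into ?H (?c g) U).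
    (\<lambda>(x, h). (x \<otimes> inv h, h)) ((\<lambda>(g, h). (g \<otimes> h, h)) a) = a"
    using Hs by (auto simp: conj_into_def m_assoc subset_iff)
   show "(\<lambda>(x, h). (x \<otimes> inv h, h)) ` (conj_into G D U \<times> H) \<subseteq>
    (SIGMA g:conj_into G D H. conj_into ?H (?c g) U)"
   proof clarify
    fix x h assume x: "x \<in> conj_into G D U" and h: "h \<in> H"
    have xG: "x \<in> carrier G" and hG: "h \<in> carrier G" using x h Hs by (auto simp: conj_into_def)
    have 1: "inv h \<otimes> (inv (x \<otimes> inv h) \<otimes> d \<otimes> (x \<otimes> inv h)) \<otimes> h \<in> U" if d: "d \<in> D" for d
    proof -
     have "inv h \<otimes> (inv (x \<otimes> inv h) \<otimes> d \<otimes> (x \<otimes> inv h)) \<otimes> h = inv x \<otimes> d \<otimes> x"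
      using cc[of "x \<otimes> inv h" h d] xG hG d D by (simp add: m_assoc subset_iff)
     then show ?thesis using x d by (simp add: conj_into_def)
    qed
    have 2: "inv (x \<otimes> inv h) \<otimes> d \<otimes> (x \<otimes> inv h) \<in> H" if d: "d \<in> D" for d
    proof -
     have "inv x \<otimes> d \<otimes> x \<in> H" using x d UH by (auto simp: conj_into_def)
     moreover have "inv (x \<otimes> inv h) \<otimes> d \<otimes> (x \<otimes> inv h) = h \<otimes> (inv x \<otimes> d \<otimes> x) \<otimes> inv h"
      using xG hG d D by (simp add: inv_mult_group m_assoc subset_iff)
     ultimately show ?thesis
      using h subgroup.m_closed[OF H] subgroup.m_inv_closed[OF H] by simp
    qed
    show "x \<otimes> inv h \<in> conj_into G D H \<and> h \<in> conj_into ?H (?c (x \<otimes> inv h)) U"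
     using 1 2 xG hG h by (auto simp: conj_into_def inv)
   qed
   show "(\<lambda>(g, h). (g \<otimes> h, h)) ` (SIGMA g:conj_into G D H. conj_into ?H (?c g) U) \<subseteq> conj_into G D U \<times> H"
    using Hs D by (auto simp: conj_into_def inv cc subset_iff)
  qed
 qed
 also have "\<dots> = (\<Sum>g\<in>conj_into G D H. card (conj_into ?H (?c g) U))"
  using fin finH by (subst card_SigmaI) (auto simp: conj_into_def)
 also have "\<dots> = (\<Sum>g\<in>conj_into G D H. card U * card (fixed_points (coset_gset ?H U) (?c g)))"
  by (rule sum.cong[OF refl], subst card_fixed_points_coset[OF gH _ U])
   (use finH in \<open>auto simp: conj_into_def\<close>)
 finally have "card U * (card H * card (fixed_points (coset_gset G U) D)) =
   card U * (\<Sum>g\<in>conj_into G D H. card (fixed_points (coset_gset ?H U) (?c g)))"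
  unfolding card_fixed_points_coset[OF G finG UG D, symmetric] by (simp add: sum_distrib_left algebra_simps)
 then have "card H * card (fixed_points (coset_gset G U) D) =
   (\<Sum>g\<in>conj_into G D H. card (fixed_points (coset_gset ?H U) (?c g)))"
  using cU by simp
 then show ?thesis by (metis (no_types, lifting) of_nat_mult of_nat_sum sum.cong)
qed

end

context
 fixes G :: "('g, 'b) monoid_scheme" (structure)
 assumes G: "group G" and finG: "finite (carrier G)"
begin

interpretation group G by (rule G)

lemma subgroup_combs_subgroup:
 assumes "subgroup H G" "n \<in> subgroup_combs (subgrp G H)"
 shows "n \<in> subgroup_combs G"
 using assms incl_subgroup by (auto simp: subgroup_combs_iff)

text \<open>Shows in particular that the marks of an induced element depend only on marks over
  \<open>H\<close>, hence only on the class in the Burnside ring of \<open>H\<close>.\<close>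

lemma mark_induced:
 assumes H: "subgroup H G" and n: "n \<in> subgroup_combs (subgrp G H)" and D: "D \<subseteq> carrier G"
 shows "int (card H) * mark D (coset_comb G n) =
  (\<Sum>g\<in>conj_into G D H. mark ((\<lambda>d. inv g \<otimes> d \<otimes> g) ` D) (coset_comb (subgrp G H) n))"
proof -
 let ?H = "subgrp G H" and ?c = "\<lambda>g. (\<lambda>d. inv g \<otimes> d \<otimes> g) ` D"
 have gH: "group ?H" by (rule subgroup_imp_group[OF H])
 have fH: "finite (carrier ?H)" using finite_subset[OF subgroup.subset[OF H] finG] by simp
 have "int (card H) * mark D (coset_comb G n) = frag_val (\<lambda>U. int (card H) * coset_mark G D U) n"
  using mark_coset_comb[OF G finG subgroup_combs_subgroup[OF H n] D]
  by (simp add: frag_val_distrib_left)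
 also have "\<dots> = frag_val (\<lambda>U. \<Sum>g\<in>conj_into G D H. coset_mark ?H (?c g) U) n"
  by (rule frag_val_cong)
   (use n in \<open>auto simp: subgroup_combs_iff coset_mark_induced[OF G finG H _ D]\<close>)
 also have "\<dots> = (\<Sum>g\<in>conj_into G D H. frag_val (coset_mark ?H (?c g)) n)"
  by (rule frag_val_sum)
 also have "\<dots> = (\<Sum>g\<in>conj_into G D H. mark (?c g) (coset_comb ?H n))"
  by (rule sum.cong[OF refl], rule mark_coset_comb[OF gH fH n, symmetric])
   (auto simp: conj_into_def)
 finally show ?thesis .
qed

lemma conj_subgroup:
 assumes H: "subgroup H G" and D: "subgroup D G" and g: "g \<in> conj_into G D H"
 shows "subgroup ((\<lambda>d. inv g \<otimes> d \<otimes> g) ` D) (subgrp G H)"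
proof (rule subgroup_incl[OF _ H])
 have gG: "g \<in> carrier G" using g by (simp add: conj_into_def)
 have Ds: "D \<subseteq> carrier G" by (rule subgroup.subset[OF D])
 show "(\<lambda>d. inv g \<otimes> d \<otimes> g) ` D \<subseteq> H" using g by (auto simp: conj_into_def)
 have m: "(inv g \<otimes> a \<otimes> g) \<otimes> (inv g \<otimes> b \<otimes> g) = inv g \<otimes> (a \<otimes> b) \<otimes> g" if "a \<in> carrier G" "b \<in> carrier G" for a b
  using that gG inv_solve_left'[of g "b \<otimes> g" "g \<otimes> (inv g \<otimes> (b \<otimes> g))"] by (simp add: m_assoc) (simp add: m_assoc[symmetric])
 have i: "inv (inv g \<otimes> a \<otimes> g) = inv g \<otimes> inv a \<otimes> g" if "a \<in> carrier G" for a
  using that gG by (simp add: inv_mult_group m_assoc)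
 show "subgroup ((\<lambda>d. inv g \<otimes> d \<otimes> g) ` D) G"
 proof (rule subgroupI)
  show "(\<lambda>d. inv g \<otimes> d \<otimes> g) ` D \<noteq> {}" using subgroup.one_closed[OF D] by blast
 qed (use gG Ds m i subgroup.m_closed[OF D] subgroup.m_inv_closed[OF D] in \<open>auto simp: subset_iff\<close>)
qed

text \<open>In marks: \<open>[G/U] \<cdot> c = Ind Res c\<close>.\<close>

lemma restrict_induce:
 assumes c: "supp c \<subseteq> finite_gsets G" and U: "subgroup U G"
 shows "\<exists>n\<in>subgroup_combs (subgrp G U). c - coset_comb (subgrp G U) n \<in> burnside_relations (subgrp G U) \<and>
  (\<forall>D. subgroup D G \<longrightarrow> mark D (coset_comb G n) = coset_mark G D U * mark D c)"
proof -
 let ?U = "subgrp G U"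
 have gU: "group ?U" by (rule subgroup_imp_group[OF U])
 have finU: "finite U" using finite_subset[OF subgroup.subset[OF U] finG] .
 then have fU: "finite (carrier ?U)" by simp
 have cU: "supp c \<subseteq> finite_gsets ?U" using c finite_gsets_subgroup[OF G U] by auto
 obtain n where n: "n \<in> subgroup_combs ?U" "c - coset_comb ?U n \<in> burnside_relations ?U"
  using burnside_decompose[OF gU fU cU] by auto
 have "mark D (coset_comb G n) = coset_mark G D U * mark D c" if D: "subgroup D G" for D
 proof -
  have Ds: "D \<subseteq> carrier G" by (rule subgroup.subset[OF D])
  let ?c = "\<lambda>g. (\<lambda>d. inv g \<otimes> d \<otimes> g) ` D"
  have "int (card U) * mark D (coset_comb G n) = (\<Sum>g\<in>conj_into G D U. mark (?c g) (coset_comb ?U n))"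
   by (rule mark_induced[OF U n(1) Ds])
  \<comment> \<open>Each conjugate of \<open>D\<close> inside \<open>U\<close> gives the same mark
    of \<open>c\<close> as \<open>D\<close> itself, so the sum only counts
    \<open>conj_into G D U\<close>.\<close>
  also have "\<dots> = (\<Sum>g\<in>conj_into G D U. mark D c)"
  proof (rule sum.cong[OF refl])
   fix g assume g: "g \<in> conj_into G D U"
   have "mark (?c g) (c - coset_comb ?U n) = 0"
    using g by (intro mark_burnside_relations[OF n(2)]) (auto simp: conj_into_def)
   then have "mark (?c g) (coset_comb ?U n) = mark (?c g) c" by simp
   also have "\<dots> = mark D c" using g by (intro mark_conj[OF G finG c _ Ds]) (simp add: conj_into_def)
   finally show "mark (?c g) (coset_comb ?U n) = mark D c" .
  qed
  also have "\<dots> = int (card U) * (coset_mark G D U * mark D c)"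
   by (simp flip: card_fixed_points_coset[OF G finG U Ds])
  finally show ?thesis
   using subgroup.one_closed[OF U] finU by auto
 qed
 then show ?thesis using n by blast
qed

end

section \<open>Marks of inflated elements\<close>

lemma coset_preimage_card:
 assumes "N \<lhd> G" and finG: "finite (carrier G)" and S: "S \<subseteq> carrier (G Mod N)"
 shows "card {g \<in> carrier G. N #>\<^bsub>G\<^esub> g \<in> S} = card N * card S"
proof -
 interpret normal N G by fact
 have Ns: "subgroup N G" by (rule subgroup_axioms)
 have S: "S \<subseteq> rcosets\<^bsub>G\<^esub> N" using S by (simp add: FactGroup_def)
 have e: "\<Union>S = {g \<in> carrier G. N #>\<^bsub>G\<^esub> g \<in> S}"
 proof
  show "\<Union>S \<subseteq> {g \<in> carrier G. N #>\<^bsub>G\<^esub> g \<in> S}"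
  proof
   fix g assume "g \<in> \<Union>S"
   then obtain A where A: "A \<in> S" "g \<in> A" by auto
   then obtain a where a: "a \<in> carrier G" "A = N #>\<^bsub>G\<^esub> a" using S by (auto simp: RCOSETS_def)
   then have "N #>\<^bsub>G\<^esub> g = A" using A repr_independence[of g N a] Ns by simp
   moreover have "g \<in> carrier G" using A a r_coset_subset_G[OF subset] by auto
   ultimately show "g \<in> {g \<in> carrier G. N #>\<^bsub>G\<^esub> g \<in> S}" using A by simp
  qed
  show "{g \<in> carrier G. N #>\<^bsub>G\<^esub> g \<in> S} \<subseteq> \<Union>S" using rcos_self[OF _ Ns] by blast
 qed
 have "card N * card S = card (\<Union>S)"
 proof (rule card_partition)
  have "\<Union>S \<subseteq> carrier G" using e by auto
  then show "finite (\<Union>S)" using finG finite_subset by blast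
  show "finite S"
   by (rule finite_subset[OF S]) (use finG rcosets_part_G[OF Ns] finite_UnionD in metis)
  show "card A = card N" if "A \<in> S" for A using card_rcosets_equal[of A N] that S subset by auto
  show "A \<inter> B = {}" if "A \<in> S" "B \<in> S" "A \<noteq> B" for A B
   using rcos_disjoint[OF Ns] that S by (auto simp: pairwise_def disjnt_def)
 qed
 then show ?thesis by (simp add: e)
qed

lemma Mod_hom:
 assumes "N \<lhd> G"
 shows "group_hom G (G Mod N) (\<lambda>g. N #>\<^bsub>G\<^esub> g)"
proof -
 interpret normal N G by fact
 show ?thesis
  using r_coset_hom_Mod factorgroup_is_group is_group by (simp add: group_hom_def group_hom_axioms_def)
qed

lemma preimage_subgroup:
 assumes N: "N \<lhd> G" and U: "subgroup U (G Mod N)"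
 shows "subgroup {g \<in> carrier G. N #>\<^bsub>G\<^esub> g \<in> U} G"
proof -
 interpret group_hom G "G Mod N" "\<lambda>g. N #>\<^bsub>G\<^esub> g" by (rule Mod_hom[OF N])
 show ?thesis
 proof (rule G.subgroupI)
  show "{g \<in> carrier G. N #>\<^bsub>G\<^esub> g \<in> U} \<noteq> {}" using subgroup.one_closed[OF U] hom_one by fastforce
  fix a b assume a: "a \<in> {g \<in> carrier G. N #>\<^bsub>G\<^esub> g \<in> U}"
  then show "inv\<^bsub>G\<^esub> a \<in> {g \<in> carrier G. N #>\<^bsub>G\<^esub> g \<in> U}"
   using subgroup.m_inv_closed[OF U] by simp
  assume "b \<in> {g \<in> carrier G. N #>\<^bsub>G\<^esub> g \<in> U}"
  then show "a \<otimes>\<^bsub>G\<^esub> b \<in> {g \<in> carrier G. N #>\<^bsub>G\<^esub> g \<in> U}"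
   using a subgroup.m_closed[OF U, of "N #>\<^bsub>G\<^esub> a" "N #>\<^bsub>G\<^esub> b"] hom_mult[of a b] by simp
 qed auto
qed

text \<open>\<open>conj_into\<close> for a preimage is the preimage of \<open>conj_into\<close> in
  the quotient, so numerator and denominator of the fixed-point count both gain the factor
  \<open>card N\<close>.\<close>

lemma coset_mark_inflated:
 assumes N: "N \<lhd> G" and finG: "finite (carrier G)" and U: "subgroup U (G Mod N)" and D: "D \<subseteq> carrier G"
 shows "coset_mark G D {g \<in> carrier G. N #>\<^bsub>G\<^esub> g \<in> U} = coset_mark (G Mod N) ((\<lambda>g. N #>\<^bsub>G\<^esub> g) ` D) U"
proof -
 interpret group_hom G "G Mod N" "\<lambda>g. N #>\<^bsub>G\<^esub> g" by (rule Mod_hom[OF N])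
 let ?pi = "\<lambda>g. N #>\<^bsub>G\<^esub> g" and ?V = "{g \<in> carrier G. N #>\<^bsub>G\<^esub> g \<in> U}"
 have onto: "?pi ` carrier G = carrier (G Mod N)" by (auto simp: FactGroup_def RCOSETS_def)
 have finQ: "finite (carrier (G Mod N))" unfolding onto[symmetric] using finG by simp
 have V: "subgroup ?V G" by (rule preimage_subgroup[OF N U])
 have cN: "card N > 0"
  using subgroup.one_closed[OF normal_imp_subgroup[OF N]]
   finite_subset[OF subgroup.subset[OF normal_imp_subgroup[OF N]] finG] card_gt_0_iff by blast
 have cU: "card U > 0"
  using subgroup.one_closed[OF U] finite_subset[OF subgroup.subset[OF U] finQ] card_gt_0_iff by blast
 have piD: "?pi ` D \<subseteq> carrier (G Mod N)" using D onto by blast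
 have "conj_into G D ?V = {g \<in> carrier G. ?pi g \<in> conj_into (G Mod N) (?pi ` D) U}"
  using D by (auto simp: conj_into_def subset_iff)
 then have "card (conj_into G D ?V) = card N * card (conj_into (G Mod N) (?pi ` D) U)"
  using coset_preimage_card[OF N finG, of "conj_into (G Mod N) (?pi ` D) U"] by (simp add: conj_into_def)
 then have "card ?V * card (fixed_points (coset_gset G ?V) D) =
   card N * (card U * card (fixed_points (coset_gset (G Mod N) U) (?pi ` D)))"
  by (simp only: card_fixed_points_coset[OF G.is_group finG V D]
    card_fixed_points_coset[OF H.is_group finQ U piD])
 moreover have "card ?V = card N * card U"
  using coset_preimage_card[OF N finG subgroup.subset[OF U]] .
 ultimately show ?thesis using cN cU by simp
qed

definition inflated_comb :: "('g, 'b) monoid_scheme \<Rightarrow> 'g set \<Rightarrow> ('g set set \<Rightarrow>\<^sub>0 int) \<Rightarrow> ('g set \<Rightarrow>\<^sub>0 int)" where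
 "inflated_comb G N n = frag_extend (\<lambda>U. frag_of {g \<in> carrier G. N #>\<^bsub>G\<^esub> g \<in> U}) n"

lemma inflated_comb_closed:
 assumes "N \<lhd> G" "n \<in> subgroup_combs (G Mod N)"
 shows "inflated_comb G N n \<in> subgroup_combs G"
 unfolding subgroup_combs_iff inflated_comb_def
 by (rule keys_frag_extend_of) (use assms preimage_subgroup in \<open>auto simp: subgroup_combs_iff\<close>)

lemma mark_inflated:
 assumes N: "N \<lhd> G" and finG: "finite (carrier G)" and n: "n \<in> subgroup_combs (G Mod N)" and D: "D \<subseteq> carrier G"
 shows "mark D (coset_comb G (inflated_comb G N n)) =
  mark ((\<lambda>g. N #>\<^bsub>G\<^esub> g) ` D) (coset_comb (G Mod N) n)"
proof -
 interpret group_hom G "G Mod N" "\<lambda>g. N #>\<^bsub>G\<^esub> g" by (rule Mod_hom[OF N])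
 have onto: "(\<lambda>g. N #>\<^bsub>G\<^esub> g) ` carrier G = carrier (G Mod N)" by (auto simp: FactGroup_def RCOSETS_def)
 have finQ: "finite (carrier (G Mod N))" unfolding onto[symmetric] using finG by simp
 have piD: "(\<lambda>g. N #>\<^bsub>G\<^esub> g) ` D \<subseteq> carrier (G Mod N)" using D onto by blast
 show ?thesis
  unfolding mark_coset_comb[OF G.is_group finG inflated_comb_closed[OF N n] D]
   mark_coset_comb[OF H.is_group finQ n piD]
  unfolding inflated_comb_def frag_val_extend frag_val_of
  by (rule frag_val_cong) (use n coset_mark_inflated[OF N finG _ D] in \<open>auto simp: subgroup_combs_iff\<close>)
qed

section \<open>Relations between permutation modules\<close>

abbreviation module_relations ::
 "('f, 'c) ring_scheme \<Rightarrow> ('g, 'b) monoid_scheme \<Rightarrow> (('f, 'g, nat \<Rightarrow> 'f) gmodule \<Rightarrow>\<^sub>0 int) set" where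
 "module_relations F G \<equiv> sum_relations (fg_gmodules F G) (is_gmodule_sum F G)"

definition gmodule_map ::
 "('f, 'c) ring_scheme \<Rightarrow> ('g, 'b) monoid_scheme \<Rightarrow> ('f, 'g, 'm) gmodule \<Rightarrow> ('f, 'g, 'n) gmodule \<Rightarrow>
  ('m \<Rightarrow> 'n) \<Rightarrow> bool" where
 "gmodule_map F G V W f \<longleftrightarrow> bij_betw f (carrier (fst V)) (carrier (fst W)) \<and>
   (\<forall>x\<in>carrier (fst V). \<forall>y\<in>carrier (fst V). f (x \<oplus>\<^bsub>fst V\<^esub> y) = f x \<oplus>\<^bsub>fst W\<^esub> f y) \<and>
   (\<forall>a\<in>carrier F. \<forall>x\<in>carrier (fst V). f (a \<odot>\<^bsub>fst V\<^esub> x) = a \<odot>\<^bsub>fst W\<^esub> f x) \<and>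
   (\<forall>g\<in>carrier G. \<forall>x\<in>carrier (fst V). f (snd V g x) = snd W g (f x))"

lemma gmodule_iso_iff: "gmodule_iso F G V W \<longleftrightarrow> (\<exists>f. gmodule_map F G V W f)"
 by (simp add: gmodule_iso_def gmodule_map_def case_prod_beta)

lemma gmodule_isoE:
 assumes "gmodule_iso F G V W"
 obtains f where "gmodule_map F G V W f"
 using assms gmodule_iso_iff by blast

lemma gmodule_isoI:
 assumes "bij_betw f (carrier M) (carrier N)"
  and "\<And>x y. x \<in> carrier M \<Longrightarrow> y \<in> carrier M \<Longrightarrow> f (x \<oplus>\<^bsub>M\<^esub> y) = f x \<oplus>\<^bsub>N\<^esub> f y"
  and "\<And>a x. a \<in> carrier F \<Longrightarrow> x \<in> carrier M \<Longrightarrow> f (a \<odot>\<^bsub>M\<^esub> x) = a \<odot>\<^bsub>N\<^esub> f x"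
  and "\<And>g x. g \<in> carrier G \<Longrightarrow> x \<in> carrier M \<Longrightarrow> f (\<rho> g x) = \<sigma> g (f x)"
 shows "gmodule_iso F G (M, \<rho>) (N, \<sigma>)"
 unfolding gmodule_iso_iff gmodule_map_def fst_conv snd_conv using assms by (intro exI[of _ f]) simp

lemma gmodule_mapD:
 assumes "gmodule_map F G V W f"
 shows "bij_betw f (carrier (fst V)) (carrier (fst W))"
  and "x \<in> carrier (fst V) \<Longrightarrow> y \<in> carrier (fst V) \<Longrightarrow> f (x \<oplus>\<^bsub>fst V\<^esub> y) = f x \<oplus>\<^bsub>fst W\<^esub> f y"
  and "a \<in> carrier F \<Longrightarrow> x \<in> carrier (fst V) \<Longrightarrow> f (a \<odot>\<^bsub>fst V\<^esub> x) = a \<odot>\<^bsub>fst W\<^esub> f x"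
  and "g \<in> carrier G \<Longrightarrow> x \<in> carrier (fst V) \<Longrightarrow> f (snd V g x) = snd W g (f x)"
  and "x \<in> carrier (fst V) \<Longrightarrow> f x \<in> carrier (fst W)"
 using assms unfolding gmodule_map_def by (simp_all, metis bij_betw_apply)

lemma gmodule_iso_trans:
 assumes VW: "gmodule_iso F G V W" and WZ: "gmodule_iso F G W Z"
 shows "gmodule_iso F G V Z"
proof -
 from VW obtain f where f: "gmodule_map F G V W f" by (rule gmodule_isoE)
 note f = gmodule_mapD[OF f]
 from WZ obtain h where h: "gmodule_map F G W Z h" by (rule gmodule_isoE)
 note h = gmodule_mapD[OF h]
 have "gmodule_iso F G (fst V, snd V) (fst Z, snd Z)"
  by (rule gmodule_isoI[of "h \<circ> f"]) (use bij_betw_trans[OF f(1) h(1)] f(2-) h(2-) in simp_all)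
 then show ?thesis by simp
qed

lemma is_gmoduleD:
 assumes "is_gmodule F G V"
 shows "module F (fst V)" "group_action G (carrier (fst V)) (snd V)"
  "\<And>g x y. g \<in> carrier G \<Longrightarrow> x \<in> carrier (fst V) \<Longrightarrow> y \<in> carrier (fst V) \<Longrightarrow>
   snd V g (x \<oplus>\<^bsub>fst V\<^esub> y) = snd V g x \<oplus>\<^bsub>fst V\<^esub> snd V g y"
  "\<And>g a x. g \<in> carrier G \<Longrightarrow> a \<in> carrier F \<Longrightarrow> x \<in> carrier (fst V) \<Longrightarrow>
   snd V g (a \<odot>\<^bsub>fst V\<^esub> x) = a \<odot>\<^bsub>fst V\<^esub> snd V g x"
  "\<And>g x. g \<in> carrier G \<Longrightarrow> x \<in> carrier (fst V) \<Longrightarrow> snd V g x \<in> carrier (fst V)"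
  "\<And>g. g \<in> carrier G \<Longrightarrow> snd V g \<zero>\<^bsub>fst V\<^esub> = \<zero>\<^bsub>fst V\<^esub>"
proof -
 show m: "module F (fst V)" and a: "group_action G (carrier (fst V)) (snd V)"
  and "\<And>g x y. g \<in> carrier G \<Longrightarrow> x \<in> carrier (fst V) \<Longrightarrow> y \<in> carrier (fst V) \<Longrightarrow>
   snd V g (x \<oplus>\<^bsub>fst V\<^esub> y) = snd V g x \<oplus>\<^bsub>fst V\<^esub> snd V g y"
  and s: "\<And>g a x. g \<in> carrier G \<Longrightarrow> a \<in> carrier F \<Longrightarrow> x \<in> carrier (fst V) \<Longrightarrow>
   snd V g (a \<odot>\<^bsub>fst V\<^esub> x) = a \<odot>\<^bsub>fst V\<^esub> snd V g x"
  using assms by (auto simp: is_gmodule_def case_prod_beta)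
 show c: "\<And>g x. g \<in> carrier G \<Longrightarrow> x \<in> carrier (fst V) \<Longrightarrow> snd V g x \<in> carrier (fst V)"
  by (rule group_action_closed[OF a])
 interpret module F "fst V" by (rule m)
 show "\<And>g. g \<in> carrier G \<Longrightarrow> snd V g \<zero>\<^bsub>fst V\<^esub> = \<zero>\<^bsub>fst V\<^esub>"
  using s[OF _ R.zero_closed M.zero_closed] c[OF _ M.zero_closed] by simp
qed

lemma gmodule_iso_sym:
 assumes V: "is_gmodule F G V" and iso: "gmodule_iso F G V W"
 shows "gmodule_iso F G W V"
proof -
 interpret module F "fst V" by (rule is_gmoduleD[OF V])
 note cl = is_gmoduleD(5)[OF V]
 from iso obtain f where f: "gmodule_map F G V W f" by (rule gmodule_isoE)
 note f = gmodule_mapD[OF f]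
 define i where "i = inv_into (carrier (fst V)) f"
 have i: "y \<in> carrier (fst W) \<Longrightarrow> i y \<in> carrier (fst V)" "y \<in> carrier (fst W) \<Longrightarrow> f (i y) = y"
  "x \<in> carrier (fst V) \<Longrightarrow> i (f x) = x" for x y
  using f(1) by (auto simp: i_def bij_betw_def inv_into_into f_inv_into_f)
 have "i (x \<oplus>\<^bsub>fst W\<^esub> y) = i x \<oplus>\<^bsub>fst V\<^esub> i y" if "x \<in> carrier (fst W)" "y \<in> carrier (fst W)" for x y
  using f(2)[of "i x" "i y"] i(3)[of "i x \<oplus>\<^bsub>fst V\<^esub> i y"] i(1,2) that by simp
 moreover have "i (a \<odot>\<^bsub>fst W\<^esub> x) = a \<odot>\<^bsub>fst V\<^esub> i x" if "a \<in> carrier F" "x \<in> carrier (fst W)" for a x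
  using f(3)[of a "i x"] i(3)[of "a \<odot>\<^bsub>fst V\<^esub> i x"] i(1,2) that by simp
 moreover have "i (snd W g x) = snd V g (i x)" if "g \<in> carrier G" "x \<in> carrier (fst W)" for g x
  using f(4)[of g "i x"] i(3)[of "snd V g (i x)"] i(1,2) cl that by simp
 ultimately have "gmodule_iso F G (fst W, snd W) (fst V, snd V)"
  using bij_betw_inv_into[OF f(1)] by (intro gmodule_isoI[of i]) (simp_all add: i_def)
 then show ?thesis by simp
qed

lemma gmodule_sum_simps:
 "carrier (fst (gmodule_sum V W)) = carrier (fst V) \<times> carrier (fst W)"
 "(x, y) \<oplus>\<^bsub>fst (gmodule_sum V W)\<^esub> (x', y') = (x \<oplus>\<^bsub>fst V\<^esub> x', y \<oplus>\<^bsub>fst W\<^esub> y')"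
 "a \<odot>\<^bsub>fst (gmodule_sum V W)\<^esub> (x, y) = (a \<odot>\<^bsub>fst V\<^esub> x, a \<odot>\<^bsub>fst W\<^esub> y)"
 "x \<in> carrier (fst V) \<Longrightarrow> y \<in> carrier (fst W) \<Longrightarrow> snd (gmodule_sum V W) g (x, y) = (snd V g x, snd W g y)"
 by (simp_all add: gmodule_sum_def case_prod_beta)

lemma gmodule_sum_iso_cong:
 assumes V: "gmodule_iso F G V' V" and W: "gmodule_iso F G W' W"
 shows "gmodule_iso F G (gmodule_sum V' W') (gmodule_sum V W)"
proof -
 from V obtain f where f: "gmodule_map F G V' V f" by (rule gmodule_isoE)
 note f = gmodule_mapD[OF f]
 from W obtain h where h: "gmodule_map F G W' W h" by (rule gmodule_isoE)
 note h = gmodule_mapD[OF h]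
 have "gmodule_iso F G (fst (gmodule_sum V' W'), snd (gmodule_sum V' W'))
  (fst (gmodule_sum V W), snd (gmodule_sum V W))"
 proof (rule gmodule_isoI[of "map_prod f h"])
  show "bij_betw (map_prod f h) (carrier (fst (gmodule_sum V' W'))) (carrier (fst (gmodule_sum V W)))"
   unfolding gmodule_sum_simps using f(1) h(1) by (simp add: bij_betw_def map_prod_inj_on map_prod_surj_on)
 qed (use f(2-) h(2-) in \<open>auto simp: gmodule_sum_simps\<close>)
 then show ?thesis by simp
qed

section \<open>Permutation modules of isomorphic G-sets and of disjoint unions\<close>

lemma free_module_simps:
 "\<zero>\<^bsub>free_module F E\<^esub> = (\<lambda>x. \<zero>\<^bsub>F\<^esub>)"
 "f \<oplus>\<^bsub>free_module F E\<^esub> h = (\<lambda>x. f x \<oplus>\<^bsub>F\<^esub> h x)"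
 "a \<odot>\<^bsub>free_module F E\<^esub> f = (\<lambda>x. a \<otimes>\<^bsub>F\<^esub> f x)"
 by (simp_all add: free_module_def)

lemma free_module_carrier:
 assumes "finite E"
 shows "f \<in> carrier (free_module F E) \<longleftrightarrow> (\<forall>x. f x \<in> carrier F) \<and> (\<forall>x. x \<notin> E \<longrightarrow> f x = \<zero>\<^bsub>F\<^esub>)"
proof -
 have "finite {x. f x \<noteq> \<zero>\<^bsub>F\<^esub>}" if "\<forall>x. x \<notin> E \<longrightarrow> f x = \<zero>\<^bsub>F\<^esub>"
  by (rule finite_subset[OF _ assms]) (use that in auto)
 then show ?thesis by (auto simp: free_module_def)
qed

lemma perm_module_simps:
 "fst (perm_module F G X) = free_module F (fst X)"
 "f \<in> carrier (free_module F (fst X)) \<Longrightarrow>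
  snd (perm_module F G X) g f = (\<lambda>x. if x \<in> fst X then f (snd X (inv\<^bsub>G\<^esub> g) x) else \<zero>\<^bsub>F\<^esub>)"
 by (simp_all add: perm_module_def)

lemma perm_module_iso:
 assumes F: "cring F" and fX: "finite (fst X)" and iso: "gset_iso G X Y" and G: "group G"
  and act: "group_action G (fst X) (snd X)"
 shows "gmodule_iso F G (perm_module F G X) (perm_module F G Y)"
proof -
 interpret F: cring F by fact
 interpret group G by fact
 obtain h where h: "bij_betw h (fst X) (fst Y)"
  "\<And>g x. g \<in> carrier G \<Longrightarrow> x \<in> fst X \<Longrightarrow> h (snd X g x) = snd Y g (h x)"
  using iso by (auto simp: gset_iso_def)
 define i where "i = inv_into (fst X) h"
 have i: "y \<in> fst Y \<Longrightarrow> i y \<in> fst X" "y \<in> fst Y \<Longrightarrow> h (i y) = y" "x \<in> fst X \<Longrightarrow> i (h x) = x"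
  "x \<in> fst X \<Longrightarrow> h x \<in> fst Y" for x y
  using h(1) by (auto simp: i_def bij_betw_def inv_into_into f_inv_into_f)
 have fY: "finite (fst Y)" using bij_betw_finite[OF h(1)] fX by simp
 note cX = free_module_carrier[OF fX, of _ F] and cY = free_module_carrier[OF fY, of _ F]
 define T where "T = (\<lambda>f y. if y \<in> fst Y then f (i y) else \<zero>\<^bsub>F\<^esub>)"
 define S where "S = (\<lambda>f x. if x \<in> fst X then f (h x) else \<zero>\<^bsub>F\<^esub>)"
 have "gmodule_iso F G (fst (perm_module F G X), snd (perm_module F G X))
  (fst (perm_module F G Y), snd (perm_module F G Y))"
 proof (rule gmodule_isoI[of T], unfold perm_module_simps(1))
  show "bij_betw T (carrier (free_module F (fst X))) (carrier (free_module F (fst Y)))"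
   by (rule bij_betw_byWitness[where f' = S]) (auto simp: cX cY T_def S_def fun_eq_iff i)
  fix g f assume g: "g \<in> carrier G" and f: "f \<in> carrier (free_module F (fst X))"
  have Tf: "T f \<in> carrier (free_module F (fst Y))" using f by (auto simp: T_def cX cY)
  have e: "snd X (inv\<^bsub>G\<^esub> g) (i y) = i (snd Y (inv\<^bsub>G\<^esub> g) y)" "snd Y (inv\<^bsub>G\<^esub> g) y \<in> fst Y" if y: "y \<in> fst Y" for y
  proof -
   have c: "snd X (inv\<^bsub>G\<^esub> g) (i y) \<in> fst X" using group_action_closed[OF act, of "inv\<^bsub>G\<^esub> g" "i y"] g i y by simp
   have "h (snd X (inv\<^bsub>G\<^esub> g) (i y)) = snd Y (inv\<^bsub>G\<^esub> g) y" using h(2)[of "inv\<^bsub>G\<^esub> g" "i y"] g i y by simp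
   then show "snd X (inv\<^bsub>G\<^esub> g) (i y) = i (snd Y (inv\<^bsub>G\<^esub> g) y)" "snd Y (inv\<^bsub>G\<^esub> g) y \<in> fst Y"
    using i(3)[OF c] i(4)[OF c] by simp_all
  qed
  show "T (snd (perm_module F G X) g f) = snd (perm_module F G Y) g (T f)"
   unfolding perm_module_simps(2)[OF f] perm_module_simps(2)[OF Tf]
   using e i by (auto simp: T_def fun_eq_iff)
 qed (auto simp: T_def free_module_simps fun_eq_iff cX)
 then show ?thesis by simp
qed

lemma perm_module_sum:
 fixes F :: "('f, 'c) ring_scheme" and G :: "('g, 'b) monoid_scheme"
  and X :: "('g, 'x) gset" and Y :: "('g, 'y) gset"
 assumes F: "cring F" and fX: "finite (fst X)" and fY: "finite (fst Y)"
 shows "gmodule_iso F G (gmodule_sum (perm_module F G X) (perm_module F G Y)) (perm_module F G (gset_sum X Y))"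
proof -
 interpret F: cring F by fact
 let ?Z = "gset_sum X Y"
 have fZ: "finite (fst ?Z)" and Z: "fst ?Z = fst X <+> fst Y" using fX fY by (simp_all add: gset_sum_def)
 note c = free_module_carrier[OF fX, of _ F] free_module_carrier[OF fY, of _ F] free_module_carrier[OF fZ, unfolded Z, of _ F]
 have P: "Inl x \<in> fst X <+> fst Y \<longleftrightarrow> x \<in> fst X" "Inr y \<in> fst X <+> fst Y \<longleftrightarrow> y \<in> fst Y" for x y
  by auto
 define T :: "('x \<Rightarrow> 'f) \<times> ('y \<Rightarrow> 'f) \<Rightarrow> 'x + 'y \<Rightarrow> 'f" where "T = (\<lambda>(u, v). case_sum u v)"
 have "gmodule_iso F G (fst (gmodule_sum (perm_module F G X) (perm_module F G Y)),
   snd (gmodule_sum (perm_module F G X) (perm_module F G Y)))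
  (fst (perm_module F G ?Z), snd (perm_module F G ?Z))"
 proof (rule gmodule_isoI[of T], unfold perm_module_simps(1) gmodule_sum_simps(1))
  show "bij_betw T (carrier (free_module F (fst X)) \<times> carrier (free_module F (fst Y)))
   (carrier (free_module F (fst ?Z)))"
   by (rule bij_betw_byWitness[where f' = "\<lambda>w. (w \<circ> Inl, w \<circ> Inr)"])
    (auto simp: c T_def Z fun_eq_iff P split: sum.splits)
 next
  fix g w assume "w \<in> carrier (free_module F (fst X)) \<times> carrier (free_module F (fst Y))"
  then obtain u v where w: "w = (u, v)" and u: "u \<in> carrier (free_module F (fst X))"
   and v: "v \<in> carrier (free_module F (fst Y))" by auto
  have Tw: "case_sum u v \<in> carrier (free_module F (fst ?Z))"
   using u v by (auto simp: c Z split: sum.splits)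
  show "T (snd (gmodule_sum (perm_module F G X) (perm_module F G Y)) g w) = snd (perm_module F G ?Z) g (T w)"
   unfolding w T_def prod.case gmodule_sum_simps perm_module_simps(2)[OF Tw]
    gmodule_sum_simps(4)[OF u[folded perm_module_simps(1)[of F G X]] v[folded perm_module_simps(1)[of F G Y]]]
    perm_module_simps(2)[OF u] perm_module_simps(2)[OF v]
   by (rule ext) (simp add: Z P split: sum.splits, simp add: gset_sum_def P)
 qed (auto simp: T_def gmodule_sum_simps perm_module_simps free_module_simps fun_eq_iff split: sum.splits)
 then show ?thesis by simp
qed

lemma perm_module_fg_gmodules:
 "cring F \<Longrightarrow> X \<in> finite_gsets G \<Longrightarrow> perm_module F G X \<in> fg_gmodules F G"
 unfolding fg_gmodules_def using perm_module_gmodule perm_module_fg finite_gsetsD by blast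

text \<open>The zero module, in the form of the permutation module of the empty set, plays the part
  that the empty G-set has in \<open>burnside_relations_iso\<close>.\<close>

lemma module_relations_iso:
 assumes F: "cring F" and G: "group G" and V: "V \<in> fg_gmodules F G" and W: "W \<in> fg_gmodules F G"
  and iso: "gmodule_iso F G V W"
 shows "frag_of V - frag_of W \<in> module_relations F G"
proof -
 interpret F: cring F by fact
 let ?E = "({}, \<lambda>g. restrict id {}) :: ('c, nat) gset"
 let ?Z = "perm_module F G ?E"
 have Z: "?Z \<in> fg_gmodules F G" using perm_module_fg_gmodules[OF F finite_gsets_empty[OF G]] .
 have cZ: "carrier (fst ?Z) = {\<lambda>x. \<zero>\<^bsub>F\<^esub>}" "snd ?Z g (\<lambda>x. \<zero>\<^bsub>F\<^esub>) = (\<lambda>x. \<zero>\<^bsub>F\<^esub>)" for g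
  by (auto simp: perm_module_def free_module_def)
 have "gmodule_iso F G (fst (gmodule_sum V ?Z), snd (gmodule_sum V ?Z)) (fst V, snd V)"
  by (rule gmodule_isoI[of fst]) (auto simp: gmodule_sum_simps cZ bij_betw_def inj_on_def)
 then have e: "gmodule_iso F G (gmodule_sum V ?Z) V" by simp
 have "frag_of V + frag_of ?Z - frag_of V \<in> module_relations F G"
  using sum_relations_gen[OF V Z V, of "is_gmodule_sum F G"] e by (simp add: is_gmodule_sum_def)
 moreover have "frag_of V + frag_of ?Z - frag_of W \<in> module_relations F G"
  using sum_relations_gen[OF V Z W, of "is_gmodule_sum F G"] gmodule_iso_trans[OF e iso] by (simp add: is_gmodule_sum_def)
 ultimately show ?thesis using sum_relations_diff by fastforce
qed

section \<open>Linearisation and its kernel\<close>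

definition frag_linearise ::
 "('f, 'c) ring_scheme \<Rightarrow> ('g, 'b) monoid_scheme \<Rightarrow> (('g, nat) gset \<Rightarrow>\<^sub>0 int) \<Rightarrow>
  (('f, 'g, nat \<Rightarrow> 'f) gmodule \<Rightarrow>\<^sub>0 int)" where
 "frag_linearise F G c = frag_extend (\<lambda>X. frag_of (perm_module F G X)) c"

lemma frag_linearise_simps [simp]:
 "frag_linearise F G 0 = 0"
 "frag_linearise F G (a + b) = frag_linearise F G a + frag_linearise F G b"
 "frag_linearise F G (a - b) = frag_linearise F G a - frag_linearise F G b"
 "frag_linearise F G (- a) = - frag_linearise F G a"
 "frag_linearise F G (frag_cmul k a) = frag_cmul k (frag_linearise F G a)"
 "frag_linearise F G (frag_of X) = frag_of (perm_module F G X)"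
 by (simp_all add: frag_linearise_def frag_extend_add frag_extend_diff frag_extend_cmul frag_extend_minus)

lemma frag_linearise_relations:
 assumes F: "cring F" and G: "group G" and "c \<in> burnside_relations G"
 shows "frag_linearise F G c \<in> module_relations F G"
 unfolding frag_linearise_def
proof (rule sum_relations_extend[OF assms(3)])
 fix X Y Z assume XYZ: "X \<in> finite_gsets G" "Y \<in> finite_gsets G" "Z \<in> finite_gsets G" "is_gset_sum G X Y Z"
 note f = finite_gsetsD[OF XYZ(1)] finite_gsetsD[OF XYZ(2)]
 have "gmodule_iso F G (gmodule_sum (perm_module F G X) (perm_module F G Y)) (perm_module F G Z)"
  using gmodule_iso_trans[OF perm_module_sum[OF F f(1,3)]
    perm_module_iso[OF F _ _ G gset_sum_action[OF f(2,4)], of Z]] XYZ(4) f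
  by (simp add: is_gset_sum_def gset_sum_def)
 then show "frag_of (perm_module F G X) + frag_of (perm_module F G Y) - frag_of (perm_module F G Z)
   \<in> module_relations F G"
  by (intro sum_relations_gen perm_module_fg_gmodules[OF F] XYZ) (simp add: is_gmodule_sum_def)
qed

text \<open>The representatives in the free group of the elements of the kernel;
  \<open>brauer_relations_iff\<close> is the dictionary.\<close>

definition relation_over ::
 "('f, 'c) ring_scheme \<Rightarrow> ('g, 'b) monoid_scheme \<Rightarrow> (('g, nat) gset \<Rightarrow>\<^sub>0 int) \<Rightarrow> bool" where
 "relation_over F G c \<longleftrightarrow>
   supp c \<subseteq> finite_gsets G \<and> frag_linearise F G c \<in> module_relations F G"

lemma relation_over_simps:
 "relation_over F G 0"
 "relation_over F G a \<Longrightarrow> relation_over F G b \<Longrightarrow> relation_over F G (a + b)"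
 "relation_over F G a \<Longrightarrow> relation_over F G b \<Longrightarrow> relation_over F G (a - b)"
 "relation_over F G a \<Longrightarrow> relation_over F G (frag_cmul k a)"
 by (simp_all add: relation_over_def sum_relations_0 sum_relations_add sum_relations_diff sum_relations_cmul
   keys_add_le keys_diff_le keys_cmul_le)

lemma relation_over_cong:
 assumes F: "cring F" and G: "group G" and a: "relation_over F G a"
  and b: "supp b \<subseteq> finite_gsets G" and ab: "a - b \<in> burnside_relations G"
 shows "relation_over F G b"
 using a b sum_relations_diff[of "frag_linearise F G a" _ _ "frag_linearise F G (a - b)"]
  frag_linearise_relations[OF F G ab]
 by (simp add: relation_over_def)

lemma brauer_relations_iff:
 assumes F: "cring F" and G: "group G" and c: "supp c \<subseteq> finite_gsets G"
 shows "burnside_class G c \<in> brauer_relations F G \<longleftrightarrow> relation_over F G c"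
proof -
 have L: "linearisation F G (burnside_class G c) =
  grothendieck_coset (fg_gmodules F G) (is_gmodule_sum F G) (frag_linearise F G c)"
 proof -
  \<comment> \<open>All members of a Burnside class linearise into one coset, so the union in
    \<open>linearisation\<close> collapses to that coset.\<close>
  have "grothendieck_coset (fg_gmodules F G) (is_gmodule_sum F G) (frag_linearise F G d) =
   grothendieck_coset (fg_gmodules F G) (is_gmodule_sum F G) (frag_linearise F G c)"
   if "d \<in> burnside_class G c" for d
   unfolding grothendieck_coset_eq_iff using that frag_linearise_relations[OF F G, of "d - c"]
   by (simp add: burnside_class_def grothendieck_coset_eq)
  moreover have "c \<in> burnside_class G c" by (simp add: burnside_class_def grothendieck_coset_eq sum_relations_0)
  ultimately show ?thesis
   unfolding linearisation_def representation_class_def frag_linearise_def[symmetric] by blast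
 qed
 have "burnside_class G c \<in> carrier (burnside_ring G)"
  unfolding burnside_ring_def carrier_grothendieck_ring burnside_class_def using c by blast
 then have "burnside_class G c \<in> brauer_relations F G \<longleftrightarrow>
  grothendieck_coset (fg_gmodules F G) (is_gmodule_sum F G) (frag_linearise F G c) = module_relations F G"
  unfolding brauer_relations_def a_kernel_def kernel_def L[symmetric]
  by (simp add: representation_ring_def zero_grothendieck_ring)
 also have "\<dots> \<longleftrightarrow> frag_linearise F G c \<in> module_relations F G"
  by (subst (2) sum_relations_eq_coset) (simp add: grothendieck_coset_eq_iff)
 finally show ?thesis using c by (simp add: relation_over_def)
qed

lemma brauer_relationsE:
 assumes F: "cring F" and G: "group G" and x: "x \<in> brauer_relations F G"
 obtains c where "relation_over F G c" "x = burnside_class G c"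
proof -
 have "x \<in> carrier (burnside_ring G)" using x by (simp add: brauer_relations_def a_kernel_def kernel_def)
 then obtain c where "supp c \<subseteq> finite_gsets G" "x = burnside_class G c"
  unfolding burnside_ring_def carrier_grothendieck_ring burnside_class_def by blast
 then show thesis using that brauer_relations_iff[OF F G] x by blast
qed

section \<open>Finite generation over F and pull-back of modules\<close>

lemma submodule_condI:
 assumes "module F M" "K \<subseteq> carrier M" "\<zero>\<^bsub>M\<^esub> \<in> K"
  and "\<And>x y. x \<in> K \<Longrightarrow> y \<in> K \<Longrightarrow> x \<oplus>\<^bsub>M\<^esub> y \<in> K"
  and s: "\<And>a x. a \<in> carrier F \<Longrightarrow> x \<in> K \<Longrightarrow> a \<odot>\<^bsub>M\<^esub> x \<in> K"
 shows "submodule K F M"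
proof -
 interpret module F M by fact
 show ?thesis
 proof (rule submoduleI)
  fix x assume x: "x \<in> K"
  have "(\<ominus>\<^bsub>F\<^esub> \<one>\<^bsub>F\<^esub>) \<odot>\<^bsub>M\<^esub> x = \<ominus>\<^bsub>M\<^esub> x"
   using x assms(2) by (subst smult_l_minus) auto
  then show "\<ominus>\<^bsub>M\<^esub> x \<in> K" using s[of "\<ominus>\<^bsub>F\<^esub> \<one>\<^bsub>F\<^esub>" x] x by simp
 qed (use assms in auto)
qed

lemma submoduleD:
 assumes "submodule K F M"
 shows "K \<subseteq> carrier M" "\<zero>\<^bsub>M\<^esub> \<in> K" "x \<in> K \<Longrightarrow> y \<in> K \<Longrightarrow> x \<oplus>\<^bsub>M\<^esub> y \<in> K"
  "a \<in> carrier F \<Longrightarrow> x \<in> K \<Longrightarrow> a \<odot>\<^bsub>M\<^esub> x \<in> K"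
 using subgroup.subset[OF submodule.axioms(1)[OF assms]] subgroup.one_closed[OF submodule.axioms(1)[OF assms]]
  subgroup.m_closed[OF submodule.axioms(1)[OF assms]] submodule.smult_closed[OF assms] by auto

text \<open>As \<open>G\<close> is finite, the translates of finitely many generators over
  \<open>F[G]\<close> generate over \<open>F\<close>.\<close>

lemma fg_gmodule_finite_span:
 assumes V: "is_gmodule F G V" and fg: "fg_gmodule F G V" and finG: "finite (carrier G)"
 obtains T where "finite T" "T \<subseteq> carrier (fst V)"
  and "\<And>K. submodule K F (fst V) \<Longrightarrow> T \<subseteq> K \<Longrightarrow> K = carrier (fst V)"
proof -
 note D = is_gmoduleD[OF V]
 interpret module F "fst V" by (rule D)
 obtain B where B: "finite B" "B \<subseteq> carrier (fst V)"
  and gen: "\<And>K. submodule K F (fst V) \<Longrightarrow> \<forall>g\<in>carrier G. \<forall>x\<in>K. snd V g x \<in> K \<Longrightarrow> B \<subseteq> K \<Longrightarrow> K = carrier (fst V)"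
  using fg by (auto simp: fg_gmodule_def case_prod_beta)
 define T where "T = (\<lambda>(g, b). snd V g b) ` (carrier G \<times> B)"
 have "K = carrier (fst V)" if K: "submodule K F (fst V)" and T: "T \<subseteq> K" for K
 proof -
  note Kd = submoduleD[OF K]
  \<comment> \<open>The elements with all translates in \<open>K\<close>: the largest G-stable part
    of \<open>K\<close>, to which generation over \<open>F[G]\<close> applies. The identity element
    then gives \<open>K\<close> itself.\<close>
  let ?L = "{x \<in> carrier (fst V). \<forall>g\<in>carrier G. snd V g x \<in> K}"
  have "?L = carrier (fst V)"
  proof (rule gen)
   show "submodule ?L F (fst V)"
    by (rule submodule_condI[OF D(1)]) (use Kd D in \<open>auto\<close>)
   show "\<forall>g\<in>carrier G. \<forall>x\<in>?L. snd V g x \<in> ?L"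
   proof (intro ballI CollectI conjI)
    fix g x h assume *: "g \<in> carrier G" "x \<in> ?L" "h \<in> carrier G"
    have "h \<otimes>\<^bsub>G\<^esub> g \<in> carrier G"
     using * group.is_monoid[OF group_action_group[OF D(2)]] by (simp add: monoid.m_closed)
    then have "snd V (h \<otimes>\<^bsub>G\<^esub> g) x \<in> K" using * by simp
    then show "snd V h (snd V g x) \<in> K"
     using * group_action_mult[OF D(2) *(3,1), of x] by simp
   qed (use D(5) in simp)
   show "B \<subseteq> ?L"
   proof (intro subsetI CollectI conjI ballI)
    fix b g assume "b \<in> B" "g \<in> carrier G"
    then have "snd V g b \<in> T" unfolding T_def by (intro image_eqI[of _ _ "(g, b)"]) auto
    then show "snd V g b \<in> K" using T by blast
   qed (use B in blast)
  qed
  moreover have "\<one>\<^bsub>G\<^esub> \<in> carrier G"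
   using monoid.one_closed[OF group.is_monoid[OF group_action_group[OF D(2)]]] .
  ultimately have "snd V \<one>\<^bsub>G\<^esub> x \<in> K" if "x \<in> carrier (fst V)" for x
   using that by blast
  then have "carrier (fst V) \<subseteq> K" using group_action_one[OF D(2)] by force
  then show ?thesis using Kd(1) by blast
 qed
 moreover have "finite T" using B finG by (simp add: T_def)
 moreover have "T \<subseteq> carrier (fst V)" using B(2) D(5) by (auto simp: T_def)
 ultimately show thesis using that by blast
qed

definition gmodule_pull :: "('h \<Rightarrow> 'g) \<Rightarrow> ('f, 'g, 'm) gmodule \<Rightarrow> ('f, 'h, 'm) gmodule" where
 "gmodule_pull t V = (fst V, \<lambda>g. snd V (t g))"

text \<open>The image of \<open>t\<close> may be small, so generators over \<open>F[H]\<close> need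
  not generate the pulled-back module; a finite generating set over \<open>F\<close> still
  does.\<close>

lemma gmodule_pull_closed:
 assumes V: "V \<in> fg_gmodules F H" and finH: "finite (carrier H)" and G: "group G" and t: "t \<in> hom G H"
 shows "gmodule_pull t V \<in> fg_gmodules F G"
proof -
 have V: "is_gmodule F H V" and fg: "fg_gmodule F H V" using V by (auto simp: fg_gmodules_def)
 note D = is_gmoduleD[OF V]
 have tc: "t g \<in> carrier H" if "g \<in> carrier G" for g using t that by (auto simp: hom_def)
 have "is_gmodule F G (gmodule_pull t V)"
  unfolding is_gmodule_def gmodule_pull_def prod.case
  using D tc group_action_pull[OF D(2) G t] by auto
 moreover obtain T where T: "finite T" "T \<subseteq> carrier (fst V)"
  "\<And>K. submodule K F (fst V) \<Longrightarrow> T \<subseteq> K \<Longrightarrow> K = carrier (fst V)"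
  using fg_gmodule_finite_span[OF V fg finH] by blast
 have "fg_gmodule F G (gmodule_pull t V)"
  unfolding fg_gmodule_def gmodule_pull_def prod.case using T by (intro exI[of _ T]) simp
 ultimately show ?thesis by (simp add: fg_gmodules_def)
qed

text \<open>Pulling back modules respects direct sums and takes the permutation module of
  \<open>X\<close> to that of the pulled-back set. This one statement covers restriction to
  subgroups, inflation, and transport along isomorphisms.\<close>

lemma relation_over_pull:
 assumes F: "cring F" and c: "relation_over F H c" and finH: "finite (carrier H)"
  and G: "group G" and H: "group H" and t: "t \<in> hom G H"
 shows "relation_over F G (frag_pull t c)"
proof -
 interpret group_hom G H t using G H t by (simp add: group_hom_def group_hom_axioms_def)
 have c: "supp c \<subseteq> finite_gsets H" "frag_linearise F H c \<in> module_relations F H"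
  using c by (auto simp: relation_over_def)
 have "frag_extend (\<lambda>V. frag_of (gmodule_pull t V)) (frag_linearise F H c) \<in> module_relations F G"
 proof (rule sum_relations_extend[OF c(2)])
  fix X Y Z assume XYZ: "X \<in> fg_gmodules F H" "Y \<in> fg_gmodules F H" "Z \<in> fg_gmodules F H" "is_gmodule_sum F H X Y Z"
  then have "gmodule_iso F H (gmodule_sum X Y) Z" by (simp add: is_gmodule_sum_def)
  then obtain f where f: "gmodule_map F H (gmodule_sum X Y) Z f" by (rule gmodule_isoE)
 note f = gmodule_mapD[OF f]
  have e: "gmodule_sum (gmodule_pull t X) (gmodule_pull t Y) = gmodule_pull t (gmodule_sum X Y)"
   by (simp add: gmodule_sum_def gmodule_pull_def case_prod_beta)
  have "gmodule_iso F G (gmodule_sum (gmodule_pull t X) (gmodule_pull t Y)) (gmodule_pull t Z)"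
   unfolding e by (simp only: gmodule_pull_def) (rule gmodule_isoI[of f], use f in auto)
  then show "frag_of (gmodule_pull t X) + frag_of (gmodule_pull t Y) - frag_of (gmodule_pull t Z)
    \<in> module_relations F G"
   by (intro sum_relations_gen gmodule_pull_closed[OF _ finH G t] XYZ) (simp add: is_gmodule_sum_def)
 qed
 moreover have "frag_extend (\<lambda>V. frag_of (gmodule_pull t V)) (frag_linearise F H c) =
  frag_extend (\<lambda>X. frag_of (gmodule_pull t (perm_module F H X))) c"
  unfolding frag_linearise_def
  by (rule free_Abelian_group_induct[of c UNIV]) (simp_all add: frag_extend_diff)
 moreover have "frag_linearise F G (frag_pull t c) = frag_extend (\<lambda>X. frag_of (perm_module F G (gset_pull t X))) c"
  unfolding frag_linearise_def frag_pull_def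
  by (rule free_Abelian_group_induct[of c UNIV]) (simp_all add: frag_extend_diff)
 moreover have "frag_extend (\<lambda>X. frag_of (gmodule_pull t (perm_module F H X))) c -
  frag_extend (\<lambda>X. frag_of (perm_module F G (gset_pull t X))) c \<in> module_relations F G"
 proof (rule sum_relations_extend_cong[OF c(1)])
  fix X assume X: "X \<in> finite_gsets H"
  have "gmodule_iso F G (gmodule_pull t (perm_module F H X)) (perm_module F G (gset_pull t X))"
   unfolding gmodule_pull_def perm_module_def
   by (rule gmodule_isoI[of id]) (auto simp: gset_pull_def restrict_def fun_eq_iff)
  then show "frag_of (gmodule_pull t (perm_module F H X)) - frag_of (perm_module F G (gset_pull t X))
    \<in> module_relations F G"
   by (intro module_relations_iso[OF F G] gmodule_pull_closed[OF _ finH G t] perm_module_fg_gmodules[OF F]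
     X gset_pull_finite[OF X G t])
 qed
 ultimately have "frag_linearise F G (frag_pull t c) \<in> module_relations F G"
  using sum_relations_diff by fastforce
 then show ?thesis using frag_pull_keys[OF c(1) G t] by (simp add: relation_over_def)
qed

subsection \<open>Induced modules\<close>

text \<open>Induction in the coinduced form, equivalent for finite groups:
  \<open>H\<close>-equivariant functions on \<open>G\<close>, on which \<open>G\<close> acts by
  right translation. Neither tensor products nor coset representatives are involved. The value zero
  off \<open>carrier G\<close> makes a function determined by its values on the group.\<close>

definition ind_carrier :: "('g, 'b) monoid_scheme \<Rightarrow> 'g set \<Rightarrow> ('f, 'g, 'm) gmodule \<Rightarrow> ('g \<Rightarrow> 'm) set" where
 "ind_carrier G H V = {f. (\<forall>x. x \<notin> carrier G \<longrightarrow> f x = \<zero>\<^bsub>fst V\<^esub>) \<and>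
   (\<forall>x\<in>carrier G. f x \<in> carrier (fst V)) \<and>
   (\<forall>x\<in>carrier G. \<forall>h\<in>H. f (h \<otimes>\<^bsub>G\<^esub> x) = snd V h (f x))}"

definition ind_gmodule ::
 "('g, 'b) monoid_scheme \<Rightarrow> 'g set \<Rightarrow> ('f, 'g, 'm) gmodule \<Rightarrow> ('f, 'g, 'g \<Rightarrow> 'm) gmodule" where
 "ind_gmodule G H V =
   (\<lparr>carrier = ind_carrier G H V, monoid.mult = undefined, one = undefined,
    zero = (\<lambda>x. \<zero>\<^bsub>fst V\<^esub>), add = (\<lambda>f k x. f x \<oplus>\<^bsub>fst V\<^esub> k x), smult = (\<lambda>a f x. a \<odot>\<^bsub>fst V\<^esub> f x)\<rparr>,
   \<lambda>g. restrict (\<lambda>f x. if x \<in> carrier G then f (x \<otimes>\<^bsub>G\<^esub> g) else \<zero>\<^bsub>fst V\<^esub>) (ind_carrier G H V))"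

lemma ind_gmodule_simps:
 "carrier (fst (ind_gmodule G H V)) = ind_carrier G H V"
 "\<zero>\<^bsub>fst (ind_gmodule G H V)\<^esub> = (\<lambda>x. \<zero>\<^bsub>fst V\<^esub>)"
 "f \<oplus>\<^bsub>fst (ind_gmodule G H V)\<^esub> k = (\<lambda>x. f x \<oplus>\<^bsub>fst V\<^esub> k x)"
 "a \<odot>\<^bsub>fst (ind_gmodule G H V)\<^esub> f = (\<lambda>x. a \<odot>\<^bsub>fst V\<^esub> f x)"
 "f \<in> ind_carrier G H V \<Longrightarrow>
  snd (ind_gmodule G H V) g f = (\<lambda>x. if x \<in> carrier G then f (x \<otimes>\<^bsub>G\<^esub> g) else \<zero>\<^bsub>fst V\<^esub>)"
 by (simp_all add: ind_gmodule_def)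

lemma ind_carrierD:
 assumes "f \<in> ind_carrier G H V"
 shows "x \<notin> carrier G \<Longrightarrow> f x = \<zero>\<^bsub>fst V\<^esub>" "x \<in> carrier G \<Longrightarrow> f x \<in> carrier (fst V)"
  "x \<in> carrier G \<Longrightarrow> h \<in> H \<Longrightarrow> f (h \<otimes>\<^bsub>G\<^esub> x) = snd V h (f x)"
 using assms by (simp_all add: ind_carrier_def)

lemma ind_carrierI:
 assumes "\<And>x. x \<notin> carrier G \<Longrightarrow> f x = \<zero>\<^bsub>fst V\<^esub>" "\<And>x. x \<in> carrier G \<Longrightarrow> f x \<in> carrier (fst V)"
  "\<And>x h. x \<in> carrier G \<Longrightarrow> h \<in> H \<Longrightarrow> f (h \<otimes>\<^bsub>G\<^esub> x) = snd V h (f x)"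
 shows "f \<in> ind_carrier G H V"
 using assms by (simp add: ind_carrier_def)

section \<open>Induction of modules: finite generation, direct sums, permutation modules\<close>

context
 fixes F :: "('f, 'c) ring_scheme" and G :: "('g, 'b) monoid_scheme" (structure) and H :: "'g set"
 assumes F: "cring F" and G: "group G" and finG: "finite (carrier G)" and H: "subgroup H G"
begin

interpretation group G by (rule G)

lemma ind_is_gmodule:
 assumes V: "is_gmodule F (subgrp G H) V"
 shows "is_gmodule F G (ind_gmodule G H V)"
proof -
 note D = is_gmoduleD[OF V, simplified]
 interpret M: module F "fst V" by (rule D(1))
 have Hs: "h \<in> carrier G" if "h \<in> H" for h using subgroup.subset[OF H] that by auto
 let ?I = "ind_gmodule G H V" and ?C = "ind_carrier G H V"
 note I = ind_carrierD[of _ G H V]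
 have z: "(\<lambda>x. \<zero>\<^bsub>fst V\<^esub>) \<in> ?C" by (rule ind_carrierI) (auto simp: D(6))
 have a: "(\<lambda>x. f x \<oplus>\<^bsub>fst V\<^esub> k x) \<in> ?C" if "f \<in> ?C" "k \<in> ?C" for f k
  by (rule ind_carrierI) (simp_all add: I[OF that(1)] I[OF that(2)] D(3))
 have s: "(\<lambda>x. b \<odot>\<^bsub>fst V\<^esub> f x) \<in> ?C" if "b \<in> carrier F" "f \<in> ?C" for b f
  by (rule ind_carrierI) (simp_all add: I[OF that(2)] that(1) D(4))
 have g: "(\<lambda>x. if x \<in> carrier G then f (x \<otimes> g) else \<zero>\<^bsub>fst V\<^esub>) \<in> ?C" if "g \<in> carrier G" "f \<in> ?C" for g f
  by (rule ind_carrierI) (simp_all add: I[OF that(2)] that(1) Hs m_assoc)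
 have Ic: "f x \<in> carrier (fst V)" if "f \<in> ?C" for f x
  using I[OF that, of x] by (cases "x \<in> carrier G") auto
 have ab: "abelian_group (fst ?I)"
 proof (rule abelian_groupI, unfold ind_gmodule_simps)
  fix f assume f: "f \<in> ?C"
  show "\<exists>k\<in>?C. (\<lambda>x. k x \<oplus>\<^bsub>fst V\<^esub> f x) = (\<lambda>x. \<zero>\<^bsub>fst V\<^esub>)"
  proof (rule bexI[of _ "\<lambda>x. (\<ominus>\<^bsub>F\<^esub> \<one>\<^bsub>F\<^esub>) \<odot>\<^bsub>fst V\<^esub> f x"])
   show "(\<lambda>x. ((\<ominus>\<^bsub>F\<^esub> \<one>\<^bsub>F\<^esub>) \<odot>\<^bsub>fst V\<^esub> f x) \<oplus>\<^bsub>fst V\<^esub> f x) = (\<lambda>x. \<zero>\<^bsub>fst V\<^esub>)"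
    by (rule ext) (simp add: M.smult_l_minus M.M.l_neg Ic[OF f])
  qed (simp add: s f)
 qed (simp_all add: a z Ic M.M.a_ac)
 have md: "module F (fst ?I)"
  by (rule moduleI[OF F ab])
   (simp_all add: ind_gmodule_simps s Ic M.smult_l_distr M.smult_r_distr M.smult_assoc1)
 have ga: "group_action G ?C (snd ?I)"
 proof (rule group_actionI[OF G])
  show "snd ?I g \<in> extensional ?C" for g by (simp add: ind_gmodule_def)
  show "snd ?I k f \<in> ?C" if "k \<in> carrier G" "f \<in> ?C" for k f
   using g[OF that] that by (simp add: ind_gmodule_simps)
  show "snd ?I \<one> f = f" if "f \<in> ?C" for f
   using that by (auto simp: ind_gmodule_simps fun_eq_iff I(1))
  show "snd ?I (k \<otimes> l) f = snd ?I k (snd ?I l f)" if "k \<in> carrier G" "l \<in> carrier G" "f \<in> ?C" for k l f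
   using that g by (auto simp: ind_gmodule_simps fun_eq_iff m_assoc)
 qed
 show ?thesis
  unfolding is_gmodule_def case_prod_beta ind_gmodule_simps
  using md ga a s by (auto simp: ind_gmodule_simps fun_eq_iff)
qed

text \<open>An equivariant function is the sum of its parts on the right cosets of \<open>H\<close>,
  and each part is a translate of a function supported on \<open>H\<close>. These latter form a copy
  of \<open>V\<close>, generated by the images of generators of \<open>V\<close>.\<close>

lemma ind_fg_gmodule:
 assumes V: "is_gmodule F (subgrp G H) V" and fg: "fg_gmodule F (subgrp G H) V"
 shows "fg_gmodule F G (ind_gmodule G H V)"
proof -
 note D = is_gmoduleD[OF V, simplified]
 interpret M: module F "fst V" by (rule D(1))
 let ?I = "ind_gmodule G H V" and ?C = "ind_carrier G H V"
 note I = ind_carrierD[of _ G H V]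
 note DI = is_gmoduleD[OF ind_is_gmodule[OF V], unfolded ind_gmodule_simps(1)]
 have Hs: "h \<in> carrier G" if "h \<in> H" for h using subgroup.subset[OF H] that by auto
 have Hm: "h \<otimes> x \<in> H \<longleftrightarrow> x \<in> H" if h: "h \<in> H" and x: "x \<in> carrier G" for h x
 proof
  assume "h \<otimes> x \<in> H"
  then have "inv h \<otimes> (h \<otimes> x) \<in> H" using subgroup.m_closed[OF H subgroup.m_inv_closed[OF H h]] by blast
  then show "x \<in> H" using h x Hs by (simp add: m_assoc[symmetric])
 qed (use h subgroup.m_closed[OF H] in blast)
 obtain T where T: "finite T" "T \<subseteq> carrier (fst V)"
  "\<And>K. submodule K F (fst V) \<Longrightarrow> T \<subseteq> K \<Longrightarrow> K = carrier (fst V)"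
  using fg_gmodule_finite_span[OF V fg] finite_subset[OF subgroup.subset[OF H] finG] by auto
 \<comment> \<open>The embedding of \<open>V\<close> as the functions supported on \<open>H\<close>;
   \<open>e m\<close> is the equivariant function with value \<open>m\<close> at the
   identity.\<close>
 define e where "e = (\<lambda>m x. if x \<in> H then snd V x m else \<zero>\<^bsub>fst V\<^esub>)"
 have mu: "snd V (h \<otimes> x) m = snd V h (snd V x m)" if "h \<in> H" "x \<in> H" "m \<in> carrier (fst V)" for h x m
  using group_action_mult[OF D(2)] that by simp
 have eC: "e m \<in> ?C" if m: "m \<in> carrier (fst V)" for m
 proof (rule ind_carrierI)
  fix x h assume "x \<in> carrier G" "h \<in> H"
  then show "e m (h \<otimes> x) = snd V h (e m x)" using Hm[of h x] mu[of h x m] m D(6) by (simp add: e_def)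
 qed (use D(5) m Hs in \<open>auto simp: e_def\<close>)
 have "K = ?C" if K: "submodule K F (fst ?I)" and st: "\<forall>g\<in>carrier G. \<forall>x\<in>K. snd ?I g x \<in> K"
  and eK: "e ` T \<subseteq> K" for K
 proof -
  note Kd = submoduleD[OF K, unfolded ind_gmodule_simps]
  have "submodule {m \<in> carrier (fst V). e m \<in> K} F (fst V)"
  proof (rule submodule_condI[OF D(1)])
   have "e \<zero>\<^bsub>fst V\<^esub> = (\<lambda>x. \<zero>\<^bsub>fst V\<^esub>)" by (auto simp: e_def D(6))
   then show "\<zero>\<^bsub>fst V\<^esub> \<in> {m \<in> carrier (fst V). e m \<in> K}" using Kd(2) by simp
   fix x y assume xy: "x \<in> {m \<in> carrier (fst V). e m \<in> K}" "y \<in> {m \<in> carrier (fst V). e m \<in> K}"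
   then have "e (x \<oplus>\<^bsub>fst V\<^esub> y) = (\<lambda>z. e x z \<oplus>\<^bsub>fst V\<^esub> e y z)" by (auto simp: e_def D(3))
   then show "x \<oplus>\<^bsub>fst V\<^esub> y \<in> {m \<in> carrier (fst V). e m \<in> K}" using xy Kd(3)[of "e x" "e y"] by simp
  next
   fix a x assume ax: "a \<in> carrier F" "x \<in> {m \<in> carrier (fst V). e m \<in> K}"
   then have "e (a \<odot>\<^bsub>fst V\<^esub> x) = (\<lambda>z. a \<odot>\<^bsub>fst V\<^esub> e x z)" by (auto simp: e_def D(4))
   then show "a \<odot>\<^bsub>fst V\<^esub> x \<in> {m \<in> carrier (fst V). e m \<in> K}" using ax Kd(4)[of a "e x"] by simp
  qed auto
  from T(3)[OF this] have "{m \<in> carrier (fst V). e m \<in> K} = carrier (fst V)" using eK T(2) by blast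
  then have eK: "e m \<in> K" if "m \<in> carrier (fst V)" for m using that by blast
  have "f \<in> K" if "f \<in> ?C" for f
   using that
  proof (induction "card {x \<in> carrier G. f x \<noteq> \<zero>\<^bsub>fst V\<^esub>}" arbitrary: f rule: less_induct)
   case less
   note If = I[OF less.prems]
   show ?case
   proof (cases "\<forall>x\<in>carrier G. f x = \<zero>\<^bsub>fst V\<^esub>")
    case True
    then have "f = (\<lambda>x. \<zero>\<^bsub>fst V\<^esub>)" using If(1) by blast
    then show ?thesis using Kd(2) by simp
   next
    case False
    then obtain x0 where x0: "x0 \<in> carrier G" "f x0 \<noteq> \<zero>\<^bsub>fst V\<^esub>" by auto
    \<comment> \<open>Delete the part of \<open>f\<close> on the coset \<open>H x0\<close>. What is
      deleted is the translate of \<open>e (f x0)\<close> by \<open>x0^-1\<close>, and the support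
      becomes smaller.\<close>
    define f' where "f' = (\<lambda>x. if x \<otimes> inv x0 \<in> H then \<zero>\<^bsub>fst V\<^esub> else f x)"
    have ass: "h \<otimes> x \<otimes> inv x0 = h \<otimes> (x \<otimes> inv x0)" if "h \<in> H" "x \<in> carrier G" for h x
     using that x0 Hs by (simp add: m_assoc)
    have f'C: "f' \<in> ?C"
    proof (rule ind_carrierI)
     fix x h assume xh: "x \<in> carrier G" "h \<in> H"
     show "f' (h \<otimes> x) = snd V h (f' x)"
      using xh Hm[of h "x \<otimes> inv x0"] x0(1) D(6) If(3) by (simp add: f'_def ass)
    qed (use If in \<open>auto simp: f'_def\<close>)
    have sub: "{x \<in> carrier G. f' x \<noteq> \<zero>\<^bsub>fst V\<^esub>} \<subset> {x \<in> carrier G. f x \<noteq> \<zero>\<^bsub>fst V\<^esub>}"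
    proof -
     have "f' x0 = \<zero>\<^bsub>fst V\<^esub>" using x0 subgroup.one_closed[OF H] by (simp add: f'_def)
     then have "x0 \<notin> {x \<in> carrier G. f' x \<noteq> \<zero>\<^bsub>fst V\<^esub>}" "x0 \<in> {x \<in> carrier G. f x \<noteq> \<zero>\<^bsub>fst V\<^esub>}"
      using x0 by simp_all
     moreover have "{x \<in> carrier G. f' x \<noteq> \<zero>\<^bsub>fst V\<^esub>} \<subseteq> {x \<in> carrier G. f x \<noteq> \<zero>\<^bsub>fst V\<^esub>}"
      by (auto simp: f'_def)
     ultimately show ?thesis by blast
    qed
    have "card {x \<in> carrier G. f' x \<noteq> \<zero>\<^bsub>fst V\<^esub>} < card {x \<in> carrier G. f x \<noteq> \<zero>\<^bsub>fst V\<^esub>}"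
     by (rule psubset_card_mono[OF _ sub]) (use finG in simp)
    from less.hyps[OF this f'C] have f'K: "f' \<in> K" .
    have m: "f x0 \<in> carrier (fst V)" using If(2) x0 by simp
    have tK: "snd ?I (inv x0) (e (f x0)) \<in> K" using st eK[OF m] x0 by simp
    have fe: "f x = f' x \<oplus>\<^bsub>fst V\<^esub> snd ?I (inv x0) (e (f x0)) x" for x
    proof (cases "x \<in> carrier G")
     case True
     have tx: "snd ?I (inv x0) (e (f x0)) x = e (f x0) (x \<otimes> inv x0)"
      using True by (simp add: ind_gmodule_simps(5)[OF eC[OF m]])
     show ?thesis
     proof (cases "x \<otimes> inv x0 \<in> H")
      case xH: True
      have "f x = f ((x \<otimes> inv x0) \<otimes> x0)" using True x0 by (simp add: m_assoc)
      also have "\<dots> = snd V (x \<otimes> inv x0) (f x0)" using If(3)[OF x0(1) xH] .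
      finally show ?thesis using True xH D(5)[OF xH m] unfolding tx by (simp add: f'_def e_def)
     next
      case False
      then show ?thesis using True If(2) unfolding tx by (simp add: f'_def e_def)
     qed
    next
     case False
     then show ?thesis using If(1) I(1)[OF f'C] by (simp add: ind_gmodule_simps(5)[OF eC[OF m]])
    qed
    have "(\<lambda>x. f' x \<oplus>\<^bsub>fst V\<^esub> snd ?I (inv x0) (e (f x0)) x) \<in> K"
     by (rule Kd(3)[OF f'K tK])
    moreover have "f = (\<lambda>x. f' x \<oplus>\<^bsub>fst V\<^esub> snd ?I (inv x0) (e (f x0)) x)"
     by (rule ext) (rule fe)
    ultimately show ?thesis by (rule ssubst[rotated])
   qed
  qed
  then show ?thesis using Kd(1) by blast
 qed
 moreover have "finite (e ` T)" "e ` T \<subseteq> ?C" using T eC by auto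
 ultimately show ?thesis
  unfolding fg_gmodule_def case_prod_beta ind_gmodule_simps
  by (intro exI[of _ "e ` T"]) simp
qed

lemma ind_gmodule_sum:
 assumes X: "is_gmodule F (subgrp G H) X" and Y: "is_gmodule F (subgrp G H) Y"
  and Z: "is_gmodule F (subgrp G H) Z"
  and iso: "gmodule_iso F (subgrp G H) (gmodule_sum X Y) Z"
 shows "gmodule_iso F G (gmodule_sum (ind_gmodule G H X) (ind_gmodule G H Y)) (ind_gmodule G H Z)"
proof -
 note DX = is_gmoduleD[OF X, simplified] and DY = is_gmoduleD[OF Y, simplified] and DZ = is_gmoduleD[OF Z, simplified]
 interpret MX: module F "fst X" by (rule DX)
 interpret MY: module F "fst Y" by (rule DY)
 interpret MZ: module F "fst Z" by (rule DZ)
 obtain f where f: "gmodule_map F (subgrp G H) (gmodule_sum X Y) Z f" using iso by (rule gmodule_isoE)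
 note fD = gmodule_mapD[OF f, unfolded gmodule_sum_simps(1), simplified]
 define i where "i = inv_into (carrier (fst X) \<times> carrier (fst Y)) f"
 have i: "i z \<in> carrier (fst X) \<times> carrier (fst Y)" "f (i z) = z" if "z \<in> carrier (fst Z)" for z
  using fD(1) that by (auto simp: i_def bij_betw_def inv_into_into f_inv_into_f)
 have if': "i (f w) = w" if "w \<in> carrier (fst X) \<times> carrier (fst Y)" for w
  using fD(1) that by (simp add: i_def bij_betw_def)
 have f0: "f (\<zero>\<^bsub>fst X\<^esub>, \<zero>\<^bsub>fst Y\<^esub>) = \<zero>\<^bsub>fst Z\<^esub>"
  using fD(3)[of "\<zero>\<^bsub>F\<^esub>" "(\<zero>\<^bsub>fst X\<^esub>, \<zero>\<^bsub>fst Y\<^esub>)"] fD(5)[of "(\<zero>\<^bsub>fst X\<^esub>, \<zero>\<^bsub>fst Y\<^esub>)"]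
  by (simp add: gmodule_sum_simps)
 have i0: "i \<zero>\<^bsub>fst Z\<^esub> = (\<zero>\<^bsub>fst X\<^esub>, \<zero>\<^bsub>fst Y\<^esub>)" using if'[of "(\<zero>\<^bsub>fst X\<^esub>, \<zero>\<^bsub>fst Y\<^esub>)"] f0 by simp
 define T where "T = (\<lambda>(u, v) (x :: 'g). f (u x, v x))"
 define S where "S = (\<lambda>w. (\<lambda>x :: 'g. fst (i (w x)), \<lambda>x :: 'g. snd (i (w x))))"
 let ?S = "gmodule_sum (ind_gmodule G H X) (ind_gmodule G H Y)"
 note c = gmodule_sum_simps(1) ind_gmodule_simps(1)
 have uc: "u x \<in> carrier (fst X)" if "u \<in> ind_carrier G H X" for u x
  using ind_carrierD[OF that, of x] by (cases "x \<in> carrier G") auto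
 have vc: "v x \<in> carrier (fst Y)" if "v \<in> ind_carrier G H Y" for v x
  using ind_carrierD[OF that, of x] by (cases "x \<in> carrier G") auto
 have wc: "w x \<in> carrier (fst Z)" if "w \<in> ind_carrier G H Z" for w x
  using ind_carrierD[OF that, of x] by (cases "x \<in> carrier G") auto
 have Tc: "T (u, v) \<in> ind_carrier G H Z" if u: "u \<in> ind_carrier G H X" and v: "v \<in> ind_carrier G H Y" for u v
 proof (rule ind_carrierI)
  fix x h assume xh: "x \<in> carrier G" "h \<in> H"
  then have "f (u (h \<otimes> x), v (h \<otimes> x)) = f (snd (gmodule_sum X Y) h (u x, v x))"
   using ind_carrierD(3)[OF u] ind_carrierD(3)[OF v] uc[OF u] vc[OF v] by (simp add: gmodule_sum_simps)
  also have "\<dots> = snd Z h (f (u x, v x))" by (rule fD(4)) (use xh uc[OF u] vc[OF v] in simp_all)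
  finally show "T (u, v) (h \<otimes> x) = snd Z h (T (u, v) x)" by (simp add: T_def)
 qed (use uc[OF u] vc[OF v] fD(5) f0 ind_carrierD(1)[OF u] ind_carrierD(1)[OF v] in \<open>simp_all add: T_def\<close>)
 have Sc: "S w \<in> ind_carrier G H X \<times> ind_carrier G H Y" if w: "w \<in> ind_carrier G H Z" for w
 proof -
  have e: "i (w (h \<otimes> x)) = (snd X h (fst (i (w x))), snd Y h (snd (i (w x))))"
   if xh: "x \<in> carrier G" "h \<in> H" for x h
  proof -
   have iw: "i (w x) \<in> carrier (fst X) \<times> carrier (fst Y)" using i wc[OF w] by simp
   have "f (snd (gmodule_sum X Y) h (i (w x))) = snd Z h (f (i (w x)))" by (rule fD(4)) (use xh iw in auto)
   also have "\<dots> = w (h \<otimes> x)" using i(2)[OF wc[OF w]] ind_carrierD(3)[OF w] xh by simp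
   finally have "f (snd X h (fst (i (w x))), snd Y h (snd (i (w x)))) = w (h \<otimes> x)"
    using gmodule_sum_simps(4)[of "fst (i (w x))" X "snd (i (w x))" Y h] iw by auto
   moreover have "(snd X h (fst (i (w x))), snd Y h (snd (i (w x)))) \<in> carrier (fst X) \<times> carrier (fst Y)"
    using iw DX(5) DY(5) xh by auto
   ultimately show ?thesis using if' by metis
  qed
  have "fst (S w) \<in> ind_carrier G H X"
   by (rule ind_carrierI) (use e i(1)[OF wc[OF w]] ind_carrierD(1)[OF w] i0 in \<open>auto simp: S_def mem_Times_iff\<close>)
  moreover have "snd (S w) \<in> ind_carrier G H Y"
   by (rule ind_carrierI) (use e i(1)[OF wc[OF w]] ind_carrierD(1)[OF w] i0 in \<open>auto simp: S_def mem_Times_iff\<close>)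
  ultimately show ?thesis by (simp add: mem_Times_iff)
 qed
 have "gmodule_iso F G (fst ?S, snd ?S) (fst (ind_gmodule G H Z), snd (ind_gmodule G H Z))"
 proof (rule gmodule_isoI[of T], unfold c)
  show "bij_betw T (ind_carrier G H X \<times> ind_carrier G H Y) (ind_carrier G H Z)"
  proof (rule bij_betw_byWitness[where f' = S])
   show "\<forall>a\<in>ind_carrier G H X \<times> ind_carrier G H Y. S (T a) = a"
    using if' uc vc by (auto simp: S_def T_def)
   show "\<forall>w\<in>ind_carrier G H Z. T (S w) = w"
    using i(2) wc by (auto simp: S_def T_def)
   show "T ` (ind_carrier G H X \<times> ind_carrier G H Y) \<subseteq> ind_carrier G H Z" using Tc by auto
   show "S ` ind_carrier G H Z \<subseteq> ind_carrier G H X \<times> ind_carrier G H Y" using Sc by blast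
  qed
 next
  fix a b assume "a \<in> ind_carrier G H X \<times> ind_carrier G H Y" "b \<in> ind_carrier G H X \<times> ind_carrier G H Y"
  then obtain u v u' v' where ab: "a = (u, v)" "b = (u', v')" "u \<in> ind_carrier G H X" "v \<in> ind_carrier G H Y"
   "u' \<in> ind_carrier G H X" "v' \<in> ind_carrier G H Y" by auto
  have "f (u x \<oplus>\<^bsub>fst X\<^esub> u' x, v x \<oplus>\<^bsub>fst Y\<^esub> v' x) = f (u x, v x) \<oplus>\<^bsub>fst Z\<^esub> f (u' x, v' x)" for x
   using fD(2)[of "(u x, v x)" "(u' x, v' x)"] uc vc ab by (simp add: gmodule_sum_simps)
  then show "T (a \<oplus>\<^bsub>fst ?S\<^esub> b) = T a \<oplus>\<^bsub>fst (ind_gmodule G H Z)\<^esub> T b"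
   by (simp add: ab gmodule_sum_simps ind_gmodule_simps T_def)
 next
  fix r a assume r: "r \<in> carrier F" and "a \<in> ind_carrier G H X \<times> ind_carrier G H Y"
  then obtain u v where a: "a = (u, v)" "u \<in> ind_carrier G H X" "v \<in> ind_carrier G H Y" by auto
  have "f (r \<odot>\<^bsub>fst X\<^esub> u x, r \<odot>\<^bsub>fst Y\<^esub> v x) = r \<odot>\<^bsub>fst Z\<^esub> f (u x, v x)" for x
   using fD(3)[of r "(u x, v x)"] uc vc a r by (simp add: gmodule_sum_simps)
  then show "T (r \<odot>\<^bsub>fst ?S\<^esub> a) = r \<odot>\<^bsub>fst (ind_gmodule G H Z)\<^esub> T a"
   by (simp add: a gmodule_sum_simps ind_gmodule_simps T_def)
 next
  fix g a assume g: "g \<in> carrier G" and "a \<in> ind_carrier G H X \<times> ind_carrier G H Y"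
  then obtain u v where a: "a = (u, v)" "u \<in> ind_carrier G H X" "v \<in> ind_carrier G H Y" by auto
  note s = gmodule_sum_simps(4)[of u "ind_gmodule G H X" v "ind_gmodule G H Y" g, unfolded ind_gmodule_simps(1), OF a(2,3)]
  show "T (snd ?S g a) = snd (ind_gmodule G H Z) g (T a)"
   unfolding a(1) s ind_gmodule_simps(5)[OF a(2)] ind_gmodule_simps(5)[OF a(3)] ind_gmodule_simps(5)[OF Tc[OF a(2,3)]]
   by (auto simp: T_def fun_eq_iff f0)
 qed
 then show ?thesis by simp
qed

lemma ind_gmodule_iso:
 assumes X: "is_gmodule F (subgrp G H) X" and Z: "is_gmodule F (subgrp G H) Z"
  and iso: "gmodule_iso F (subgrp G H) X Z"
 shows "gmodule_iso F G (ind_gmodule G H X) (ind_gmodule G H Z)"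
proof -
 note DX = is_gmoduleD[OF X, simplified] and DZ = is_gmoduleD[OF Z, simplified]
 interpret MX: module F "fst X" by (rule DX)
 interpret MZ: module F "fst Z" by (rule DZ)
 obtain f where f: "gmodule_map F (subgrp G H) X Z f" using iso by (rule gmodule_isoE)
 note fD = gmodule_mapD[OF f, simplified]
 define i where "i = inv_into (carrier (fst X)) f"
 have i: "i z \<in> carrier (fst X)" "f (i z) = z" if "z \<in> carrier (fst Z)" for z
  using fD(1) that by (auto simp: i_def bij_betw_def inv_into_into f_inv_into_f)
 have if': "i (f w) = w" if "w \<in> carrier (fst X)" for w
  using fD(1) that by (simp add: i_def bij_betw_def)
 have f0: "f \<zero>\<^bsub>fst X\<^esub> = \<zero>\<^bsub>fst Z\<^esub>"
  using fD(3)[of "\<zero>\<^bsub>F\<^esub>" "\<zero>\<^bsub>fst X\<^esub>"] fD(5)[of "\<zero>\<^bsub>fst X\<^esub>"] by simp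
 have i0: "i \<zero>\<^bsub>fst Z\<^esub> = \<zero>\<^bsub>fst X\<^esub>" using if'[of "\<zero>\<^bsub>fst X\<^esub>"] f0 by simp
 define T where "T = (\<lambda>u x :: 'g. f (u x))"
 define S where "S = (\<lambda>w x :: 'g. i (w x))"
 have uc: "u x \<in> carrier (fst X)" if "u \<in> ind_carrier G H X" for u x
  using ind_carrierD[OF that, of x] by (cases "x \<in> carrier G") auto
 have wc: "w x \<in> carrier (fst Z)" if "w \<in> ind_carrier G H Z" for w x
  using ind_carrierD[OF that, of x] by (cases "x \<in> carrier G") auto
 have Tc: "T u \<in> ind_carrier G H Z" if u: "u \<in> ind_carrier G H X" for u
  by (rule ind_carrierI)
   (use uc[OF u] fD(4,5) f0 ind_carrierD(1,3)[OF u] in \<open>simp_all add: T_def\<close>)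
 have Sc: "S w \<in> ind_carrier G H X" if w: "w \<in> ind_carrier G H Z" for w
 proof -
  have e: "i (w (h \<otimes> x)) = snd X h (i (w x))" if xh: "x \<in> carrier G" "h \<in> H" for x h
  proof -
   have iw: "i (w x) \<in> carrier (fst X)" using i wc[OF w] by simp
   have "f (snd X h (i (w x))) = w (h \<otimes> x)"
    using fD(4)[OF xh(2) iw] i(2)[OF wc[OF w]] ind_carrierD(3)[OF w] xh by simp
   then show ?thesis using if'[of "snd X h (i (w x))"] DX(5)[OF xh(2) iw] by simp
  qed
  show ?thesis
   by (rule ind_carrierI) (use e i(1)[OF wc[OF w]] ind_carrierD(1)[OF w] i0 in \<open>simp_all add: S_def\<close>)
 qed
 have "gmodule_iso F G (fst (ind_gmodule G H X), snd (ind_gmodule G H X))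
  (fst (ind_gmodule G H Z), snd (ind_gmodule G H Z))"
 proof (rule gmodule_isoI[of T], unfold ind_gmodule_simps(1))
  show "bij_betw T (ind_carrier G H X) (ind_carrier G H Z)"
  proof (rule bij_betw_byWitness[where f' = S])
   show "\<forall>a\<in>ind_carrier G H X. S (T a) = a" using if' uc by (simp add: S_def T_def)
   show "\<forall>w\<in>ind_carrier G H Z. T (S w) = w" using i(2) wc by (simp add: S_def T_def)
  qed (use Tc Sc in auto)
 next
  fix u v assume "u \<in> ind_carrier G H X" "v \<in> ind_carrier G H X"
  then show "T (u \<oplus>\<^bsub>fst (ind_gmodule G H X)\<^esub> v) = T u \<oplus>\<^bsub>fst (ind_gmodule G H Z)\<^esub> T v"
   using uc fD(2) by (simp add: ind_gmodule_simps T_def)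
 next
  fix r u assume "r \<in> carrier F" "u \<in> ind_carrier G H X"
  then show "T (r \<odot>\<^bsub>fst (ind_gmodule G H X)\<^esub> u) = r \<odot>\<^bsub>fst (ind_gmodule G H Z)\<^esub> T u"
   using uc fD(3) by (simp add: ind_gmodule_simps T_def)
 next
  fix g u assume g: "g \<in> carrier G" and u: "u \<in> ind_carrier G H X"
  show "T (snd (ind_gmodule G H X) g u) = snd (ind_gmodule G H Z) g (T u)"
   unfolding ind_gmodule_simps(5)[OF u] ind_gmodule_simps(5)[OF Tc[OF u]]
   by (auto simp: T_def fun_eq_iff f0)
 qed
 then show ?thesis by simp
qed

text \<open>Transitivity of induction in function form: \<open>\<phi>\<close> goes to
  \<open>yU \<mapsto> \<phi>(y^-1)(U)\<close>, and \<open>\<psi>\<close> goes back to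
  \<open>x \<mapsto> (B \<mapsto> \<psi>(x^-1 B))\<close>.\<close>

lemma ind_perm_module_coset:
 assumes U: "subgroup U (subgrp G H)"
 shows "gmodule_iso F G (ind_gmodule G H (perm_module F (subgrp G H) (coset_gset (subgrp G H) U)))
  (perm_module F G (coset_gset G U))"
proof -
 interpret F: cring F by (rule F)
 let ?H = "subgrp G H"
 let ?X = "coset_gset ?H U" and ?Y = "coset_gset G U"
 let ?V = "perm_module F ?H ?X"
 have Hs: "h \<in> carrier G" if "h \<in> H" for h using subgroup.subset[OF H] that by auto
 have finH: "finite H" using finite_subset[OF subgroup.subset[OF H] finG] .
 have UG: "subgroup U G" by (rule incl_subgroup[OF H U])
 have UH: "U \<subseteq> H" using subgroup.subset[OF U] by simp
 have Us: "U \<subseteq> carrier G" using subgroup.subset[OF UG] .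
 have lc: "x <#\<^bsub>?H\<^esub> A = x <#\<^bsub>G\<^esub> A" for x A by (simp add: l_coset_def)
 have as: "x <#\<^bsub>G\<^esub> (y <#\<^bsub>G\<^esub> U) = (x \<otimes> y) <#\<^bsub>G\<^esub> U" if "x \<in> carrier G" "y \<in> carrier G" for x y
  using lcos_m_assoc[OF Us] that by simp
 have oneU: "\<one> <#\<^bsub>G\<^esub> U = U" by (rule lcos_mult_one[OF Us])
 have uU: "u <#\<^bsub>G\<^esub> U = U" if "u \<in> U" for u
  using that UG Us subgroup.subset[OF UG] l_repr_independence[of u \<one> U] oneU by auto
 have fX: "fst ?X = (\<lambda>h. h <#\<^bsub>G\<^esub> U) ` H" and fY: "fst ?Y = (\<lambda>h. h <#\<^bsub>G\<^esub> U) ` carrier G"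
  by (simp_all add: coset_gset_def lc)
 have finX: "finite (fst ?X)" "finite (fst ?Y)" using finH finG by (simp_all add: fX fY)
 have sX: "snd ?X h A = h <#\<^bsub>G\<^esub> A" if "A \<in> fst ?X" for h A
  using that by (simp add: coset_gset_def lc)
 have sY: "snd ?Y h A = h <#\<^bsub>G\<^esub> A" if "A \<in> fst ?Y" for h A
  using that by (simp add: coset_gset_def)
 have iH: "inv\<^bsub>?H\<^esub> h = inv h" if "h \<in> H" for h using m_inv_consistent[OF H that] .
 have UX: "U \<in> fst ?X" unfolding fX using oneU subgroup.one_closed[OF H] by force
 note cX = free_module_carrier[OF finX(1), of _ F] and cY = free_module_carrier[OF finX(2), of _ F]
 have Vc: "carrier (fst ?V) = carrier (free_module F (fst ?X))" by (simp add: perm_module_simps)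
 have V0: "\<zero>\<^bsub>fst ?V\<^esub> = (\<lambda>x. \<zero>\<^bsub>F\<^esub>)" by (simp add: perm_module_simps free_module_simps)
 have Vs: "snd ?V h f A = (if A \<in> fst ?X then f (inv h <#\<^bsub>G\<^esub> A) else \<zero>\<^bsub>F\<^esub>)"
  if "f \<in> carrier (free_module F (fst ?X))" "h \<in> H" for h f A
  using perm_module_simps(2)[OF that(1), of ?H h] sX[of A "inv h"] iH[OF that(2)] by simp
 note Cd = ind_carrierD[of _ G H ?V, unfolded Vc V0]
 \<comment> \<open>The representative of the coset is chosen by \<open>SOME\<close>; the fact
   \<open>T\<close> that follows shows, by equivariance of \<open>\<phi>\<close>, that the choice
   does not matter.\<close>
 define T where "T = (\<lambda>\<phi> A. if A \<in> fst ?Y then \<phi> (inv (SOME y. y \<in> carrier G \<and> y <#\<^bsub>G\<^esub> U = A)) U else \<zero>\<^bsub>F\<^esub>)"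
 define S where "S = (\<lambda>\<psi> x B. if x \<in> carrier G \<and> B \<in> fst ?X then \<psi> (inv x <#\<^bsub>G\<^esub> B) else \<zero>\<^bsub>F\<^esub>)"
 have T: "T \<phi> (y <#\<^bsub>G\<^esub> U) = \<phi> (inv y) U" if \<phi>: "\<phi> \<in> ind_carrier G H ?V" and y: "y \<in> carrier G" for \<phi> y
 proof -
  define z where "z = (SOME z. z \<in> carrier G \<and> z <#\<^bsub>G\<^esub> U = y <#\<^bsub>G\<^esub> U)"
  have z: "z \<in> carrier G" "z <#\<^bsub>G\<^esub> U = y <#\<^bsub>G\<^esub> U"
   using someI[of "\<lambda>z. z \<in> carrier G \<and> z <#\<^bsub>G\<^esub> U = y <#\<^bsub>G\<^esub> U" y] y unfolding z_def by blast+
  define u where "u = inv y \<otimes> z"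
  have u: "u \<in> U" using l_coset_eq_iff[OF G finG UG y z(1)] z(2) by (simp add: u_def)
  have uG: "u \<in> carrier G" and uH: "u \<in> H" using u Us UH by auto
  have iu: "inv u \<in> H" using subgroup.m_inv_closed[OF H uH] .
  have "inv z = inv u \<otimes> inv y"
   unfolding u_def using y z(1) by (simp add: inv_mult_group m_assoc)
  then have "\<phi> (inv z) U = snd ?V (inv u) (\<phi> (inv y)) U"
   using Cd(3)[OF \<phi> _ iu, of "inv y"] y by simp
  also have "\<dots> = \<phi> (inv y) U"
   using Vs[OF Cd(2)[OF \<phi>] iu, of "inv y" U] y UX uG uU[OF u] by simp
  finally show ?thesis using y by (simp add: T_def fY z_def)
 qed
 have Tc: "T \<phi> \<in> carrier (free_module F (fst ?Y))" if \<phi>: "\<phi> \<in> ind_carrier G H ?V" for \<phi>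
 proof -
  have "T \<phi> A \<in> carrier F" if A: "A \<in> fst ?Y" for A
  proof -
   obtain y where y: "y \<in> carrier G" "A = y <#\<^bsub>G\<^esub> U" using A by (auto simp: fY)
   then show ?thesis using T[OF \<phi> y(1)] Cd(2)[OF \<phi>, of "inv y"] by (simp add: cX)
  qed
  then have "T \<phi> A \<in> carrier F" for A by (cases "A \<in> fst ?Y") (auto simp: T_def)
  then show ?thesis by (simp add: cY T_def)
 qed
 have YX: "inv x <#\<^bsub>G\<^esub> (h <#\<^bsub>G\<^esub> U) = (inv x \<otimes> h) <#\<^bsub>G\<^esub> U" if "x \<in> carrier G" "h \<in> H" for x h
  using as[of "inv x" h] that Hs by simp
 have Sc: "S \<psi> \<in> ind_carrier G H ?V" if \<psi>: "\<psi> \<in> carrier (free_module F (fst ?Y))" for \<psi>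
 proof (rule ind_carrierI)
  have SX: "S \<psi> x \<in> carrier (free_module F (fst ?X))" for x using \<psi> by (simp add: cX cY S_def)
  then show "S \<psi> x \<in> carrier (fst ?V)" for x by (simp add: Vc)
  show "S \<psi> x = \<zero>\<^bsub>fst ?V\<^esub>" if "x \<notin> carrier G" for x using that by (simp add: S_def V0)
  fix x h assume x: "x \<in> carrier G" and h: "h \<in> H"
  have "S \<psi> (h \<otimes> x) B = snd ?V h (S \<psi> x) B" for B
  proof (cases "B \<in> fst ?X")
   case True
   then obtain k where k: "k \<in> H" "B = k <#\<^bsub>G\<^esub> U" by (auto simp: fX)
   have ih: "inv h \<in> H" using subgroup.m_inv_closed[OF H h] .
   have b: "inv h <#\<^bsub>G\<^esub> B = (inv h \<otimes> k) <#\<^bsub>G\<^esub> U" using YX[OF Hs[OF h] k(1)] k(2) by simp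
   have hk: "inv h \<otimes> k \<in> H" using subgroup.m_closed[OF H ih k(1)] .
   have "inv (h \<otimes> x) <#\<^bsub>G\<^esub> B = (inv x \<otimes> (inv h \<otimes> k)) <#\<^bsub>G\<^esub> U"
    using YX[of "h \<otimes> x" k] k x Hs[OF h] Hs[OF k(1)] by (simp add: inv_mult_group m_assoc)
   also have "\<dots> = inv x <#\<^bsub>G\<^esub> (inv h <#\<^bsub>G\<^esub> B)" using YX[OF x hk] b by simp
   finally have e: "inv (h \<otimes> x) <#\<^bsub>G\<^esub> B = inv x <#\<^bsub>G\<^esub> (inv h <#\<^bsub>G\<^esub> B)" .
   have "inv h <#\<^bsub>G\<^esub> B \<in> fst ?X" unfolding fX b using hk by blast
   then show ?thesis using Vs[OF SX h, of x B] True x Hs[OF h] e by (simp add: S_def)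
  next
   case False
   then show ?thesis using Vs[OF SX h, of x B] by (simp add: S_def)
  qed
  then show "S \<psi> (h \<otimes> x) = snd ?V h (S \<psi> x)" by blast
 qed
 have "gmodule_iso F G (fst (ind_gmodule G H ?V), snd (ind_gmodule G H ?V)) (fst (perm_module F G ?Y), snd (perm_module F G ?Y))"
 proof (rule gmodule_isoI[of T], unfold ind_gmodule_simps(1) perm_module_simps(1)[of F G])
  show "bij_betw T (ind_carrier G H ?V) (carrier (free_module F (fst ?Y)))"
  proof (rule bij_betw_byWitness[where f' = S])
   show "\<forall>\<phi>\<in>ind_carrier G H ?V. S (T \<phi>) = \<phi>"
   proof (intro ballI ext)
    fix \<phi> x B assume \<phi>: "\<phi> \<in> ind_carrier G H ?V"
    show "S (T \<phi>) x B = \<phi> x B"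
    proof (cases "x \<in> carrier G \<and> B \<in> fst ?X")
     case True
     then obtain h where h: "h \<in> H" "B = h <#\<^bsub>G\<^esub> U" by (auto simp: fX)
     have x: "x \<in> carrier G" using True by simp
     have ih: "inv h \<in> H" using subgroup.m_inv_closed[OF H h(1)] .
     have "S (T \<phi>) x B = T \<phi> ((inv x \<otimes> h) <#\<^bsub>G\<^esub> U)"
      using True YX[OF x h(1)] h(2) by (simp add: S_def)
     also have "\<dots> = \<phi> (inv h \<otimes> x) U"
      using T[OF \<phi>, of "inv x \<otimes> h"] x Hs[OF h(1)] by (simp add: inv_mult_group)
     also have "\<dots> = snd ?V (inv h) (\<phi> x) U" using Cd(3)[OF \<phi> x ih] by simp
     also have "\<dots> = \<phi> x (h <#\<^bsub>G\<^esub> U)"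
      using Vs[OF Cd(2)[OF \<phi> x] ih, of U] UX Hs[OF h(1)] by simp
     finally show ?thesis using h by simp
    next
     case False
     then show ?thesis using Cd(1)[OF \<phi>, of x] Cd(2)[OF \<phi>, of x]
      by (cases "x \<in> carrier G") (auto simp: S_def cX)
    qed
   qed
   show "\<forall>\<psi>\<in>carrier (free_module F (fst ?Y)). T (S \<psi>) = \<psi>"
   proof (intro ballI ext)
    fix \<psi> A assume \<psi>: "\<psi> \<in> carrier (free_module F (fst ?Y))"
    show "T (S \<psi>) A = \<psi> A"
    proof (cases "A \<in> fst ?Y")
     case True
     then obtain y where y: "y \<in> carrier G" "A = y <#\<^bsub>G\<^esub> U" by (auto simp: fY)
     then show ?thesis using T[OF Sc[OF \<psi>] y(1)] UX by (simp add: S_def)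
    next
     case False
     then show ?thesis using \<psi> by (simp add: T_def cY)
    qed
   qed
  qed (use Tc Sc in auto)
 next
  fix g \<phi> assume g: "g \<in> carrier G" and \<phi>: "\<phi> \<in> ind_carrier G H ?V"
  have g\<phi>: "snd (ind_gmodule G H ?V) g \<phi> \<in> ind_carrier G H ?V"
   using is_gmoduleD(5)[OF ind_is_gmodule, of ?V g \<phi>] g \<phi> ind_gmodule_simps(1)
    perm_module_gmodule[OF F coset_gset_action[OF subgroup_imp_group[OF H] U]] by metis
  show "T (snd (ind_gmodule G H ?V) g \<phi>) = snd (perm_module F G ?Y) g (T \<phi>)"
  proof
   fix A
   show "T (snd (ind_gmodule G H ?V) g \<phi>) A = snd (perm_module F G ?Y) g (T \<phi>) A"
   proof (cases "A \<in> fst ?Y")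
    case True
    then obtain y where y: "y \<in> carrier G" "A = y <#\<^bsub>G\<^esub> U" by (auto simp: fY)
    have "T (snd (ind_gmodule G H ?V) g \<phi>) A = \<phi> (inv y \<otimes> g) U"
     using T[OF g\<phi> y(1)] y ind_gmodule_simps(5)[OF \<phi>, of g] by simp
    also have "\<dots> = T \<phi> ((inv g \<otimes> y) <#\<^bsub>G\<^esub> U)"
     using T[OF \<phi>, of "inv g \<otimes> y"] g y by (simp add: inv_mult_group)
    also have "\<dots> = snd (perm_module F G ?Y) g (T \<phi>) A"
     using perm_module_simps(2)[OF Tc[OF \<phi>], of G g] sY[OF True, of "inv g"] True as[of "inv g" y] g y by simp
    finally show ?thesis .
   next
    case False
    then show ?thesis using perm_module_simps(2)[OF Tc[OF \<phi>], of G g] by (simp add: T_def)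
   qed
  qed
 qed (auto simp: ind_gmodule_simps perm_module_simps free_module_simps T_def fun_eq_iff)
 then show ?thesis by simp
qed

text \<open>Induction respects direct sums and isomorphisms, so it maps module relations to module
  relations, and on permutation modules of coset spaces it replaces \<open>H/U\<close> by
  \<open>G/U\<close>.\<close>

lemma relation_over_induced:
 assumes n: "n \<in> subgroup_combs (subgrp G H)"
  and rel: "relation_over F (subgrp G H) (coset_comb (subgrp G H) n)"
 shows "relation_over F G (coset_comb G n)"
proof -
 let ?H = "subgrp G H"
 have gH: "group ?H" by (rule subgroup_imp_group[OF H])
 have fH: "finite (carrier ?H)" using finite_subset[OF subgroup.subset[OF H] finG] by simp
 \<comment> \<open>An induced module consists of functions on \<open>G\<close> with values in
   functions; a model among the generators has to be chosen to stay in the free group.\<close>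
 define \<Phi> where "\<Phi> = (\<lambda>V :: ('f, 'g, nat \<Rightarrow> 'f) gmodule. gmodule_rep F G (ind_gmodule G H V))"
 have I: "is_gmodule F G (ind_gmodule G H V)" "fg_gmodule F G (ind_gmodule G H V)"
  if "V \<in> fg_gmodules F ?H" for V :: "('f, 'g, nat \<Rightarrow> 'f) gmodule"
  using that ind_is_gmodule[of V] ind_fg_gmodule[of V] unfolding fg_gmodules_def by blast+
 have \<Phi>: "\<Phi> V \<in> fg_gmodules F G" "gmodule_iso F G (ind_gmodule G H V) (\<Phi> V)"
  if "V \<in> fg_gmodules F ?H" for V
  using someI_ex[of "\<lambda>W. W \<in> fg_gmodules F G \<and> gmodule_iso F G (ind_gmodule G H V) W"]
   gmodule_model[OF finG I[OF that]] unfolding \<Phi>_def gmodule_rep_def by blast+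
 have 1: "frag_extend (\<lambda>V. frag_of (\<Phi> V)) (frag_linearise F ?H (coset_comb ?H n)) \<in> module_relations F G"
 proof (rule sum_relations_extend)
  show "frag_linearise F ?H (coset_comb ?H n) \<in> module_relations F ?H"
   using rel by (simp add: relation_over_def)
  fix X Y Z assume XYZ: "X \<in> fg_gmodules F ?H" "Y \<in> fg_gmodules F ?H" "Z \<in> fg_gmodules F ?H" "is_gmodule_sum F ?H X Y Z"
  have "gmodule_iso F G (gmodule_sum (ind_gmodule G H X) (ind_gmodule G H Y)) (ind_gmodule G H Z)"
   by (rule ind_gmodule_sum) (use XYZ in \<open>simp_all add: fg_gmodules_def is_gmodule_sum_def\<close>)
  then have "gmodule_iso F G (gmodule_sum (\<Phi> X) (\<Phi> Y)) (\<Phi> Z)"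
   using gmodule_iso_trans[OF gmodule_sum_iso_cong[OF gmodule_iso_sym[OF I(1)[OF XYZ(1)] \<Phi>(2)[OF XYZ(1)]]
      gmodule_iso_sym[OF I(1)[OF XYZ(2)] \<Phi>(2)[OF XYZ(2)]]] gmodule_iso_trans[OF _ \<Phi>(2)[OF XYZ(3)]]] by blast
  then show "frag_of (\<Phi> X) + frag_of (\<Phi> Y) - frag_of (\<Phi> Z) \<in> module_relations F G"
   by (intro sum_relations_gen \<Phi>(1) XYZ) (simp add: is_gmodule_sum_def)
 qed
 let ?r = "\<lambda>U. gset_rep ?H (coset_gset ?H U)"
 have e1: "frag_extend (\<lambda>V. frag_of (\<Phi> V)) (frag_linearise F ?H (coset_comb ?H n)) =
  frag_extend (\<lambda>U. frag_of (\<Phi> (perm_module F ?H (?r U)))) n"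
  unfolding frag_linearise_def coset_comb_def
  by (rule free_Abelian_group_induct[of n UNIV]) (simp_all add: frag_extend_diff)
 have e2: "frag_linearise F G (coset_comb G n) = frag_extend (\<lambda>U. frag_of (perm_module F G (gset_rep G (coset_gset G U)))) n"
  unfolding frag_linearise_def coset_comb_def
  by (rule free_Abelian_group_induct[of n UNIV]) (simp_all add: frag_extend_diff)
 have 2: "frag_extend (\<lambda>U. frag_of (\<Phi> (perm_module F ?H (?r U)))) n -
  frag_extend (\<lambda>U. frag_of (perm_module F G (gset_rep G (coset_gset G U)))) n \<in> module_relations F G"
 proof (rule sum_relations_extend_cong)
  show "supp n \<subseteq> {U. subgroup U ?H}" using n by (simp add: subgroup_combs_iff)
  fix U assume "U \<in> {U. subgroup U ?H}"
  then have U: "subgroup U ?H" by simp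
  have UG: "subgroup U G" by (rule incl_subgroup[OF H U])
  note r = coset_rep[OF gH fH U] and rG = coset_rep[OF G finG UG]
  note aH = coset_gset_action[OF gH U] and aG = coset_gset_action[OF G UG]
  have pH: "perm_module F ?H (?r U) \<in> fg_gmodules F ?H" by (rule perm_module_fg_gmodules[OF F r(1)])
  have gm: "is_gmodule F ?H (perm_module F ?H (coset_gset ?H U))" "is_gmodule F ?H (perm_module F ?H (?r U))"
   using perm_module_gmodule[OF F] aH finite_gsetsD(2)[OF r(1)] by blast+
  have "gmodule_iso F G (ind_gmodule G H (perm_module F ?H (coset_gset ?H U))) (ind_gmodule G H (perm_module F ?H (?r U)))"
   by (rule ind_gmodule_iso[OF gm perm_module_iso[OF F coset_gset_finite[OF gH fH] r(2) gH aH]])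
  from gmodule_iso_trans[OF gmodule_iso_sym[OF ind_is_gmodule[OF gm(1)] this] ind_perm_module_coset[OF U]]
  have "gmodule_iso F G (ind_gmodule G H (perm_module F ?H (?r U))) (perm_module F G (coset_gset G U))" .
  from gmodule_iso_trans[OF gmodule_iso_sym[OF I(1)[OF pH] \<Phi>(2)[OF pH]] this]
  have "gmodule_iso F G (\<Phi> (perm_module F ?H (?r U))) (perm_module F G (coset_gset G U))" .
  from gmodule_iso_trans[OF this perm_module_iso[OF F coset_gset_finite[OF G finG] rG(2) G aG]]
  show "frag_of (\<Phi> (perm_module F ?H (?r U))) - frag_of (perm_module F G (gset_rep G (coset_gset G U)))
   \<in> module_relations F G"
   by (intro module_relations_iso[OF F G \<Phi>(1)[OF pH] perm_module_fg_gmodules[OF F rG(1)]])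
 qed
 have "frag_linearise F G (coset_comb G n) \<in> module_relations F G"
  unfolding e2 using sum_relations_diff[OF 1[unfolded e1] 2] by simp
 then show ?thesis
  using coset_comb_keys[OF G finG subgroup_combs_subgroup[OF G finG H n]] by (simp add: relation_over_def)
qed

end

section \<open>The rank of the trivial part\<close>

definition closure_indep :: "('a set \<Rightarrow> 'a set) \<Rightarrow> 'a set \<Rightarrow> bool" where
 "closure_indep cl I \<longleftrightarrow> (\<forall>b\<in>I. b \<notin> cl (I - {b}))"

text \<open>The closure axioms of a matroid. They provide a dimension theory for spans modulo a
  submodule without forming a quotient space over the residue field.\<close>

locale exchange_closure =
 fixes C :: "'a set" and cl :: "'a set \<Rightarrow> 'a set"
 assumes ext: "S \<subseteq> C \<Longrightarrow> S \<subseteq> cl S"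
  and closed: "S \<subseteq> C \<Longrightarrow> cl S \<subseteq> C"
  and mono: "S \<subseteq> T \<Longrightarrow> T \<subseteq> C \<Longrightarrow> cl S \<subseteq> cl T"
  and idem: "S \<subseteq> C \<Longrightarrow> T \<subseteq> cl S \<Longrightarrow> cl T \<subseteq> cl S"
  and exch: "S \<subseteq> C \<Longrightarrow> x \<in> C \<Longrightarrow> y \<in> cl (insert x S) \<Longrightarrow> y \<notin> cl S \<Longrightarrow> x \<in> cl (insert y S)"
begin

lemma indep_insert:
 assumes I: "closure_indep cl I" "I \<subseteq> C" and x: "x \<in> C" "x \<notin> cl I"
 shows "closure_indep cl (insert x I)"
 unfolding closure_indep_def
proof
 have xI: "x \<notin> I" using ext I x by blast
 fix b assume b: "b \<in> insert x I"
 show "b \<notin> cl (insert x I - {b})"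
 proof (cases "b = x")
  case True
  then show ?thesis using x xI by simp
 next
  case False
  then have bI: "b \<in> I" using b by simp
  have e: "insert x I - {b} = insert x (I - {b})" "insert b (I - {b}) = I" using False bI by auto
  have "I - {b} \<subseteq> C" using I(2) by auto
  then have "b \<in> cl (insert x (I - {b})) \<Longrightarrow> x \<in> cl I"
   using exch[of "I - {b}" x b] x I(1) bI e(2) unfolding closure_indep_def by auto
  then show ?thesis using x e(1) by auto
 qed
qed

lemma indep_subset: "closure_indep cl I \<Longrightarrow> I \<subseteq> C \<Longrightarrow> J \<subseteq> I \<Longrightarrow> closure_indep cl J"
 unfolding closure_indep_def
proof (intro ballI notI)
 fix b assume I: "\<forall>b\<in>I. b \<notin> cl (I - {b})" "I \<subseteq> C" "J \<subseteq> I" and b: "b \<in> J" "b \<in> cl (J - {b})"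
 have "cl (J - {b}) \<subseteq> cl (I - {b})" using I by (intro mono) auto
 then show False using I b by blast
qed

text \<open>Steinitz exchange: for \<open>x\<close> in \<open>I\<close> outside \<open>S\<close>,
  some \<open>s\<close> in \<open>S\<close> is not in the closure of \<open>I - {x}\<close>, since
  otherwise \<open>x\<close> would be. Replacing \<open>x\<close> by \<open>s\<close> keeps
  independence and cardinality and brings \<open>I\<close> closer to \<open>S\<close>.\<close>

lemma indep_card_le:
 assumes "finite S" "S \<subseteq> C" "finite I" "I \<subseteq> C" "closure_indep cl I" "I \<subseteq> cl S"
 shows "card I \<le> card S"
 using assms(3-6)
proof (induction "card (I - S)" arbitrary: I rule: less_induct)
 case less
 show ?case
 proof (cases "I \<subseteq> S")
  case True
  then show ?thesis using assms(1) by (rule card_mono[rotated])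
 next
  case False
  then obtain x where x: "x \<in> I" "x \<notin> S" by auto
  have I': "I - {x} \<subseteq> C" using less.prems(2) by auto
  have "\<not> S \<subseteq> cl (I - {x})"
  proof
   assume "S \<subseteq> cl (I - {x})"
   then have "cl S \<subseteq> cl (I - {x})" using idem[OF I'] by blast
   then show False using less.prems(3,4) x(1) unfolding closure_indep_def by blast
  qed
  then obtain s where s: "s \<in> S" "s \<notin> cl (I - {x})" by auto
  have sI: "s \<notin> I - {x}" using s(2) ext[OF I'] by blast
  have sC: "s \<in> C" using s(1) assms(2) by auto
  define J where "J = insert s (I - {x})"
  have ind: "closure_indep cl J"
   unfolding J_def by (rule indep_insert[OF indep_subset[OF less.prems(3,2)] I' sC s(2)]) auto
  have cJ: "card J = card I"
   using less.prems(1) x(1) sI card.remove[of I x] by (simp add: J_def)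
  have "J - S \<subset> I - S" using x s(1) by (auto simp: J_def)
  then have "card (J - S) < card (I - S)" using less.prems(1) by (intro psubset_card_mono) auto
  moreover have "J \<subseteq> cl S" using less.prems(4) s(1) ext[OF assms(2)] by (auto simp: J_def)
  ultimately have "card J \<le> card S"
   using less.hyps[of J] ind less.prems(1,2) sC by (auto simp: J_def)
  then show ?thesis by (simp add: cJ)
 qed
qed

end

text \<open>\<open>m\<close> is the maximal ideal of the local ring \<open>F\<close> with residue characteristic \<open>p\<close>; for a field, \<open>m = 0\<close>.\<close>

definition residue_char_ideal :: "('f, 'c) ring_scheme \<Rightarrow> 'f set \<Rightarrow> nat \<Rightarrow> bool" where
 "residue_char_ideal F m p \<longleftrightarrow> cring F \<and> ideal m F \<and> (\<forall>a\<in>carrier F - m. a \<in> Units F) \<and>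
   (\<forall>n::nat. [n] \<cdot>\<^bsub>F\<^esub> \<one>\<^bsub>F\<^esub> \<in> m \<longleftrightarrow> p dvd n)"

text \<open>The submodules modulo which \<open>V\<close> is killed by \<open>m\<close> and has
  trivial \<open>H\<close>-action. The smallest of them is \<open>mV + I_H V\<close>; working with
  all of them avoids describing that one by sums.\<close>

definition augmenting ::
 "('f, 'c) ring_scheme \<Rightarrow> 'f set \<Rightarrow> 'g set \<Rightarrow> ('f, 'g, 'm) gmodule \<Rightarrow> 'm set \<Rightarrow> bool" where
 "augmenting F m H V K \<longleftrightarrow> submodule K F (fst V) \<and>
   (\<forall>h\<in>H. \<forall>x\<in>carrier (fst V). \<exists>k\<in>K. snd V h x = x \<oplus>\<^bsub>fst V\<^esub> k) \<and>
   (\<forall>a\<in>m. \<forall>x\<in>carrier (fst V). a \<odot>\<^bsub>fst V\<^esub> x \<in> K)"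

lemma augmentingD:
 assumes "augmenting F m H V K"
 shows "submodule K F (fst V)"
  "h \<in> H \<Longrightarrow> x \<in> carrier (fst V) \<Longrightarrow> \<exists>k\<in>K. snd V h x = x \<oplus>\<^bsub>fst V\<^esub> k"
  "a \<in> m \<Longrightarrow> x \<in> carrier (fst V) \<Longrightarrow> a \<odot>\<^bsub>fst V\<^esub> x \<in> K"
 using assms by (simp_all add: augmenting_def)

text \<open>The \<open>F\<close>-span of \<open>S\<close> together with \<open>mV + I_H V\<close>,
  that is, the preimage of a span in a vector space over the residue field.\<close>

definition aug_span ::
 "('f, 'c) ring_scheme \<Rightarrow> 'f set \<Rightarrow> 'g set \<Rightarrow> ('f, 'g, 'm) gmodule \<Rightarrow> 'm set \<Rightarrow> 'm set" where
 "aug_span F m H V S = {x \<in> carrier (fst V). \<forall>K. augmenting F m H V K \<longrightarrow> S \<subseteq> K \<longrightarrow> x \<in> K}"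

definition gmodule_invariants :: "'g set \<Rightarrow> ('f, 'g, 'm) gmodule \<Rightarrow> 'm set" where
 "gmodule_invariants H V = {x \<in> carrier (fst V). \<forall>h\<in>H. snd V h x = x}"

text \<open>Invariant lifts of a basis of the image of \<open>V^H\<close> in
  \<open>V/(mV + I_H V)\<close>.\<close>

definition trivial_basis ::
 "('f, 'c) ring_scheme \<Rightarrow> 'f set \<Rightarrow> 'g set \<Rightarrow> ('f, 'g, 'm) gmodule \<Rightarrow> 'm set \<Rightarrow> bool" where
 "trivial_basis F m H V B \<longleftrightarrow> finite B \<and> B \<subseteq> gmodule_invariants H V \<and>
   closure_indep (aug_span F m H V) B \<and> gmodule_invariants H V \<subseteq> aug_span F m H V B"

text \<open>The rank of the image of \<open>V\<^sup>H\<close> in \<open>V/(mV + I\<^sub>H V)\<close>.\<close>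

definition trivial_rank ::
 "('f, 'c) ring_scheme \<Rightarrow> 'f set \<Rightarrow> 'g set \<Rightarrow> ('f, 'g, 'm) gmodule \<Rightarrow> nat" where
 "trivial_rank F m H V = card (SOME B. trivial_basis F m H V B)"

text \<open>If \<open>y = a x + z\<close> modulo the rest and \<open>y\<close> is not in the smaller
  span, then \<open>a\<close> is not in \<open>m\<close>, hence a unit, and the equation can be
  solved for \<open>x\<close>. This is where locality of \<open>F\<close> enters the rank.\<close>

lemma aug_span_exchange:
 assumes m: "residue_char_ideal F m p" and V: "is_gmodule F G V" and H: "H \<subseteq> carrier G"
 shows "exchange_closure (carrier (fst V)) (aug_span F m H V)"
proof
 note D = is_gmoduleD[OF V]
 interpret M: module F "fst V" by (rule D(1))
 interpret m: ideal m F using m by (simp add: residue_char_ideal_def)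
 let ?C = "carrier (fst V)" and ?cl = "aug_span F m H V"
 show "S \<subseteq> ?cl S" if "S \<subseteq> ?C" for S using that by (auto simp: aug_span_def)
 show "?cl S \<subseteq> ?C" for S by (auto simp: aug_span_def)
 show "?cl S \<subseteq> ?cl T" if "S \<subseteq> T" for S T using that by (fastforce simp: aug_span_def)
 show "?cl T \<subseteq> ?cl S" if "T \<subseteq> ?cl S" for S T
  using that unfolding aug_span_def by (smt (verit, ccfv_SIG) mem_Collect_eq subset_iff)
 fix S x y assume S: "S \<subseteq> ?C" and x: "x \<in> ?C" and y: "y \<in> ?cl (insert x S)" and ny: "y \<notin> ?cl S"
 have yC: "y \<in> ?C" using y by (simp add: aug_span_def)
 from ny yC obtain K where K: "augmenting F m H V K" "S \<subseteq> K" "y \<notin> K" by (auto simp: aug_span_def)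
 show "x \<in> ?cl (insert y S)"
  unfolding aug_span_def
 proof (intro CollectI conjI allI impI x)
  fix L assume L: "augmenting F m H V L" "insert y S \<subseteq> L"
  \<comment> \<open>\<open>K\<close> witnesses that \<open>y\<close> is outside the span of
    \<open>S\<close>, and \<open>L\<close> is a submodule that must be shown to contain
    \<open>x\<close>. Their intersection is again augmenting, because the element
    \<open>hz - z\<close> is the same for both.\<close>
  define K' where "K' = L \<inter> K"
  have aug_ex: "\<exists>k\<in>K'. snd V h z = z \<oplus>\<^bsub>fst V\<^esub> k" if h: "h \<in> H" and z: "z \<in> ?C" for h z
  proof -
   obtain k where k: "k \<in> K" "snd V h z = z \<oplus>\<^bsub>fst V\<^esub> k" using augmentingD(2)[OF K(1) h z] by blast
   obtain l where l: "l \<in> L" "snd V h z = z \<oplus>\<^bsub>fst V\<^esub> l" using augmentingD(2)[OF L(1) h z] by blast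
   have "k \<in> ?C" "l \<in> ?C" using k l K(1) L(1) submoduleD(1) unfolding augmenting_def by blast+
   then have "k = l" using k l z by simp
   then show ?thesis using k l by (auto simp: K'_def)
  qed
  have sK: "submodule K F (fst V)" and sL: "submodule L F (fst V)" using K L by (auto simp: augmenting_def)
  note Kd = submoduleD[OF sK] and Ld = submoduleD[OF sL]
  have K'C: "K' \<subseteq> ?C" using Kd(1) by (auto simp: K'_def)
  have K'0: "\<zero>\<^bsub>fst V\<^esub> \<in> K'" using Kd(2) Ld(2) by (simp add: K'_def)
  have K'a: "u \<oplus>\<^bsub>fst V\<^esub> v \<in> K'" if "u \<in> K'" "v \<in> K'" for u v using Kd(3) Ld(3) that by (simp add: K'_def)
  have K's: "a \<odot>\<^bsub>fst V\<^esub> v \<in> K'" if "a \<in> carrier F" "v \<in> K'" for a v using Kd(4) Ld(4) that by (simp add: K'_def)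
  have K'm: "a \<odot>\<^bsub>fst V\<^esub> v \<in> K'" if "a \<in> m" "v \<in> ?C" for a v
   using K(1) L(1) that by (auto simp: augmenting_def K'_def)
  define N where "N = {a \<odot>\<^bsub>fst V\<^esub> x \<oplus>\<^bsub>fst V\<^esub> z | a z. a \<in> carrier F \<and> z \<in> K'}"
  have NK: "z \<in> N" if z: "z \<in> K'" for z
  proof -
   have "z = \<zero>\<^bsub>F\<^esub> \<odot>\<^bsub>fst V\<^esub> x \<oplus>\<^bsub>fst V\<^esub> z" using x z K'C by auto
   then show ?thesis unfolding N_def using z M.R.zero_closed by blast
  qed
  have "augmenting F m H V N"
   unfolding augmenting_def
  proof (intro conjI)
   show "submodule N F (fst V)"
   proof (rule submodule_condI[OF D(1)])
    show "N \<subseteq> ?C" using K'C x by (auto simp: N_def)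
    show "\<zero>\<^bsub>fst V\<^esub> \<in> N" using NK K'0 by simp
   next
    fix u v assume "u \<in> N" "v \<in> N"
    then obtain a b z w where uv: "u = a \<odot>\<^bsub>fst V\<^esub> x \<oplus>\<^bsub>fst V\<^esub> z" "v = b \<odot>\<^bsub>fst V\<^esub> x \<oplus>\<^bsub>fst V\<^esub> w"
     "a \<in> carrier F" "b \<in> carrier F" "z \<in> K'" "w \<in> K'" unfolding N_def by blast
    have "z \<in> ?C" "w \<in> ?C" using uv K'C by auto
    then have "u \<oplus>\<^bsub>fst V\<^esub> v = (a \<oplus>\<^bsub>F\<^esub> b) \<odot>\<^bsub>fst V\<^esub> x \<oplus>\<^bsub>fst V\<^esub> (z \<oplus>\<^bsub>fst V\<^esub> w)"
     using uv x by (simp add: M.smult_l_distr M.M.a_ac)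
    then show "u \<oplus>\<^bsub>fst V\<^esub> v \<in> N" unfolding N_def using uv K'a by blast
   next
    fix a u assume a: "a \<in> carrier F" and "u \<in> N"
    then obtain b z where u: "u = b \<odot>\<^bsub>fst V\<^esub> x \<oplus>\<^bsub>fst V\<^esub> z" "b \<in> carrier F" "z \<in> K'"
     unfolding N_def by blast
    have "z \<in> ?C" using u K'C by auto
    then have "a \<odot>\<^bsub>fst V\<^esub> u = (a \<otimes>\<^bsub>F\<^esub> b) \<odot>\<^bsub>fst V\<^esub> x \<oplus>\<^bsub>fst V\<^esub> (a \<odot>\<^bsub>fst V\<^esub> z)"
     using u a x by (simp add: M.smult_r_distr M.smult_assoc1)
    then show "a \<odot>\<^bsub>fst V\<^esub> u \<in> N" unfolding N_def using u a K's by blast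
   qed
   show "\<forall>h\<in>H. \<forall>x\<in>?C. \<exists>k\<in>N. snd V h x = x \<oplus>\<^bsub>fst V\<^esub> k" using aug_ex NK by blast
   show "\<forall>a\<in>m. \<forall>x\<in>?C. a \<odot>\<^bsub>fst V\<^esub> x \<in> N" using K'm NK by blast
  qed
  moreover have "insert x S \<subseteq> N"
  proof -
   have "x = \<one>\<^bsub>F\<^esub> \<odot>\<^bsub>fst V\<^esub> x \<oplus>\<^bsub>fst V\<^esub> \<zero>\<^bsub>fst V\<^esub>" using x by simp
   then have "x \<in> N" unfolding N_def using K'0 M.R.one_closed by blast
   moreover have "S \<subseteq> K'" using K(2) L(2) by (auto simp: K'_def)
   ultimately show ?thesis using NK by blast
  qed
  ultimately have "y \<in> N" using y by (auto simp: aug_span_def)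
  then obtain a z where az: "y = a \<odot>\<^bsub>fst V\<^esub> x \<oplus>\<^bsub>fst V\<^esub> z" "a \<in> carrier F" "z \<in> K'" unfolding N_def by blast
  have zC: "z \<in> ?C" using az K'C by auto
  \<comment> \<open>Otherwise \<open>a x\<close> would lie in \<open>K'\<close>, and so would
    \<open>y\<close>, against the choice of \<open>K\<close>.\<close>
  have "a \<notin> m"
  proof
   assume "a \<in> m"
   then have "y \<in> K'" using az K'm x K'a by simp
   then show False using K(3) by (simp add: K'_def)
  qed
  then have aU: "a \<in> Units F" using m az(2) by (auto simp: residue_char_ideal_def)
  have "a \<odot>\<^bsub>fst V\<^esub> x = y \<oplus>\<^bsub>fst V\<^esub> (\<ominus>\<^bsub>F\<^esub> \<one>\<^bsub>F\<^esub>) \<odot>\<^bsub>fst V\<^esub> z"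
   using az x zC by (simp add: M.smult_l_minus M.M.a_assoc M.M.r_neg)
  moreover have "y \<in> L" "z \<in> L" using L(2) az(3) by (auto simp: K'_def)
  ultimately have "a \<odot>\<^bsub>fst V\<^esub> x \<in> L" using Ld(3,4) by simp
  then have "inv\<^bsub>F\<^esub> a \<odot>\<^bsub>fst V\<^esub> (a \<odot>\<^bsub>fst V\<^esub> x) \<in> L" using Ld(4) aU by simp
  then show "x \<in> L" using aU x az(2) by (simp flip: M.smult_assoc1)
 qed
qed

text \<open>Any two bases have the same size by exchange, so the choice in
  \<open>trivial_rank\<close> is harmless once some basis is known.\<close>

lemma trivial_basis_card:
 assumes m: "residue_char_ideal F m p" and V: "is_gmodule F G V" and H: "H \<subseteq> carrier G"
  and B: "trivial_basis F m H V B"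
 shows "trivial_rank F m H V = card B"
proof -
 interpret exchange_closure "carrier (fst V)" "aug_span F m H V"
  by (rule aug_span_exchange[OF m V H])
 have le: "card B \<le> card B'" if "trivial_basis F m H V B" "trivial_basis F m H V B'" for B B'
  by (rule indep_card_le) (use that in \<open>auto simp: trivial_basis_def gmodule_invariants_def\<close>)
 have "trivial_basis F m H V (SOME B. trivial_basis F m H V B)" using B by (rule someI)
 then show ?thesis unfolding trivial_rank_def using le B by (meson order_antisym)
qed

text \<open>Take a largest independent set of invariants; its size is bounded by that of a finite
  generating set over \<open>F\<close>.\<close>

lemma trivial_basis_exists:
 assumes m: "residue_char_ideal F m p" and V: "V \<in> fg_gmodules F G" and H: "H \<subseteq> carrier G"
  and finG: "finite (carrier G)"
 shows "\<exists>B. trivial_basis F m H V B"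
proof -
 have g: "is_gmodule F G V" and fg: "fg_gmodule F G V" using V by (auto simp: fg_gmodules_def)
 interpret exchange_closure "carrier (fst V)" "aug_span F m H V"
  by (rule aug_span_exchange[OF m g H])
 obtain T where T: "finite T" "T \<subseteq> carrier (fst V)"
  "\<And>K. submodule K F (fst V) \<Longrightarrow> T \<subseteq> K \<Longrightarrow> K = carrier (fst V)"
  using fg_gmodule_finite_span[OF g fg finG] by blast
 have span: "aug_span F m H V T = carrier (fst V)"
 proof -
  have "x \<in> K" if "x \<in> carrier (fst V)" "augmenting F m H V K" "T \<subseteq> K" for x K
   using T(3)[of K] that by (auto simp: augmenting_def)
  then show ?thesis by (auto simp: aug_span_def)
 qed
 let ?P = "\<lambda>I. finite I \<and> I \<subseteq> gmodule_invariants H V \<and> closure_indep (aug_span F m H V) I"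
 have invC: "gmodule_invariants H V \<subseteq> carrier (fst V)" by (auto simp: gmodule_invariants_def)
 have b: "card I \<le> card T" if "?P I" for I
  by (rule indep_card_le[OF T(1,2)]) (use that invC span in auto)
 have "?P {}" by (simp add: closure_indep_def)
 then obtain B where B: "?P B" "\<And>I. ?P I \<Longrightarrow> card I \<le> card B"
 proof -
  \<comment> \<open>The principle for greatest values wants a strict bound, hence the
    successor.\<close>
  have "\<exists>B. ?P B \<and> (\<forall>I. ?P I \<longrightarrow> card I \<le> card B)"
   by (rule ex_has_greatest_nat[of ?P "{}" card "Suc (card T)"]) (use \<open>?P {}\<close> b in \<open>simp_all add: less_Suc_eq_le\<close>)
  then show thesis using that by (elim exE conjE) simp
 qed
 have "x \<in> aug_span F m H V B" if x: "x \<in> gmodule_invariants H V" for x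
 proof (rule ccontr)
  assume nx: "x \<notin> aug_span F m H V B"
  have "closure_indep (aug_span F m H V) (insert x B)"
   by (rule indep_insert) (use B(1) x nx invC in auto)
  then have "card (insert x B) \<le> card B" using B x by auto
  moreover have "x \<notin> B" using ext[of B] B(1) invC nx by blast
  ultimately show False using B(1) by simp
 qed
 then show ?thesis using B(1) unfolding trivial_basis_def by blast
qed

section \<open>Additivity of the trivial rank\<close>

definition lin_map ::
 "('f, 'c) ring_scheme \<Rightarrow> 'g set \<Rightarrow> ('f, 'g, 'm) gmodule \<Rightarrow> ('f, 'g, 'n) gmodule \<Rightarrow> ('m \<Rightarrow> 'n) \<Rightarrow> bool" where
 "lin_map F H V W f \<longleftrightarrow> (\<forall>x\<in>carrier (fst V). f x \<in> carrier (fst W) \<and>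
   (\<forall>y\<in>carrier (fst V). f (x \<oplus>\<^bsub>fst V\<^esub> y) = f x \<oplus>\<^bsub>fst W\<^esub> f y) \<and>
   (\<forall>a\<in>carrier F. f (a \<odot>\<^bsub>fst V\<^esub> x) = a \<odot>\<^bsub>fst W\<^esub> f x) \<and> (\<forall>h\<in>H. f (snd V h x) = snd W h (f x)))"

lemma lin_mapD:
 assumes "lin_map F H V W f" "x \<in> carrier (fst V)"
 shows "f x \<in> carrier (fst W)" "y \<in> carrier (fst V) \<Longrightarrow> f (x \<oplus>\<^bsub>fst V\<^esub> y) = f x \<oplus>\<^bsub>fst W\<^esub> f y"
  "a \<in> carrier F \<Longrightarrow> f (a \<odot>\<^bsub>fst V\<^esub> x) = a \<odot>\<^bsub>fst W\<^esub> f x" "h \<in> H \<Longrightarrow> f (snd V h x) = snd W h (f x)"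
 using assms by (simp_all add: lin_map_def)

text \<open>Makes \<open>aug_span\<close> functorial: a linear \<open>H\<close>-map sends spans into
  spans, as recorded in \<open>lin_map_aug_span\<close>.\<close>

lemma augmenting_preimage:
 assumes V: "is_gmodule F G V" and H: "H \<subseteq> carrier G" and L: "augmenting F m H W L" and W: "module F (fst W)"
  and mF: "m \<subseteq> carrier F"
  and f: "lin_map F H V W f"
 shows "augmenting F m H V {x \<in> carrier (fst V). f x \<in> L}"
proof -
 note D = is_gmoduleD[OF V] and fx = lin_mapD[OF f]
 interpret M: module F "fst V" by (rule D(1))
 interpret N: module F "fst W" by (rule W)
 have sL: "submodule L F (fst W)" using L by (simp add: augmenting_def)
 note Ld = submoduleD[OF sL]
 have f0: "f \<zero>\<^bsub>fst V\<^esub> = \<zero>\<^bsub>fst W\<^esub>"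
  using fx(1,3)[of "\<zero>\<^bsub>fst V\<^esub>"] by (metis M.M.zero_closed M.R.zero_closed M.smult_r_null N.smult_l_null M.smult_l_null)
 show ?thesis
  unfolding augmenting_def
 proof (intro conjI ballI)
  show "submodule {x \<in> carrier (fst V). f x \<in> L} F (fst V)"
   by (rule submodule_condI[OF D(1)]) (use f0 fx Ld in auto)
  fix h x assume h: "h \<in> H" and x: "x \<in> carrier (fst V)"
  have hx: "snd V h x \<in> carrier (fst V)" using D(5) h x H by auto
  define k where "k = snd V h x \<oplus>\<^bsub>fst V\<^esub> (\<ominus>\<^bsub>F\<^esub> \<one>\<^bsub>F\<^esub>) \<odot>\<^bsub>fst V\<^esub> x"
  obtain l where l: "l \<in> L" "snd W h (f x) = f x \<oplus>\<^bsub>fst W\<^esub> l"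
   using augmentingD(2)[OF L h fx(1)[OF x]] by blast
  have lC: "l \<in> carrier (fst W)" using l Ld by auto
  have "f k = snd W h (f x) \<oplus>\<^bsub>fst W\<^esub> (\<ominus>\<^bsub>F\<^esub> \<one>\<^bsub>F\<^esub>) \<odot>\<^bsub>fst W\<^esub> f x"
   unfolding k_def using fx(2)[OF hx, of "(\<ominus>\<^bsub>F\<^esub> \<one>\<^bsub>F\<^esub>) \<odot>\<^bsub>fst V\<^esub> x"] fx(3)[OF x, of "\<ominus>\<^bsub>F\<^esub> \<one>\<^bsub>F\<^esub>"] fx(4)[OF x h] x by simp
  also have "\<dots> = l"
   using fx(1)[OF x] lC by (simp add: l N.smult_l_minus N.M.a_ac N.M.r_neg2 N.M.r_neg1 N.M.r_neg)
  finally have "f k = l" .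
  moreover have "k \<in> carrier (fst V)" using hx x by (simp add: k_def)
  moreover have "snd V h x = x \<oplus>\<^bsub>fst V\<^esub> k"
   unfolding k_def using hx x by (simp add: M.smult_l_minus M.M.a_lcomm[of x] M.M.r_neg)
  ultimately show "\<exists>k\<in>{x \<in> carrier (fst V). f x \<in> L}. snd V h x = x \<oplus>\<^bsub>fst V\<^esub> k"
   using l by (intro bexI[of _ k]) simp_all
 next
  fix a x assume a: "a \<in> m" and x: "x \<in> carrier (fst V)"
  have "a \<odot>\<^bsub>fst W\<^esub> f x \<in> L" using augmentingD(3)[OF L a fx(1)[OF x]] .
  then show "a \<odot>\<^bsub>fst V\<^esub> x \<in> {x \<in> carrier (fst V). f x \<in> L}" using a x mF fx(3)[OF x, of a] by auto
 qed
qed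

lemma lin_map_aug_span:
 assumes V: "is_gmodule F G V" and H: "H \<subseteq> carrier G" and W: "module F (fst W)" and mF: "m \<subseteq> carrier F"
  and f: "lin_map F H V W f" and B: "B \<subseteq> carrier (fst V)" and x: "x \<in> aug_span F m H V B"
 shows "f x \<in> aug_span F m H W (f ` B)"
 unfolding aug_span_def
proof (intro CollectI conjI allI impI)
 show "f x \<in> carrier (fst W)" using lin_mapD(1)[OF f] x by (simp add: aug_span_def)
 fix L assume L: "augmenting F m H W L" "f ` B \<subseteq> L"
 then have "B \<subseteq> {x \<in> carrier (fst V). f x \<in> L}" using B by auto
 then have "x \<in> {x \<in> carrier (fst V). f x \<in> L}"
  using x augmenting_preimage[OF V H L(1) W mF f] unfolding aug_span_def by blast
 then show "f x \<in> L" by simp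
qed

text \<open>The two inclusions and the two projections of the direct sum are linear
  \<open>H\<close>-maps, so they preserve invariants and spans. Hence the images of bases of the
  summands together form a basis of the sum.\<close>

lemma trivial_rank_sum:
 fixes F :: "('f, 'c) ring_scheme" and G :: "('g, 'b) monoid_scheme"
 assumes m: "residue_char_ideal F m p" and H: "H \<subseteq> carrier G" and finG: "finite (carrier G)"
  and V: "V \<in> fg_gmodules F G" and W: "W \<in> fg_gmodules F G" and Z: "Z \<in> fg_gmodules F G"
  and sum: "is_gmodule_sum F G V W Z"
 shows "trivial_rank F m H V + trivial_rank F m H W = trivial_rank F m H Z"
proof -
 have gV: "is_gmodule F G V" and gW: "is_gmodule F G W" and gZ: "is_gmodule F G Z"
  using V W Z by (auto simp: fg_gmodules_def)
 note DV = is_gmoduleD[OF gV] and DW = is_gmoduleD[OF gW] and DZ = is_gmoduleD[OF gZ]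
 interpret MV: module F "fst V" by (rule DV(1))
 interpret MW: module F "fst W" by (rule DW(1))
 have mF: "m \<subseteq> carrier F" using m ideal.Icarr[of m F] by (auto simp: residue_char_ideal_def)
 have Hc: "h \<in> carrier G" if "h \<in> H" for h using H that by auto
 obtain f where f: "gmodule_map F G (gmodule_sum V W) Z f"
  using sum unfolding is_gmodule_sum_def by (rule gmodule_isoE)
 note fD = gmodule_mapD[OF f, unfolded gmodule_sum_simps(1)]
 let ?CV = "carrier (fst V)" and ?CW = "carrier (fst W)" and ?CZ = "carrier (fst Z)"
 define i where "i = inv_into (?CV \<times> ?CW) f"
 have i: "i z \<in> ?CV \<times> ?CW" "f (i z) = z" if "z \<in> ?CZ" for z
  using fD(1) that by (auto simp: i_def bij_betw_def inv_into_into f_inv_into_f)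
 have if': "i (f w) = w" if "w \<in> ?CV \<times> ?CW" for w
  using fD(1) that by (simp add: i_def bij_betw_def)
 define i1 i2 p1 p2 where d: "i1 = (\<lambda>x. f (x, \<zero>\<^bsub>fst W\<^esub>))" "i2 = (\<lambda>y. f (\<zero>\<^bsub>fst V\<^esub>, y))"
  "p1 = (\<lambda>z. fst (i z))" "p2 = (\<lambda>z. snd (i z))"
 have fa: "f (x \<oplus>\<^bsub>fst V\<^esub> x', y \<oplus>\<^bsub>fst W\<^esub> y') = f (x, y) \<oplus>\<^bsub>fst Z\<^esub> f (x', y')"
  if "x \<in> ?CV" "x' \<in> ?CV" "y \<in> ?CW" "y' \<in> ?CW" for x x' y y'
  using fD(2)[of "(x, y)" "(x', y')"] that by (simp add: gmodule_sum_simps)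
 have fs: "a \<in> carrier F \<Longrightarrow> f (a \<odot>\<^bsub>fst V\<^esub> x, a \<odot>\<^bsub>fst W\<^esub> y) = a \<odot>\<^bsub>fst Z\<^esub> f (x, y)"
  "g \<in> carrier G \<Longrightarrow> f (snd V g x, snd W g y) = snd Z g (f (x, y))" "f (x, y) \<in> ?CZ"
  if "x \<in> ?CV" "y \<in> ?CW" for x y a g
  using fD(3)[of a "(x, y)"] fD(4)[of g "(x, y)"] fD(5)[of "(x, y)"] that by (simp_all add: gmodule_sum_simps)
 have li: "lin_map F H V Z i1" "lin_map F H W Z i2"
  using fa[of _ _ "\<zero>\<^bsub>fst W\<^esub>" "\<zero>\<^bsub>fst W\<^esub>"] fa[of "\<zero>\<^bsub>fst V\<^esub>" "\<zero>\<^bsub>fst V\<^esub>"]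
   fs[of _ "\<zero>\<^bsub>fst W\<^esub>"] fs[of "\<zero>\<^bsub>fst V\<^esub>"] Hc DV(6) DW(6)
  by (simp_all add: lin_map_def d)
 have ex: "\<exists>x\<in>?CV. \<exists>y\<in>?CW. z = f (x, y)" if "z \<in> ?CZ" for z
  using i[OF that] by (intro bexI[of _ "fst (i z)"] bexI[of _ "snd (i z)"]) auto
 have p: "p1 (f (x, y)) = x" "p2 (f (x, y)) = y" if "x \<in> ?CV" "y \<in> ?CW" for x y
  using that if'[of "(x, y)"] by (simp_all add: d)
 have lp: "lin_map F H Z V p1" "lin_map F H Z W p2"
  unfolding lin_map_def
  by (auto dest!: ex simp: fa[symmetric] fs(1,2)[symmetric] p Hc DV(5) DW(5))
 have p1: "p1 (i1 x) = x" "p2 (i1 x) = \<zero>\<^bsub>fst W\<^esub>" if "x \<in> ?CV" for x using that p by (simp_all add: d)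
 have p2: "p1 (i2 y) = \<zero>\<^bsub>fst V\<^esub>" "p2 (i2 y) = y" if "y \<in> ?CW" for y using that p by (simp_all add: d)
 have ip: "z = i1 (p1 z) \<oplus>\<^bsub>fst Z\<^esub> i2 (p2 z)" if z: "z \<in> ?CZ" for z
 proof -
  obtain x y where xy: "x \<in> ?CV" "y \<in> ?CW" "z = f (x, y)" using ex[OF z] by blast
  show ?thesis using fa[OF xy(1) _ _ xy(2), of "\<zero>\<^bsub>fst V\<^esub>" "\<zero>\<^bsub>fst W\<^esub>"] p[OF xy(1,2)] xy by (simp add: d)
 qed
 obtain B where B: "trivial_basis F m H V B" using trivial_basis_exists[OF m V H finG] by blast
 obtain C where C: "trivial_basis F m H W C" using trivial_basis_exists[OF m W H finG] by blast
 have BC: "B \<subseteq> ?CV" "C \<subseteq> ?CW" using B C by (auto simp: trivial_basis_def gmodule_invariants_def)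
 have zero: "\<zero>\<^bsub>fst U\<^esub> \<in> aug_span F m H U S" if "is_gmodule F G U" for U :: "('f, 'g, nat \<Rightarrow> 'f) gmodule" and S
 proof -
  interpret U: module F "fst U" by (rule is_gmoduleD(1)[OF that])
  show ?thesis using submoduleD(2) by (auto simp: aug_span_def augmenting_def)
 qed
 let ?D = "i1 ` B \<union> i2 ` C"
 \<comment> \<open>Independence is tested by projecting to one summand: the basis of the other
   summand is mapped to zero, and zero lies in every span.\<close>
 have half: "i b \<notin> aug_span F m H Z (?D - {i b})"
  if U: "is_gmodule F G U" "trivial_basis F m H U S" "b \<in> S" and l: "lin_map F H Z U p"
   and p: "\<And>x. x \<in> S \<Longrightarrow> p (i x) = x" "\<And>z. z \<in> ?D \<Longrightarrow> p z = \<zero>\<^bsub>fst U\<^esub> \<or> (\<exists>x\<in>S. z = i x)"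
  for U :: "('f, 'g, nat \<Rightarrow> 'f) gmodule" and S b and i p :: "(nat \<Rightarrow> 'f) \<Rightarrow> nat \<Rightarrow> 'f"
 proof
  assume s: "i b \<in> aug_span F m H Z (?D - {i b})"
  have D: "?D \<subseteq> ?CZ" using BC lin_mapD(1)[OF li(1)] lin_mapD(1)[OF li(2)] by blast
  have nb: "b \<notin> aug_span F m H U (S - {b})" using U(2,3) by (simp add: trivial_basis_def closure_indep_def)
  have "b \<in> aug_span F m H U (p ` (?D - {i b}))"
   using lin_map_aug_span[OF gZ H is_gmoduleD(1)[OF U(1)] mF l _ s] D p(1)[OF U(3)] by auto
  moreover have "p ` (?D - {i b}) \<subseteq> aug_span F m H U (S - {b})"
  proof
   fix y assume "y \<in> p ` (?D - {i b})"
   then obtain z where z: "z \<in> ?D" "z \<noteq> i b" "y = p z" by blast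
   then have "y = \<zero>\<^bsub>fst U\<^esub> \<or> y \<in> S - {b}" using p(2)[OF z(1)] p(1) by auto
   moreover have "S \<subseteq> carrier (fst U)" using U(2) by (auto simp: trivial_basis_def gmodule_invariants_def)
   ultimately show "y \<in> aug_span F m H U (S - {b})" using zero[OF U(1)] by (auto simp: aug_span_def)
  qed
  ultimately have "b \<in> aug_span F m H U (S - {b})" unfolding aug_span_def by blast
  then show False using nb by simp
 qed
 have indep: "i1 b \<notin> aug_span F m H Z (?D - {i1 b})" if "b \<in> B" for b
  by (rule half[OF gV B that lp(1)]) (use p1 p2 BC in auto)
 have indep': "i2 c \<notin> aug_span F m H Z (?D - {i2 c})" if "c \<in> C" for c
  by (rule half[OF gW C that lp(2)]) (use p1 p2 BC in auto)
 have "i1 ` B \<inter> i2 ` C = {}"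
 proof (rule equals0I)
  fix z assume "z \<in> i1 ` B \<inter> i2 ` C"
  then obtain b c where bc: "b \<in> B" "c \<in> C" "i1 b = i2 c" by auto
  then have "b = \<zero>\<^bsub>fst V\<^esub>" using p1(1)[of b] p2(1)[of c] BC by auto
  then show False using bc(1) B zero[OF gV] unfolding trivial_basis_def closure_indep_def by blast
 qed
 moreover have "inj_on i1 B" "inj_on i2 C"
  using p1(1) p2(2) BC by (metis inj_on_def subsetD)+
 ultimately have card: "card ?D = card B + card C"
  using B C by (subst card_Un_disjoint) (auto simp: trivial_basis_def card_image)
 have inv: "f x \<in> gmodule_invariants H U'" if f: "lin_map F H U U' f" and x: "x \<in> gmodule_invariants H U"
  for U U' :: "('f, 'g, nat \<Rightarrow> 'f) gmodule" and f x
 proof -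
  have xU: "x \<in> carrier (fst U)" "\<And>h. h \<in> H \<Longrightarrow> snd U h x = x" using x by (auto simp: gmodule_invariants_def)
  show ?thesis using lin_mapD(1)[OF f xU(1)] lin_mapD(4)[OF f xU(1), symmetric] xU(2) by (simp add: gmodule_invariants_def)
 qed
 have "trivial_basis F m H Z ?D"
  unfolding trivial_basis_def
 proof (intro conjI)
  show "finite ?D" using B C by (simp add: trivial_basis_def)
  show "?D \<subseteq> gmodule_invariants H Z" using inv[OF li(1)] inv[OF li(2)] B C by (auto simp: trivial_basis_def)
  show "gmodule_invariants H Z \<subseteq> aug_span F m H Z ?D"
  proof
   fix z assume z: "z \<in> gmodule_invariants H Z"
   then have zC: "z \<in> ?CZ" by (simp add: gmodule_invariants_def)
   have "p1 z \<in> aug_span F m H V B" "p2 z \<in> aug_span F m H W C"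
    using inv[OF lp(1) z] inv[OF lp(2) z] B C by (auto simp: trivial_basis_def)
   then have s: "i1 (p1 z) \<in> aug_span F m H Z (i1 ` B)" "i2 (p2 z) \<in> aug_span F m H Z (i2 ` C)"
    using lin_map_aug_span[OF gV H DZ(1) mF li(1) BC(1)] lin_map_aug_span[OF gW H DZ(1) mF li(2) BC(2)] by blast+
   have "z \<in> K" if K: "augmenting F m H Z K" "?D \<subseteq> K" for K
   proof -
    have "i1 (p1 z) \<in> K" "i2 (p2 z) \<in> K" using s K unfolding aug_span_def by blast+
    then show ?thesis by (subst ip[OF zC]) (rule submoduleD(3)[OF augmentingD(1)[OF K(1)]])
   qed
   then show "z \<in> aug_span F m H Z ?D" using zC by (simp add: aug_span_def)
  qed
  show "closure_indep (aug_span F m H Z) ?D" using indep indep' by (auto simp: closure_indep_def)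
 qed
 then have "trivial_rank F m H Z = card B + card C"
  using trivial_basis_card[OF m gZ H] card by simp
 then show ?thesis using trivial_basis_card[OF m gV H B] trivial_basis_card[OF m gW H C] by simp
qed

subsection \<open>The rank of a permutation module\<close>

lemma group_action_restrict_group:
 assumes "group G" "subgroup H G" "group_action G E \<phi>"
 shows "group_action (subgrp G H) E \<phi>"
proof -
 have "(\<lambda>g. g) \<in> hom (subgrp G H) G"
  using subgroup.subset[OF assms(2)] by (auto simp: hom_def)
 from group_action_pull[OF assms(3) group.subgroup_imp_group[OF assms(1,2)] this] show ?thesis .
qed

definition indicator_fun :: "('f, 'c) ring_scheme \<Rightarrow> 'x set \<Rightarrow> 'x \<Rightarrow> 'f" where
 "indicator_fun F S = (\<lambda>x. if x \<in> S then \<one>\<^bsub>F\<^esub> else \<zero>\<^bsub>F\<^esub>)"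

text \<open>The invariants are the combinations of orbit indicators. Modulo the elements
  \<open>hx - x\<close>, an orbit indicator is the orbit length times a point, hence zero modulo
  \<open>m\<close> if \<open>p\<close> divides the length. The other indicators are independent,
  since the sum of the values over an orbit detects them.\<close>

lemma perm_trivial_rank:
 fixes F :: "('f, 'c) ring_scheme" and G :: "('g, 'b) monoid_scheme" (structure) and X :: "('g, 'x) gset"
 assumes m: "residue_char_ideal F m p" and p: "prime p" and G: "group G" and H: "subgroup H G"
  and finE: "finite (fst X)" and act: "group_action G (fst X) (snd X)"
 shows "trivial_rank F m H (perm_module F G X) =
  card {Q \<in> orbits (subgrp G H) (fst X) (snd X). \<not> p dvd card Q}"
proof -
 interpret group G by (rule G)
 have F: "cring F" using m by (simp add: residue_char_ideal_def)
 interpret F: cring F by (rule F)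
 interpret mi: ideal m F using m by (simp add: residue_char_ideal_def)
 have m1: "[n] \<cdot>\<^bsub>F\<^esub> \<one>\<^bsub>F\<^esub> \<in> m \<longleftrightarrow> p dvd n" for n :: nat using m by (simp add: residue_char_ideal_def)
 have one_m: "\<one>\<^bsub>F\<^esub> \<notin> m" using m1[of 1] prime_gt_1_nat[OF p] by simp
 have one_zero: "\<one>\<^bsub>F\<^esub> \<noteq> \<zero>\<^bsub>F\<^esub>" using one_m mi.zero_closed by metis
 let ?L = "subgrp G H" and ?E = "fst X" and ?\<phi> = "snd X"
 have aL: "group_action ?L ?E ?\<phi>" by (rule group_action_restrict_group[OF G H act])
 interpret A: group_action ?L ?E ?\<phi> by (rule aL)
 have Hs: "h \<in> carrier G" if "h \<in> H" for h using subgroup.subset[OF H] that by auto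
 have Hi: "inv h \<in> H" if "h \<in> H" for h using subgroup.m_inv_closed[OF H that] .
 let ?Os = "orbits ?L ?E ?\<phi>"
 let ?V = "perm_module F G X"
 let ?M = "free_module F ?E"
 let ?C = "carrier ?M" and ?c = "\<lambda>S. [card S] \<cdot>\<^bsub>F\<^esub> \<one>\<^bsub>F\<^esub>"
 have gV: "is_gmodule F G ?V" by (rule perm_module_gmodule[OF F act])
 note D = is_gmoduleD[OF gV]
 interpret M: module F ?M using D(1) by (simp add: perm_module_simps)
 note c = free_module_carrier[OF finE, of _ F]
 have aV: "snd ?V h f x = (if x \<in> ?E then f (?\<phi> (inv h) x) else \<zero>\<^bsub>F\<^esub>)"
  if "f \<in> ?C" for h f x
  using perm_module_simps(2)[OF that, of G h] by simp
 have OE: "Ob \<subseteq> ?E" if "Ob \<in> ?Os" for Ob using A.orbits_coverture that by blast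
 have Ofin: "finite Ob" if "Ob \<in> ?Os" for Ob using OE[OF that] finE finite_subset by blast
 have Ocl: "?\<phi> h y \<in> Ob" if Ob: "Ob \<in> ?Os" and y: "y \<in> Ob" and h: "h \<in> H" for Ob y h
 proof -
  obtain x where x: "x \<in> ?E" "Ob = orbit ?L ?\<phi> x" using Ob by (auto simp: orbits_def)
  obtain k where k: "k \<in> H" "y = ?\<phi> k x" using y x by (auto simp: orbit_def)
  have "?\<phi> h y = ?\<phi> (h \<otimes> k) x" using group_action_mult[OF act Hs[OF h] Hs[OF k(1)] x(1)] k by simp
  then show ?thesis using x h k subgroup.m_closed[OF H] by (auto simp: orbit_def)
 qed
 have Otr: "\<exists>h\<in>H. z = ?\<phi> h y" if Ob: "Ob \<in> ?Os" and y: "y \<in> Ob" and z: "z \<in> Ob" for Ob y z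
 proof -
  obtain x where x: "x \<in> ?E" "Ob = orbit ?L ?\<phi> x" using Ob by (auto simp: orbits_def)
  obtain k where k: "k \<in> H" "y = ?\<phi> k x" using y x by (auto simp: orbit_def)
  obtain l where l: "l \<in> H" "z = ?\<phi> l x" using z x by (auto simp: orbit_def)
  have "x = ?\<phi> (inv k) y" using group_action_inv(1)[OF act Hs[OF k(1)] x(1)] k by simp
  then have "z = ?\<phi> (l \<otimes> inv k) y"
   using group_action_mult[OF act Hs[OF l(1)] Hs[OF Hi[OF k(1)]], of y] l y OE[OF Ob] by auto
  then show ?thesis using l k Hi subgroup.m_closed[OF H] by blast
 qed
 have Oinv: "?\<phi> (inv h) y \<in> Ob \<longleftrightarrow> y \<in> Ob" if Ob: "Ob \<in> ?Os" and y: "y \<in> ?E" and h: "h \<in> H" for Ob y h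
  using Ocl[OF Ob _ Hi[OF h], of y] Ocl[OF Ob _ h, of "?\<phi> (inv h) y"] group_action_inv(2)[OF act Hs[OF h] y] by auto
 let ?i = "indicator_fun F"
 have iC: "?i S \<in> ?C" if "S \<subseteq> ?E" for S
  using that by (auto simp: c indicator_fun_def)
 let ?B = "?i ` {Q \<in> ?Os. \<not> p dvd card Q}"
 have finO: "finite ?Os"
 proof -
  have "?Os = (\<lambda>x. orbit ?L ?\<phi> x) ` ?E" by (auto simp: orbits_def)
  then show ?thesis using finE by simp
 qed
 have inj_i: "inj_on ?i (Pow ?E)"
 proof (rule inj_onI)
  fix S T assume e: "?i S = ?i T"
  have "x \<in> S \<longleftrightarrow> x \<in> T" for x using fun_cong[OF e, of x] one_zero by (auto simp: indicator_fun_def split: if_splits)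
  then show "S = T" by blast
 qed
 have cardB: "card ?B = card {Q \<in> ?Os. \<not> p dvd card Q}"
  by (rule card_image, rule inj_on_subset[OF inj_i]) (use OE in auto)
 have inv_i: "?i Ob \<in> gmodule_invariants H ?V" if Ob: "Ob \<in> ?Os" for Ob
 proof -
  have "snd ?V h (?i Ob) x = ?i Ob x" if h: "h \<in> H" for h x
   using aV[OF iC[OF OE[OF Ob]], of h x] Oinv[OF Ob _ h, of x] OE[OF Ob] by (auto simp: indicator_fun_def)
  then show ?thesis using iC[OF OE[OF Ob]] by (auto simp: gmodule_invariants_def perm_module_simps(1))
 qed
 \<comment> \<open>The kernel of the functional "sum over the orbit, modulo \<open>m\<close>". It
   sees only the indicator of its own orbit, with value the orbit length.\<close>
 have aug: "augmenting F m H ?V {f \<in> ?C. finsum F f Ob \<in> m}" if Ob: "Ob \<in> ?Os" for Ob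
  unfolding augmenting_def perm_module_simps(1)
 proof (intro conjI ballI)
  let ?K = "{f \<in> ?C. finsum F f Ob \<in> m}"
  have fc: "f \<in> Ob \<rightarrow> carrier F" if "f \<in> ?C" for f using that by (auto simp: c)
  show "submodule ?K F (?M)"
  proof (rule submodule_condI[OF M.module_axioms])
   show "\<zero>\<^bsub>?M\<^esub> \<in> ?K"
    using M.M.zero_closed mi.zero_closed by (simp add: free_module_simps)
   fix f g assume f: "f \<in> ?K" and g: "g \<in> ?K"
   then have "finsum F (\<lambda>x. f x \<oplus>\<^bsub>F\<^esub> g x) Ob = finsum F f Ob \<oplus>\<^bsub>F\<^esub> finsum F g Ob"
    using fc by (intro F.finsum_addf) auto
   then show "f \<oplus>\<^bsub>?M\<^esub> g \<in> ?K"
    using f g M.M.a_closed[of f g] mi.a_closed by (simp add: free_module_simps)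
  next
   fix a f assume a: "a \<in> carrier F" and f: "f \<in> ?K"
   have "finsum F (\<lambda>x. a \<otimes>\<^bsub>F\<^esub> f x) Ob = a \<otimes>\<^bsub>F\<^esub> finsum F f Ob"
    using fc f a Ofin[OF Ob] by (intro F.finsum_rdistr[symmetric]) auto
   then show "a \<odot>\<^bsub>?M\<^esub> f \<in> ?K"
    using f a M.smult_closed[of a f] mi.I_l_closed by (simp add: free_module_simps)
  qed auto
  fix h f assume h: "h \<in> H" and f: "f \<in> ?C"
  have hf: "snd ?V h f \<in> ?C" using D(5)[OF Hs[OF h]] f by (simp add: perm_module_simps(1))
  define k where "k = (\<lambda>x. snd ?V h f x \<oplus>\<^bsub>F\<^esub> (\<ominus>\<^bsub>F\<^esub> \<one>\<^bsub>F\<^esub>) \<otimes>\<^bsub>F\<^esub> f x)"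
  have "finsum F (snd ?V h f) Ob = finsum F (\<lambda>x. f (?\<phi> (inv h) x)) Ob"
   by (rule F.finsum_cong') (use f OE[OF Ob] aV[OF f] in \<open>auto simp: c\<close>)
  also have "\<dots> = finsum F f (?\<phi> (inv h) ` Ob)"
  proof (rule F.finsum_reindex[symmetric])
   show "inj_on (?\<phi> (inv h)) Ob"
    using A.inj_prop[of "inv h"] Hi[OF h] OE[OF Ob] by (simp add: inj_on_subset)
  qed (use f in \<open>auto simp: c\<close>)
  also have "?\<phi> (inv h) ` Ob = Ob"
  proof
   show "?\<phi> (inv h) ` Ob \<subseteq> Ob" using Ocl[OF Ob _ Hi[OF h]] by auto
   show "Ob \<subseteq> ?\<phi> (inv h) ` Ob"
   proof
    fix y assume y: "y \<in> Ob"
    then have "y = ?\<phi> (inv h) (?\<phi> h y)" using group_action_inv(1)[OF act Hs[OF h], of y] OE[OF Ob] by auto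
    then show "y \<in> ?\<phi> (inv h) ` Ob" using Ocl[OF Ob y h] by blast
   qed
  qed
  finally have s1: "finsum F (snd ?V h f) Ob = finsum F f Ob" .
  have "finsum F k Ob = finsum F (snd ?V h f) Ob \<oplus>\<^bsub>F\<^esub> finsum F (\<lambda>x. (\<ominus>\<^bsub>F\<^esub> \<one>\<^bsub>F\<^esub>) \<otimes>\<^bsub>F\<^esub> f x) Ob"
   unfolding k_def by (rule F.finsum_addf) (use fc[OF f] fc[OF hf] in auto)
  also have "finsum F (\<lambda>x. (\<ominus>\<^bsub>F\<^esub> \<one>\<^bsub>F\<^esub>) \<otimes>\<^bsub>F\<^esub> f x) Ob = (\<ominus>\<^bsub>F\<^esub> \<one>\<^bsub>F\<^esub>) \<otimes>\<^bsub>F\<^esub> finsum F f Ob"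
   using fc[OF f] Ofin[OF Ob] by (intro F.finsum_rdistr[symmetric]) auto
  finally have "finsum F k Ob = \<zero>\<^bsub>F\<^esub>"
   using s1 F.finsum_closed[OF fc[OF f]] by (simp add: F.l_minus F.r_neg)
  moreover have "k \<in> ?C" using f hf by (simp add: c k_def)
  moreover have "snd ?V h f = f \<oplus>\<^bsub>?M\<^esub> k"
  proof
   fix x
   have "f x \<in> carrier F" "snd ?V h f x \<in> carrier F" using f hf by (simp_all add: c)
   then show "snd ?V h f x = (f \<oplus>\<^bsub>?M\<^esub> k) x"
    by (simp add: free_module_simps k_def F.l_minus F.a_lcomm[of "f x"] F.r_neg)
  qed
  ultimately show "\<exists>k\<in>?K. snd ?V h f = f \<oplus>\<^bsub>?M\<^esub> k"
   using mi.zero_closed by (intro bexI[of _ k]) simp_all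
 next
  fix a f assume a: "a \<in> m" and f: "f \<in> ?C"
  have aF: "a \<in> carrier F" using mi.Icarr[OF a] .
  have fc: "f \<in> Ob \<rightarrow> carrier F" using f by (auto simp: c)
  have "finsum F (\<lambda>x. a \<otimes>\<^bsub>F\<^esub> f x) Ob = a \<otimes>\<^bsub>F\<^esub> finsum F f Ob"
   using fc aF Ofin[OF Ob] by (intro F.finsum_rdistr[symmetric]) auto
  then show "a \<odot>\<^bsub>?M\<^esub> f \<in> {f \<in> ?C. finsum F f Ob \<in> m}"
   using M.smult_closed[OF aF f] mi.I_r_closed[OF a F.finsum_closed[OF fc]] by (simp add: free_module_simps)
 qed
 have sum_i: "finsum F (?i S) Ob = (if S = Ob then [card Ob] \<cdot>\<^bsub>F\<^esub> \<one>\<^bsub>F\<^esub> else \<zero>\<^bsub>F\<^esub>)" if Ob: "Ob \<in> ?Os" and S: "S \<in> ?Os" for Ob S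
 proof (cases "S = Ob")
  case True
  have "finsum F (?i S) Ob = finsum F (\<lambda>_. \<one>\<^bsub>F\<^esub>) Ob"
   by (rule F.finsum_cong') (auto simp: indicator_fun_def True)
  then show ?thesis using True F.add.finprod_const[of "\<one>\<^bsub>F\<^esub>" Ob] by simp
 next
  case False
  have "S \<inter> Ob = {}" using A.disjoint_union[OF S Ob] False by auto
  then have "finsum F (?i S) Ob = finsum F (\<lambda>_. \<zero>\<^bsub>F\<^esub>) Ob"
   by (intro F.finsum_cong') (auto simp: indicator_fun_def)
  then show ?thesis using False by simp
 qed
 have "trivial_basis F m H ?V ?B"
  unfolding trivial_basis_def
 proof (intro conjI)
  show "finite ?B" using finO by simp
  show "?B \<subseteq> gmodule_invariants H ?V" using inv_i by auto
  show "closure_indep (aug_span F m H ?V) ?B"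
   unfolding closure_indep_def
  proof
   fix b assume "b \<in> ?B"
   then obtain Q where Q: "Q \<in> ?Os" "\<not> p dvd card Q" "b = ?i Q" by auto
   have "?B - {b} \<subseteq> {f \<in> ?C. finsum F f Q \<in> m}"
    using sum_i[OF Q(1)] iC OE Q(3) mi.zero_closed by auto
   moreover have "b \<notin> {f \<in> ?C. finsum F f Q \<in> m}"
    using sum_i[OF Q(1,1)] Q m1 by simp
   ultimately show "b \<notin> aug_span F m H ?V (?B - {b})"
    using aug[OF Q(1)] unfolding aug_span_def by blast
  qed
  show "gmodule_invariants H ?V \<subseteq> aug_span F m H ?V ?B"
  proof
   fix f assume f: "f \<in> gmodule_invariants H ?V"
   have "f \<in> K" if K: "augmenting F m H ?V K" and BK: "?B \<subseteq> K" for K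
   proof -
    have sK: "submodule K F (?M)" using augmentingD(1)[OF K] by (simp add: perm_module_simps(1))
    note Kd = submoduleD[OF sK]
    have iK: "?i Ob \<in> K" if Ob: "Ob \<in> ?Os" for Ob
    proof (cases "p dvd card Ob")
     case False
     then show ?thesis using BK Ob by auto
    next
     case True
     obtain x0 where x0: "x0 \<in> Ob" using Ob A.orbit_refl by (auto simp: orbits_def)
     have x0E: "x0 \<in> ?E" using x0 OE[OF Ob] by auto
     have dC: "?i {x} \<in> ?C" if "x \<in> Ob" for x using iC[of "{x}"] OE[OF Ob] that by auto
     have d: "\<exists>k\<in>K. ?i {x} = ?i {x0} \<oplus>\<^bsub>?M\<^esub> k" if x: "x \<in> Ob" for x
     proof -
      obtain h where h: "h \<in> H" "x = ?\<phi> h x0" using Otr[OF Ob x0 x] by auto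
      have "snd ?V h (?i {x0}) = ?i {x}"
      proof
       fix y
       have "?\<phi> (inv h) y = x0 \<longleftrightarrow> y = x" if y: "y \<in> ?E"
        using group_action_inv[OF act Hs[OF h(1)]] h x0E y by metis
       then show "snd ?V h (?i {x0}) y = ?i {x} y"
        using aV[OF dC[OF x0], of h y] OE[OF Ob] x by (auto simp: indicator_fun_def)
      qed
      moreover have "\<exists>k\<in>K. snd ?V h (?i {x0}) = ?i {x0} \<oplus>\<^bsub>fst ?V\<^esub> k"
       by (rule augmentingD(2)[OF K h(1)]) (use dC[OF x0] in \<open>simp add: perm_module_simps(1)\<close>)
      ultimately show ?thesis by (simp add: perm_module_simps(1))
     qed
     \<comment> \<open>Points are moved to \<open>x0\<close> one at a time. For \<open>S\<close> the
       whole orbit, the coefficient of the point \<open>x0\<close> is the orbit length, which lies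
       in \<open>m\<close>.\<close>
     have "\<exists>k\<in>K. ?i S = (\<lambda>x. ?c S \<otimes>\<^bsub>F\<^esub> ?i {x0} x \<oplus>\<^bsub>F\<^esub> k x)" if "finite S" "S \<subseteq> Ob" for S
      using that
     proof (induction S)
      case empty
      show ?case
       by (rule bexI[of _ "\<lambda>x. \<zero>\<^bsub>F\<^esub>"])
        (use Kd(2) in \<open>auto simp: indicator_fun_def free_module_simps fun_eq_iff\<close>)
     next
      case (insert y S)
      then obtain k where k: "k \<in> K" "?i S = (\<lambda>x. ?c S \<otimes>\<^bsub>F\<^esub> ?i {x0} x \<oplus>\<^bsub>F\<^esub> k x)" by auto
      obtain l where l: "l \<in> K" "?i {y} = ?i {x0} \<oplus>\<^bsub>?M\<^esub> l" using d insert.prems by auto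
      have kF: "k x \<in> carrier F" "l x \<in> carrier F" for x using k l Kd(1) by (auto simp: c)
      have xF: "?i T x \<in> carrier F" for T x by (simp add: indicator_fun_def)
      have ly: "?i {y} x = ?i {x0} x \<oplus>\<^bsub>F\<^esub> l x" for x using fun_cong[OF l(2), of x] by (simp add: free_module_simps)
      have "?i (insert y S) x = ([card (insert y S)] \<cdot>\<^bsub>F\<^esub> \<one>\<^bsub>F\<^esub>) \<otimes>\<^bsub>F\<^esub> ?i {x0} x \<oplus>\<^bsub>F\<^esub> (k x \<oplus>\<^bsub>F\<^esub> l x)" for x
      proof -
       have "?i (insert y S) x = ?i S x \<oplus>\<^bsub>F\<^esub> ?i {y} x"
        using insert.hyps(2) by (auto simp: indicator_fun_def)
       also have "\<dots> = (?c S \<otimes>\<^bsub>F\<^esub> ?i {x0} x \<oplus>\<^bsub>F\<^esub> k x) \<oplus>\<^bsub>F\<^esub> (?i {x0} x \<oplus>\<^bsub>F\<^esub> l x)"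
        using fun_cong[OF k(2), of x] ly by simp
       also have "\<dots> = (?c S \<oplus>\<^bsub>F\<^esub> \<one>\<^bsub>F\<^esub>) \<otimes>\<^bsub>F\<^esub> ?i {x0} x \<oplus>\<^bsub>F\<^esub> (k x \<oplus>\<^bsub>F\<^esub> l x)"
       proof -
        have "a \<otimes>\<^bsub>F\<^esub> u \<oplus>\<^bsub>F\<^esub> v \<oplus>\<^bsub>F\<^esub> (u \<oplus>\<^bsub>F\<^esub> w) = (a \<oplus>\<^bsub>F\<^esub> \<one>\<^bsub>F\<^esub>) \<otimes>\<^bsub>F\<^esub> u \<oplus>\<^bsub>F\<^esub> (v \<oplus>\<^bsub>F\<^esub> w)"
         if "a \<in> carrier F" "u \<in> carrier F" "v \<in> carrier F" "w \<in> carrier F" for a u v w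
         using that by (simp add: F.l_distr F.a_ac)
        from this[OF F.add.nat_pow_closed[OF F.one_closed] xF kF] show ?thesis .
       qed
       also have "?c S \<oplus>\<^bsub>F\<^esub> \<one>\<^bsub>F\<^esub> = [card (insert y S)] \<cdot>\<^bsub>F\<^esub> \<one>\<^bsub>F\<^esub>"
        using insert.hyps by (simp add: F.add.nat_pow_Suc)
       finally show ?thesis .
      qed
      then show ?case using Kd(3)[OF k(1) l(1)] by (intro bexI[of _ "k \<oplus>\<^bsub>?M\<^esub> l"]) (auto simp: free_module_simps)
     qed
     from this[OF Ofin[OF Ob] order_refl] obtain k where k: "k \<in> K"
      "?i Ob = (\<lambda>x. ?c Ob \<otimes>\<^bsub>F\<^esub> ?i {x0} x \<oplus>\<^bsub>F\<^esub> k x)" by auto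
     have "?c Ob \<odot>\<^bsub>fst ?V\<^esub> ?i {x0} \<in> K"
      by (rule augmentingD(3)[OF K]) (use True m1 dC[OF x0] in \<open>simp_all add: perm_module_simps(1)\<close>)
     from Kd(3)[OF this[unfolded perm_module_simps(1)] k(1)]
     have "(\<lambda>x. ?c Ob \<otimes>\<^bsub>F\<^esub> ?i {x0} x \<oplus>\<^bsub>F\<^esub> k x) \<in> K" by (simp add: free_module_simps)
     then show ?thesis using k(2) by simp
    qed
    show ?thesis
     using f
    proof (induction "card {x \<in> ?E. f x \<noteq> \<zero>\<^bsub>F\<^esub>}" arbitrary: f rule: less_induct)
     case less
     have fC: "f \<in> ?C" using less.prems by (simp add: gmodule_invariants_def perm_module_simps(1))
     have fi: "f (?\<phi> (inv h) x) = f x" if "h \<in> H" "x \<in> ?E" for h x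
     proof -
      have "snd ?V h f = f" using less.prems that by (simp add: gmodule_invariants_def)
      then show ?thesis using aV[OF fC, of h x] that by simp
     qed
     show ?case
     proof (cases "\<forall>x\<in>?E. f x = \<zero>\<^bsub>F\<^esub>")
      case True
      then have "f = (\<lambda>x. \<zero>\<^bsub>F\<^esub>)" using fC by (auto simp: c fun_eq_iff)
      then show ?thesis using Kd(2) by (simp add: free_module_simps)
     next
      case False
      then obtain x0 where x0: "x0 \<in> ?E" "f x0 \<noteq> \<zero>\<^bsub>F\<^esub>" by auto
      define Ob where "Ob = orbit ?L ?\<phi> x0"
      have Ob: "Ob \<in> ?Os" using x0 by (auto simp: Ob_def orbits_def)
      have x0O: "x0 \<in> Ob" using A.orbit_refl[OF x0(1)] by (simp add: Ob_def)
      have fO: "f x = f x0" if x: "x \<in> Ob" for x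
      proof -
       obtain h where h: "h \<in> H" "x = ?\<phi> h x0" using Otr[OF Ob x0O x] by auto
       have "f (?\<phi> (inv h) x) = f x" using fi[OF h(1)] OE[OF Ob] x by auto
       then show ?thesis using h group_action_inv(1)[OF act Hs[OF h(1)] x0(1)] by simp
      qed
      \<comment> \<open>An invariant function is constant on the orbit of a point of its support;
        removing that orbit lowers the support.\<close>
      define f' where "f' = (\<lambda>x. if x \<in> Ob then \<zero>\<^bsub>F\<^esub> else f x)"
      have f'C: "f' \<in> ?C" using fC by (simp add: c f'_def)
      have "snd ?V h f' = f'" if h: "h \<in> H" for h
      proof
       fix x show "snd ?V h f' x = f' x"
        using aV[OF f'C, of h x] Oinv[OF Ob _ h, of x] fi[OF h, of x] fC by (auto simp: f'_def c)
      qed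
      then have f'i: "f' \<in> gmodule_invariants H ?V" using f'C by (simp add: gmodule_invariants_def perm_module_simps(1))
      have "x0 \<notin> {x \<in> ?E. f' x \<noteq> \<zero>\<^bsub>F\<^esub>}" "x0 \<in> {x \<in> ?E. f x \<noteq> \<zero>\<^bsub>F\<^esub>}" using x0 x0O by (simp_all add: f'_def)
      moreover have "{x \<in> ?E. f' x \<noteq> \<zero>\<^bsub>F\<^esub>} \<subseteq> {x \<in> ?E. f x \<noteq> \<zero>\<^bsub>F\<^esub>}" by (auto simp: f'_def)
      ultimately have "{x \<in> ?E. f' x \<noteq> \<zero>\<^bsub>F\<^esub>} \<subset> {x \<in> ?E. f x \<noteq> \<zero>\<^bsub>F\<^esub>}" by blast
      then have "card {x \<in> ?E. f' x \<noteq> \<zero>\<^bsub>F\<^esub>} < card {x \<in> ?E. f x \<noteq> \<zero>\<^bsub>F\<^esub>}"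
       by (rule psubset_card_mono[rotated]) (use finE in simp)
      from less.hyps[OF this f'i] have f'K: "f' \<in> K" .
      have "f x0 \<odot>\<^bsub>?M\<^esub> ?i Ob \<in> K" using Kd(4)[OF _ iK[OF Ob]] fC by (simp add: c)
      from Kd(3)[OF f'K this] have "(\<lambda>x. f' x \<oplus>\<^bsub>F\<^esub> f x0 \<otimes>\<^bsub>F\<^esub> ?i Ob x) \<in> K" by (simp add: free_module_simps)
      moreover have "f = (\<lambda>x. f' x \<oplus>\<^bsub>F\<^esub> f x0 \<otimes>\<^bsub>F\<^esub> ?i Ob x)"
      proof
       fix x show "f x = f' x \<oplus>\<^bsub>F\<^esub> f x0 \<otimes>\<^bsub>F\<^esub> ?i Ob x"
        using fO[of x] fC by (simp add: f'_def indicator_fun_def c)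
      qed
      ultimately show ?thesis by (rule ssubst[rotated])
     qed
    qed
   qed
   then show "f \<in> aug_span F m H ?V ?B"
    using f by (simp add: aug_span_def gmodule_invariants_def)
  qed
 qed
 from trivial_basis_card[OF m gV subgroup.subset[OF H] this] show ?thesis by (simp add: cardB)
qed

text \<open>The trivial rank is additive on direct sums, so it vanishes on the linearisation of a
  relation; on permutation modules it counts orbits.\<close>

lemma relation_orbit_count:
 assumes m: "residue_char_ideal F m p" and p: "prime p" and G: "group G" and finG: "finite (carrier G)"
  and c: "relation_over F G c" and H: "subgroup H G"
 shows "frag_val (\<lambda>X. int (card {Q \<in> orbits (subgrp G H) (fst X) (snd X). \<not> p dvd card Q})) c = 0"
proof -
 have F: "cring F" using m by (simp add: residue_char_ideal_def)
 have "frag_val (\<lambda>V. int (trivial_rank F m H V)) (frag_linearise F G c) = 0"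
 proof (rule sum_relations_val)
  show "frag_linearise F G c \<in> module_relations F G" using c by (simp add: relation_over_def)
  show "int (trivial_rank F m H V) + int (trivial_rank F m H W) = int (trivial_rank F m H Z)"
   if "V \<in> fg_gmodules F G" "W \<in> fg_gmodules F G" "Z \<in> fg_gmodules F G" "is_gmodule_sum F G V W Z" for V W Z
   using trivial_rank_sum[OF m subgroup.subset[OF H] finG that] by simp
 qed
 moreover have "frag_val (\<lambda>V. int (trivial_rank F m H V)) (frag_linearise F G c) =
  frag_val (\<lambda>X. int (card {Q \<in> orbits (subgrp G H) (fst X) (snd X). \<not> p dvd card Q})) c"
  unfolding frag_linearise_def frag_val_extend frag_val_of
 proof (rule frag_val_cong)
  fix X assume "X \<in> supp c"
  then have "X \<in> finite_gsets G" using c by (auto simp: relation_over_def)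
  from finite_gsetsD[OF this]
  show "int (trivial_rank F m H (perm_module F G X)) =
   int (card {Q \<in> orbits (subgrp G H) (fst X) (snd X). \<not> p dvd card Q})"
   using perm_trivial_rank[OF m p G H] by simp
 qed
 ultimately show ?thesis by simp
qed

section \<open>Congruences for fixed points\<close>

text \<open>Singleton orbits are the fixed points, and every other orbit contributes a multiple of
  \<open>l\<close>.\<close>

lemma card_orbits_cong:
 assumes act: "group_action G E \<phi>" and finE: "finite E"
  and orb: "\<And>x. x \<in> E \<Longrightarrow> card (orbit G \<phi> x) = 1 \<or> l dvd card (orbit G \<phi> x)"
 shows "int l dvd int (card E) - int (card {x \<in> E. \<forall>g\<in>carrier G. \<phi> g x = x})"
proof -
 interpret group_action G E \<phi> by (rule act)
 let ?f = "\<lambda>x. if \<forall>g\<in>carrier G. \<phi> g x = x then 1 else 0 :: int"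
 have sub: "B \<subseteq> E" if "B \<in> orbits G E \<phi>" for B using orbits_coverture that by blast
 have "int (card E) = (\<Sum>x\<in>E. 1)" by simp
 also have "\<dots> = (\<Sum>B\<in>orbits G E \<phi>. \<Sum>x\<in>B. 1)" by (rule disjoint_sum[OF finE, symmetric])
 finally have 1: "int (card E) = (\<Sum>B\<in>orbits G E \<phi>. int (card B))" by simp
 have "int (card {x \<in> E. \<forall>g\<in>carrier G. \<phi> g x = x}) = (\<Sum>x\<in>E. ?f x)"
  using finE by (simp add: sum.If_cases Int_def)
 also have "\<dots> = (\<Sum>B\<in>orbits G E \<phi>. \<Sum>x\<in>B. ?f x)" by (rule disjoint_sum[OF finE, symmetric])
 finally have "int (card E) - int (card {x \<in> E. \<forall>g\<in>carrier G. \<phi> g x = x}) =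
  (\<Sum>B\<in>orbits G E \<phi>. int (card B) - (\<Sum>x\<in>B. ?f x))"
  using 1 by (simp add: sum_subtractf)
 moreover have "int l dvd int (card B) - (\<Sum>x\<in>B. ?f x)" if B: "B \<in> orbits G E \<phi>" for B
 proof -
  obtain x where x: "x \<in> E" "B = orbit G \<phi> x" using B by (auto simp: orbits_def)
  have xB: "x \<in> B" using orbit_refl[OF x(1)] x(2) by simp
  show ?thesis
  proof (cases "card B = 1")
   case True
   then have Bx: "B = {x}" using xB by (metis card_1_singletonE singletonD)
   have "\<phi> g x = x" if "g \<in> carrier G" for g using Bx x(2) that by (auto simp: orbit_def)
   then show ?thesis by (simp add: Bx)
  next
   case False
   have "?f y = 0" if y: "y \<in> B" for y
   proof (rule ccontr)
    assume "?f y \<noteq> 0"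
    then have fy: "\<forall>g\<in>carrier G. \<phi> g y = y" by (simp split: if_splits)
    have yE: "y \<in> E" using y sub[OF B] by auto
    have "z = y" if z: "z \<in> B" for z
    proof -
     have "z \<in> orbit G \<phi> y"
      using orbit_trans[OF yE x(1), of z] orbit_sym[OF x(1) yE] y z x(2) sub[OF B] by auto
     then show ?thesis using fy by (auto simp: orbit_def)
    qed
    then have "B = {y}" using y by blast
    then show False using False by simp
   qed
   then show ?thesis using orb[OF x(1)] x(2) False by simp
  qed
 qed
 ultimately show ?thesis by (simp add: dvd_sum)
qed

lemma p_group_fixed_cong:
 assumes act: "group_action Q E \<phi>" and finE: "finite E" and Q: "card (carrier Q) = p ^ k" and p: "prime p"
 shows "int p dvd int (card E) - int (card {x \<in> E. \<forall>g\<in>carrier Q. \<phi> g x = x})"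
proof (rule card_orbits_cong[OF act finE])
 interpret group_action Q E \<phi> by (rule act)
 fix x assume x: "x \<in> E"
 have "p ^ k = card (orbit Q \<phi> x) * card (stabilizer Q \<phi> x)"
  using orbit_stabilizer_theorem[OF x] Q by (simp add: order_def)
 then have "card (orbit Q \<phi> x) dvd p ^ k" by (rule dvdI)
 then obtain i where "card (orbit Q \<phi> x) = p ^ i" using divides_primepow_nat[OF p] by blast
 then show "card (orbit Q \<phi> x) = 1 \<or> p dvd card (orbit Q \<phi> x)" by (cases i) auto
qed

text \<open>If \<open>Q\<close> fixes \<open>x\<close>, the orbit length divides the index of
  \<open>Q\<close>. Conversely an orbit of length prime to \<open>p\<close> contains a point fixed
  by the \<open>p\<close>-group \<open>Q\<close>, and normality spreads this to the whole
  orbit.\<close>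

lemma prime_orbits_normal_p_subgroup:
 assumes act: "group_action G E \<phi>" and finE: "finite E" and finG: "finite (carrier G)"
  and N: "Q \<lhd> G" and Q: "card Q = p ^ k" and p: "prime p"
  and idx: "\<not> p dvd card (carrier G) div card Q" and x: "x \<in> E"
 shows "\<not> p dvd card (orbit G \<phi> x) \<longleftrightarrow> (\<forall>g\<in>Q. \<phi> g x = x)"
proof
 interpret group_action G E \<phi> by (rule act)
 interpret N: normal Q G by (rule N)
 have Qs: "subgroup Q G" by (rule N.subgroup_axioms)
 have G: "group G" by (rule N.is_group)
 have cQ: "card Q > 0" using Q p by (simp add: prime_gt_0_nat)
 {
  assume fx: "\<forall>g\<in>Q. \<phi> g x = x"
  let ?S = "stabilizer G \<phi> x"
  have S: "subgroup ?S G" by (rule stabilizer_subgroup[OF x])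
  have "Q \<subseteq> ?S" using fx N.subset by (auto simp: stabilizer_def)
  then have "subgroup Q (subgrp G ?S)" by (rule group.subgroup_incl[OF G Qs S])
  from group.lagrange[OF group.subgroup_imp_group[OF G S] this]
  have "card (rcosets\<^bsub>(subgrp G ?S)\<^esub> Q) * card Q = card ?S" by (simp add: order_def)
  then have "card Q dvd card ?S" by (metis dvd_triv_right)
  then obtain t where t: "card ?S = card Q * t" by (auto simp: dvd_def)
  have "card (orbit G \<phi> x) * t * card Q = card (carrier G)"
   using orbit_stabilizer_theorem[OF x] t by (simp add: order_def algebra_simps)
  then have "card (orbit G \<phi> x) * t = card (carrier G) div card Q"
   using cQ by (metis nonzero_mult_div_cancel_right less_not_refl)
  then show "\<not> p dvd card (orbit G \<phi> x)" using idx by (metis dvd_mult2)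
 }
 {
  assume np: "\<not> p dvd card (orbit G \<phi> x)"
  let ?B = "orbit G \<phi> x"
  have BE: "?B \<subseteq> E" using group_action_closed[OF act _ x] by (auto simp: orbit_def)
  have Bc: "\<phi> g y \<in> ?B" if g: "g \<in> carrier G" and y: "y \<in> ?B" for g y
  proof -
   obtain h where h: "h \<in> carrier G" "y = \<phi> h x" using y by (auto simp: orbit_def)
   then have "\<phi> g y = \<phi> (g \<otimes>\<^bsub>G\<^esub> h) x" using group_action_mult[OF act g h(1) x] by simp
   then show ?thesis using g h N.m_closed by (auto simp: orbit_def)
  qed
  let ?Q = "subgrp G Q"
  have "group_action G ?B (\<lambda>g. restrict (\<phi> g) ?B)" by (rule group_action_sub[OF act BE Bc])
  then have "group_action ?Q ?B (\<lambda>g. restrict (\<phi> g) ?B)" by (rule group_action_restrict_group[OF G Qs])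
  from p_group_fixed_cong[OF this finite_subset[OF BE finE] _ p, of k]
  have "int p dvd int (card ?B) - int (card {y \<in> ?B. \<forall>g\<in>Q. restrict (\<phi> g) ?B y = y})" using Q by simp
  moreover have "\<not> int p dvd int (card ?B)" using np by simp
  ultimately have "card {y \<in> ?B. \<forall>g\<in>Q. restrict (\<phi> g) ?B y = y} \<noteq> 0"
   by (metis diff_zero of_nat_0)
  then have "{y \<in> ?B. \<forall>g\<in>Q. restrict (\<phi> g) ?B y = y} \<noteq> {}" by (metis card.empty)
  then obtain y where y: "y \<in> ?B" "\<forall>g\<in>Q. restrict (\<phi> g) ?B y = y" by blast
  have fy: "\<phi> g y = y" if "g \<in> Q" for g using y that by simp
  have yE: "y \<in> E" using y BE by auto
  obtain h where h: "h \<in> carrier G" "x = \<phi> h y" using orbit_sym[OF x yE y(1)] by (auto simp: orbit_def)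
  show "\<forall>g\<in>Q. \<phi> g x = x"
  proof
   fix g assume g: "g \<in> Q"
   have gG: "g \<in> carrier G" using g N.subset by auto
   have c: "inv\<^bsub>G\<^esub> h \<otimes>\<^bsub>G\<^esub> g \<otimes>\<^bsub>G\<^esub> h \<in> Q" using N.inv_op_closed1[OF h(1) g] .
   have "\<phi> g x = \<phi> (h \<otimes>\<^bsub>G\<^esub> (inv\<^bsub>G\<^esub> h \<otimes>\<^bsub>G\<^esub> g \<otimes>\<^bsub>G\<^esub> h)) y"
    using h gG group_action_mult[OF act gG h(1) yE] by (simp add: N.m_assoc[symmetric])
   also have "\<dots> = \<phi> h (\<phi> (inv\<^bsub>G\<^esub> h \<otimes>\<^bsub>G\<^esub> g \<otimes>\<^bsub>G\<^esub> h) y)"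
    using group_action_mult[OF act h(1) _ yE] c N.subset by blast
   also have "\<dots> = x" using fy[OF c] h by simp
   finally show "\<phi> g x = x" .
  qed
 }
qed

section \<open>Marks of a relation at extensions of cyclic groups by p-groups\<close>

lemma fixed_points_generate:
 assumes act: "group_action G (fst X) (snd X)" and S: "S \<subseteq> carrier G"
 shows "fixed_points X (generate G S) = fixed_points X S"
proof
 have G: "group G" by (rule group_action_group[OF act])
 show "fixed_points X (generate G S) \<subseteq> fixed_points X S"
  by (auto simp: fixed_points_def intro: generate.incl)
 show "fixed_points X S \<subseteq> fixed_points X (generate G S)"
 proof
  fix x assume x: "x \<in> fixed_points X S"
  then have xX: "x \<in> fst X" by (simp add: fixed_points_def)
  have "snd X g x = x" if "g \<in> generate G S" for g
   using that
  proof (induction rule: generate.induct)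
   case one
   show ?case by (rule group_action_one[OF act xX])
  next
   case (incl h)
   then show ?case using x by (simp add: fixed_points_def)
  next
   case (inv h)
   then show ?case using x group_action_inv(1)[OF act _ xX, of h] S by (auto simp: fixed_points_def)
  next
   case (eng h k)
   then show ?case
    using group_action_mult[OF act _ _ xX, of h k] group.generate_in_carrier[OF G S] by simp
  qed
  then show "x \<in> fixed_points X (generate G S)" using xX by (simp add: fixed_points_def)
 qed
qed

lemma mark_generate:
 assumes "supp c \<subseteq> finite_gsets G" and "S \<subseteq> carrier G"
 shows "mark (generate G S) c = mark S c"
 unfolding mark_def
 by (rule frag_val_cong) (use assms fixed_points_generate finite_gsetsD(2) in \<open>metis subsetD\<close>)

lemma subgroup_index_dvd:
 assumes G: "group G" and finG: "finite (carrier G)" and H: "subgroup H G" and Q: "subgroup Q G" and QH: "Q \<subseteq> H"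
 shows "card H div card Q dvd card (carrier G) div card Q" "card Q dvd card H"
proof -
 have "subgroup Q (subgrp G H)" by (rule group.subgroup_incl[OF G Q H QH])
 from group.lagrange[OF group.subgroup_imp_group[OF G H] this]
 have *: "card (rcosets\<^bsub>subgrp G H\<^esub> Q) * card Q = card H" by (simp add: order_def)
 then show "card Q dvd card H" by (metis dvd_triv_right)
 then have "card (carrier G) div card Q = card (rcosets\<^bsub>G\<^esub> H) * (card H div card Q)"
  using group.lagrange[OF G H] by (metis div_mult_swap order_def)
 then show "card H div card Q dvd card (carrier G) div card Q" by simp
qed

text \<open>By Burnside's lemma, the orbits of size prime to \<open>p\<close> are counted by a sum of marks at the groups \<open>Q\<langle>h\<rangle>\<close>,
 \<open>h \<in> H\<close>; by induction only those with \<open>Q\<langle>h\<rangle> = H\<close> remain.\<close>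

lemma relation_mark_eq_0:
 fixes G :: "('g, 'b) monoid_scheme" (structure)
 assumes m: "residue_char_ideal F m p" and p: "prime p" and G: "group G" and finG: "finite (carrier G)"
  and c: "relation_over F G c" and N: "Q \<lhd> G" and Q: "card Q = p ^ k"
  and idx: "\<not> p dvd card (carrier G) div card Q" and d: "d \<in> carrier G"
 shows "mark (insert d Q) c = 0"
 using d
proof (induction "card (generate G (insert d Q))" arbitrary: d rule: less_induct)
 case less
 interpret group G by (rule G)
 interpret N: normal Q G by (rule N)
 have Qs: "subgroup Q G" by (rule N.subgroup_axioms)
 have k: "supp c \<subseteq> finite_gsets G" using c by (simp add: relation_over_def)
 define H where "H = generate G (insert d Q)"
 have dQ: "insert d Q \<subseteq> carrier G" using less.prems N.subset by simp
 have H: "subgroup H G" unfolding H_def by (rule generate_is_subgroup[OF dQ])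
 have QH: "Q \<subseteq> H" unfolding H_def by (auto intro: generate.incl)
 have dH: "d \<in> H" unfolding H_def by (auto intro: generate.incl)
 have finH: "finite H" using finite_subset[OF subgroup.subset[OF H] finG] .
 let ?L = "subgrp G H"
 have gL: "group ?L" by (rule subgroup_imp_group[OF H])
 have NL: "Q \<lhd> ?L" by (rule normal_restrict_supergroup[OF H N QH])
 have idxL: "\<not> p dvd card (carrier ?L) div card Q"
  using dvd_trans[OF _ subgroup_index_dvd(1)[OF G finG H Qs QH], of p] idx by auto
 have e: "int (card H) * int (card {B \<in> orbits ?L (fst X) (snd X). \<not> p dvd card B}) =
   (\<Sum>h\<in>H. int (card (fixed_points X (insert h Q))))" if X: "X \<in> finite_gsets G" for X
 proof -
  note finX = finite_gsetsD(1)[OF X] and act = finite_gsetsD(2)[OF X]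
  have aL: "group_action ?L (fst X) (snd X)" by (rule group_action_restrict_group[OF G H act])
  \<comment> \<open>As \<open>Q\<close> is normal, \<open>H\<close> acts on the
    \<open>Q\<close>-fixed points, and its orbits there are exactly its orbits on \<open>X\<close>
    of length prime to \<open>p\<close>. Burnside's lemma is applied to this action.\<close>
  define Y where "Y = fixed_points X Q"
  have YX: "Y \<subseteq> fst X" by (auto simp: Y_def fixed_points_def)
  have Yc: "snd X h y \<in> Y" if h: "h \<in> carrier ?L" and y: "y \<in> Y" for h y
  proof -
   have hG: "h \<in> carrier G" using h subgroup.subset[OF H] by auto
   have yX: "y \<in> fst X" using y YX by auto
   have "snd X g (snd X h y) = snd X h y" if g: "g \<in> Q" for g
   proof -
    have gG: "g \<in> carrier G" using g N.subset by auto
    have cc: "inv h \<otimes> g \<otimes> h \<in> Q" using N.inv_op_closed1[OF hG g] .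
    have "snd X g (snd X h y) = snd X (h \<otimes> (inv h \<otimes> g \<otimes> h)) y"
     using hG gG group_action_mult[OF act gG hG yX] by (simp add: m_assoc[symmetric])
    also have "\<dots> = snd X h (snd X (inv h \<otimes> g \<otimes> h) y)"
     using group_action_mult[OF act hG _ yX] cc N.subset by blast
    finally show ?thesis using y cc by (simp add: Y_def fixed_points_def)
   qed
   then show ?thesis using group_action_closed[OF act hG yX] by (simp add: Y_def fixed_points_def)
  qed
  have aY: "group_action ?L Y (\<lambda>h. restrict (snd X h) Y)" by (rule group_action_sub[OF aL YX Yc])
  interpret AY: group_action ?L Y "\<lambda>h. restrict (snd X h) Y" by (rule aY)
  have oY: "orbit ?L (\<lambda>h. restrict (snd X h) Y) y = orbit ?L (snd X) y" if "y \<in> Y" for y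
   using that by (simp add: orbit_def)
  have "{B \<in> orbits ?L (fst X) (snd X). \<not> p dvd card B} = orbits ?L Y (\<lambda>h. restrict (snd X h) Y)"
  proof -
   have iff: "\<not> p dvd card (orbit ?L (snd X) x) \<longleftrightarrow> x \<in> Y" if x: "x \<in> fst X" for x
    using prime_orbits_normal_p_subgroup[OF aL finX _ NL Q p idxL x] finH x by (simp add: Y_def fixed_points_def)
   show ?thesis
   proof (rule equalityI; rule subsetI)
    fix B assume "B \<in> {B \<in> orbits ?L (fst X) (snd X). \<not> p dvd card B}"
    then obtain x where x: "x \<in> fst X" "B = orbit ?L (snd X) x" "\<not> p dvd card B" by (auto simp: orbits_def)
    then have "x \<in> Y" using iff by simp
    then show "B \<in> orbits ?L Y (\<lambda>h. restrict (snd X h) Y)" using x oY unfolding orbits_def by blast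
   next
    fix B assume "B \<in> orbits ?L Y (\<lambda>h. restrict (snd X h) Y)"
    then obtain y where y: "y \<in> Y" "B = orbit ?L (snd X) y" using oY unfolding orbits_def by blast
    then show "B \<in> {B \<in> orbits ?L (fst X) (snd X). \<not> p dvd card B}"
     using iff[of y] YX unfolding orbits_def by blast
   qed
  qed
  then have "card {B \<in> orbits ?L (fst X) (snd X). \<not> p dvd card B} * card H =
   (\<Sum>h\<in>H. card (invariants Y (\<lambda>h. restrict (snd X h) Y) h))"
   using AY.burnside finH finite_subset[OF YX finX] by (simp add: order_def)
  also have "\<dots> = (\<Sum>h\<in>H. card (fixed_points X (insert h Q)))"
  proof (rule sum.cong[OF refl])
   fix h
   have "invariants Y (\<lambda>h. restrict (snd X h) Y) h = fixed_points X (insert h Q)"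
    by (auto simp: invariants_def Y_def fixed_points_def)
   then show "card (invariants Y (\<lambda>h. restrict (snd X h) Y) h) = card (fixed_points X (insert h Q))" by simp
  qed
  finally show ?thesis by (metis (mono_tags, lifting) mult.commute of_nat_mult of_nat_sum sum.cong)
 qed
 have "(\<Sum>h\<in>H. mark (insert h Q) c) =
  frag_val (\<lambda>X. int (card H) * int (card {B \<in> orbits ?L (fst X) (snd X). \<not> p dvd card B})) c"
  unfolding mark_def frag_val_sum[symmetric] by (rule frag_val_cong) (use e k in auto)
 also have "\<dots> = 0"
  using relation_orbit_count[OF m p G finG c H] by (simp add: frag_val_distrib_left)
 finally have z: "(\<Sum>h\<in>H. mark (insert h Q) c) = 0" .
 have hm: "mark (insert h Q) c = (if generate G (insert h Q) = H then mark (insert d Q) c else 0)" if h: "h \<in> H" for h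
 proof -
  have hG: "h \<in> carrier G" using h subgroup.subset[OF H] by auto
  then have hQ: "insert h Q \<subseteq> carrier G" using N.subset by simp
  have sub: "generate G (insert h Q) \<subseteq> H" by (rule generate_subgroup_incl[OF _ H]) (use h QH in auto)
  show ?thesis
  proof (cases "generate G (insert h Q) = H")
   case True
   have "mark (insert h Q) c = mark H c" using mark_generate[OF k hQ] True by simp
   also have "\<dots> = mark (insert d Q) c" using mark_generate[OF k dQ] by (simp add: H_def)
   finally show ?thesis using True by simp
  next
   case False
   then have "generate G (insert h Q) \<subset> H" using sub by auto
   then have "card (generate G (insert h Q)) < card (generate G (insert d Q))"
    using psubset_card_mono[OF finH] by (simp add: H_def)
   from less.hyps[OF this hG] show ?thesis using False by simp
  qed
 qed
 have "(\<Sum>h\<in>H. mark (insert h Q) c) = (\<Sum>h\<in>H. if generate G (insert h Q) = H then mark (insert d Q) c else 0)"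
  by (rule sum.cong[OF refl]) (rule hm)
 also have "\<dots> = int (card {h \<in> H. generate G (insert h Q) = H}) * mark (insert d Q) c"
  using finH by (simp add: sum.If_cases Int_def)
 finally have "int (card {h \<in> H. generate G (insert h Q) = H}) * mark (insert d Q) c = 0" using z by simp
 \<comment> \<open>\<open>d\<close> itself is counted, so the remaining factor, the mark, must
   vanish.\<close>
 moreover have "card {h \<in> H. generate G (insert h Q) = H} \<noteq> 0"
  using dH finH by (auto simp: H_def)
 ultimately show ?case by simp
qed

section \<open>Semisimple modules over a prime field\<close>

text \<open>\<open>V\<close> is a finite elementary abelian \<open>p\<close>-group, written multiplicatively, on which the group \<open>K\<close>
 of order prime to \<open>p\<close> acts by automorphisms.\<close>

locale semisimple_space = V: comm_group V for V (structure) +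
 fixes K :: "('k, 'kb) monoid_scheme" and \<alpha> :: "'k \<Rightarrow> 'a \<Rightarrow> 'a" and p :: nat
 assumes finV: "finite (carrier V)" and finK: "finite (carrier K)" and K: "group K"
  and p: "prime p" and pK: "\<not> p dvd card (carrier K)"
  and exp_p: "v \<in> carrier V \<Longrightarrow> v [^] p = \<one>"
  and \<alpha>_closed: "g \<in> carrier K \<Longrightarrow> v \<in> carrier V \<Longrightarrow> \<alpha> g v \<in> carrier V"
  and \<alpha>_mult: "g \<in> carrier K \<Longrightarrow> u \<in> carrier V \<Longrightarrow> v \<in> carrier V \<Longrightarrow> \<alpha> g (u \<otimes> v) = \<alpha> g u \<otimes> \<alpha> g v"
  and \<alpha>_one: "v \<in> carrier V \<Longrightarrow> \<alpha> \<one>\<^bsub>K\<^esub> v = v"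
  and \<alpha>_comp: "g \<in> carrier K \<Longrightarrow> h \<in> carrier K \<Longrightarrow> v \<in> carrier V \<Longrightarrow> \<alpha> (g \<otimes>\<^bsub>K\<^esub> h) v = \<alpha> g (\<alpha> h v)"
begin

interpretation K: group K by (rule K)

definition stable :: "'a set \<Rightarrow> bool" where
 "stable A \<longleftrightarrow> subgroup A V \<and> (\<forall>g\<in>carrier K. \<forall>x\<in>A. \<alpha> g x \<in> A)"

text \<open>Maps are extensional on \<open>A\<close>, so that a homomorphism is counted once and
  restriction to a summand is again a homomorphism in this sense.\<close>

definition Homs :: "'a set \<Rightarrow> 'a set \<Rightarrow> ('a \<Rightarrow> 'a) set" where
 "Homs A B = {f \<in> extensional A. (\<forall>x\<in>A. f x \<in> B) \<and> (\<forall>x\<in>A. \<forall>y\<in>A. f (x \<otimes> y) = f x \<otimes> f y) \<and>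
   (\<forall>g\<in>carrier K. \<forall>x\<in>A. f (\<alpha> g x) = \<alpha> g (f x))}"

definition direct :: "'a set \<Rightarrow> 'a set \<Rightarrow> 'a set \<Rightarrow> bool" where
 "direct M A B \<longleftrightarrow> stable A \<and> stable B \<and> A \<subseteq> M \<and> B \<subseteq> M \<and> A \<inter> B = {\<one>} \<and>
   (\<forall>v\<in>M. \<exists>a\<in>A. \<exists>b\<in>B. v = a \<otimes> b)"

lemma stableD:
 assumes "stable A"
 shows "A \<subseteq> carrier V" "\<one> \<in> A" "x \<in> A \<Longrightarrow> y \<in> A \<Longrightarrow> x \<otimes> y \<in> A" "x \<in> A \<Longrightarrow> inv x \<in> A"
  "g \<in> carrier K \<Longrightarrow> x \<in> A \<Longrightarrow> \<alpha> g x \<in> A" "subgroup A V" "finite A" "x \<in> A \<Longrightarrow> x \<in> carrier V"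
proof -
 show sub: "A \<subseteq> carrier V" using assms subgroup.subset by (auto simp: stable_def)
 show "\<one> \<in> A" "x \<in> A \<Longrightarrow> y \<in> A \<Longrightarrow> x \<otimes> y \<in> A" "x \<in> A \<Longrightarrow> inv x \<in> A" "subgroup A V"
  using assms subgroup.one_closed subgroup.m_closed subgroup.m_inv_closed by (auto simp: stable_def)
 show "g \<in> carrier K \<Longrightarrow> x \<in> A \<Longrightarrow> \<alpha> g x \<in> A" using assms by (simp add: stable_def)
 show "finite A" using finite_subset[OF sub finV] .
 show "x \<in> A \<Longrightarrow> x \<in> carrier V" using sub by blast
qed

lemma \<alpha>_id: "g \<in> carrier K \<Longrightarrow> \<alpha> g \<one> = \<one>"
proof -
 assume g: "g \<in> carrier K"
 have "\<alpha> g \<one> \<otimes> \<alpha> g \<one> = \<alpha> g \<one> \<otimes> \<one>" using \<alpha>_mult[OF g, of \<one> \<one>] \<alpha>_closed[OF g] by simp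
 then show ?thesis using \<alpha>_closed[OF g V.one_closed] by simp
qed

lemma \<alpha>_inv: "g \<in> carrier K \<Longrightarrow> v \<in> carrier V \<Longrightarrow> \<alpha> g (inv v) = inv (\<alpha> g v)"
 by (rule V.inv_equality[symmetric]) (simp_all add: \<alpha>_mult[symmetric] \<alpha>_id \<alpha>_closed)

lemma HomsD:
 assumes "f \<in> Homs A B"
 shows "x \<in> A \<Longrightarrow> f x \<in> B" "x \<in> A \<Longrightarrow> y \<in> A \<Longrightarrow> f (x \<otimes> y) = f x \<otimes> f y"
  "g \<in> carrier K \<Longrightarrow> x \<in> A \<Longrightarrow> f (\<alpha> g x) = \<alpha> g (f x)" "f \<in> extensional A"
 using assms by (simp_all add: Homs_def)

lemma Homs_undefined: "f \<in> Homs A B \<Longrightarrow> x \<notin> A \<Longrightarrow> f x = undefined"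
 by (simp add: Homs_def extensional_def)

lemma Homs_one:
 assumes "f \<in> Homs A B" "stable A" "stable B"
 shows "f \<one> = \<one>"
proof -
 have "f \<one> \<otimes> f \<one> = f \<one> \<otimes> \<one>"
  using HomsD(2)[OF assms(1), of \<one> \<one>] HomsD(1)[OF assms(1), of \<one>] stableD(2)[OF assms(2)] stableD(8)[OF assms(3)] by simp
 moreover have "f \<one> \<in> carrier V" using HomsD(1)[OF assms(1)] stableD(2)[OF assms(2)] stableD(8)[OF assms(3)] by simp
 ultimately show ?thesis by simp
qed

lemma Homs_inv:
 assumes "f \<in> Homs A B" "stable A" "stable B" "x \<in> A"
 shows "f (inv x) = inv (f x)"
proof -
 have "f (inv x) \<otimes> f x = \<one>"
  using HomsD(2)[OF assms(1), of "inv x" x] Homs_one[OF assms(1-3)] stableD(4,8)[OF assms(2)] assms(4) by simp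
 then show ?thesis
  using V.inv_equality HomsD(1)[OF assms(1)] stableD(4)[OF assms(2)] stableD(8)[OF assms(3)] assms(4) by metis
qed

lemma finite_Homs: "stable A \<Longrightarrow> stable B \<Longrightarrow> finite (Homs A B)"
 by (rule finite_subset[OF _ finite_PiE[OF stableD(7), of A "\<lambda>_. B"]]) (auto simp: Homs_def PiE_def stableD(7))

lemma Homs_trivial: "stable A \<Longrightarrow> stable B \<Longrightarrow> (\<lambda>x\<in>A. \<one>) \<in> Homs A B"
 by (auto simp: Homs_def stableD \<alpha>_id)

lemma directD:
 assumes "direct M A B"
 shows "stable A" "stable B" "A \<subseteq> M" "B \<subseteq> M" "x \<in> A \<Longrightarrow> x \<in> B \<Longrightarrow> x = \<one>"
  "v \<in> M \<Longrightarrow> \<exists>a\<in>A. \<exists>b\<in>B. v = a \<otimes> b"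
 using assms unfolding direct_def by auto

definition proj :: "'a set \<Rightarrow> 'a set \<Rightarrow> 'a \<Rightarrow> 'a" where
 "proj A B v = (SOME a. a \<in> A \<and> (\<exists>b\<in>B. v = a \<otimes> b))"

lemma proj_eq:
 assumes A: "subgroup A V" and B: "subgroup B V" and AB: "A \<inter> B = {\<one>}" and a: "a \<in> A" and b: "b \<in> B"
 shows "proj A B (a \<otimes> b) = a"
proof -
 let ?c = "proj A B (a \<otimes> b)"
 obtain d where c: "?c \<in> A" and d: "d \<in> B" "a \<otimes> b = ?c \<otimes> d"
  using someI_ex[of "\<lambda>c. c \<in> A \<and> (\<exists>d\<in>B. a \<otimes> b = c \<otimes> d)"] a b unfolding proj_def by blast
 have V: "a \<in> carrier V" "b \<in> carrier V" "?c \<in> carrier V" "d \<in> carrier V"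
  using a b c d subgroup.subset[OF A] subgroup.subset[OF B] by auto
 have "inv ?c \<otimes> a = inv ?c \<otimes> (a \<otimes> b) \<otimes> inv b" using V by (simp add: V.m_assoc)
 also have "\<dots> = inv ?c \<otimes> (?c \<otimes> d) \<otimes> inv b" using d(2) by simp
 also have "\<dots> = d \<otimes> inv b" using V by (simp add: V.m_assoc[symmetric])
 finally have e: "inv ?c \<otimes> a = d \<otimes> inv b" .
 have "inv ?c \<otimes> a \<in> A" using a c subgroup.m_closed[OF A] subgroup.m_inv_closed[OF A] by simp
 moreover have "inv ?c \<otimes> a \<in> B" unfolding e using b d(1) subgroup.m_closed[OF B] subgroup.m_inv_closed[OF B] by simp
 ultimately have "inv ?c \<otimes> a = \<one>" using AB by blast
 then show ?thesis using V by (metis V.inv_equality V.inv_inv V.inv_closed)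
qed

lemma direct_sym: "direct M A B \<Longrightarrow> direct M B A"
proof -
 assume d: "direct M A B"
 have "\<exists>b\<in>B. \<exists>a\<in>A. v = b \<otimes> a" if "v \<in> M" for v
  using directD(6)[OF d that] V.m_comm stableD(8)[OF directD(1)[OF d]] stableD(8)[OF directD(2)[OF d]] by metis
 then show ?thesis using d unfolding direct_def by auto
qed

lemma direct_proj:
 assumes d: "direct M A B"
 shows "a \<in> A \<Longrightarrow> b \<in> B \<Longrightarrow> proj A B (a \<otimes> b) = a"
  and "v \<in> M \<Longrightarrow> proj A B v \<in> A"
  and "v \<in> M \<Longrightarrow> v = proj A B v \<otimes> proj B A v"
  and "u \<in> M \<Longrightarrow> v \<in> M \<Longrightarrow> proj A B (u \<otimes> v) = proj A B u \<otimes> proj A B v"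
  and "g \<in> carrier K \<Longrightarrow> v \<in> M \<Longrightarrow> proj A B (\<alpha> g v) = \<alpha> g (proj A B v)"
proof -
 note A = stableD[OF directD(1)[OF d]] and B = stableD[OF directD(2)[OF d]]
 have AB: "A \<inter> B = {\<one>}" using d by (simp add: direct_def)
 have eq: "proj A B (a \<otimes> b) = a" "proj B A (a \<otimes> b) = b" if "a \<in> A" "b \<in> B" for a b
  using proj_eq[OF A(6) B(6) AB that] proj_eq[OF B(6) A(6) _ that(2,1)] AB V.m_comm[OF A(8)[OF that(1)] B(8)[OF that(2)]]
  by (simp_all add: Int_commute)
 then show "a \<in> A \<Longrightarrow> b \<in> B \<Longrightarrow> proj A B (a \<otimes> b) = a" by blast
 show "proj A B v \<in> A" "v = proj A B v \<otimes> proj B A v" if v: "v \<in> M"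
 proof -
  obtain a b where ab: "a \<in> A" "b \<in> B" "v = a \<otimes> b" using directD(6)[OF d v] by blast
  then have "proj A B v = a" "proj B A v = b" using eq[OF ab(1,2)] by simp_all
  then show "proj A B v \<in> A" "v = proj A B v \<otimes> proj B A v" using ab by simp_all
 qed
 show "proj A B (u \<otimes> v) = proj A B u \<otimes> proj A B v" if u: "u \<in> M" and v: "v \<in> M"
 proof -
  obtain a b where ab: "a \<in> A" "b \<in> B" "u = a \<otimes> b" using directD(6)[OF d u] by blast
  obtain a' b' where ab': "a' \<in> A" "b' \<in> B" "v = a' \<otimes> b'" using directD(6)[OF d v] by blast
  have "u \<otimes> v = (a \<otimes> a') \<otimes> (b \<otimes> b')"
   using A(8)[OF ab(1)] A(8)[OF ab'(1)] B(8)[OF ab(2)] B(8)[OF ab'(2)] by (simp only: ab(3) ab'(3) V.m_ac V.m_closed)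
  then show ?thesis using eq(1) A(3) B(3) ab ab' by simp
 qed
 show "proj A B (\<alpha> g v) = \<alpha> g (proj A B v)" if g: "g \<in> carrier K" and v: "v \<in> M"
 proof -
  obtain a b where ab: "a \<in> A" "b \<in> B" "v = a \<otimes> b" using directD(6)[OF d v] by blast
  then show ?thesis using eq(1) \<alpha>_mult[OF g A(8) B(8)] A(5)[OF g] B(5)[OF g] by simp
 qed
qed

lemma direct_unique:
 assumes d: "direct M A B" and ab: "a \<in> A" "a' \<in> A" "b \<in> B" "b' \<in> B" and e: "a \<otimes> b = a' \<otimes> b'"
 shows "a = a'" "b = b'"
proof -
 show "a = a'" using direct_proj(1)[OF d ab(1,3)] direct_proj(1)[OF d ab(2,4)] e by simp
 have "b \<otimes> a = b' \<otimes> a'" using e ab V.m_comm stableD(8)[OF directD(1)[OF d]] stableD(8)[OF directD(2)[OF d]] by metis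
 then show "b = b'"
  using direct_proj(1)[OF direct_sym[OF d] ab(3,1)] direct_proj(1)[OF direct_sym[OF d] ab(4,2)] by simp
qed

section \<open>Complements and Maschke's theorem\<close>

lemma ex_inverse_mod_p:
 assumes "\<not> p dvd i"
 shows "\<exists>j. [i * j = 1] (mod p)"
proof -
 have "coprime i p" using assms p prime_imp_coprime coprime_commute by blast
 then show ?thesis using cong_solve_coprime_nat[of i p] by simp
qed

lemma pow_cong: "v \<in> carrier V \<Longrightarrow> [i = j] (mod p) \<Longrightarrow> v [^] i = v [^] (j :: nat)"
proof -
 assume v: "v \<in> carrier V" and c: "[i = j] (mod p)"
 have r: "v [^] n = v [^] (n mod p)" for n :: nat
 proof -
  have "v [^] n = v [^] (p * (n div p) + n mod p)" by simp
  also have "\<dots> = (v [^] p) [^] (n div p) \<otimes> v [^] (n mod p)"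
   using v by (simp only: V.nat_pow_mult V.nat_pow_pow)
  also have "\<dots> = v [^] (n mod p)" using v by (simp add: exp_p)
  finally show ?thesis .
 qed
 show ?thesis using r[of i] r[of j] c by (simp add: cong_def)
qed

lemma pow_closed_subgroup: "subgroup C V \<Longrightarrow> c \<in> C \<Longrightarrow> c [^] (n :: nat) \<in> C"
 by (induction n) (auto simp: subgroup.one_closed subgroup.m_closed)

text \<open>A subgroup \<open>C\<close> of largest order meeting \<open>A\<close> trivially is a
  complement: if \<open>v\<close> is not in \<open>AC\<close>, adjoining the powers of
  \<open>v\<close> to \<open>C\<close> must create an element \<open>a = c v^i\<close> of
  \<open>A\<close> other than the identity. Then \<open>i\<close> is invertible modulo
  \<open>p\<close>, and \<open>v\<close> is a product of a power of \<open>a\<close> and a power of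
  \<open>c^-1\<close> after all.\<close>

lemma complement_exists:
 assumes A: "subgroup A V"
 shows "\<exists>C. subgroup C V \<and> A \<inter> C = {\<one>} \<and> (\<forall>v\<in>carrier V. \<exists>a\<in>A. \<exists>c\<in>C. v = a \<otimes> c)"
proof -
 let ?P = "\<lambda>C. subgroup C V \<and> A \<inter> C = {\<one>}"
 have "?P {\<one>}" using subgroup.one_closed[OF A] V.triv_subgroup by auto
 moreover have "\<forall>C. ?P C \<longrightarrow> card C < Suc (card (carrier V))"
  using card_mono[OF finV subgroup.subset] by (simp add: less_Suc_eq_le)
 ultimately have "\<exists>C. ?P C \<and> (\<forall>D. ?P D \<longrightarrow> card D \<le> card C)" by (rule ex_has_greatest_nat[of ?P])
 then obtain C where C: "subgroup C V" "A \<inter> C = {\<one>}" and mx: "\<And>D. ?P D \<Longrightarrow> card D \<le> card C" by auto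
 have As: "x \<in> carrier V" if "x \<in> A" for x using subgroup.subset[OF A] that by auto
 have Cs: "x \<in> carrier V" if "x \<in> C" for x using subgroup.subset[OF C(1)] that by auto
 have "\<exists>a\<in>A. \<exists>c\<in>C. v = a \<otimes> c" if v: "v \<in> carrier V" for v
 proof (rule ccontr)
  assume nv: "\<not> (\<exists>a\<in>A. \<exists>c\<in>C. v = a \<otimes> c)"
  have vC: "v \<notin> C" using nv subgroup.one_closed[OF A] v by (metis V.l_one)
  define D where "D = {c \<otimes> v [^] i | c i. c \<in> C \<and> i \<in> (UNIV :: nat set)}"
  have D: "subgroup D V"
  proof (rule V.subgroupI)
   show "D \<subseteq> carrier V" using Cs v by (auto simp: D_def)
   show "D \<noteq> {}" using subgroup.one_closed[OF C(1)] by (auto simp: D_def)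
   fix x assume "x \<in> D"
   then obtain c and i :: nat where x: "x = c \<otimes> v [^] i" "c \<in> C" unfolding D_def by blast
   \<comment> \<open>The inverse of \<open>v^i\<close> is written with the natural exponent
     \<open>i (p - 1)\<close>, since \<open>v^p = 1\<close>.\<close>
   have "inv x = inv c \<otimes> v [^] (i * (p - 1))"
   proof (rule V.inv_equality)
    have "i + i * (p - 1) = i * p" using prime_gt_0_nat[OF p] by (cases p) auto
    moreover have "v [^] (i * p) = \<one>" using pow_cong[OF v, of "i * p" 0] by (simp add: cong_def)
    ultimately have "v [^] (i * (p - 1)) \<otimes> v [^] i = \<one>"
     using v by (simp add: V.nat_pow_mult add.commute)
    moreover have "inv c \<otimes> v [^] (i * (p - 1)) \<otimes> x = (inv c \<otimes> c) \<otimes> (v [^] (i * (p - 1)) \<otimes> v [^] i)"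
     unfolding x using Cs[OF x(2)] v by (simp only: V.m_ac V.inv_closed V.m_closed V.nat_pow_closed)
    ultimately show "inv c \<otimes> v [^] (i * (p - 1)) \<otimes> x = \<one>" using Cs[OF x(2)] by simp
   qed (use Cs[OF x(2)] v x in auto)
   then show "inv x \<in> D" using subgroup.m_inv_closed[OF C(1) x(2)] unfolding D_def by blast
   fix y assume "y \<in> D"
   then obtain d and j :: nat where y: "y = d \<otimes> v [^] j" "d \<in> C" unfolding D_def by blast
   have "x \<otimes> y = (c \<otimes> d) \<otimes> (v [^] i \<otimes> v [^] j)"
    unfolding x y using Cs[OF x(2)] Cs[OF y(2)] v by (simp only: V.m_ac V.m_closed V.nat_pow_closed)
   then have "x \<otimes> y = (c \<otimes> d) \<otimes> v [^] (i + j)" using v by (simp add: V.nat_pow_mult)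
   then show "x \<otimes> y \<in> D" using subgroup.m_closed[OF C(1) x(2) y(2)] unfolding D_def by blast
  qed
  have CD: "C \<subseteq> D"
  proof
   fix c assume c: "c \<in> C"
   then have "c = c \<otimes> v [^] (0 :: nat)" using Cs by simp
   then show "c \<in> D" using c unfolding D_def by blast
  qed
  have vD: "v \<in> D"
  proof -
   have "v = \<one> \<otimes> v [^] (1 :: nat)" using v by simp
   then show ?thesis using subgroup.one_closed[OF C(1)] unfolding D_def by blast
  qed
  have "card C < card D"
   using CD vD vC finite_subset[OF subgroup.subset[OF D] finV] by (intro psubset_card_mono) auto
  then have "A \<inter> D \<noteq> {\<one>}" using mx[of D] D by auto
  then obtain a where a: "a \<in> A" "a \<in> D" "a \<noteq> \<one>"
   using subgroup.one_closed[OF A] subgroup.one_closed[OF D] by blast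
  obtain c and i :: nat where ci: "a = c \<otimes> v [^] i" "c \<in> C" using a(2) unfolding D_def by blast
  show False
  proof (cases "p dvd i")
   case True
   then have "v [^] i = \<one>" using pow_cong[OF v, of i 0] by (simp add: cong_def)
   then have "a = c" using ci Cs by simp
   then show False using a ci C(2) by auto
  next
   case False
   then obtain j where j: "[i * j = 1] (mod p)" using ex_inverse_mod_p by blast
   have "v [^] i = a \<otimes> inv c" using ci Cs[OF ci(2)] v by (simp add: V.m_comm[of c] V.m_assoc)
   moreover have "v = (v [^] i) [^] j" using pow_cong[OF v j] v by (simp add: V.nat_pow_pow)
   ultimately have "v = a [^] j \<otimes> (inv c) [^] j"
    using As[OF a(1)] Cs[OF ci(2)] by (simp add: V.nat_pow_distrib)
   then show False
    using nv pow_closed_subgroup[OF A a(1)] pow_closed_subgroup[OF C(1) subgroup.m_inv_closed[OF C(1) ci(2)]] by blast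
  qed
 qed
 then show ?thesis using C by blast
qed

text \<open>Maschke: average a projection onto \<open>A\<close>.\<close>

lemma maschke:
 assumes A: "stable A"
 shows "\<exists>B. direct (carrier V) A B"
proof -
 note Ad = stableD[OF A]
 obtain C where C: "subgroup C V" "A \<inter> C = {\<one>}" "\<And>v. v \<in> carrier V \<Longrightarrow> \<exists>a\<in>A. \<exists>c\<in>C. v = a \<otimes> c"
  using complement_exists[OF Ad(6)] by blast
 have Cs: "x \<in> carrier V" if "x \<in> C" for x using subgroup.subset[OF C(1)] that by auto
 define \<pi> where "\<pi> = proj A C"
 have \<pi>_eq: "\<pi> (a \<otimes> c) = a" if "a \<in> A" "c \<in> C" for a c unfolding \<pi>_def by (rule proj_eq[OF Ad(6) C(1,2) that])
 have \<pi>: "\<pi> v \<in> A" "\<exists>c\<in>C. v = \<pi> v \<otimes> c" if v: "v \<in> carrier V" for v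
 proof -
  obtain a c where ac: "a \<in> A" "c \<in> C" "v = a \<otimes> c" using C(3)[OF v] by blast
  have "\<pi> v = a" unfolding ac(3) by (rule \<pi>_eq[OF ac(1,2)])
  then show "\<pi> v \<in> A" "\<exists>c\<in>C. v = \<pi> v \<otimes> c" using ac by auto
 qed
 have \<pi>_mult: "\<pi> (u \<otimes> v) = \<pi> u \<otimes> \<pi> v" if u: "u \<in> carrier V" and v: "v \<in> carrier V" for u v
 proof -
  obtain c d where cd: "c \<in> C" "u = \<pi> u \<otimes> c" "d \<in> C" "v = \<pi> v \<otimes> d" using \<pi>(2)[OF u] \<pi>(2)[OF v] by blast
  have c: "\<pi> u \<in> carrier V" "\<pi> v \<in> carrier V" "c \<in> carrier V" "d \<in> carrier V"
   using \<pi>(1)[OF u] \<pi>(1)[OF v] Ad(8) Cs cd by auto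
  have "u \<otimes> v = (\<pi> u \<otimes> c) \<otimes> (\<pi> v \<otimes> d)" using cd by simp
  also have "\<dots> = (\<pi> u \<otimes> \<pi> v) \<otimes> (c \<otimes> d)" using c by (simp only: V.m_ac V.m_closed)
  finally show ?thesis
   using \<pi>_eq[of "\<pi> u \<otimes> \<pi> v" "c \<otimes> d"] Ad(3) \<pi>(1)[OF u] \<pi>(1)[OF v] subgroup.m_closed[OF C(1)] cd by simp
 qed
 have \<pi>_A: "\<pi> a = a" if "a \<in> A" for a
  using \<pi>_eq[OF that subgroup.one_closed[OF C(1)]] Ad(8)[OF that] by simp
 \<comment> \<open>The sum of all conjugates of the projection, without division: on
   \<open>A\<close> it is multiplication by the order of \<open>K\<close>, written as a
   power.\<close>
 define \<sigma> where "\<sigma> = (\<lambda>v. finprod V (\<lambda>g. \<alpha> g (\<pi> (\<alpha> (inv\<^bsub>K\<^esub> g) v))) (carrier K))"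
 have tA: "\<alpha> g (\<pi> (\<alpha> (inv\<^bsub>K\<^esub> g) v)) \<in> A" if "g \<in> carrier K" "v \<in> carrier V" for g v
  using that \<alpha>_closed \<pi>(1) Ad(5) by simp
 have tV: "(\<lambda>g. \<alpha> g (\<pi> (\<alpha> (inv\<^bsub>K\<^esub> g) v))) \<in> carrier K \<rightarrow> carrier V" if "v \<in> carrier V" for v
  using tA[OF _ that] Ad(8) by auto
 have prodA: "finprod V f S \<in> A" if "finite S" "\<And>g. g \<in> S \<Longrightarrow> f g \<in> A" for f and S :: "'k set"
  using that by (induction S) (auto simp: Ad(2,3,8))
 have \<sigma>A: "\<sigma> v \<in> A" if "v \<in> carrier V" for v unfolding \<sigma>_def by (rule prodA[OF finK]) (use tA that in auto)
 have \<sigma>_mult: "\<sigma> (u \<otimes> v) = \<sigma> u \<otimes> \<sigma> v" if u: "u \<in> carrier V" and v: "v \<in> carrier V" for u v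
 proof -
  have "\<sigma> (u \<otimes> v) = finprod V (\<lambda>g. \<alpha> g (\<pi> (\<alpha> (inv\<^bsub>K\<^esub> g) u)) \<otimes> \<alpha> g (\<pi> (\<alpha> (inv\<^bsub>K\<^esub> g) v))) (carrier K)"
   unfolding \<sigma>_def
  proof (rule V.finprod_cong')
   fix g assume g: "g \<in> carrier K"
   show "\<alpha> g (\<pi> (\<alpha> (inv\<^bsub>K\<^esub> g) (u \<otimes> v))) = \<alpha> g (\<pi> (\<alpha> (inv\<^bsub>K\<^esub> g) u)) \<otimes> \<alpha> g (\<pi> (\<alpha> (inv\<^bsub>K\<^esub> g) v))"
    using g u v \<alpha>_closed \<pi>(1) Ad(8) by (simp add: \<alpha>_mult \<pi>_mult)
  qed (use tV[OF u] tV[OF v] in auto)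
  then show ?thesis unfolding \<sigma>_def using V.finprod_multf[OF tV[OF u] tV[OF v]] by simp
 qed
 have \<sigma>_\<alpha>: "\<sigma> (\<alpha> h v) = \<alpha> h (\<sigma> v)" if h: "h \<in> carrier K" and v: "v \<in> carrier V" for h v
 proof -
  let ?t = "\<lambda>g. \<alpha> g (\<pi> (\<alpha> (inv\<^bsub>K\<^esub> g) (\<alpha> h v)))"
  have hv: "\<alpha> h v \<in> carrier V" using \<alpha>_closed[OF h v] .
  have dist: "\<alpha> h (finprod V f S) = finprod V (\<lambda>g. \<alpha> h (f g)) S" if "finite S" "f \<in> S \<rightarrow> carrier V" for f and S :: "'k set"
   using that
  proof (induction S)
   case empty
   then show ?case by (simp add: \<alpha>_id h)
  next
   case (insert x S)
   have "(\<lambda>g. \<alpha> h (f g)) \<in> S \<rightarrow> carrier V" using insert \<alpha>_closed[OF h] by auto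
   then show ?case using insert \<alpha>_closed[OF h] by (simp add: \<alpha>_mult[OF h] Pi_iff)
  qed
  have im: "(\<lambda>g. h \<otimes>\<^bsub>K\<^esub> g) ` carrier K = carrier K"
  proof
   show "carrier K \<subseteq> (\<lambda>g. h \<otimes>\<^bsub>K\<^esub> g) ` carrier K"
   proof
    fix x assume "x \<in> carrier K"
    then have "x = h \<otimes>\<^bsub>K\<^esub> (inv\<^bsub>K\<^esub> h \<otimes>\<^bsub>K\<^esub> x)" using h by (simp add: K.m_assoc[symmetric])
    then show "x \<in> (\<lambda>g. h \<otimes>\<^bsub>K\<^esub> g) ` carrier K" using h \<open>x \<in> carrier K\<close> by blast
   qed
  qed (use h in auto)
  have "\<sigma> (\<alpha> h v) = finprod V ?t ((\<lambda>g. h \<otimes>\<^bsub>K\<^esub> g) ` carrier K)" by (simp add: im \<sigma>_def)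
  also have "\<dots> = finprod V (\<lambda>g. ?t (h \<otimes>\<^bsub>K\<^esub> g)) (carrier K)"
   by (rule V.finprod_reindex) (use tV[OF hv] h im in \<open>auto simp: inj_on_def\<close>)
  also have "\<dots> = finprod V (\<lambda>g. \<alpha> h (\<alpha> g (\<pi> (\<alpha> (inv\<^bsub>K\<^esub> g) v)))) (carrier K)"
  proof (rule V.finprod_cong')
   fix g assume g: "g \<in> carrier K"
   have "\<alpha> (inv\<^bsub>K\<^esub> (h \<otimes>\<^bsub>K\<^esub> g)) (\<alpha> h v) = \<alpha> (inv\<^bsub>K\<^esub> (h \<otimes>\<^bsub>K\<^esub> g) \<otimes>\<^bsub>K\<^esub> h) v"
    using g h v by (simp add: \<alpha>_comp)
   also have "inv\<^bsub>K\<^esub> (h \<otimes>\<^bsub>K\<^esub> g) \<otimes>\<^bsub>K\<^esub> h = inv\<^bsub>K\<^esub> g" using g h by (simp add: K.inv_mult_group K.m_assoc)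
   finally show "?t (h \<otimes>\<^bsub>K\<^esub> g) = \<alpha> h (\<alpha> g (\<pi> (\<alpha> (inv\<^bsub>K\<^esub> g) v)))"
    using g h v \<alpha>_closed \<pi>(1) Ad(8) by (simp add: \<alpha>_comp)
  qed (use tV[OF v] \<alpha>_closed[OF h] in auto)
  also have "\<dots> = \<alpha> h (\<sigma> v)" unfolding \<sigma>_def by (rule dist[OF finK tV[OF v], symmetric])
  finally show ?thesis .
 qed
 have \<sigma>_A: "\<sigma> a = a [^] card (carrier K)" if a: "a \<in> A" for a
 proof -
  have "\<sigma> a = finprod V (\<lambda>g. a) (carrier K)"
   unfolding \<sigma>_def
  proof (rule V.finprod_cong')
   fix g assume g: "g \<in> carrier K"
   have "\<alpha> g (\<alpha> (inv\<^bsub>K\<^esub> g) a) = a" using g a Ad(8) \<alpha>_comp[of g "inv\<^bsub>K\<^esub> g" a] \<alpha>_one by simp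
   then show "\<alpha> g (\<pi> (\<alpha> (inv\<^bsub>K\<^esub> g) a)) = a" using \<pi>_A[OF Ad(5)] g a by simp
  qed (use a Ad(8) in auto)
  then show ?thesis using V.finprod_const[OF Ad(8)[OF a]] by simp
 qed
 \<comment> \<open>Raising to the power \<open>n\<close> undoes the factor
   \<open>card (carrier K)\<close> on \<open>A\<close>; this is the place where the order of
   \<open>K\<close> has to be prime to \<open>p\<close>. The complement is the kernel of the
   resulting equivariant projection \<open>\<tau>\<close>.\<close>
 obtain n where n: "[card (carrier K) * n = 1] (mod p)" using ex_inverse_mod_p[OF pK] by blast
 define \<tau> where "\<tau> = (\<lambda>v. \<sigma> v [^] n)"
 have \<tau>A: "\<tau> v \<in> A" if "v \<in> carrier V" for v unfolding \<tau>_def by (rule pow_closed_subgroup[OF Ad(6) \<sigma>A[OF that]])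
 have \<tau>_A: "\<tau> a = a" if a: "a \<in> A" for a
  unfolding \<tau>_def \<sigma>_A[OF a] using pow_cong[OF Ad(8)[OF a] n] Ad(8)[OF a] by (simp add: V.nat_pow_pow)
 have \<tau>_mult: "\<tau> (u \<otimes> v) = \<tau> u \<otimes> \<tau> v" if "u \<in> carrier V" "v \<in> carrier V" for u v
  unfolding \<tau>_def using \<sigma>_mult[OF that] \<sigma>A that Ad(8) by (simp add: V.nat_pow_distrib)
 have \<alpha>_pow: "\<alpha> h (v [^] k) = \<alpha> h v [^] k" if "h \<in> carrier K" "v \<in> carrier V" for h v and k :: nat
  using that by (induction k) (simp_all add: \<alpha>_id \<alpha>_mult)
 have \<tau>_\<alpha>: "\<tau> (\<alpha> h v) = \<alpha> h (\<tau> v)" if "h \<in> carrier K" "v \<in> carrier V" for h v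
  unfolding \<tau>_def using \<sigma>_\<alpha>[OF that] \<alpha>_pow[OF that(1) Ad(8)[OF \<sigma>A[OF that(2)]]] by simp
 have \<tau>_inv: "\<tau> (inv v) = inv (\<tau> v)" if v: "v \<in> carrier V" for v
 proof (rule V.inv_equality[symmetric])
  have "\<tau> (inv v) \<otimes> \<tau> v = \<tau> \<one>" using \<tau>_mult[of "inv v" v] v by simp
  then show "\<tau> (inv v) \<otimes> \<tau> v = \<one>" using \<tau>_A[OF Ad(2)] by simp
 qed (use \<tau>A v Ad(8) in auto)
 define B where "B = {v \<in> carrier V. \<tau> v = \<one>}"
 have "stable B"
  unfolding stable_def
 proof (intro conjI ballI)
  show "subgroup B V"
  proof (rule V.subgroupI)
   show "B \<noteq> {}" using \<tau>_A[OF Ad(2)] by (auto simp: B_def)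
  qed (auto simp: B_def \<tau>_inv \<tau>_mult)
 qed (auto simp: B_def \<tau>_\<alpha> \<alpha>_closed \<alpha>_id)
 moreover have "A \<inter> B = {\<one>}" using \<tau>_A Ad(2) by (auto simp: B_def)
 moreover have "\<exists>a\<in>A. \<exists>b\<in>B. v = a \<otimes> b" if v: "v \<in> carrier V" for v
 proof (intro bexI)
  have t: "\<tau> v \<in> carrier V" using \<tau>A[OF v] Ad(8) by simp
  show "v = \<tau> v \<otimes> (inv (\<tau> v) \<otimes> v)" using v t by (simp add: V.m_assoc[symmetric])
  have "\<tau> (inv (\<tau> v) \<otimes> v) = inv (\<tau> v) \<otimes> \<tau> v"
   using \<tau>_mult[of "inv (\<tau> v)" v] \<tau>_inv[OF t] \<tau>_A[OF \<tau>A[OF v]] v t by simp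
  then show "inv (\<tau> v) \<otimes> v \<in> B" using v t by (simp add: B_def)
 qed (rule \<tau>A[OF v])
 ultimately show ?thesis using A Ad(1) unfolding direct_def by (intro exI[of _ B]) (auto simp: B_def)
qed

text \<open>By the modular law, a complement of \<open>A\<close> in the whole space meets
  \<open>M\<close> in a complement of \<open>A\<close> in \<open>M\<close>.\<close>

lemma maschke_in:
 assumes M: "stable M" and A: "stable A" and AM: "A \<subseteq> M"
 shows "\<exists>B. direct M A B"
proof -
 obtain B where B: "direct (carrier V) A B" using maschke[OF A] by blast
 note Md = stableD[OF M] and Bd = stableD[OF directD(2)[OF B]] and Ad = stableD[OF A]
 have "stable (B \<inter> M)"
  unfolding stable_def using V.subgroups_Inter_pair[OF Bd(6) Md(6)] Bd(5) Md(5) by auto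
 moreover have "\<exists>a\<in>A. \<exists>b\<in>B \<inter> M. v = a \<otimes> b" if v: "v \<in> M" for v
 proof -
  obtain a b where ab: "a \<in> A" "b \<in> B" "v = a \<otimes> b" using directD(6)[OF B, of v] Md(8)[OF v] by blast
  have "b = inv a \<otimes> v" using ab Ad(8) Bd(8) by (simp add: V.m_assoc[symmetric])
  then have "b \<in> M" using Md(3)[OF Md(4) v] ab(1) AM by auto
  then show ?thesis using ab by blast
 qed
 moreover have "A \<inter> (B \<inter> M) = {\<one>}" using B Md(2) unfolding direct_def by blast
 ultimately show ?thesis using A AM unfolding direct_def by (intro exI[of _ "B \<inter> M"]) auto
qed

section \<open>Numbers of homomorphisms determine isomorphism\<close>

lemma Homs_left_bij:
 assumes d: "direct M A B" and M: "stable M" and C: "stable C"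
 shows "bij_betw (\<lambda>f. (restrict f A, restrict f B)) (Homs M C) (Homs A C \<times> Homs B C)"
proof -
 note Ad = stableD[OF directD(1)[OF d]] and Bd = stableD[OF directD(2)[OF d]] and Md = stableD[OF M] and Cd = stableD[OF C]
 have AM: "x \<in> M" if "x \<in> A" for x using directD(3)[OF d] that by auto
 have BM: "x \<in> M" if "x \<in> B" for x using directD(4)[OF d] that by auto
 note dB = direct_sym[OF d]
 let ?a = "proj A B" and ?b = "proj B A"
 note a = direct_proj(2)[OF d] and b = direct_proj(2)[OF dB] and v = direct_proj(3)[OF d]
  and mult = direct_proj(4)[OF d] direct_proj(4)[OF dB] and act = direct_proj(5)[OF d] direct_proj(5)[OF dB]
 have ab: "?a (x \<otimes> y) = x" "?b (x \<otimes> y) = y" if "x \<in> A" "y \<in> B" for x y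
  using direct_proj(1)[OF d that] direct_proj(1)[OF dB that(2,1)] V.m_comm[OF Ad(8)[OF that(1)] Bd(8)[OF that(2)]] by simp_all
 have res: "restrict f A \<in> Homs A C" "restrict f B \<in> Homs B C" if f: "f \<in> Homs M C" for f
  using HomsD[OF f] AM BM Ad(3,5) Bd(3,5) by (simp_all add: Homs_def)
 define J where "J = (\<lambda>(f, h). \<lambda>v\<in>M. f (?a v) \<otimes> h (?b v))"
 have J: "J (f, h) \<in> Homs M C" if f: "f \<in> Homs A C" and h: "h \<in> Homs B C" for f h
 proof -
  note fD = HomsD[OF f] and hD = HomsD[OF h]
  have fc: "f (?a u) \<in> C" "h (?b u) \<in> C" if "u \<in> M" for u using fD(1)[OF a[OF that]] hD(1)[OF b[OF that]] .
  have "f (?a u \<otimes> ?a v) \<otimes> h (?b u \<otimes> ?b v) = (f (?a u) \<otimes> h (?b u)) \<otimes> (f (?a v) \<otimes> h (?b v))"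
   if u: "u \<in> M" and v: "v \<in> M" for u v
   unfolding fD(2)[OF a[OF u] a[OF v]] hD(2)[OF b[OF u] b[OF v]]
   using fc[OF u] fc[OF v] Cd(8) by (simp only: V.m_ac V.m_closed)
  then show ?thesis
   unfolding J_def Homs_def prod.case
   using fc Cd(3,8) Md(3,5) by (simp add: mult act fD(3) hD(3) a b \<alpha>_mult)
 qed
 show ?thesis
 proof (rule bij_betw_byWitness[where f' = J])
  show "\<forall>f\<in>Homs M C. J (restrict f A, restrict f B) = f"
  proof
   fix f assume f: "f \<in> Homs M C"
   show "J (restrict f A, restrict f B) = f"
   proof (rule extensionalityI[where A = M])
    fix x assume x: "x \<in> M"
    show "J (restrict f A, restrict f B) x = f x"
     using HomsD(2)[OF f AM[OF a[OF x]] BM[OF b[OF x]]] v[OF x, symmetric] a[OF x] b[OF x] x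
     by (simp add: J_def)
   qed (use HomsD(4)[OF f] in \<open>auto simp: J_def\<close>)
  qed
  show "\<forall>w\<in>Homs A C \<times> Homs B C. (restrict (J w) A, restrict (J w) B) = w"
  proof
   fix w assume "w \<in> Homs A C \<times> Homs B C"
   then obtain f h where w: "w = (f, h)" and f: "f \<in> Homs A C" and h: "h \<in> Homs B C" by auto
   have "restrict (J (f, h)) A = f"
   proof (rule extensionalityI[where A = A])
    fix v assume v: "v \<in> A"
    then show "restrict (J (f, h)) A v = f v"
     using ab[OF v Bd(2)] AM[OF v] Ad(8)[OF v] HomsD(1)[OF f v] Cd(8)
      Homs_one[OF h directD(2)[OF d] C] by (simp add: J_def)
   qed (use HomsD(4)[OF f] in auto)
   moreover have "restrict (J (f, h)) B = h"
   proof (rule extensionalityI[where A = B])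
    fix v assume v: "v \<in> B"
    then show "restrict (J (f, h)) B v = h v"
     using ab[OF Ad(2) v] BM[OF v] Bd(8)[OF v] HomsD(1)[OF h v] Cd(8)
      Homs_one[OF f directD(1)[OF d] C] by (simp add: J_def)
   qed (use HomsD(4)[OF h] in auto)
   ultimately show "(restrict (J w) A, restrict (J w) B) = w" by (simp add: w)
  qed
  show "(\<lambda>f. (restrict f A, restrict f B)) ` Homs M C \<subseteq> Homs A C \<times> Homs B C" using res by auto
  show "J ` (Homs A C \<times> Homs B C) \<subseteq> Homs M C" using J by auto
 qed
qed

lemma card_Homs_left:
 assumes "direct M A B" "stable M" "stable C"
 shows "card (Homs M C) = card (Homs A C) * card (Homs B C)"
 using bij_betw_same_card[OF Homs_left_bij[OF assms]] by (simp add: card_cartesian_product)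

lemma card_Homs_right:
 assumes d: "direct N A B" and N: "stable N" and M: "stable M"
 shows "card (Homs M N) = card (Homs M A) * card (Homs M B)"
proof -
 note Ad = stableD[OF directD(1)[OF d]] and Bd = stableD[OF directD(2)[OF d]] and Md = stableD[OF M] and Nd = stableD[OF N]
 have AN: "x \<in> N" if "x \<in> A" for x using directD(3)[OF d] that by auto
 have BN: "x \<in> N" if "x \<in> B" for x using directD(4)[OF d] that by auto
 note dB = direct_sym[OF d]
 let ?a = "proj A B" and ?b = "proj B A"
 note a = direct_proj(2)[OF d] and b = direct_proj(2)[OF dB] and v = direct_proj(3)[OF d]
  and mult = direct_proj(4)[OF d] direct_proj(4)[OF dB] and act = direct_proj(5)[OF d] direct_proj(5)[OF dB]
 define J where "J = (\<lambda>(f, h). \<lambda>v\<in>M. f v \<otimes> h v)"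
 have J: "J (f, h) \<in> Homs M N" if f: "f \<in> Homs M A" and h: "h \<in> Homs M B" for f h
 proof -
  note fD = HomsD[OF f] and hD = HomsD[OF h]
  have c: "f u \<in> carrier V" "h u \<in> carrier V" if "u \<in> M" for u using fD(1) hD(1) Ad(8) Bd(8) that by auto
  have "f (u \<otimes> v) \<otimes> h (u \<otimes> v) = (f u \<otimes> h u) \<otimes> (f v \<otimes> h v)" if u: "u \<in> M" and v: "v \<in> M" for u v
   unfolding fD(2)[OF u v] hD(2)[OF u v] using c[OF u] c[OF v] by (simp only: V.m_ac V.m_closed)
  then show ?thesis
   unfolding J_def Homs_def prod.case
   using c fD(1) hD(1) AN BN Nd(3) Md(3,5) by (simp add: fD(3) hD(3) \<alpha>_mult)
 qed
 have "bij_betw J (Homs M A \<times> Homs M B) (Homs M N)"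
  unfolding bij_betw_def
 proof
  show "inj_on J (Homs M A \<times> Homs M B)"
  proof (rule inj_onI)
   fix w w' assume "w \<in> Homs M A \<times> Homs M B" "w' \<in> Homs M A \<times> Homs M B" and e: "J w = J w'"
   then obtain f h f' h' where w: "w = (f, h)" "w' = (f', h')" and f: "f \<in> Homs M A" "f' \<in> Homs M A"
    and h: "h \<in> Homs M B" "h' \<in> Homs M B" by auto
   have "f v = f' v \<and> h v = h' v" if v: "v \<in> M" for v
   proof -
    have "f v \<otimes> h v = f' v \<otimes> h' v" using fun_cong[OF e, of v] v by (simp add: w J_def)
    then show ?thesis
     using direct_unique[OF d HomsD(1)[OF f(1) v] HomsD(1)[OF f(2) v] HomsD(1)[OF h(1) v] HomsD(1)[OF h(2) v]] by simp
   qed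
   then have "f = f'" "h = h'"
    using extensionalityI[OF HomsD(4)[OF f(1)] HomsD(4)[OF f(2)]] extensionalityI[OF HomsD(4)[OF h(1)] HomsD(4)[OF h(2)]]
    by simp_all
   then show "w = w'" by (simp add: w)
  qed
  show "J ` (Homs M A \<times> Homs M B) = Homs M N"
  proof
   show "J ` (Homs M A \<times> Homs M B) \<subseteq> Homs M N" using J by auto
   show "Homs M N \<subseteq> J ` (Homs M A \<times> Homs M B)"
   proof
    fix f assume f: "f \<in> Homs M N"
    note fD = HomsD[OF f]
    have "(\<lambda>v\<in>M. ?a (f v)) \<in> Homs M A" "(\<lambda>v\<in>M. ?b (f v)) \<in> Homs M B"
     unfolding Homs_def using Md(3,5) by (simp_all add: fD a b mult act)
    moreover have "f = J (\<lambda>v\<in>M. ?a (f v), \<lambda>v\<in>M. ?b (f v))"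
     by (rule extensionalityI[where A = M]) (use fD(1,4) v in \<open>auto simp: J_def\<close>)
    ultimately show "f \<in> J ` (Homs M A \<times> Homs M B)" by blast
   qed
  qed
 qed
 then show ?thesis by (metis bij_betw_same_card card_cartesian_product)
qed

lemma Homs_compose:
 assumes f: "f \<in> Homs A B" and h: "h \<in> Homs B C" and A: "stable A"
 shows "compose A h f \<in> Homs A C"
 using HomsD[OF f] HomsD[OF h] stableD(3,5)[OF A] by (simp add: Homs_def compose_def)

lemma Homs_inverse:
 assumes t: "t \<in> Homs A B" and bij: "bij_betw t A B" and A: "stable A" and B: "stable B"
 shows "(\<lambda>y\<in>B. inv_into A t y) \<in> Homs B A" "bij_betw (\<lambda>y\<in>B. inv_into A t y) B A"
proof -
 note tD = HomsD[OF t] and Ad = stableD[OF A] and Bd = stableD[OF B]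
 have i: "inv_into A t y \<in> A" "t (inv_into A t y) = y" if "y \<in> B" for y
  using bij that by (auto simp: bij_betw_def inv_into_into f_inv_into_f)
 have it: "inv_into A t (t x) = x" if "x \<in> A" for x using bij that by (simp add: bij_betw_def)
 have "inv_into A t (x \<otimes> y) = inv_into A t x \<otimes> inv_into A t y" if "x \<in> B" "y \<in> B" for x y
  using it[OF Ad(3)[OF i(1)[OF that(1)] i(1)[OF that(2)]]] tD(2)[OF i(1)[OF that(1)] i(1)[OF that(2)]] i(2) that by simp
 moreover have "inv_into A t (\<alpha> g x) = \<alpha> g (inv_into A t x)" if "g \<in> carrier K" "x \<in> B" for g x
  using it[OF Ad(5)[OF that(1) i(1)[OF that(2)]]] tD(3)[OF that(1) i(1)[OF that(2)]] i(2) that by simp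
 ultimately show "(\<lambda>y\<in>B. inv_into A t y) \<in> Homs B A"
  using i(1) Bd(3,5) by (simp add: Homs_def)
 show "bij_betw (\<lambda>y\<in>B. inv_into A t y) B A"
  using bij_betw_inv_into[OF bij] by (simp add: bij_betw_cong[of B "\<lambda>y\<in>B. inv_into A t y" "inv_into A t"])
qed

lemma card_Homs_iso:
 assumes t: "t \<in> Homs A A'" and bij: "bij_betw t A A'" and A: "stable A" and A': "stable A'" and B: "stable B"
 shows "card (Homs A B) = card (Homs A' B)" "card (Homs B A) = card (Homs B A')"
proof -
 define s where "s = (\<lambda>y\<in>A'. inv_into A t y)"
 have s: "s \<in> Homs A' A" using Homs_inverse(1)[OF t bij A A'] by (simp add: s_def)
 have st: "s (t x) = x" if "x \<in> A" for x using bij that HomsD(1)[OF t that] by (simp add: s_def bij_betw_def)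
 have ts: "t (s y) = y" if "y \<in> A'" for y using bij that by (auto simp: s_def bij_betw_def f_inv_into_f)
 have "bij_betw (\<lambda>f. compose A' f s) (Homs A B) (Homs A' B)"
 proof (rule bij_betw_byWitness[where f' = "\<lambda>f. compose A f t"])
  show "\<forall>f\<in>Homs A B. compose A (compose A' f s) t = f"
   using HomsD(1)[OF t] st by (auto simp: compose_def restrict_def fun_eq_iff Homs_undefined)
  show "\<forall>f\<in>Homs A' B. compose A' (compose A f t) s = f"
   using HomsD(1)[OF s] ts by (auto simp: compose_def restrict_def fun_eq_iff Homs_undefined)
  show "(\<lambda>f. compose A' f s) ` Homs A B \<subseteq> Homs A' B" using Homs_compose[OF s _ A'] by auto
  show "(\<lambda>f. compose A f t) ` Homs A' B \<subseteq> Homs A B" using Homs_compose[OF t _ A] by auto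
 qed
 then show "card (Homs A B) = card (Homs A' B)" by (rule bij_betw_same_card)
 have "bij_betw (\<lambda>f. compose B t f) (Homs B A) (Homs B A')"
 proof (rule bij_betw_byWitness[where f' = "\<lambda>f. compose B s f"])
  show "\<forall>f\<in>Homs B A. compose B s (compose B t f) = f"
   using HomsD(1) st by (fastforce simp: compose_def restrict_def fun_eq_iff Homs_undefined)
  show "\<forall>f\<in>Homs B A'. compose B t (compose B s f) = f"
   using HomsD(1) ts by (fastforce simp: compose_def restrict_def fun_eq_iff Homs_undefined)
  show "(\<lambda>f. compose B t f) ` Homs B A \<subseteq> Homs B A'" using Homs_compose[OF _ t B] by auto
  show "(\<lambda>f. compose B s f) ` Homs B A' \<subseteq> Homs B A" using Homs_compose[OF _ s B] by auto
 qed
 then show "card (Homs B A) = card (Homs B A')" by (rule bij_betw_same_card)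
qed

text \<open>A non-trivial \<open>f\<close> gives \<open>M = k + m\<close> and
  \<open>N = i + n\<close> with \<open>m\<close> isomorphic to the image \<open>i\<close>. Numbers
  of homomorphisms are multiplicative in both arguments; all factors that involve \<open>i\<close>
  cancel from the equation, and the same equation is left for the smaller pair \<open>k\<close>,
  \<open>n\<close>. An isomorphism of \<open>k\<close> with \<open>n\<close> is then glued to the
  one of \<open>m\<close> with \<open>i\<close>.\<close>

lemma Homs_iso_step:
 assumes M: "stable M" and N: "stable N"
  and IH: "\<And>M' N'. \<lbrakk>stable M'; stable N'; card M' + card N' < card M + card N;
   card (Homs M' M') * card (Homs N' N') = card (Homs M' N') * card (Homs N' M')\<rbrakk>
   \<Longrightarrow> \<exists>t\<in>Homs M' N'. bij_betw t M' N'"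
  and eq: "card (Homs M M) * card (Homs N N) = card (Homs M N) * card (Homs N M)"
  and f: "f \<in> Homs M N" and x0: "x0 \<in> M" "f x0 \<noteq> \<one>"
 shows "\<exists>t\<in>Homs M N. bij_betw t M N"
proof -
 note fD = HomsD[OF f] and Md = stableD[OF M] and Nd = stableD[OF N]
 have f1: "f \<one> = \<one>" by (rule Homs_one[OF f M N])
 have fi: "f (inv x) = inv (f x)" if "x \<in> M" for x by (rule Homs_inv[OF f M N that])
 define k where "k = {x \<in> M. f x = \<one>}"
 define i where "i = f ` M"
 have k: "stable k"
  unfolding stable_def
 proof (intro conjI ballI)
  show "subgroup k V"
  proof (rule V.subgroupI)
   show "k \<noteq> {}" using Md(2) f1 by (auto simp: k_def)
  qed (use Md(3,4,8) fD(2) fi in \<open>auto simp: k_def\<close>)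
 qed (use Md(5) fD(3) \<alpha>_id in \<open>auto simp: k_def\<close>)
 have i: "stable i"
  unfolding stable_def
 proof (intro conjI ballI)
  show "subgroup i V"
  proof (rule V.subgroupI)
   show "i \<subseteq> carrier V" using fD(1) Nd(8) by (auto simp: i_def)
   show "i \<noteq> {}" using Md(2) by (auto simp: i_def)
   show "inv a \<in> i" if "a \<in> i" for a using that Md(4) by (auto simp: i_def fi[symmetric])
   show "a \<otimes> b \<in> i" if "a \<in> i" "b \<in> i" for a b using that Md(3) by (auto simp: i_def fD(2)[symmetric])
  qed
  show "\<alpha> g a \<in> i" if "g \<in> carrier K" "a \<in> i" for g a
   using that Md(5) by (auto simp: i_def fD(3)[symmetric])
 qed
 have kM: "k \<subseteq> M" and iN: "i \<subseteq> N" using fD(1) by (auto simp: k_def i_def)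
 obtain m where m: "direct M k m" using maschke_in[OF M k kM] by blast
 obtain n where n: "direct N i n" using maschke_in[OF N i iN] by blast
 have sm: "stable m" and sn: "stable n" using directD(2)[OF m] directD(2)[OF n] by auto
 have mM: "x \<in> M" if "x \<in> m" for x using directD(4)[OF m] that by auto
 have nN: "x \<in> N" if "x \<in> n" for x using directD(4)[OF n] that by auto
 define r where "r = restrict f m"
 have r: "r \<in> Homs m i"
  using mM fD(2,3) stableD(3,5)[OF sm] by (auto simp: Homs_def r_def i_def)
 have ker_m: "x = \<one>" if "x \<in> m" "f x = \<one>" for x
  using directD(5)[OF m, of x] that mM by (simp add: k_def)
 have fm: "\<exists>b\<in>m. f v = f b" if v: "v \<in> M" for v
 proof -
  obtain a b where ab: "a \<in> k" "b \<in> m" "v = a \<otimes> b" using directD(6)[OF m v] by blast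
  have "f v = f a \<otimes> f b" using fD(2)[of a b] ab kM mM by auto
  also have "\<dots> = f b" using ab(1) fD(1)[OF mM[OF ab(2)]] Nd(8) by (simp add: k_def)
  finally show ?thesis using ab(2) by blast
 qed
 have bij_r: "bij_betw r m i"
  unfolding bij_betw_def
 proof
  show "inj_on r m"
  proof (rule inj_onI)
   fix x y assume x: "x \<in> m" and y: "y \<in> m" and e: "r x = r y"
   have iy: "inv y \<in> m" using stableD(4)[OF sm y] .
   have "f (x \<otimes> inv y) = f x \<otimes> inv (f y)" using fD(2)[OF mM[OF x] mM[OF iy]] fi[OF mM[OF y]] by simp
   also have "\<dots> = \<one>" using e x y fD(1)[OF mM[OF y]] Nd(8) by (simp add: r_def)
   finally have "x \<otimes> inv y = \<one>" using ker_m[of "x \<otimes> inv y"] stableD(3)[OF sm x iy] by simp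
   then show "x = y" using x y stableD(8)[OF sm] by (metis V.inv_closed V.inv_equality V.inv_inv)
  qed
  show "r ` m = i" using fm mM unfolding i_def r_def by fastforce
 qed
 note R = card_Homs_iso[OF r bij_r sm i]
 have pos: "card (Homs A B) > 0" if "stable A" "stable B" for A B
  using Homs_trivial[OF that] finite_Homs[OF that] card_gt_0_iff by blast
 let ?h = "\<lambda>A B. card (Homs A B)"
 have 1: "?h M M = ?h k k * ?h k i * (?h i k * ?h i i)"
  using card_Homs_left[OF m M M] card_Homs_right[OF m M k] card_Homs_right[OF m M sm] R[OF k] R[OF sm] R[OF i] by simp
 have 2: "?h N N = ?h i i * ?h i n * (?h n i * ?h n n)"
  using card_Homs_left[OF n N N] card_Homs_right[OF n N i] card_Homs_right[OF n N sn] by simp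
 have 3: "?h M N = ?h k i * ?h k n * (?h i i * ?h i n)"
  using card_Homs_left[OF m M N] card_Homs_right[OF n N k] card_Homs_right[OF n N sm] R(1)[OF i] R(1)[OF sn] by simp
 have 4: "?h N M = ?h i k * ?h i i * (?h n k * ?h n i)"
  using card_Homs_left[OF n N M] card_Homs_right[OF m M i] card_Homs_right[OF m M sn] R(2)[OF i] R(2)[OF sn] by simp
 \<comment> \<open>The common factor of both sides of the equation after \<open>m\<close> has been
   replaced by \<open>i\<close>. It is positive, as trivial homomorphisms exist.\<close>
 define c where "c = ?h k i * ?h i k * ?h i i * ?h i i * ?h i n * ?h n i"
 have "c > 0" unfolding c_def using pos k i sn by simp
 moreover have "c * (?h k k * ?h n n) = c * (?h k n * ?h n k)"
  using eq unfolding 1 2 3 4 c_def by (simp only: mult_ac)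
 ultimately have eq': "?h k k * ?h n n = ?h k n * ?h n k" by simp
 have "x0 \<notin> k" using x0 by (simp add: k_def)
 then have "card k < card M" using kM x0 Md(7) by (intro psubset_card_mono) auto
 moreover have "card n \<le> card N" using directD(4)[OF n] Nd(7) by (rule card_mono[rotated])
 ultimately obtain t where t: "t \<in> Homs k n" "bij_betw t k n" using IH[OF k sn _ eq'] by auto
 note tD = HomsD[OF t(1)]
 have "t \<in> Homs k N" using t(1) nN by (auto simp: Homs_def)
 moreover have "r \<in> Homs m N" using r iN by (auto simp: Homs_def)
 ultimately have "(t, r) \<in> (\<lambda>f. (restrict f k, restrict f m)) ` Homs M N"
  using Homs_left_bij[OF m M N] by (simp add: bij_betw_def)
 \<comment> \<open>Homomorphisms on the two summands extend uniquely to \<open>M\<close>.\<close>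
 then obtain \<theta> where \<theta>: "\<theta> \<in> Homs M N" "t = restrict \<theta> k" "r = restrict \<theta> m" by auto
 have \<theta>_eq: "\<theta> (a \<otimes> b) = t a \<otimes> f b" if a: "a \<in> k" and b: "b \<in> m" for a b
 proof -
  have "\<theta> a = t a" using a \<theta>(2) by simp
  moreover have "\<theta> b = f b" using b fun_cong[OF \<theta>(3), of b] by (simp add: r_def)
  ultimately show ?thesis using HomsD(2)[OF \<theta>(1), of a b] a b kM mM by auto
 qed
 have "bij_betw \<theta> M N"
  unfolding bij_betw_def
 proof
  have ker: "v = \<one>" if v: "v \<in> M" and e: "\<theta> v = \<one>" for v
  proof -
   obtain a b where ab: "a \<in> k" "b \<in> m" "v = a \<otimes> b" using directD(6)[OF m v] by blast
   have ta: "t a \<in> n" and fb: "f b \<in> i" using tD(1)[OF ab(1)] mM[OF ab(2)] by (auto simp: i_def)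
   have "f b \<otimes> t a = \<one> \<otimes> \<one>"
    using \<theta>_eq[OF ab(1,2)] ab(3) e stableD(8)[OF sn ta] stableD(8)[OF i fb] by (simp add: V.m_comm)
   then have "f b = \<one>" "t a = \<one>"
    using direct_unique[OF n fb stableD(2)[OF i] ta stableD(2)[OF sn]] by auto
   then have "b = \<one>" "t a = t \<one>" using ker_m[OF ab(2)] Homs_one[OF t(1) k sn] by auto
   moreover from this(2) have "a = \<one>"
    using t(2) ab(1) stableD(2)[OF k] by (auto simp: bij_betw_def inj_on_def)
   ultimately show ?thesis using ab(3) by simp
  qed
  show "inj_on \<theta> M"
  proof (rule inj_onI)
   fix x y assume x: "x \<in> M" and y: "y \<in> M" and e: "\<theta> x = \<theta> y"
   have iy: "inv y \<in> M" using Md(4)[OF y] .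
   have "\<theta> (x \<otimes> inv y) = \<theta> x \<otimes> inv (\<theta> y)"
    using HomsD(2)[OF \<theta>(1) x iy] Homs_inv[OF \<theta>(1) M N y] by simp
   also have "\<dots> = \<one>" using e HomsD(1)[OF \<theta>(1) y] Nd(8) by simp
   finally have "x \<otimes> inv y = \<one>" using ker[of "x \<otimes> inv y"] Md(3)[OF x iy] by simp
   then show "x = y" using x y Md(8) by (metis V.inv_closed V.inv_equality V.inv_inv)
  qed
  show "\<theta> ` M = N"
  proof
   show "\<theta> ` M \<subseteq> N" using HomsD(1)[OF \<theta>(1)] by auto
   show "N \<subseteq> \<theta> ` M"
   proof
    fix y assume "y \<in> N"
    then obtain u w where uw: "u \<in> i" "w \<in> n" "y = u \<otimes> w" using directD(6)[OF n] by blast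
    obtain v where "v \<in> M" "u = f v" using uw(1) by (auto simp: i_def)
    then obtain b where b: "b \<in> m" "u = f b" using fm by metis
    obtain a where a: "a \<in> k" "w = t a" using t(2) uw(2) by (auto simp: bij_betw_def)
    have "\<theta> (a \<otimes> b) = y"
     using \<theta>_eq[OF a(1) b(1)] uw a b stableD(8)[OF sn uw(2)] stableD(8)[OF i uw(1)] by (simp add: V.m_comm)
    moreover have "a \<otimes> b \<in> M" using Md(3) kM mM[OF b(1)] a(1) by auto
    ultimately show "y \<in> \<theta> ` M" by blast
   qed
  qed
 qed
 then show ?thesis using \<theta>(1) by blast
qed

text \<open>If \<open>a_S\<close> and \<open>b_S\<close> are the multiplicities of a simple module
  \<open>S\<close> in \<open>M\<close> and \<open>N\<close>, the logarithm of the equation is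
  \<open>sum d_S (a_S - b_S)^2 = 0\<close> with positive \<open>d_S\<close>. The proof by induction
  never mentions simple modules.\<close>

theorem Homs_card_eq_imp_iso:
 assumes "stable M" and "stable N"
  and "card (Homs M M) * card (Homs N N) = card (Homs M N) * card (Homs N M)"
 shows "\<exists>t\<in>Homs M N. bij_betw t M N"
 using assms
proof (induction "card M + card N" arbitrary: M N rule: less_induct)
 case less
 note M = less.prems(1) and N = less.prems(2) and eq = less.prems(3)
 have IH: "\<exists>t\<in>Homs M' N'. bij_betw t M' N'"
  if "stable M'" "stable N'" "card M' + card N' < card M + card N"
   "card (Homs M' M') * card (Homs N' N') = card (Homs M' N') * card (Homs N' M')" for M' N'
  using less.hyps[OF that(3,1,2,4)] .
 consider (a) f x where "f \<in> Homs M N" "x \<in> M" "f x \<noteq> \<one>"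
  | (b) f x where "f \<in> Homs N M" "x \<in> N" "f x \<noteq> \<one>"
  | (c) "\<forall>f\<in>Homs M N. \<forall>x\<in>M. f x = \<one>" "\<forall>f\<in>Homs N M. \<forall>x\<in>N. f x = \<one>" by blast
 then show ?case
 proof cases
  case a
  show ?thesis by (rule Homs_iso_step[OF M N IH eq a])
 next
  case b
  have "\<exists>t\<in>Homs N M. bij_betw t N M"
  proof (rule Homs_iso_step[OF N M _ _ b])
   show "\<exists>t\<in>Homs M' N'. bij_betw t M' N'"
    if "stable M'" "stable N'" "card M' + card N' < card N + card M"
     "card (Homs M' M') * card (Homs N' N') = card (Homs M' N') * card (Homs N' M')" for M' N'
    using IH[OF that(1,2) _ that(4)] that(3) by (simp add: add.commute)
   show "card (Homs N N) * card (Homs M M) = card (Homs N M) * card (Homs M N)"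
    using eq by (simp add: mult.commute)
  qed
  then obtain t where "t \<in> Homs N M" "bij_betw t N M" by blast
  from Homs_inverse[OF this N M] show ?thesis by blast
 next
  \<comment> \<open>Without non-trivial maps between \<open>M\<close> and \<open>N\<close>, the
    equation leaves one endomorphism on each, so the identity is trivial and both modules are
    zero.\<close>
  case c
  have one: "Homs A B = {\<lambda>x\<in>A. \<one>}" if "stable A" "stable B" "\<forall>f\<in>Homs A B. \<forall>x\<in>A. f x = \<one>" for A B
  proof -
   have "f = (\<lambda>x\<in>A. \<one>)" if "f \<in> Homs A B" for f
    using that \<open>\<forall>f\<in>Homs A B. \<forall>x\<in>A. f x = \<one>\<close> Homs_undefined[OF that] by (auto simp: restrict_def fun_eq_iff)
   then show ?thesis using Homs_trivial[OF that(1,2)] by blast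
  qed
  have c1: "card (Homs M M) = 1" "card (Homs N N) = 1"
   using eq one[OF M N c(1)] one[OF N M c(2)] by auto
  have triv: "A = {\<one>}" if A: "stable A" and 1: "card (Homs A A) = 1" for A
  proof -
   have "(\<lambda>x\<in>A. x) \<in> Homs A A" using stableD(3,5)[OF A] by (simp add: Homs_def)
   moreover have "(\<lambda>x\<in>A. \<one>) \<in> Homs A A" by (rule Homs_trivial[OF A A])
   ultimately have e: "(\<lambda>x\<in>A. x) = (\<lambda>x\<in>A. \<one>)" using 1 by (metis card_1_singletonE singletonD)
   have "x = \<one>" if "x \<in> A" for x using fun_cong[OF e, of x] that by simp
   then show ?thesis using stableD(2)[OF A] by blast
  qed
  have MN: "M = {\<one>}" "N = {\<one>}" using triv[OF M c1(1)] triv[OF N c1(2)] .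
  show ?thesis
   using Homs_trivial[OF M N] by (intro bexI[of _ "\<lambda>x\<in>M. \<one>"]) (simp_all add: MN bij_betw_def)
 qed
qed

end

subsection \<open>Permutation modules over the prime field\<close>

text \<open>The vector space of functions from \<open>Z\<close> to the field with \<open>p\<close>
  elements, represented by the residues \<open>0, ..., p - 1\<close> and zero off \<open>Z\<close>.
  Addition is the multiplication of the record, to fit \<open>semisimple_space\<close>.\<close>

definition fp_space :: "nat \<Rightarrow> 'z set \<Rightarrow> ('z \<Rightarrow> int) monoid" where
 "fp_space p Z = \<lparr>carrier = {v. (\<forall>z\<in>Z. 0 \<le> v z \<and> v z < int p) \<and> (\<forall>z. z \<notin> Z \<longrightarrow> v z = 0)},
   monoid.mult = (\<lambda>u v z. (u z + v z) mod int p), one = (\<lambda>z. 0)\<rparr>"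

definition fp_action :: "('g, 'b) monoid_scheme \<Rightarrow> ('g, 'z) gset \<Rightarrow> 'g \<Rightarrow> ('z \<Rightarrow> int) \<Rightarrow> ('z \<Rightarrow> int)" where
 "fp_action G Z g v = (\<lambda>z. if z \<in> fst Z then v (snd Z (inv\<^bsub>G\<^esub> g) z) else 0)"

text \<open>The permutation module of a stable subset, as a submodule of that of \<open>Z\<close>.
  The locale compares submodules of one space, so two G-sets are compared inside their disjoint
  union.\<close>

definition fp_supp :: "nat \<Rightarrow> 'z set \<Rightarrow> 'z set \<Rightarrow> ('z \<Rightarrow> int) set" where
 "fp_supp p Z S = {v \<in> carrier (fp_space p Z). \<forall>z. z \<notin> S \<longrightarrow> v z = 0}"

definition fp_basis :: "'z \<Rightarrow> 'z \<Rightarrow> int" where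
 "fp_basis x = (\<lambda>z. if z = x then 1 else 0)"

text \<open>For \<open>W\<close> a product of two G-sets, these are the matrices of equivariant maps
  between their permutation modules.\<close>

definition invariant_funs :: "('g, 'b) monoid_scheme \<Rightarrow> nat \<Rightarrow> ('g, 'w) gset \<Rightarrow> ('w \<Rightarrow> int) set" where
 "invariant_funs G p W = {t. (\<forall>w\<in>fst W. 0 \<le> t w \<and> t w < int p) \<and> (\<forall>w. w \<notin> fst W \<longrightarrow> t w = 0) \<and>
   (\<forall>g\<in>carrier G. \<forall>w\<in>fst W. t (snd W g w) = t w)}"

lemma card_invariant_funs:
 assumes act: "group_action G (fst W) (snd W)" and finW: "finite (fst W)"
 shows "card (invariant_funs G p W) = p ^ card (orbits G (fst W) (snd W))"
proof -
 interpret group_action G "fst W" "snd W" by (rule act)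
 let ?Os = "orbits G (fst W) (snd W)" and ?o = "orbit G (snd W)"
 have finO: "finite ?Os" using finW by (simp add: orbits_def)
 have o_eq: "?o (snd W g w) = ?o w" if g: "g \<in> carrier G" and w: "w \<in> fst W" for g w
 proof -
  have c: "snd W g w \<in> fst W" by (rule group_action_closed[OF act g w])
  have "snd W g w \<in> ?o w" using g by (auto simp: orbit_def)
  then have "?o w \<inter> ?o (snd W g w) \<noteq> {}" using orbit_refl[OF c] by blast
  moreover have "?o w \<in> ?Os" "?o (snd W g w) \<in> ?Os" using w c by (auto simp: orbits_def)
  ultimately show ?thesis using disjoint_union by metis
 qed
 define J where "J = (\<lambda>r w. if w \<in> fst W then r (?o w) else (0 :: int))"
 define I where "I = (\<lambda>t. \<lambda>B\<in>?Os. (t (SOME w. w \<in> fst W \<and> ?o w = B) :: int))"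
 have ch: "(SOME w. w \<in> fst W \<and> ?o w = B) \<in> fst W" "?o (SOME w. w \<in> fst W \<and> ?o w = B) = B" if "B \<in> ?Os" for B
  using someI_ex[of "\<lambda>w. w \<in> fst W \<and> ?o w = B"] that by (auto simp: orbits_def)
 have "bij_betw J (?Os \<rightarrow>\<^sub>E {0..<int p}) (invariant_funs G p W)"
 proof (rule bij_betw_byWitness[where f' = I])
  show "\<forall>r\<in>?Os \<rightarrow>\<^sub>E {0..<int p}. I (J r) = r"
  proof
   fix r assume r: "r \<in> ?Os \<rightarrow>\<^sub>E {0..<int p}"
   show "I (J r) = r"
    by (rule extensionalityI[where A = ?Os]) (use r ch in \<open>auto simp: I_def J_def PiE_def\<close>)
  qed
  show "\<forall>t\<in>invariant_funs G p W. J (I t) = t"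
  proof (intro ballI ext)
   fix t w assume t: "t \<in> invariant_funs G p W"
   show "J (I t) w = t w"
   proof (cases "w \<in> fst W")
    case True
    define w' where "w' = (SOME w'. w' \<in> fst W \<and> ?o w' = ?o w)"
    have O: "?o w \<in> ?Os" using True by (auto simp: orbits_def)
    have w': "w' \<in> fst W" "?o w' = ?o w" using ch[OF O] by (simp_all add: w'_def)
    then have "w' \<in> ?o w" using orbit_refl[OF w'(1)] by simp
    then obtain g where "g \<in> carrier G" "w' = snd W g w" by (auto simp: orbit_def)
    then have "t w' = t w" using t True by (simp add: invariant_funs_def)
    then show ?thesis using True O by (simp add: J_def I_def w'_def)
   next
    case False
    then show ?thesis using t by (simp add: J_def invariant_funs_def)
   qed
  qed
  show "J ` (?Os \<rightarrow>\<^sub>E {0..<int p}) \<subseteq> invariant_funs G p W"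
  proof (rule image_subsetI)
   fix r assume r: "r \<in> ?Os \<rightarrow>\<^sub>E {0..<int p}"
   have "0 \<le> r (?o w) \<and> r (?o w) < int p" if "w \<in> fst W" for w
    using PiE_mem[OF r, of "?o w"] that by (auto simp: orbits_def)
   then show "J r \<in> invariant_funs G p W"
    using o_eq group_action_closed[OF act] by (simp add: invariant_funs_def J_def)
  qed
  show "I ` invariant_funs G p W \<subseteq> ?Os \<rightarrow>\<^sub>E {0..<int p}"
   using ch(1) by (auto simp: I_def invariant_funs_def)
 qed
 then have "card (invariant_funs G p W) = card (?Os \<rightarrow>\<^sub>E {0..<int p})" using bij_betw_same_card by metis
 also have "\<dots> = p ^ card ?Os" using finO by (simp add: card_PiE)
 finally show ?thesis .
qed

section \<open>Homomorphisms between permutation modules over the prime field\<close>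

context
 fixes G :: "('g, 'b) monoid_scheme" (structure) and Z :: "('g, 'z) gset" and p :: nat
 assumes G: "group G" and finG: "finite (carrier G)" and finZ: "finite (fst Z)"
  and act: "group_action G (fst Z) (snd Z)" and p: "prime p" and pG: "\<not> p dvd card (carrier G)"
begin

interpretation group G by (rule G)

abbreviation (input) "VV \<equiv> fp_space p (fst Z)"

lemma fp_simps:
 "u \<otimes>\<^bsub>VV\<^esub> v = (\<lambda>z. (u z + v z) mod int p)" "\<one>\<^bsub>VV\<^esub> = (\<lambda>z. 0)"
 by (simp_all add: fp_space_def)

lemma fp_carrier: "v \<in> carrier VV \<longleftrightarrow> (\<forall>z\<in>fst Z. 0 \<le> v z \<and> v z < int p) \<and> (\<forall>z. z \<notin> fst Z \<longrightarrow> v z = 0)"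
 by (simp add: fp_space_def)

lemma p_pos: "int p > 1" using prime_gt_1_nat[OF p] by simp

lemma fp_mod: "v \<in> carrier VV \<Longrightarrow> v z mod int p = v z"
 using p_pos by (cases "z \<in> fst Z") (auto simp: fp_carrier)

lemma fp_comm_group: "comm_group VV"
proof (rule comm_groupI)
 fix x y z assume "x \<in> carrier VV" "y \<in> carrier VV" "z \<in> carrier VV"
 show "x \<otimes>\<^bsub>VV\<^esub> y \<otimes>\<^bsub>VV\<^esub> z = x \<otimes>\<^bsub>VV\<^esub> (y \<otimes>\<^bsub>VV\<^esub> z)"
  by (simp add: fp_simps mod_simps add.assoc)
next
 fix x y assume x: "x \<in> carrier VV" and y: "y \<in> carrier VV"
 show "x \<otimes>\<^bsub>VV\<^esub> y \<in> carrier VV" using x y p_pos by (simp add: fp_simps fp_carrier)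
 show "x \<otimes>\<^bsub>VV\<^esub> y = y \<otimes>\<^bsub>VV\<^esub> x" by (simp add: fp_simps add.commute)
next
 show "\<one>\<^bsub>VV\<^esub> \<in> carrier VV" using p_pos by (simp add: fp_simps fp_carrier)
 fix x assume x: "x \<in> carrier VV"
 show "\<one>\<^bsub>VV\<^esub> \<otimes>\<^bsub>VV\<^esub> x = x" using fp_mod[OF x] by (simp add: fp_simps)
 show "\<exists>y\<in>carrier VV. y \<otimes>\<^bsub>VV\<^esub> x = \<one>\<^bsub>VV\<^esub>"
  by (rule bexI[of _ "\<lambda>z. (- x z) mod int p"]) (use x p_pos in \<open>auto simp: fp_simps fp_carrier mod_simps\<close>)
qed

lemma fp_finite: "finite (carrier VV)"
proof -
 have "inj_on (\<lambda>v. restrict v (fst Z)) (carrier VV)"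
  by (rule inj_onI) (auto simp: fp_carrier restrict_def fun_eq_iff split: if_splits, metis)
 moreover have "(\<lambda>v. restrict v (fst Z)) ` carrier VV \<subseteq> fst Z \<rightarrow>\<^sub>E {0..<int p}" by (auto simp: fp_carrier)
 moreover have "finite (fst Z \<rightarrow>\<^sub>E {0..<int p})" using finZ by (simp add: finite_PiE)
 ultimately show ?thesis using finite_subset finite_imageD by metis
qed

lemma fp_pow: "u \<in> carrier VV \<Longrightarrow> u [^]\<^bsub>VV\<^esub> n = (\<lambda>z. (int n * u z) mod int p)" for n :: nat
proof (induction n)
 case 0
 then show ?case by (simp add: fp_simps nat_pow_def)
next
 case (Suc n)
 have "u [^]\<^bsub>VV\<^esub> Suc n = u [^]\<^bsub>VV\<^esub> n \<otimes>\<^bsub>VV\<^esub> u" by (simp add: nat_pow_def)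
 then show ?case using Suc by (simp add: fp_simps mod_simps algebra_simps)
qed

lemma fp_semisimple: "semisimple_space VV G (fp_action G Z) p"
proof -
 interpret V: comm_group VV by (rule fp_comm_group)
 note cl = group_action_closed[OF act]
 show ?thesis
 proof
  show "v [^]\<^bsub>VV\<^esub> p = \<one>\<^bsub>VV\<^esub>" if "v \<in> carrier VV" for v using fp_pow[OF that] by (simp add: fp_simps)
  show "fp_action G Z g v \<in> carrier VV" if "g \<in> carrier G" "v \<in> carrier VV" for g v
   using that cl by (simp add: fp_action_def fp_carrier)
  show "fp_action G Z g (u \<otimes>\<^bsub>VV\<^esub> v) = fp_action G Z g u \<otimes>\<^bsub>VV\<^esub> fp_action G Z g v" for g u v
   by (auto simp: fp_action_def fp_simps)
  show "fp_action G Z \<one> v = v" if "v \<in> carrier VV" for v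
   using that group_action_one[OF act] by (auto simp: fp_action_def fp_carrier fun_eq_iff)
  show "fp_action G Z (g \<otimes> h) v = fp_action G Z g (fp_action G Z h v)" if "g \<in> carrier G" "h \<in> carrier G" for g h v
   using that cl by (auto simp: fp_action_def inv_mult_group group_action_mult[OF act])
 qed (use finG G p pG fp_finite in auto)
qed

interpretation semisimple_space VV G "fp_action G Z" p by (rule fp_semisimple)

definition gstable :: "'z set \<Rightarrow> bool" where
 "gstable S \<longleftrightarrow> S \<subseteq> fst Z \<and> (\<forall>g\<in>carrier G. \<forall>z\<in>S. snd Z g z \<in> S)"

lemma gstable_iff:
 assumes S: "gstable S" and g: "g \<in> carrier G" and z: "z \<in> fst Z"
 shows "snd Z g z \<in> S \<longleftrightarrow> z \<in> S"
proof
 assume "snd Z g z \<in> S"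
 then have "snd Z (inv g) (snd Z g z) \<in> S" using S g by (simp add: gstable_def)
 then show "z \<in> S" using group_action_inv(1)[OF act g z] by simp
qed (use S g in \<open>simp add: gstable_def\<close>)

abbreviation (input) "MM \<equiv> fp_supp p (fst Z)"

lemma supp_stable:
 assumes S: "gstable S"
 shows "stable (MM S)"
 unfolding stable_def
proof (intro conjI ballI)
 show "subgroup (MM S) VV"
 proof (rule V.subgroupI)
  show "MM S \<noteq> {}" using V.one_closed by (auto simp: fp_supp_def fp_simps(2))
  fix u assume u: "u \<in> MM S"
  have "inv\<^bsub>VV\<^esub> u = (\<lambda>z. (- u z) mod int p)"
   by (rule V.inv_equality) (use u p_pos in \<open>auto simp: fp_supp_def fp_simps fp_carrier mod_simps\<close>)
  then show "inv\<^bsub>VV\<^esub> u \<in> MM S" using u V.inv_closed[of u] by (simp add: fp_supp_def)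
  fix v assume "v \<in> MM S"
  then show "u \<otimes>\<^bsub>VV\<^esub> v \<in> MM S" using u V.m_closed[of u v] by (simp add: fp_supp_def fp_simps(1))
 qed (auto simp: fp_supp_def)
 fix g v assume g: "g \<in> carrier G" and v: "v \<in> MM S"
 then show "fp_action G Z g v \<in> MM S"
  using \<alpha>_closed[OF g, of v] gstable_iff[OF S, of "inv g"] by (auto simp: fp_supp_def fp_action_def)
qed

lemma basis_supp: "gstable S \<Longrightarrow> x \<in> S \<Longrightarrow> fp_basis x \<in> MM S"
 using p_pos by (auto simp: fp_supp_def fp_carrier fp_basis_def gstable_def)

lemma fp_action_basis:
 assumes g: "g \<in> carrier G" and x: "x \<in> fst Z"
 shows "fp_action G Z g (fp_basis x) = fp_basis (snd Z g x)"
proof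
 fix z
 have "snd Z (inv g) z = x \<longleftrightarrow> z = snd Z g x" if "z \<in> fst Z"
  using group_action_inv[OF act g x] group_action_inv[OF act g that] by metis
 then show "fp_action G Z g (fp_basis x) z = fp_basis (snd Z g x) z"
  using group_action_closed[OF act g x] by (auto simp: fp_action_def fp_basis_def)
qed

lemma Homs_pow:
 assumes f: "f \<in> Homs (MM S) (MM T)" and S: "gstable S" and T: "gstable T" and u: "u \<in> MM S"
 shows "f (u [^]\<^bsub>VV\<^esub> (n :: nat)) = f u [^]\<^bsub>VV\<^esub> n"
proof (induction n)
 case 0
 then show ?case using Homs_one[OF f supp_stable[OF S] supp_stable[OF T]] by simp
next
 case (Suc n)
 have "u [^]\<^bsub>VV\<^esub> n \<in> MM S" using pow_closed_subgroup[OF stableD(6)[OF supp_stable[OF S]] u] .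
 then show ?case using HomsD(2)[OF f _ u] Suc by simp
qed

text \<open>A homomorphism of elementary abelian groups is linear: each \<open>v\<close> is a
  product of powers of basis vectors, which are collected by induction on a set containing the
  support.\<close>

lemma Homs_matrix:
 assumes f: "f \<in> Homs (MM S) (MM T)" and S: "gstable S" and T: "gstable T" and v: "v \<in> MM S"
 shows "f v y = (\<Sum>x\<in>S. f (fp_basis x) y * v x) mod int p"
proof -
 have finS: "finite S" using S finZ finite_subset by (auto simp: gstable_def)
 note Sd = stableD[OF supp_stable[OF S]] and Td = stableD[OF supp_stable[OF T]] and fD = HomsD[OF f]
 have "f v y = (\<Sum>x\<in>R. f (fp_basis x) y * v x) mod int p" if "finite R" "R \<subseteq> S" "v \<in> MM S" "\<forall>x. x \<notin> R \<longrightarrow> v x = 0" for v R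
  using that
 proof (induction R arbitrary: v)
  case empty
  then have "v = \<one>\<^bsub>VV\<^esub>" by (auto simp: fp_simps)
  then show ?case using Homs_one[OF f supp_stable[OF S] supp_stable[OF T]] by (simp add: fp_simps)
 next
  case (insert a R)
  have aS: "a \<in> S" using insert.prems by simp
  define v' where "v' = v(a := 0)"
  have vV: "v \<in> carrier VV" using insert.prems(2) by (simp add: fp_supp_def)
  have v': "v' \<in> MM S" using insert.prems(2) p_pos by (auto simp: fp_supp_def fp_carrier v'_def)
  have d: "fp_basis a \<in> MM S" by (rule basis_supp[OF S aS])
  define n where "n = nat (v a)"
  have n: "int n = v a" using vV by (cases "a \<in> fst Z") (auto simp: n_def fp_carrier)
  have dn: "fp_basis a [^]\<^bsub>VV\<^esub> n \<in> MM S" using pow_closed_subgroup[OF Sd(6) d] .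
  have "v = v' \<otimes>\<^bsub>VV\<^esub> fp_basis a [^]\<^bsub>VV\<^esub> n"
  proof
   fix z
   show "v z = (v' \<otimes>\<^bsub>VV\<^esub> fp_basis a [^]\<^bsub>VV\<^esub> n) z"
    unfolding fp_pow[OF Sd(8)[OF d]] fp_simps(1)
    using fp_mod[OF vV, of z] by (auto simp: v'_def fp_basis_def n)
  qed
  then have "f v = f v' \<otimes>\<^bsub>VV\<^esub> f (fp_basis a) [^]\<^bsub>VV\<^esub> n"
   using fD(2)[OF v' dn] Homs_pow[OF f S T d] by simp
  then have "f v y = (f v' y + (v a * f (fp_basis a) y) mod int p) mod int p"
   by (simp add: fp_simps(1) fp_pow[OF Td(8)[OF fD(1)[OF d]]] n)
  moreover have "f v' y = (\<Sum>x\<in>R. f (fp_basis x) y * v' x) mod int p"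
  proof (rule insert.IH)
   show "R \<subseteq> S" using insert.prems(1) by simp
   show "v' \<in> MM S" by (rule v')
   show "\<forall>x. x \<notin> R \<longrightarrow> v' x = 0" using insert.prems(3) by (simp add: v'_def)
  qed
  moreover have "(\<Sum>x\<in>R. f (fp_basis x) y * v' x) = (\<Sum>x\<in>R. f (fp_basis x) y * v x)"
   by (rule sum.cong) (use insert.hyps in \<open>auto simp: v'_def\<close>)
  ultimately show ?case using insert.hyps by (simp add: mod_simps algebra_simps)
 qed
 from this[OF finS order_refl v] v show ?thesis by (simp add: fp_supp_def)
qed

text \<open>The entry at \<open>(y, x)\<close> is \<open>f (fp_basis x) y\<close>; equivariance of
  \<open>f\<close> is invariance of the entries under the diagonal action on
  \<open>T \<times> S\<close>.\<close>

lemma card_Homs_supp: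
 assumes S: "gstable S" and T: "gstable T"
 shows "card (Homs (MM S) (MM T)) = card (invariant_funs G p (gset_prod (T, \<lambda>g. restrict (snd Z g) T) (S, \<lambda>g. restrict (snd Z g) S)))"
proof -
 have finS: "finite S" using S finZ finite_subset by (auto simp: gstable_def)
 have SZ: "x \<in> fst Z" if "x \<in> S" for x using S that by (auto simp: gstable_def)
 have TZ: "x \<in> fst Z" if "x \<in> T" for x using T that by (auto simp: gstable_def)
 have Sc: "snd Z g x \<in> S" if "x \<in> S" "g \<in> carrier G" for x g using S that by (auto simp: gstable_def)
 have Tc: "snd Z g x \<in> T" if "x \<in> T" "g \<in> carrier G" for x g using T that by (auto simp: gstable_def)
 let ?W = "gset_prod (T, \<lambda>g. restrict (snd Z g) T) (S, \<lambda>g. restrict (snd Z g) S)"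
 have W: "t \<in> invariant_funs G p ?W \<longleftrightarrow> (\<forall>y\<in>T. \<forall>x\<in>S. 0 \<le> t (y, x) \<and> t (y, x) < int p) \<and>
  (\<forall>w. w \<notin> T \<times> S \<longrightarrow> t w = 0) \<and> (\<forall>g\<in>carrier G. \<forall>y\<in>T. \<forall>x\<in>S. t (snd Z g y, snd Z g x) = t (y, x))" for t
  by (simp add: invariant_funs_def gset_prod_def)
 note Sd = stableD[OF supp_stable[OF S]] and Td = stableD[OF supp_stable[OF T]]
 define I where "I = (\<lambda>f w. if w \<in> T \<times> S then f (fp_basis (snd w)) (fst w) else (0 :: int))"
 define J where "J = (\<lambda>t. \<lambda>v\<in>MM S. \<lambda>y. if y \<in> T then (\<Sum>x\<in>S. t (y, x) * v x) mod int p else (0 :: int))"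
 have IJ: "I f \<in> invariant_funs G p ?W" if f: "f \<in> Homs (MM S) (MM T)" for f
  unfolding W
 proof (intro conjI ballI allI impI)
  note fD = HomsD[OF f]
  fix y x assume y: "y \<in> T" and x: "x \<in> S"
  have fb: "f (fp_basis x) \<in> carrier VV" using Td(8) fD(1)[OF basis_supp[OF S x]] by simp
  then show "0 \<le> I f (y, x)" "I f (y, x) < int p" using y x TZ by (auto simp: I_def fp_carrier)
  fix g assume g: "g \<in> carrier G"
  have "f (fp_basis (snd Z g x)) = fp_action G Z g (f (fp_basis x))"
   using fD(3)[OF g basis_supp[OF S x]] fp_action_basis[OF g SZ[OF x]] by simp
  then have "f (fp_basis (snd Z g x)) (snd Z g y) = f (fp_basis x) y"
   using group_action_inv(1)[OF act g TZ[OF y]] group_action_closed[OF act g TZ[OF y]] by (simp add: fp_action_def)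
  then show "I f (snd Z g y, snd Z g x) = I f (y, x)" using x y Sc[OF x g] Tc[OF y g] by (simp add: I_def)
 next
  fix w assume "w \<notin> T \<times> S"
  then show "I f w = 0" by (simp only: I_def if_False)
 qed
 have JI: "J t \<in> Homs (MM S) (MM T)" if t: "t \<in> invariant_funs G p ?W" for t
 proof -
  have Jc: "J t v \<in> MM T" if "v \<in> MM S" for v
   using that p_pos TZ by (auto simp: J_def fp_supp_def fp_carrier)
  have Ja: "J t (u \<otimes>\<^bsub>VV\<^esub> v) = J t u \<otimes>\<^bsub>VV\<^esub> J t v" if u: "u \<in> MM S" and v: "v \<in> MM S" for u v
  proof
   fix y
   have "(\<Sum>x\<in>S. t (y, x) * ((u x + v x) mod int p)) mod int p = (\<Sum>x\<in>S. t (y, x) * (u x + v x)) mod int p"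
    by (subst (1 2) mod_sum_eq[symmetric]) (simp add: mod_simps)
   then show "J t (u \<otimes>\<^bsub>VV\<^esub> v) y = (J t u \<otimes>\<^bsub>VV\<^esub> J t v) y"
    using u v Sd(3)[OF u v] by (simp add: J_def fp_simps(1) mod_simps sum.distrib algebra_simps)
  qed
  have Jg: "J t (fp_action G Z g v) = fp_action G Z g (J t v)" if g: "g \<in> carrier G" and v: "v \<in> MM S" for g v
  proof
   fix y
   show "J t (fp_action G Z g v) y = fp_action G Z g (J t v) y"
   proof (cases "y \<in> T")
    case True
    have ig: "inv g \<in> carrier G" using g by simp
    have "(\<Sum>x\<in>S. t (y, x) * fp_action G Z g v x) = (\<Sum>x\<in>S. t (snd Z (inv g) y, snd Z (inv g) x) * v (snd Z (inv g) x))"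
     by (rule sum.cong[OF refl]) (use t True ig SZ in \<open>simp add: W fp_action_def\<close>)
    also have "\<dots> = (\<Sum>x\<in>S. t (snd Z (inv g) y, x) * v x)"
    proof (rule sum.reindex_bij_betw)
     show "bij_betw (snd Z (inv g)) S S"
      by (rule bij_betw_byWitness[where f' = "snd Z g"])
       (use Sc[OF _ g] Sc[OF _ ig] SZ group_action_inv[OF act g] in auto)
    qed
    finally have "(\<Sum>x\<in>S. t (y, x) * fp_action G Z g v x) = (\<Sum>x\<in>S. t (snd Z (inv g) y, x) * v x)" .
    then show ?thesis using True Tc[OF True ig] TZ[OF True] Sd(5)[OF g v] v by (simp add: J_def fp_action_def)
   next
    case False
    then show ?thesis using gstable_iff[OF T, of "inv g" y] Sd(5)[OF g v] v g by (simp add: J_def fp_action_def)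
   qed
  qed
  show ?thesis unfolding Homs_def using Jc Ja Jg by (auto simp: J_def)
 qed
 have "bij_betw I (Homs (MM S) (MM T)) (invariant_funs G p ?W)"
 proof (rule bij_betw_byWitness[where f' = J])
  show "\<forall>f\<in>Homs (MM S) (MM T). J (I f) = f"
  proof
   fix f assume f: "f \<in> Homs (MM S) (MM T)"
   show "J (I f) = f"
   proof (rule extensionalityI[where A = "MM S"])
    fix v assume v: "v \<in> MM S"
    show "J (I f) v = f v"
    proof
     fix y
     have "f v y = 0" if "y \<notin> T" using HomsD(1)[OF f v] that by (simp add: fp_supp_def)
     moreover have "(\<Sum>x\<in>S. I f (y, x) * v x) = (\<Sum>x\<in>S. f (fp_basis x) y * v x)" if "y \<in> T"
      by (rule sum.cong) (use that in \<open>auto simp: I_def\<close>)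
     ultimately show "J (I f) v y = f v y" using Homs_matrix[OF f S T v, of y] v by (simp add: J_def)
    qed
   qed (use HomsD(4)[OF f] in \<open>auto simp: J_def\<close>)
  qed
  show "\<forall>t\<in>invariant_funs G p ?W. I (J t) = t"
  proof (intro ballI ext)
   fix t w assume t: "t \<in> invariant_funs G p ?W"
   show "I (J t) w = t w"
   proof (cases "w \<in> T \<times> S")
    case True
    then obtain y x where w: "w = (y, x)" "y \<in> T" "x \<in> S" by auto
    have "(\<Sum>x'\<in>S. t (y, x') * fp_basis x x') = t (y, x)"
     using w(3) finS by (simp add: fp_basis_def if_distrib[of "\<lambda>a. _ * a"] sum.delta cong: if_cong)
    then show ?thesis using w t basis_supp[OF S w(3)] by (simp add: I_def J_def W)
   next
    case False
    then have "t w = 0" using t unfolding W by meson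
    then show ?thesis using False by (simp only: I_def if_False)
   qed
  qed
 qed (use IJ JI in auto)
 then show ?thesis by (rule bij_betw_same_card)
qed

text \<open>The exponent \<open>n\<close> is the number of orbits on \<open>T \<times> S\<close>.
  Burnside's lemma expresses it by the fixed-point numbers of single elements on \<open>S\<close>
  and \<open>T\<close>.\<close>

lemma card_Homs_supp_orbits:
 assumes S: "gstable S" and T: "gstable T"
 obtains n where "card (Homs (MM S) (MM T)) = p ^ n"
  and "n * card (carrier G) = (\<Sum>g\<in>carrier G. card {z \<in> T. snd Z g z = z} * card {z \<in> S. snd Z g z = z})"
proof -
 let ?T = "(T, \<lambda>g. restrict (snd Z g) T)" and ?S = "(S, \<lambda>g. restrict (snd Z g) S)"
 let ?W = "gset_prod ?T ?S"
 have fin: "finite S" "finite T" using S T finZ finite_subset by (auto simp: gstable_def)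
 have aS: "group_action G (fst ?S) (snd ?S)" "group_action G (fst ?T) (snd ?T)"
  using group_action_sub[OF act] S T by (auto simp: gstable_def)
 have aW: "group_action G (fst ?W) (snd ?W)" by (rule gset_prod_action[OF aS(2,1)])
 interpret W: group_action G "fst ?W" "snd ?W" by (rule aW)
 have finW: "finite (fst ?W)" using fin by (simp add: gset_prod_def)
 have "card (orbits G (fst ?W) (snd ?W)) * card (carrier G) = (\<Sum>g\<in>carrier G. card (invariants (fst ?W) (snd ?W) g))"
  using W.burnside[OF finG finW] by (simp add: order_def)
 also have "\<dots> = (\<Sum>g\<in>carrier G. card {z \<in> T. snd Z g z = z} * card {z \<in> S. snd Z g z = z})"
 proof (rule sum.cong[OF refl])
  fix g
  have "invariants (fst ?W) (snd ?W) g = {z \<in> T. snd Z g z = z} \<times> {z \<in> S. snd Z g z = z}"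
   by (auto simp: invariants_def gset_prod_def)
  then show "card (invariants (fst ?W) (snd ?W) g) = card {z \<in> T. snd Z g z = z} * card {z \<in> S. snd Z g z = z}"
   by (simp add: card_cartesian_product)
 qed
 finally show thesis
  using that card_Homs_supp[OF S T] card_invariant_funs[OF aW finW] by metis
qed

text \<open>Equal fixed-point numbers make all four groups of homomorphisms equally large, which is
  more than \<open>Homs_card_eq_imp_iso\<close> asks for.\<close>

lemma supp_iso:
 assumes S: "gstable S" and T: "gstable T"
  and eq: "\<And>g. g \<in> carrier G \<Longrightarrow> card {z \<in> S. snd Z g z = z} = card {z \<in> T. snd Z g z = z}"
 shows "\<exists>t\<in>Homs (MM S) (MM T). bij_betw t (MM S) (MM T)"
proof (rule Homs_card_eq_imp_iso[OF supp_stable[OF S] supp_stable[OF T]])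
 have c: "card (carrier G) > 0" using finG one_closed card_gt_0_iff by blast
 obtain a where a: "card (Homs (MM S) (MM S)) = p ^ a"
  "a * card (carrier G) = (\<Sum>g\<in>carrier G. card {z \<in> S. snd Z g z = z} * card {z \<in> S. snd Z g z = z})"
  using card_Homs_supp_orbits[OF S S] .
 obtain b where b: "card (Homs (MM T) (MM T)) = p ^ b"
  "b * card (carrier G) = (\<Sum>g\<in>carrier G. card {z \<in> T. snd Z g z = z} * card {z \<in> T. snd Z g z = z})"
  using card_Homs_supp_orbits[OF T T] .
 obtain d where d: "card (Homs (MM S) (MM T)) = p ^ d"
  "d * card (carrier G) = (\<Sum>g\<in>carrier G. card {z \<in> T. snd Z g z = z} * card {z \<in> S. snd Z g z = z})"
  using card_Homs_supp_orbits[OF S T] .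
 obtain e where e: "card (Homs (MM T) (MM S)) = p ^ e"
  "e * card (carrier G) = (\<Sum>g\<in>carrier G. card {z \<in> S. snd Z g z = z} * card {z \<in> T. snd Z g z = z})"
  using card_Homs_supp_orbits[OF T S] .
 have "a * card (carrier G) = b * card (carrier G)" "d * card (carrier G) = b * card (carrier G)"
  "e * card (carrier G) = b * card (carrier G)"
  unfolding a b d e by (rule sum.cong[OF refl], simp add: eq)+
 then have "a = b" "d = b" "e = b" using c by auto
 then show "card (Homs (MM S) (MM S)) * card (Homs (MM T) (MM T)) = card (Homs (MM S) (MM T)) * card (Homs (MM T) (MM S))"
  by (simp add: a b d e)
qed

text \<open>The entries are natural numbers, so that they act on modules over any ring. Those of
  \<open>t\<close> are invariant exactly and not only modulo \<open>p\<close>, so the map that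
  \<open>t\<close> defines over \<open>F\<close> is still equivariant; only invertibility has to be
  lifted.\<close>

lemma supp_iso_matrices:
 assumes S: "gstable S" and T: "gstable T"
  and eq: "\<And>g. g \<in> carrier G \<Longrightarrow> card {z \<in> S. snd Z g z = z} = card {z \<in> T. snd Z g z = z}"
 obtains t s :: "'z \<Rightarrow> 'z \<Rightarrow> nat" where
  "\<And>g x y. \<lbrakk>g \<in> carrier G; x \<in> S; y \<in> T\<rbrakk> \<Longrightarrow> t (snd Z g y) (snd Z g x) = t y x"
  "\<And>x x'. \<lbrakk>x \<in> S; x' \<in> S\<rbrakk> \<Longrightarrow> (\<Sum>y\<in>T. s x y * t y x') mod p = (if x = x' then 1 else 0)"
  "\<And>y y'. \<lbrakk>y \<in> T; y' \<in> T\<rbrakk> \<Longrightarrow> (\<Sum>x\<in>S. t y x * s x y') mod p = (if y = y' then 1 else 0)"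
proof -
 obtain \<theta> where \<theta>: "\<theta> \<in> Homs (MM S) (MM T)" "bij_betw \<theta> (MM S) (MM T)" using supp_iso[OF assms] by blast
 define \<eta> where "\<eta> = (\<lambda>y\<in>MM T. inv_into (MM S) \<theta> y)"
 have \<eta>: "\<eta> \<in> Homs (MM T) (MM S)" unfolding \<eta>_def
  by (rule Homs_inverse(1)[OF \<theta> supp_stable[OF S] supp_stable[OF T]])
 have \<eta>\<theta>: "\<eta> (\<theta> v) = v" if "v \<in> MM S" for v
  using \<theta>(2) that HomsD(1)[OF \<theta>(1) that] by (simp add: \<eta>_def bij_betw_def)
 have \<theta>\<eta>: "\<theta> (\<eta> v) = v" if "v \<in> MM T" for v
  using \<theta>(2) that by (auto simp: \<eta>_def bij_betw_def f_inv_into_f)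
 have SZ: "x \<in> fst Z" if "x \<in> S" for x using S that by (auto simp: gstable_def)
 have TZ: "x \<in> fst Z" if "x \<in> T" for x using T that by (auto simp: gstable_def)
 have nn: "0 \<le> v z" if "v \<in> MM R" for v z R
  using that by (cases "z \<in> fst Z") (auto simp: fp_supp_def fp_carrier)
 define t where "t = (\<lambda>y x. nat (\<theta> (fp_basis x) y))"
 define s where "s = (\<lambda>x y. nat (\<eta> (fp_basis y) x))"
 have t: "int (t y x) = \<theta> (fp_basis x) y" if "x \<in> S" for x y
  using nn[OF HomsD(1)[OF \<theta>(1) basis_supp[OF S that]]] by (simp add: t_def)
 have s: "int (s x y) = \<eta> (fp_basis y) x" if "y \<in> T" for x y
  using nn[OF HomsD(1)[OF \<eta> basis_supp[OF T that]]] by (simp add: s_def)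
 show thesis
 proof (rule that)
  fix g x y assume g: "g \<in> carrier G" and x: "x \<in> S" and y: "y \<in> T"
  have "\<theta> (fp_basis (snd Z g x)) = fp_action G Z g (\<theta> (fp_basis x))"
   using HomsD(3)[OF \<theta>(1) g basis_supp[OF S x]] fp_action_basis[OF g SZ[OF x]] by simp
  then show "t (snd Z g y) (snd Z g x) = t y x"
   using group_action_inv(1)[OF act g TZ[OF y]] group_action_closed[OF act g TZ[OF y]] by (simp add: fp_action_def t_def)
 next
  fix x x' assume x: "x \<in> S" and x': "x' \<in> S"
  have "int ((\<Sum>y\<in>T. s x y * t y x') mod p) = (\<Sum>y\<in>T. \<eta> (fp_basis y) x * \<theta> (fp_basis x') y) mod int p"
   by (simp add: zmod_int s t x')
  also have "\<dots> = \<eta> (\<theta> (fp_basis x')) x"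
   using Homs_matrix[OF \<eta> T S HomsD(1)[OF \<theta>(1) basis_supp[OF S x']]] by simp
  also have "\<dots> = (if x = x' then 1 else 0)" using \<eta>\<theta>[OF basis_supp[OF S x']] by (simp add: fp_basis_def)
  finally show "(\<Sum>y\<in>T. s x y * t y x') mod p = (if x = x' then 1 else 0)" by (simp split: if_splits)
 next
  fix y y' assume y: "y \<in> T" and y': "y' \<in> T"
  have "int ((\<Sum>x\<in>S. t y x * s x y') mod p) = (\<Sum>x\<in>S. \<theta> (fp_basis x) y * \<eta> (fp_basis y') x) mod int p"
   by (simp add: zmod_int s t y')
  also have "\<dots> = \<theta> (\<eta> (fp_basis y')) y"
   using Homs_matrix[OF \<theta>(1) S T HomsD(1)[OF \<eta> basis_supp[OF T y']]] by simp
  also have "\<dots> = (if y = y' then 1 else 0)" using \<theta>\<eta>[OF basis_supp[OF T y']] by (simp add: fp_basis_def)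
  finally show "(\<Sum>x\<in>S. t y x * s x y') mod p = (if y = y' then 1 else 0)" by (simp split: if_splits)
 qed
qed

end

subsection \<open>Lifting isomorphisms to local rings\<close>

text \<open>Elimination: the operator for \<open>insert a S\<close> is the composite of an operator for \<open>S\<close> and the
 one for \<open>{a}\<close>, and the latter is invertible because \<open>1 + \<eta> a a\<close> is a unit.\<close>

lemma perturbation_bij:
 fixes F :: "('f, 'c) ring_scheme" (structure) and \<eta> :: "'x \<Rightarrow> 'x \<Rightarrow> 'f"
 assumes m: "residue_char_ideal F m p" and p: "prime p" and S: "finite S" and \<eta>: "\<And>x b. \<eta> x b \<in> m"
 shows "bij_betw (\<lambda>f x. f x \<oplus> (\<Oplus>b\<in>S. \<eta> x b \<otimes> f b)) (UNIV \<rightarrow> carrier F) (UNIV \<rightarrow> carrier F)"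
 using S \<eta>
proof (induction S arbitrary: \<eta>)
 case empty
 interpret cring F using m by (simp add: residue_char_ideal_def)
 have "bij_betw (\<lambda>f. f) (UNIV \<rightarrow> carrier F) (UNIV \<rightarrow> carrier F)" by (simp add: bij_betw_def)
 then show ?case by (rule bij_betw_cong[THEN iffD1, rotated]) (auto simp: fun_eq_iff Pi_iff)
next
 case (insert a S)
 interpret cring F using m by (simp add: residue_char_ideal_def)
 interpret m: ideal m F using m by (simp add: residue_char_ideal_def)
 note \<eta>m = insert.prems
 have \<eta>F: "\<eta> x b \<in> carrier F" for x b using m.a_subset \<eta>m by blast
 have "\<not> p dvd 1" using prime_gt_1_nat[OF p] by simp
 then have "[(1::nat)] \<cdot> \<one> \<notin> m" using m unfolding residue_char_ideal_def by blast
 then have one: "\<one> \<notin> m" by (simp add: add.nat_pow_eone)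
 have "\<one> \<oplus> \<eta> a a \<notin> m"
 proof
  assume "\<one> \<oplus> \<eta> a a \<in> m"
  then have "\<one> \<oplus> \<eta> a a \<oplus> (\<ominus> \<eta> a a) \<in> m" using \<eta>m by simp
  moreover have "\<one> \<oplus> \<eta> a a \<oplus> (\<ominus> \<eta> a a) = \<one>" using \<eta>F by (simp add: a_assoc r_neg)
  ultimately show False using one by simp
 qed
 then have "\<one> \<oplus> \<eta> a a \<in> Units F" using m \<eta>F by (simp add: residue_char_ideal_def)
 then obtain w where w: "w \<in> carrier F" "w \<otimes> (\<one> \<oplus> \<eta> a a) = \<one>" by (auto simp: Units_def)
 define U where "U = (\<lambda>f (x :: 'x). f x \<oplus> \<eta> x a \<otimes> f a)"
 \<comment> \<open>\<open>U\<close> multiplies the coordinate at \<open>a\<close> by the unit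
   \<open>1 + \<eta> a a\<close>, with inverse \<open>w\<close>; the old coordinate is recovered
   from the new one and its contribution is subtracted everywhere.\<close>
 define U' where "U' = (\<lambda>f (x :: 'x). f x \<ominus> \<eta> x a \<otimes> (w \<otimes> f a))"
 have e1: "w \<otimes> (z \<oplus> \<eta> a a \<otimes> z) = z" if "z \<in> carrier F" for z
 proof -
  have "w \<otimes> (z \<oplus> \<eta> a a \<otimes> z) = w \<otimes> (\<one> \<oplus> \<eta> a a) \<otimes> z" using w(1) \<eta>F that by algebra
  then show ?thesis using w(2) that by simp
 qed
 have e2: "z \<ominus> \<eta> a a \<otimes> (w \<otimes> z) = w \<otimes> z" if "z \<in> carrier F" for z
 proof -
  have "z \<ominus> \<eta> a a \<otimes> (w \<otimes> z) = w \<otimes> (z \<oplus> \<eta> a a \<otimes> z) \<ominus> \<eta> a a \<otimes> (w \<otimes> z)" using e1[OF that] by simp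
  also have "\<dots> = w \<otimes> z" using w(1) \<eta>F that by algebra
  finally show ?thesis .
 qed
 have U: "bij_betw U (UNIV \<rightarrow> carrier F) (UNIV \<rightarrow> carrier F)"
 proof (rule bij_betw_byWitness[where f' = U'])
  show "\<forall>f\<in>UNIV \<rightarrow> carrier F. U' (U f) = f"
  proof (intro ballI ext)
   fix f :: "'x \<Rightarrow> 'f" and x assume "f \<in> UNIV \<rightarrow> carrier F"
   then have f: "f y \<in> carrier F" for y by auto
   have "U' (U f) x = f x \<oplus> \<eta> x a \<otimes> f a \<ominus> \<eta> x a \<otimes> (w \<otimes> (f a \<oplus> \<eta> a a \<otimes> f a))" by (simp add: U_def U'_def)
   also have "\<dots> = f x" unfolding e1[OF f] using f[of x] f[of a] \<eta>F[of x a] by algebra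
   finally show "U' (U f) x = f x" .
  qed
  show "\<forall>f\<in>UNIV \<rightarrow> carrier F. U (U' f) = f"
  proof (intro ballI ext)
   fix f :: "'x \<Rightarrow> 'f" and x assume "f \<in> UNIV \<rightarrow> carrier F"
   then have f: "f y \<in> carrier F" for y by auto
   have "U (U' f) x = f x \<ominus> \<eta> x a \<otimes> (w \<otimes> f a) \<oplus> \<eta> x a \<otimes> (f a \<ominus> \<eta> a a \<otimes> (w \<otimes> f a))" by (simp add: U_def U'_def)
   also have "\<dots> = f x" unfolding e2[OF f] using f[of x] f[of a] \<eta>F[of x a] w(1) by algebra
   finally show "U (U' f) x = f x" .
  qed
 qed (use \<eta>F w in \<open>auto simp: U_def U'_def Pi_iff\<close>)
 \<comment> \<open>Solves
   \<open>\<eta>' x b + \<eta> x a \<otimes> \<eta>' a b = \<eta> x b\<close>, the condition that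
   \<open>U\<close> composed with the operator of \<open>\<eta>'\<close> on \<open>S\<close> is the
   operator of \<open>\<eta>\<close> on \<open>insert a S\<close>.\<close>
 define \<eta>' where "\<eta>' = (\<lambda>x b. \<eta> x b \<ominus> \<eta> x a \<otimes> (w \<otimes> \<eta> a b))"
 have \<eta>'m: "\<eta>' x b \<in> m" for x b
  using \<eta>m \<eta>F w(1) m.I_r_closed by (simp add: \<eta>'_def a_minus_def)
 have \<eta>'F: "\<eta>' x b \<in> carrier F" for x b using m.a_subset \<eta>'m by blast
 let ?B = "\<lambda>f x. f x \<oplus> (\<Oplus>b\<in>S. \<eta>' x b \<otimes> f b)"
 have eq: "\<eta>' x b \<oplus> \<eta> x a \<otimes> \<eta>' a b = \<eta> x b" for x b
  unfolding \<eta>'_def e2[OF \<eta>F] using \<eta>F[of x b] \<eta>F[of x a] \<eta>F[of a b] w(1) by algebra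
 have "bij_betw (U \<circ> ?B) (UNIV \<rightarrow> carrier F) (UNIV \<rightarrow> carrier F)"
  using bij_betw_trans[OF insert.IH[OF \<eta>'m] U] .
 moreover have "(U \<circ> ?B) f = (\<lambda>x. f x \<oplus> (\<Oplus>b\<in>insert a S. \<eta> x b \<otimes> f b))" if "f \<in> UNIV \<rightarrow> carrier F" for f
 proof
  fix x
  have f: "f y \<in> carrier F" for y using that by auto
  let ?s = "\<lambda>x. \<Oplus>b\<in>S. \<eta>' x b \<otimes> f b"
  have s: "?s x \<in> carrier F" for x using f \<eta>'F by simp
  have "?s x \<oplus> \<eta> x a \<otimes> ?s a = (\<Oplus>b\<in>S. \<eta>' x b \<otimes> f b \<oplus> \<eta> x a \<otimes> (\<eta>' a b \<otimes> f b))"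
   using insert.hyps(1) f \<eta>'F \<eta>F by (simp add: finsum_rdistr finsum_addf Pi_iff)
  also have "\<dots> = (\<Oplus>b\<in>S. \<eta> x b \<otimes> f b)"
  proof (rule finsum_cong')
   fix b
   have "\<eta>' x b \<otimes> f b \<oplus> \<eta> x a \<otimes> (\<eta>' a b \<otimes> f b) = (\<eta>' x b \<oplus> \<eta> x a \<otimes> \<eta>' a b) \<otimes> f b"
    using \<eta>'F[of x b] \<eta>'F[of a b] \<eta>F[of x a] f[of b] by algebra
   then show "\<eta>' x b \<otimes> f b \<oplus> \<eta> x a \<otimes> (\<eta>' a b \<otimes> f b) = \<eta> x b \<otimes> f b" by (simp add: eq)
  qed (use f \<eta>F in auto)
  finally have s2: "?s x \<oplus> \<eta> x a \<otimes> ?s a = (\<Oplus>b\<in>S. \<eta> x b \<otimes> f b)" .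
  have "(U \<circ> ?B) f x = f x \<oplus> ?s x \<oplus> \<eta> x a \<otimes> (f a \<oplus> ?s a)" by (simp add: U_def)
  also have "\<dots> = f x \<oplus> (\<eta> x a \<otimes> f a \<oplus> (?s x \<oplus> \<eta> x a \<otimes> ?s a))"
   using s f \<eta>F by (simp add: r_distr a_ac)
  also have "\<dots> = f x \<oplus> (\<Oplus>b\<in>insert a S. \<eta> x b \<otimes> f b)"
   unfolding s2 using insert.hyps f \<eta>F by (simp add: finsum_insert)
  finally show "(U \<circ> ?B) f x = f x \<oplus> (\<Oplus>b\<in>insert a S. \<eta> x b \<otimes> f b)" .
 qed
 ultimately show ?case by (rule bij_betw_cong[THEN iffD1, rotated])
qed

definition matrix_map :: "('f, 'c) ring_scheme \<Rightarrow> 'y set \<Rightarrow> 'x set \<Rightarrow> ('y \<Rightarrow> 'x \<Rightarrow> nat) \<Rightarrow> ('x \<Rightarrow> 'f) \<Rightarrow> ('y \<Rightarrow> 'f)" where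
 "matrix_map F Y X t f = (\<lambda>y. if y \<in> Y then finsum F (\<lambda>x. [t y x] \<cdot>\<^bsub>F\<^esub> f x) X else \<zero>\<^bsub>F\<^esub>)"

section \<open>Matrices of natural numbers over local rings\<close>

context
 fixes F :: "('f, 'c) ring_scheme" (structure) and m :: "'f set" and p :: nat
 assumes m: "residue_char_ideal F m p" and p: "prime p"
begin

interpretation cring F using m by (simp add: residue_char_ideal_def)

lemma add_pow_add: "x \<in> carrier F \<Longrightarrow> y \<in> carrier F \<Longrightarrow> [n] \<cdot> (x \<oplus> y) = [n] \<cdot> x \<oplus> [n] \<cdot> y" for n :: nat
 by (rule add.nat_pow_distrib)

lemma add_pow_zero: "[n] \<cdot> \<zero> = \<zero>" for n :: nat
 using add_pow_ldistr[OF zero_closed one_closed, of n] by simp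

lemma matrix_map_closed:
 "finite Y \<Longrightarrow> f \<in> carrier (free_module F X) \<Longrightarrow> finite X \<Longrightarrow> matrix_map F Y X t f \<in> carrier (free_module F Y)"
 by (auto simp: free_module_carrier matrix_map_def intro!: finsum_closed)

text \<open>Composition corresponds to the product of matrices over the natural numbers, so
  congruences modulo \<open>p\<close> can be used before passing to \<open>F\<close>.\<close>

lemma matrix_map_comp:
 fixes X :: "'x set" and Y :: "'y set"
 assumes X: "finite X" and Y: "finite Y" and f: "f \<in> carrier (free_module F X)"
 shows "matrix_map F Z Y s (matrix_map F Y X t f) = matrix_map F Z X (\<lambda>z x. \<Sum>y\<in>Y. s z y * t y x) f"
proof -
 have fF: "f x \<in> carrier F" for x using f X by (simp add: free_module_carrier)
 have one: "(\<Oplus>y\<in>Y. [s y] \<cdot> ([t y] \<cdot> a)) = [(\<Sum>y\<in>Y. s y * t y)] \<cdot> a"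
  if "a \<in> carrier F" for a and s t :: "'y \<Rightarrow> nat"
  using Y that by (induction Y rule: finite_induct) (auto simp: add.nat_pow_pow add.nat_pow_mult mult.commute Pi_iff)
 have "(\<Oplus>y\<in>Y. [s y] \<cdot> (\<Oplus>x\<in>X. [t y x] \<cdot> f x)) = (\<Oplus>x\<in>X. [(\<Sum>y\<in>Y. s y * t y x)] \<cdot> f x)" for s :: "'y \<Rightarrow> nat" and t
  using X
 proof (induction X rule: finite_induct)
  case empty
  have "(\<Oplus>y\<in>Y. [s y] \<cdot> \<zero>) = (\<Oplus>y\<in>Y. \<zero>)" by (rule finsum_cong') (simp_all add: add_pow_zero)
  then show ?case by simp
 next
  case (insert a X)
  have "(\<Oplus>y\<in>Y. [s y] \<cdot> (\<Oplus>x\<in>insert a X. [t y x] \<cdot> f x)) =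
   (\<Oplus>y\<in>Y. [s y] \<cdot> ([t y a] \<cdot> f a) \<oplus> [s y] \<cdot> (\<Oplus>x\<in>X. [t y x] \<cdot> f x))"
   using insert.hyps fF by (intro finsum_cong') (auto simp: add_pow_add Pi_iff)
  also have "\<dots> = (\<Oplus>y\<in>Y. [s y] \<cdot> ([t y a] \<cdot> f a)) \<oplus> (\<Oplus>y\<in>Y. [s y] \<cdot> (\<Oplus>x\<in>X. [t y x] \<cdot> f x))"
   using fF by (intro finsum_addf) (auto simp: Pi_iff)
  finally show ?case using insert one[OF fF] fF by (simp add: Pi_iff)
 qed
 from this[of "s z" t for z] show ?thesis
  unfolding matrix_map_def using fF by (auto simp: fun_eq_iff Pi_iff cong: finsum_cong)
qed

text \<open>The difference to the identity matrix has entries divisible by \<open>p\<close>, whose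
  images in \<open>F\<close> lie in \<open>m\<close>, so \<open>perturbation_bij\<close>
  applies.\<close>

lemma near_identity_bij:
 fixes X :: "'x set"
 assumes X: "finite X" and n: "\<And>x x'. \<lbrakk>x \<in> X; x' \<in> X\<rbrakk> \<Longrightarrow> n x x' mod p = (if x = x' then 1 else 0)"
 shows "bij_betw (matrix_map F X X n) (carrier (free_module F X)) (carrier (free_module F X))"
proof -
 define \<delta> where "\<delta> = (\<lambda>x x' :: 'x. if x = x' then 1 else 0 :: nat)"
 define \<eta> where "\<eta> = (\<lambda>x x'. if x \<in> X \<and> x' \<in> X then [(n x x' - \<delta> x x')] \<cdot> \<one> else \<zero>)"
 let ?B = "\<lambda>f x. f x \<oplus> (\<Oplus>b\<in>X. \<eta> x b \<otimes> f b)"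
 \<comment> \<open>The residue of an entry is its Kronecker delta, which therefore does not exceed
   the entry: the subtraction of natural numbers is a true one.\<close>
 have nd: "n x x' = \<delta> x x' + (n x x' - \<delta> x x')" "p dvd n x x' - \<delta> x x'" if "x \<in> X" "x' \<in> X" for x x'
 proof -
  have "\<delta> x x' = n x x' mod p" using n[OF that] by (simp add: \<delta>_def)
  then show "n x x' = \<delta> x x' + (n x x' - \<delta> x x')" "p dvd n x x' - \<delta> x x'" by (simp_all add: dvd_minus_mod)
 qed
 have \<eta>: "\<eta> x b \<in> m" for x b
 proof -
  interpret m: ideal m F using m by (simp add: residue_char_ideal_def)
  show ?thesis using nd(2) m by (simp add: \<eta>_def residue_char_ideal_def)
 qed
 have \<eta>F: "\<eta> x b \<in> carrier F" for x b by (simp add: \<eta>_def)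
 have B: "bij_betw ?B (UNIV \<rightarrow> carrier F) (UNIV \<rightarrow> carrier F)" by (rule perturbation_bij[OF m p X \<eta>])
 \<comment> \<open>Outside \<open>X\<close> the operator changes nothing, so a function vanishes off
   \<open>X\<close> exactly if its image does; this brings the bijection down to
   \<open>free_module F X\<close>.\<close>
 have out: "?B f x = f x" if "x \<notin> X" "f \<in> UNIV \<rightarrow> carrier F" for f x
  using that by (simp add: \<eta>_def finsum_zero Pi_iff cong: finsum_cong)
 have MB: "matrix_map F X X n f = ?B f" if f: "f \<in> carrier (free_module F X)" for f
 proof
  fix x
  have fF: "f x \<in> carrier F" for x using f X by (simp add: free_module_carrier)
  show "matrix_map F X X n f x = ?B f x"
  proof (cases "x \<in> X")
   case True
   have "(\<Oplus>b\<in>X. [n x b] \<cdot> f b) = (\<Oplus>b\<in>X. (if x = b then f b else \<zero>) \<oplus> \<eta> x b \<otimes> f b)"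
   proof (rule finsum_cong')
    fix b assume b: "b \<in> X"
    have "[n x b] \<cdot> f b = [\<delta> x b] \<cdot> f b \<oplus> [(n x b - \<delta> x b)] \<cdot> f b"
     by (subst nd(1)[OF True b]) (simp add: add.nat_pow_mult fF)
    then show "[n x b] \<cdot> f b = (if x = b then f b else \<zero>) \<oplus> \<eta> x b \<otimes> f b"
     using True b fF by (simp add: \<delta>_def \<eta>_def add_pow_ldistr)
   qed (use fF \<eta>F in auto)
   also have "\<dots> = (\<Oplus>b\<in>X. if x = b then f b else \<zero>) \<oplus> (\<Oplus>b\<in>X. \<eta> x b \<otimes> f b)"
    using fF \<eta>F by (intro finsum_addf) (auto simp: Pi_iff)
   also have "(\<Oplus>b\<in>X. if x = b then f b else \<zero>) = f x"
    by (rule finsum_singleton[OF True X]) (use fF in auto)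
   finally show ?thesis using True by (simp add: matrix_map_def)
  next
   case False
   then have "f x = \<zero>" using f X by (simp add: free_module_carrier)
   moreover have "?B f x = f x" by (rule out[OF False]) (use fF in auto)
   ultimately show ?thesis using False by (simp add: matrix_map_def)
  qed
 qed
 have sub: "carrier (free_module F X) = {f \<in> UNIV \<rightarrow> carrier F. \<forall>x. x \<notin> X \<longrightarrow> f x = \<zero>}"
  using X by (auto simp: free_module_carrier Pi_iff)
 have "bij_betw ?B (carrier (free_module F X)) (carrier (free_module F X))"
  unfolding bij_betw_def
 proof (intro conjI equalityI subsetI)
  show "inj_on ?B (carrier (free_module F X))"
   using bij_betw_imp_inj_on[OF B] by (rule inj_on_subset) (auto simp: sub)
 next
  fix h assume "h \<in> ?B ` carrier (free_module F X)"
  then obtain f where "f \<in> carrier (free_module F X)" "h = ?B f" by blast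
  then show "h \<in> carrier (free_module F X)" using MB[of f] matrix_map_closed[OF X _ X, of f n] by simp
 next
  fix h assume h: "h \<in> carrier (free_module F X)"
  then have "h \<in> ?B ` (UNIV \<rightarrow> carrier F)" using B by (simp add: bij_betw_def sub)
  then obtain f where f: "f \<in> UNIV \<rightarrow> carrier F" "h = ?B f" by blast
  have "f x = \<zero>" if "x \<notin> X" for x
   using out[OF that f(1)] h that fun_cong[OF f(2), of x] by (simp add: sub)
  then show "h \<in> ?B ` carrier (free_module F X)" using f by (intro image_eqI[of _ _ f]) (simp_all add: sub)
 qed
 then show ?thesis by (rule bij_betw_cong[THEN iffD1, rotated]) (use MB in auto)
qed

text \<open>Over \<open>F\<close> the two matrices need not be inverse to each other, but both
  composites are bijective by \<open>near_identity_bij\<close>, which makes \<open>t\<close>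
  injective and surjective.\<close>

lemma matrix_map_bij:
 assumes X: "finite X" and Y: "finite Y"
  and st: "\<And>x x'. \<lbrakk>x \<in> X; x' \<in> X\<rbrakk> \<Longrightarrow> (\<Sum>y\<in>Y. s x y * t y x') mod p = (if x = x' then 1 else 0)"
  and ts: "\<And>y y'. \<lbrakk>y \<in> Y; y' \<in> Y\<rbrakk> \<Longrightarrow> (\<Sum>x\<in>X. t y x * s x y') mod p = (if y = y' then 1 else 0)"
 shows "bij_betw (matrix_map F Y X t) (carrier (free_module F X)) (carrier (free_module F Y))"
proof -
 let ?X = "carrier (free_module F X)" and ?Y = "carrier (free_module F Y)"
 let ?t = "matrix_map F Y X t" and ?s = "matrix_map F X Y s"
 have 1: "bij_betw (\<lambda>f. ?s (?t f)) ?X ?X"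
  by (rule bij_betw_cong[THEN iffD1, OF _ near_identity_bij[OF X st]]) (simp_all add: matrix_map_comp[OF X Y])
 have 2: "bij_betw (\<lambda>f. ?t (?s f)) ?Y ?Y"
  by (rule bij_betw_cong[THEN iffD1, OF _ near_identity_bij[OF Y ts]]) (simp_all add: matrix_map_comp[OF Y X])
 show ?thesis unfolding bij_betw_def
 proof (intro conjI equalityI subsetI)
  show "inj_on ?t ?X" using bij_betw_imp_inj_on[OF 1] by (auto simp: inj_on_def)
  show "h \<in> ?Y" if "h \<in> ?t ` ?X" for h using that matrix_map_closed[OF Y _ X] by auto
  show "h \<in> ?t ` ?X" if "h \<in> ?Y" for h
  proof -
   have "h \<in> (\<lambda>f. ?t (?s f)) ` ?Y" using 2 that by (simp add: bij_betw_def)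
   then show ?thesis using matrix_map_closed[OF X _ Y] by auto
  qed
 qed
qed

end

text \<open>The isomorphism over the prime field is found inside the permutation module of the
  disjoint union of \<open>X\<close> and \<open>Y\<close>; its matrix is then used over
  \<open>F\<close>.\<close>

lemma perm_module_iso_of_fixed:
 fixes F :: "('f, 'c) ring_scheme" and G :: "('g, 'b) monoid_scheme"
 assumes m: "residue_char_ideal F m p" and p: "prime p" and G: "group G" and finG: "finite (carrier G)"
  and pG: "\<not> p dvd card (carrier G)" and X: "X \<in> finite_gsets G" and Y: "Y \<in> finite_gsets G"
  and eq: "\<And>g. g \<in> carrier G \<Longrightarrow> card (fixed_points X {g}) = card (fixed_points Y {g})"
 shows "gmodule_iso F G (perm_module F G X) (perm_module F G Y)"
proof -
 interpret F: cring F using m by (simp add: residue_char_ideal_def)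
 interpret group G by (rule G)
 note XD = finite_gsetsD[OF X] and YD = finite_gsetsD[OF Y]
 let ?Z = "gset_sum X Y" and ?S = "Inl ` fst X" and ?T = "Inr ` fst Y"
 have act: "group_action G (fst ?Z) (snd ?Z)" by (rule gset_sum_action) (use XD YD in auto)
 have fin: "finite (fst ?Z)" using XD YD by (simp add: gset_sum_def)
 have Zi: "snd ?Z g (Inl x) = Inl (snd X g x)" if "x \<in> fst X" for g x using that by (simp add: gset_sum_def InlI)
 have Zr: "snd ?Z g (Inr x) = Inr (snd Y g x)" if "x \<in> fst Y" for g x using that by (simp add: gset_sum_def InrI)
 have clX: "snd X g x \<in> fst X" if "g \<in> carrier G" "x \<in> fst X" for g x by (rule group_action_closed) (use XD that in auto)
 have clY: "snd Y g x \<in> fst Y" if "g \<in> carrier G" "x \<in> fst Y" for g x by (rule group_action_closed) (use YD that in auto)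
 have fZ: "fst ?Z = fst X <+> fst Y" by (simp add: gset_sum_def)
 have S: "gstable G ?Z ?S" and T: "gstable G ?Z ?T"
  unfolding gstable_def[OF G finG fin act p pG] using clX clY Zi Zr by (auto simp: fZ)
 have fS: "{z \<in> ?S. snd ?Z g z = z} = Inl ` fixed_points X {g}" and fT: "{z \<in> ?T. snd ?Z g z = z} = Inr ` fixed_points Y {g}" for g
  using Zi Zr by (auto simp: fixed_points_def)
 have cd: "card {z \<in> ?S. snd ?Z g z = z} = card {z \<in> ?T. snd ?Z g z = z}" if "g \<in> carrier G" for g
  unfolding fS fT using eq[OF that] by (simp add: card_image)
 show ?thesis
 proof (rule supp_iso_matrices[OF G finG fin act p pG S T])
  show "\<And>g. g \<in> carrier G \<Longrightarrow> card {z \<in> ?S. snd ?Z g z = z} = card {z \<in> ?T. snd ?Z g z = z}" by (rule cd)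
 next
 fix t s :: "nat + nat \<Rightarrow> nat + nat \<Rightarrow> nat" assume
  ts: "\<And>g x y. \<lbrakk>g \<in> carrier G; x \<in> ?S; y \<in> ?T\<rbrakk> \<Longrightarrow> t (snd ?Z g y) (snd ?Z g x) = t y x"
  "\<And>x x'. \<lbrakk>x \<in> ?S; x' \<in> ?S\<rbrakk> \<Longrightarrow> (\<Sum>y\<in>?T. s x y * t y x') mod p = (if x = x' then 1 else 0)"
  "\<And>y y'. \<lbrakk>y \<in> ?T; y' \<in> ?T\<rbrakk> \<Longrightarrow> (\<Sum>x\<in>?S. t y x * s x y') mod p = (if y = y' then 1 else 0)"
 define t' where "t' = (\<lambda>y x. t (Inr y) (Inl x))"
 define s' where "s' = (\<lambda>x y. s (Inl x) (Inr y))"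
 have t'g: "t' (snd Y g y) (snd X g x) = t' y x" if "g \<in> carrier G" "x \<in> fst X" "y \<in> fst Y" for g x y
  using ts(1)[of g "Inl x" "Inr y"] that by (simp add: t'_def Zi Zr)
 have st': "(\<Sum>y\<in>fst Y. s' x y * t' y x') mod p = (if x = x' then 1 else 0)" if "x \<in> fst X" "x' \<in> fst X" for x x'
  using ts(2)[of "Inl x" "Inl x'"] that by (simp add: t'_def s'_def sum.reindex)
 have ts': "(\<Sum>x\<in>fst X. t' y x * s' x y') mod p = (if y = y' then 1 else 0)" if "y \<in> fst Y" "y' \<in> fst Y" for y y'
  using ts(3)[of "Inr y" "Inr y'"] that by (simp add: t'_def s'_def sum.reindex)
 let ?T' = "matrix_map F (fst Y) (fst X) t'"
 note fc = free_module_carrier[OF XD(1)]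
 let ?CX = "carrier (free_module F (fst X))" and ?CY = "carrier (free_module F (fst Y))"
 have cl: "?T' f \<in> ?CY" if "f \<in> ?CX" for f
  by (rule matrix_map_closed[OF m p YD(1) that XD(1)])
 show ?thesis unfolding perm_module_def
 proof (rule gmodule_isoI[of ?T'])
  show "bij_betw ?T' ?CX ?CY"
   by (rule matrix_map_bij[OF m p XD(1) YD(1) st' ts'])
 next
  fix f h assume "f \<in> ?CX" "h \<in> ?CX"
  then show "?T' (f \<oplus>\<^bsub>free_module F (fst X)\<^esub> h) = ?T' f \<oplus>\<^bsub>free_module F (fst Y)\<^esub> ?T' h"
   by (auto simp: free_module_simps matrix_map_def fc F.add.nat_pow_distrib F.finsum_addf Pi_iff)
 next
  fix a f assume "a \<in> carrier F" "f \<in> ?CX"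
  then show "?T' (a \<odot>\<^bsub>free_module F (fst X)\<^esub> f) = a \<odot>\<^bsub>free_module F (fst Y)\<^esub> ?T' f"
   using XD(1) by (auto simp: free_module_simps matrix_map_def fc F.finsum_rdistr F.add_pow_rdistr Pi_iff intro!: F.finsum_cong')
 next
  fix g f assume g: "g \<in> carrier G" and f: "f \<in> ?CX"
  have ig: "inv\<^bsub>G\<^esub> g \<in> carrier G" using g by simp
  define f' where "f' = (\<lambda>x. if x \<in> fst X then f (snd X (inv\<^bsub>G\<^esub> g) x) else \<zero>\<^bsub>F\<^esub>)"
  have f': "f' \<in> ?CX" using f clX[OF ig] by (auto simp: fc f'_def)
  have "?T' f' y = (if y \<in> fst Y then ?T' f (snd Y (inv\<^bsub>G\<^esub> g) y) else \<zero>\<^bsub>F\<^esub>)" for y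
  proof (cases "y \<in> fst Y")
   case True
   let ?h = "\<lambda>x. [t' (snd Y (inv\<^bsub>G\<^esub> g) y) x] \<cdot>\<^bsub>F\<^esub> f x"
   have bij: "bij_betw (snd X (inv\<^bsub>G\<^esub> g)) (fst X) (fst X)"
    by (rule bij_betw_byWitness[where f' = "snd X g"])
     (use clX[OF g] clX[OF ig] group_action_inv[OF XD(2) g] in auto)
   have "?T' f' y = finsum F (\<lambda>x. ?h (snd X (inv\<^bsub>G\<^esub> g) x)) (fst X)"
    using True f t'g[OF ig _ True] unfolding matrix_map_def
    by (auto simp: f'_def fc intro!: F.finsum_cong')
   also have "\<dots> = finsum F ?h (snd X (inv\<^bsub>G\<^esub> g) ` fst X)"
    by (rule F.finsum_reindex[symmetric]) (use f bij in \<open>auto simp: fc bij_betw_def\<close>)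
   also have "\<dots> = ?T' f (snd Y (inv\<^bsub>G\<^esub> g) y)"
    using bij clY[OF ig True] by (simp add: matrix_map_def bij_betw_def)
   finally show ?thesis using True by simp
  qed (simp add: matrix_map_def)
  then show "?T' (restrict (\<lambda>f x. if x \<in> fst X then f (snd X (inv\<^bsub>G\<^esub> g) x) else \<zero>\<^bsub>F\<^esub>)
    ?CX f) =
   restrict (\<lambda>f x. if x \<in> fst Y then f (snd Y (inv\<^bsub>G\<^esub> g) x) else \<zero>\<^bsub>F\<^esub>)
    ?CY (?T' f)"
   using f cl[OF f] by (simp add: f'_def fun_eq_iff)
 qed
 qed
qed

section \<open>Relations of groups of order prime to p, detected on single elements\<close>

lemma burnside_difference:
 fixes G :: "('g, 'b) monoid_scheme"
 assumes G: "group G" and c: "supp c \<subseteq> finite_gsets G"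
 obtains X Y where "X \<in> finite_gsets G" "Y \<in> finite_gsets G" "c - (frag_of X - frag_of Y) \<in> burnside_relations G"
proof -
 let ?R = "burnside_relations G"
 define E where "E = (({}, \<lambda>g. restrict id {}) :: ('g, nat) gset)"
 have E: "E \<in> finite_gsets G" unfolding E_def by (rule finite_gsets_empty[OF G])
 have sum: "\<exists>Z\<in>finite_gsets G. frag_of X + frag_of Y - frag_of Z \<in> ?R" if XY: "X \<in> finite_gsets G" "Y \<in> finite_gsets G" for X Y
 proof -
  have "gset_rep G (gset_sum X Y) \<in> finite_gsets G" "gset_iso G (gset_sum X Y) (gset_rep G (gset_sum X Y))"
   using gset_rep[of "gset_sum X Y" G] gset_sum_action[of G X Y] finite_gsetsD[OF XY(1)] finite_gsetsD[OF XY(2)]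
   by (simp_all add: gset_sum_def)
  then show ?thesis using sum_relations_gen[OF XY, of _ "is_gset_sum G"] unfolding is_gset_sum_def by blast
 qed
 have "gset_iso G (gset_sum E E) E"
  unfolding gset_iso_def E_def gset_sum_def by (intro exI[of _ undefined]) (auto simp: bij_betw_def Plus_def)
 then have eE: "frag_of E \<in> ?R" using sum_relations_gen[OF E E E, of "is_gset_sum G"] by (simp add: is_gset_sum_def)
 have "\<exists>X\<in>finite_gsets G. \<exists>Y\<in>finite_gsets G. c - (frag_of X - frag_of Y) \<in> ?R"
  using c
 proof (induction c rule: frag_induction)
  case zero
  show ?case by (intro bexI[of _ E]) (simp_all add: E sum_relations_0)
 next
  case (one X)
  then show ?case by (intro bexI[of _ X] bexI[of _ E]) (simp_all add: E eE)
 next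
  case (diff a b)
  then obtain X Y X' Y' where XY: "X \<in> finite_gsets G" "Y \<in> finite_gsets G" "X' \<in> finite_gsets G" "Y' \<in> finite_gsets G"
   and r: "a - (frag_of X - frag_of Y) \<in> ?R" "b - (frag_of X' - frag_of Y') \<in> ?R" by meson
  obtain A where A: "A \<in> finite_gsets G" "frag_of X + frag_of Y' - frag_of A \<in> ?R" using sum[OF XY(1,4)] by meson
  obtain B where B: "B \<in> finite_gsets G" "frag_of Y + frag_of X' - frag_of B \<in> ?R" using sum[OF XY(2,3)] by meson
  have "(a - (frag_of X - frag_of Y)) - (b - (frag_of X' - frag_of Y')) +
   ((frag_of X + frag_of Y' - frag_of A) - (frag_of Y + frag_of X' - frag_of B)) \<in> ?R"
   by (intro sum_relations_add sum_relations_diff r A B)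
  then show ?case using A(1) B(1) by (intro bexI[of _ A] bexI[of _ B]) (simp_all add: algebra_simps)
 qed
 then show thesis using that by meson
qed

text \<open>Modulo the Burnside relations \<open>c\<close> is a difference of two G-sets, and
  vanishing marks at all \<open>{g}\<close> say that these have isomorphic permutation modules. It
  is the source of all relations of \<open>G/P\<close> constructed below.\<close>

lemma relation_of_fixed:
 fixes F :: "('f, 'c) ring_scheme" and G :: "('g, 'b) monoid_scheme"
 assumes m: "residue_char_ideal F m p" and p: "prime p" and G: "group G" and finG: "finite (carrier G)"
  and pG: "\<not> p dvd card (carrier G)" and c: "supp c \<subseteq> finite_gsets G"
  and zero: "\<And>g. g \<in> carrier G \<Longrightarrow> mark {g} c = 0"
 shows "relation_over F G c"
proof -
 have F: "cring F" using m by (simp add: residue_char_ideal_def)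
 obtain X Y where XY: "X \<in> finite_gsets G" "Y \<in> finite_gsets G" "c - (frag_of X - frag_of Y) \<in> burnside_relations G"
  using burnside_difference[OF G c] .
 have "card (fixed_points X {g}) = card (fixed_points Y {g})" if "g \<in> carrier G" for g
  using zero[OF that] mark_burnside_relations[OF XY(3), of "{g}"] that by simp
 from perm_module_iso_of_fixed[OF m p G finG pG XY(1,2) this]
 have "frag_of (perm_module F G X) - frag_of (perm_module F G Y) \<in> module_relations F G"
  using module_relations_iso[OF F G] perm_module_fg_gmodules[OF F] XY by blast
 then have "relation_over F G (frag_of X - frag_of Y)" using XY by (simp add: relation_over_def keys_diff_le)
 then show ?thesis
  by (rule relation_over_cong[OF F G _ c])
   (rule sum_relations_swap[OF XY(3)])
qed

section \<open>The span of the imprimitive relations\<close>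

lemma burnside_class_eq_iff: "burnside_class G c = burnside_class G d \<longleftrightarrow> c - d \<in> burnside_relations G"
 by (simp add: burnside_class_def grothendieck_coset_eq_iff)

lemma coset_comb_keys': "\<lbrakk>group G; finite (carrier G); n \<in> subgroup_combs G\<rbrakk> \<Longrightarrow> supp (coset_comb G n) \<subseteq> finite_gsets G"
 using coset_comb_keys by blast

section \<open>Induction and inflation on representatives\<close>

context
 fixes G :: "('g, 'b) monoid_scheme" (structure)
 assumes G: "group G" and finG: "finite (carrier G)"
begin

lemma marks_eq_relations:
 assumes "supp c \<subseteq> finite_gsets G" "supp d \<subseteq> finite_gsets G"
  and "\<And>D. subgroup D G \<Longrightarrow> mark D c = mark D d"
 shows "c - d \<in> burnside_relations G"
 by (rule burnside_relations_iff[OF G finG, THEN iffD2]) (use assms in \<open>simp_all add: keys_diff_le\<close>)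

text \<open>Whatever combination \<open>SOME\<close> picks, its inflation has at \<open>D\<close>
  the mark of \<open>c\<close> at the image of \<open>D\<close>, so inflation is pull-back along the
  quotient map.\<close>

lemma inflation_class:
 assumes N: "N \<lhd> G" and c: "supp c \<subseteq> finite_gsets (G Mod N)"
 shows "inflation G N (burnside_class (G Mod N) c) = burnside_class G (frag_pull (\<lambda>g. N #> g) c)"
proof -
 interpret group_hom G "G Mod N" "\<lambda>g. N #> g" by (rule Mod_hom[OF N])
 have onto: "(\<lambda>g. N #> g) ` carrier G = carrier (G Mod N)" by (auto simp: FactGroup_def RCOSETS_def)
 have finQ: "finite (carrier (G Mod N))" unfolding onto[symmetric] using finG by simp
 define n where "n = (SOME n. n \<in> subgroup_combs (G Mod N) \<and> burnside_elem (G Mod N) n = burnside_class (G Mod N) c)"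
 have "\<exists>n. n \<in> subgroup_combs (G Mod N) \<and> burnside_elem (G Mod N) n = burnside_class (G Mod N) c"
  using burnside_decompose[OF H.is_group finQ c] unfolding burnside_elem_coset_comb burnside_class_eq_iff
  using sum_relations_swap by blast
 note some = someI_ex[OF this, folded n_def]
 have n: "n \<in> subgroup_combs (G Mod N)" using some by (rule conjunct1)
 have nc: "coset_comb (G Mod N) n - c \<in> burnside_relations (G Mod N)"
  using conjunct2[OF some] by (simp only: burnside_elem_coset_comb burnside_class_eq_iff)
 have "coset_comb G (inflated_comb G N n) - frag_pull (\<lambda>g. N #> g) c \<in> burnside_relations G"
 proof (rule marks_eq_relations)
  show "supp (coset_comb G (inflated_comb G N n)) \<subseteq> finite_gsets G"
   by (rule coset_comb_keys'[OF G finG inflated_comb_closed[OF N n]])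
  show "supp (frag_pull (\<lambda>g. N #> g) c) \<subseteq> finite_gsets G"
   by (rule frag_pull_keys[OF c G homh])
  fix D assume "subgroup D G"
  then have D: "D \<subseteq> carrier G" by (rule subgroup.subset)
  then have "(\<lambda>g. N #> g) ` D \<subseteq> carrier (G Mod N)" using onto by blast
  from mark_burnside_relations[OF nc this]
  show "mark D (coset_comb G (inflated_comb G N n)) = mark D (frag_pull (\<lambda>g. N #> g) c)"
   by (simp add: mark_inflated[OF N finG n D] mark_pull)
 qed
 then show ?thesis
  unfolding inflation_def n_def[symmetric]
  unfolding inflated_comb_def[symmetric] burnside_elem_coset_comb burnside_class_eq_iff .
qed

text \<open>By \<open>mark_induced\<close>, combinations with the same class over \<open>H\<close>
  induce to the same marks over \<open>G\<close>; hence the value is independent of the choice made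
  by \<open>SOME\<close>.\<close>

lemma induction_class:
 assumes H: "subgroup H G" and n: "n \<in> subgroup_combs (subgrp G H)"
 shows "induction G H (burnside_class (subgrp G H) (coset_comb (subgrp G H) n)) = burnside_class G (coset_comb G n)"
proof -
 let ?L = "subgrp G H"
 interpret group G by (rule G)
 have L: "group ?L" by (rule subgroup_imp_group[OF H])
 have finH: "finite H" by (rule finite_subset[OF subgroup.subset[OF H] finG])
 define k where "k = (SOME k. k \<in> subgroup_combs ?L \<and> burnside_elem ?L k = burnside_class ?L (coset_comb ?L n))"
 have "\<exists>k. k \<in> subgroup_combs ?L \<and> burnside_elem ?L k = burnside_class ?L (coset_comb ?L n)"
  using n by (intro exI[of _ n]) (simp add: burnside_elem_coset_comb)
 note some = someI_ex[OF this, folded k_def]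
 have k: "k \<in> subgroup_combs ?L" using some by (rule conjunct1)
 have kn: "coset_comb ?L k - coset_comb ?L n \<in> burnside_relations ?L"
  using conjunct2[OF some] by (simp only: burnside_elem_coset_comb burnside_class_eq_iff)
 have "coset_comb G k - coset_comb G n \<in> burnside_relations G"
 proof (rule marks_eq_relations)
  fix D assume D: "subgroup D G"
  have "int (card H) * mark D (coset_comb G k) = int (card H) * mark D (coset_comb G n)"
   unfolding mark_induced[OF G finG H k subgroup.subset[OF D]] mark_induced[OF G finG H n subgroup.subset[OF D]]
  proof (rule sum.cong[OF refl])
   fix g assume g: "g \<in> conj_into G D H"
   show "mark ((\<lambda>d. inv g \<otimes> d \<otimes> g) ` D) (coset_comb ?L k) = mark ((\<lambda>d. inv g \<otimes> d \<otimes> g) ` D) (coset_comb ?L n)"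
    using mark_burnside_relations[OF kn subgroup.subset[OF conj_subgroup[OF G finG H D g]]] by simp
  qed
  moreover have "card H \<noteq> 0" using finH subgroup.one_closed[OF H] by auto
  ultimately show "mark D (coset_comb G k) = mark D (coset_comb G n)" by simp
 qed (intro coset_comb_keys'[OF G finG] subgroup_combs_subgroup[OF G finG H] k n)+
 then show ?thesis
  unfolding induction_def Let_def k_def[symmetric]
  unfolding burnside_elem_coset_comb burnside_class_eq_iff .
qed

end

text \<open>The preimage in the free group of the subgroup that is factored out in
  \<open>prim_group\<close>.\<close>

definition imprim_span :: "('f, 'c) ring_scheme \<Rightarrow> ('g, 'b) monoid_scheme \<Rightarrow> (('g, nat) gset \<Rightarrow>\<^sub>0 int) set" where
 "imprim_span F G = {c. supp c \<subseteq> finite_gsets G \<and>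
   burnside_class G c \<in> generate (relation_group F G) {x. imprimitive F G x}}"

section \<open>The span as a subgroup of the relations\<close>

context
 fixes F :: "('f, 'c) ring_scheme" and G :: "('g, 'b) monoid_scheme" (structure)
 assumes F: "cring F" and G: "group G" and finG: "finite (carrier G)"
begin

interpretation group G by (rule G)

lemma burnside_class_carrier:
 "x \<in> carrier (relation_group F G) \<longleftrightarrow> (\<exists>c. relation_over F G c \<and> x = burnside_class G c)"
proof
 assume "x \<in> carrier (relation_group F G)"
 then show "\<exists>c. relation_over F G c \<and> x = burnside_class G c"
  using brauer_relationsE[OF F G, of x] by (auto simp: relation_group_def)
next
 assume "\<exists>c. relation_over F G c \<and> x = burnside_class G c"
 then show "x \<in> carrier (relation_group F G)"
  using brauer_relations_iff[OF F G] by (auto simp: relation_group_def relation_over_def)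
qed

lemma relation_group_mult:
 "burnside_class G c \<otimes>\<^bsub>relation_group F G\<^esub> burnside_class G d = burnside_class G (c + d)"
 by (simp add: relation_group_def burnside_ring_def burnside_class_def add_grothendieck_ring)

lemma relation_group_one: "\<one>\<^bsub>relation_group F G\<^esub> = burnside_class G 0"
 unfolding burnside_class_def
 by (subst sum_relations_eq_coset[symmetric]) (simp add: relation_group_def burnside_ring_def zero_grothendieck_ring)

lemma relation_comm_group: "comm_group (relation_group F G)"
proof (rule comm_groupI)
 let ?R = "relation_group F G"
 note simps = relation_group_mult relation_group_one
 show "\<one>\<^bsub>?R\<^esub> \<in> carrier ?R" unfolding burnside_class_carrier relation_group_one using relation_over_simps(1) by blast
 fix x assume "x \<in> carrier ?R"
 then obtain c where c: "relation_over F G c" "x = burnside_class G c" unfolding burnside_class_carrier by blast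
 show "\<one>\<^bsub>?R\<^esub> \<otimes>\<^bsub>?R\<^esub> x = x" unfolding c(2) simps by simp
 have "relation_over F G (0 - c)" by (intro relation_over_simps c)
 then show "\<exists>y\<in>carrier ?R. y \<otimes>\<^bsub>?R\<^esub> x = \<one>\<^bsub>?R\<^esub>"
  unfolding c(2) by (intro bexI[of _ "burnside_class G (0 - c)"]) (simp add: simps, auto simp: burnside_class_carrier)
 fix y assume "y \<in> carrier ?R"
 then obtain d where d: "relation_over F G d" "y = burnside_class G d" unfolding burnside_class_carrier by blast
 show "x \<otimes>\<^bsub>?R\<^esub> y \<in> carrier ?R"
  unfolding c(2) d(2) simps burnside_class_carrier using relation_over_simps(2)[OF c(1) d(1)] by blast
 show "x \<otimes>\<^bsub>?R\<^esub> y = y \<otimes>\<^bsub>?R\<^esub> x" unfolding c(2) d(2) simps by (simp add: add.commute)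
 fix z assume "z \<in> carrier ?R"
 then obtain e where e: "z = burnside_class G e" unfolding burnside_class_carrier by blast
 show "x \<otimes>\<^bsub>?R\<^esub> y \<otimes>\<^bsub>?R\<^esub> z = x \<otimes>\<^bsub>?R\<^esub> (y \<otimes>\<^bsub>?R\<^esub> z)" unfolding c(2) d(2) e simps by (simp add: add.assoc)
qed

text \<open>Replaces the choices in \<open>induction\<close> and \<open>inflation\<close> by
  arbitrary representatives \<open>c\<close> and \<open>n\<close>; the intermediate element of the
  Burnside ring of \<open>H\<close> occurs only through its two descriptions.\<close>

lemma imprimitive_iff:
 "imprimitive F G x \<longleftrightarrow> (\<exists>H N c n. subgroup H G \<and> N \<lhd> (subgrp G H) \<and> (H \<noteq> carrier G \<or> N \<noteq> {\<one>}) \<and>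
   relation_over F ((subgrp G H) Mod N) c \<and> n \<in> subgroup_combs (subgrp G H) \<and>
   frag_pull (\<lambda>g. N #>\<^bsub>subgrp G H\<^esub> g) c - coset_comb (subgrp G H) n \<in> burnside_relations (subgrp G H) \<and>
   x = burnside_class G (coset_comb G n))"
 (is "_ \<longleftrightarrow> (\<exists>H N c n. ?P H N c n)")
proof
 assume "imprimitive F G x"
 then obtain H N y where H: "subgroup H G" "N \<lhd> (subgrp G H)" "H \<noteq> carrier G \<or> N \<noteq> {\<one>}"
  and y: "y \<in> brauer_relations F ((subgrp G H) Mod N)" and x: "x = induction G H (inflation (subgrp G H) N y)"
  unfolding imprimitive_def by blast
 let ?L = "subgrp G H"
 have L: "group ?L" by (rule subgroup_imp_group[OF H(1)])
 have finL: "finite (carrier ?L)" using finite_subset[OF subgroup.subset[OF H(1)] finG] by simp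
 have hom: "group_hom ?L (?L Mod N) (\<lambda>g. N #>\<^bsub>?L\<^esub> g)" by (rule Mod_hom[OF H(2)])
 then have Q: "group (?L Mod N)" by (simp add: group_hom_def)
 obtain c where c: "relation_over F (?L Mod N) c" "y = burnside_class (?L Mod N) c" using brauer_relationsE[OF F Q y] by blast
 have ck: "supp c \<subseteq> finite_gsets (?L Mod N)" using c(1) by (simp add: relation_over_def)
 have pk: "supp (frag_pull (\<lambda>g. N #>\<^bsub>?L\<^esub> g) c) \<subseteq> finite_gsets ?L"
  by (rule frag_pull_keys[OF ck L group_hom.homh[OF hom]])
 obtain n where n: "n \<in> subgroup_combs ?L" "frag_pull (\<lambda>g. N #>\<^bsub>?L\<^esub> g) c - coset_comb ?L n \<in> burnside_relations ?L"
  using burnside_decompose[OF L finL pk] by blast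
 have "inflation ?L N y = burnside_class ?L (coset_comb ?L n)"
  using n(2) by (simp add: c(2) inflation_class[OF L finL H(2) ck] burnside_class_eq_iff)
 then have "x = burnside_class G (coset_comb G n)" by (simp add: x induction_class[OF G finG H(1) n(1)])
 then have "?P H N c n" using H c n by blast
 then show "\<exists>H N c n. ?P H N c n" by blast
next
 assume "\<exists>H N c n. ?P H N c n"
 then obtain H N c n where P: "?P H N c n" by blast
 let ?L = "subgrp G H"
 have H: "subgroup H G" "N \<lhd> ?L" and n: "n \<in> subgroup_combs ?L" using P by blast+
 have L: "group ?L" by (rule subgroup_imp_group[OF H(1)])
 have finL: "finite (carrier ?L)" using finite_subset[OF subgroup.subset[OF H(1)] finG] by simp
 have Q: "group (?L Mod N)" using Mod_hom[OF H(2)] by (simp add: group_hom_def)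
 have ck: "supp c \<subseteq> finite_gsets (?L Mod N)" using P by (simp add: relation_over_def)
 have "inflation ?L N (burnside_class (?L Mod N) c) = burnside_class ?L (coset_comb ?L n)"
  using P by (simp add: inflation_class[OF L finL H(2) ck] burnside_class_eq_iff)
 then have "x = induction G H (inflation ?L N (burnside_class (?L Mod N) c))"
  using P by (simp add: induction_class[OF G finG H(1) n])
 moreover have "burnside_class (?L Mod N) c \<in> brauer_relations F (?L Mod N)"
  using P brauer_relations_iff[OF F Q ck] by blast
 ultimately show "imprimitive F G x" unfolding imprimitive_def using P by blast
qed

text \<open>Inflation and induction preserve relations over \<open>F\<close>, so the generators do
  lie in the relation group and generate a subgroup of it.\<close>

lemma imprimitive_relation:
 assumes "imprimitive F G x"
 shows "x \<in> carrier (relation_group F G)"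
proof -
 obtain H N c n where H: "subgroup H G" "N \<lhd> (subgrp G H)" and c: "relation_over F ((subgrp G H) Mod N) c"
  and n: "n \<in> subgroup_combs (subgrp G H)"
  and eq: "frag_pull (\<lambda>g. N #>\<^bsub>subgrp G H\<^esub> g) c - coset_comb (subgrp G H) n \<in> burnside_relations (subgrp G H)"
  and x: "x = burnside_class G (coset_comb G n)"
  using assms unfolding imprimitive_iff by blast
 let ?L = "subgrp G H"
 have L: "group ?L" by (rule subgroup_imp_group[OF H(1)])
 have finL: "finite (carrier ?L)" using finite_subset[OF subgroup.subset[OF H(1)] finG] by simp
 have hom: "group_hom ?L (?L Mod N) (\<lambda>g. N #>\<^bsub>?L\<^esub> g)" by (rule Mod_hom[OF H(2)])
 have "carrier (?L Mod N) = (\<lambda>g. N #>\<^bsub>?L\<^esub> g) ` carrier ?L" by (auto simp: FactGroup_def RCOSETS_def)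
 then have finQ: "finite (carrier (?L Mod N))" using finL by simp
 have "relation_over F ?L (frag_pull (\<lambda>g. N #>\<^bsub>?L\<^esub> g) c)"
  by (rule relation_over_pull[OF F c finQ L _ group_hom.homh[OF hom]]) (use hom in \<open>simp add: group_hom_def\<close>)
 then have "relation_over F ?L (coset_comb ?L n)"
  using relation_over_cong[OF F L _ coset_comb_keys'[OF L finL n] eq] by blast
 then have "relation_over F G (coset_comb G n)" by (rule relation_over_induced[OF F G finG H(1) n])
 then show ?thesis unfolding burnside_class_carrier x by blast
qed

lemma imprim_span_relation: "c \<in> imprim_span F G \<Longrightarrow> relation_over F G c"
proof -
 interpret R: comm_group "relation_group F G" by (rule relation_comm_group)
 assume c: "c \<in> imprim_span F G"
 then have "burnside_class G c \<in> carrier (relation_group F G)"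
  using R.generate_incl[of "{x. imprimitive F G x}"] imprimitive_relation unfolding imprim_span_def by blast
 then show ?thesis
  using brauer_relations_iff[OF F G] c by (simp add: relation_group_def imprim_span_def)
qed

text \<open>Membership in the span depends only on marks. Through this lemma, identities in the
  Burnside ring become identities between integers, one for each subgroup.\<close>

lemma imprim_span_marks:
 assumes "c \<in> imprim_span F G" and "supp d \<subseteq> finite_gsets G"
  and "\<And>D. subgroup D G \<Longrightarrow> mark D c = mark D d"
 shows "d \<in> imprim_span F G"
proof -
 have "burnside_class G c = burnside_class G d"
  unfolding burnside_class_eq_iff by (rule marks_eq_relations[OF G finG _ assms(2,3)]) (use assms(1) in \<open>simp add: imprim_span_def\<close>)
 then show ?thesis using assms by (simp add: imprim_span_def)
qed

lemma imprim_span_add: "c \<in> imprim_span F G \<Longrightarrow> d \<in> imprim_span F G \<Longrightarrow> c + d \<in> imprim_span F G"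
 unfolding imprim_span_def using generate.eng[of "burnside_class G c" "relation_group F G" _ "burnside_class G d"]
 by (simp add: relation_group_mult keys_add_le)

lemma imprim_span_zero: "0 \<in> imprim_span F G"
 unfolding imprim_span_def using generate.one[of "relation_group F G"] by (simp add: relation_group_one)

lemma imprim_span_uminus: "c \<in> imprim_span F G \<Longrightarrow> - c \<in> imprim_span F G"
proof -
 interpret R: comm_group "relation_group F G" by (rule relation_comm_group)
 assume c: "c \<in> imprim_span F G"
 have sub: "subgroup (generate (relation_group F G) {x. imprimitive F G x}) (relation_group F G)"
  by (rule R.generate_is_subgroup) (use imprimitive_relation in blast)
 have r: "relation_over F G c" "relation_over F G (0 - c)"
  using imprim_span_relation[OF c] relation_over_simps(1,3) by blast+
 have "inv\<^bsub>relation_group F G\<^esub> (burnside_class G c) = burnside_class G (0 - c)"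
  by (rule R.inv_equality) (use r in \<open>auto simp: burnside_class_carrier relation_group_mult relation_group_one\<close>)
 then show ?thesis using subgroup.m_inv_closed[OF sub, of "burnside_class G c"] c by (simp add: imprim_span_def)
qed

lemma imprim_span_diff: "c \<in> imprim_span F G \<Longrightarrow> d \<in> imprim_span F G \<Longrightarrow> c - d \<in> imprim_span F G"
 using imprim_span_add[of c "- d"] imprim_span_uminus[of d] by simp

lemma imprim_span_cmul: "c \<in> imprim_span F G \<Longrightarrow> frag_cmul k c \<in> imprim_span F G"
proof (induction k rule: int_induct[where k = 0])
 case base
 then show ?case by (simp add: imprim_span_zero)
next
 case (step1 i)
 then show ?case using imprim_span_add by (simp add: frag_cmul_distrib)
next
 case (step2 i)
 have "frag_cmul (i - 1) c = frag_cmul i c - c" using frag_cmul_distrib[of "i - 1" 1 c] by simp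
 then show ?case using step2 imprim_span_diff by simp
qed

text \<open>Pure induction is the case of the trivial normal subgroup, where a relation of
  \<open>H/1\<close> instead of \<open>H\<close> is required; the relation is carried over along the
  isomorphism.\<close>

lemma imprim_span_induced:
 assumes H: "subgroup H G" "H \<noteq> carrier G" and n: "n \<in> subgroup_combs (subgrp G H)"
  and rel: "relation_over F (subgrp G H) (coset_comb (subgrp G H) n)"
 shows "coset_comb G n \<in> imprim_span F G"
proof -
 let ?L = "subgrp G H" and ?N = "{\<one>}"
 have L: "group ?L" by (rule subgroup_imp_group[OF H(1)])
 interpret L: group ?L by (rule L)
 have finL: "finite (carrier ?L)" using finite_subset[OF subgroup.subset[OF H(1)] finG] by simp
 have N: "?N \<lhd> ?L" using L.one_is_normal by simp
 interpret hom: group_hom ?L "?L Mod ?N" "\<lambda>g. ?N #>\<^bsub>?L\<^esub> g" by (rule Mod_hom[OF N])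
 have pi: "?N #> g = {g}" if "g \<in> H" for g using that by (auto simp: r_coset_def subgroup.mem_carrier[OF H(1)])
 have cQ: "carrier (?L Mod ?N) = (\<lambda>g. {g}) ` H" by (auto simp: FactGroup_def RCOSETS_def pi)
 \<comment> \<open>The cosets of the trivial subgroup are singletons, and \<open>the_elem\<close> is
   the inverse of the quotient map.\<close>
 have th: "the_elem \<in> hom (?L Mod ?N) ?L"
 proof (rule homI)
  fix x y assume "x \<in> carrier (?L Mod ?N)" "y \<in> carrier (?L Mod ?N)"
  then obtain a b where ab: "a \<in> H" "b \<in> H" "x = {a}" "y = {b}" by (auto simp: cQ)
  show "the_elem x \<in> carrier ?L" using ab by simp
  have "x \<otimes>\<^bsub>?L Mod ?N\<^esub> y = {a \<otimes> b}" using hom.hom_mult[of a b] ab subgroup.m_closed[OF H(1)] by (simp add: pi)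
  then show "the_elem (x \<otimes>\<^bsub>?L Mod ?N\<^esub> y) = the_elem x \<otimes>\<^bsub>?L\<^esub> the_elem y" using ab by simp
 qed
 let ?c = "frag_pull the_elem (coset_comb ?L n)"
 have c: "relation_over F (?L Mod ?N) ?c" by (rule relation_over_pull[OF F rel finL hom.H.is_group L th])
 have "frag_pull (\<lambda>g. ?N #>\<^bsub>?L\<^esub> g) ?c - coset_comb ?L n \<in> burnside_relations ?L"
 proof (rule marks_eq_relations[OF L finL])
  show "supp (frag_pull (\<lambda>g. ?N #>\<^bsub>?L\<^esub> g) ?c) \<subseteq> finite_gsets ?L"
   by (rule frag_pull_keys[OF _ L hom.homh]) (use c in \<open>simp add: relation_over_def\<close>)
  fix D assume "subgroup D ?L"
  then have "D \<subseteq> H" using subgroup.subset by force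
  then have "the_elem ` (\<lambda>g. ?N #>\<^bsub>?L\<^esub> g) ` D = D" using pi by (force simp: image_image subset_iff)
  then show "mark D (frag_pull (\<lambda>g. ?N #>\<^bsub>?L\<^esub> g) ?c) = mark D (coset_comb ?L n)" by (simp add: mark_pull)
 qed (rule coset_comb_keys'[OF L finL n])
 then have "imprimitive F G (burnside_class G (coset_comb G n))"
  unfolding imprimitive_iff using H N c n by blast
 then show ?thesis
  unfolding imprim_span_def using coset_comb_keys'[OF G finG subgroup_combs_subgroup[OF G finG H(1) n]]
  by (simp add: generate.incl)
qed

lemma imprim_span_inflated:
 assumes N: "N \<lhd> G" "N \<noteq> {\<one>}" and c: "relation_over F (G Mod N) c"
 shows "frag_pull (\<lambda>g. N #> g) c \<in> imprim_span F G"
proof -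
 have e: "(subgrp G (carrier G)) = G" by simp
 interpret hom: group_hom G "G Mod N" "\<lambda>g. N #> g" by (rule Mod_hom[OF N(1)])
 have k: "supp (frag_pull (\<lambda>g. N #> g) c) \<subseteq> finite_gsets G"
  by (rule frag_pull_keys[OF _ G hom.homh]) (use c in \<open>simp add: relation_over_def\<close>)
 obtain n where n: "n \<in> subgroup_combs G" "frag_pull (\<lambda>g. N #> g) c - coset_comb G n \<in> burnside_relations G"
  using burnside_decompose[OF G finG k] by blast
 have "imprimitive F G (burnside_class G (coset_comb G n))"
  unfolding imprimitive_iff using subgroup_self N c n
  by (intro exI[of _ "carrier G"] exI[of _ N] exI[of _ c] exI[of _ n]) (simp add: e)
 then have "imprimitive F G (burnside_class G (frag_pull (\<lambda>g. N #> g) c))"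
  using n(2) burnside_class_eq_iff by metis
 then show ?thesis unfolding imprim_span_def using k by (simp add: generate.incl)
qed

lemma prim_group_trivial:
 assumes "\<And>c. relation_over F G c \<Longrightarrow> c \<in> imprim_span F G"
 shows "trivial_group (prim_group F G)"
proof -
 let ?R = "relation_group F G" and ?S = "generate (relation_group F G) {x. imprimitive F G x}"
 interpret R: comm_group ?R by (rule relation_comm_group)
 have "?S = carrier ?R"
 proof (intro equalityI subsetI)
  fix x assume "x \<in> ?S" then show "x \<in> carrier ?R" using R.generate_incl imprimitive_relation by blast
 next
  fix x assume "x \<in> carrier ?R"
  then show "x \<in> ?S" using assms unfolding burnside_class_carrier imprim_span_def by blast
 qed
 moreover have "carrier ?R \<lhd> ?R" using R.subgroup_self by (rule R.subgroup_imp_normal)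
 ultimately have S: "?S \<lhd> ?R" and Se: "?S = carrier ?R" by simp_all
 interpret S: normal ?S ?R by (rule S)
 show ?thesis unfolding prim_group_def trivial_group_def
 proof
  show "group (?R Mod ?S)" by (rule S.factorgroup_is_group)
  have "?S #>\<^bsub>?R\<^esub> x = ?S" if "x \<in> carrier ?R" for x
   using R.coset_join2[OF that S.subgroup_axioms] that Se by simp
  then show "carrier (?R Mod ?S) = {\<one>\<^bsub>?R Mod ?S\<^esub>}"
   using R.one_closed by (auto simp: FactGroup_def RCOSETS_def)
 qed
qed

end

section \<open>Multiples of relations in the span\<close>

text \<open>On the \<open>W\<close>-fixed points the group \<open>W'\<close> has orbits of length
  dividing the prime \<open>l\<close>, because all stabilisers contain \<open>W\<close>.\<close>

lemma fixed_points_index_cong: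
 fixes G :: "('g, 'b) monoid_scheme" (structure)
 assumes G: "group G" and finG: "finite (carrier G)" and act: "group_action G (fst X) (snd X)" and finX: "finite (fst X)"
  and W': "subgroup W' G" and N: "W \<lhd> (subgrp G W')" and idx: "card W' = l * card W" and l: "prime l"
 shows "int l dvd int (card (fixed_points X W)) - int (card (fixed_points X W'))"
proof -
 interpret group G by (rule G)
 let ?L = "subgrp G W'" and ?E = "fixed_points X W"
 interpret N: normal W ?L by (rule N)
 have L: "group ?L" by (rule subgroup_imp_group[OF W'])
 have WW: "W \<subseteq> W'" using N.subset by simp
 have W'G: "W' \<subseteq> carrier G" by (rule subgroup.subset[OF W'])
 have finW: "finite W'" using W'G finG finite_subset by blast
 have EX: "?E \<subseteq> fst X" by (auto simp: fixed_points_def)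
 have cl: "snd X h x \<in> ?E" if h: "h \<in> W'" and x: "x \<in> ?E" for h x
 proof -
  have hG: "h \<in> carrier G" and xX: "x \<in> fst X" using h x W'G EX by auto
  have "snd X w (snd X h x) = snd X h x" if w: "w \<in> W" for w
  proof -
   have wG: "w \<in> carrier G" using w WW W'G by blast
   have "inv\<^bsub>?L\<^esub> h \<otimes>\<^bsub>?L\<^esub> w \<otimes>\<^bsub>?L\<^esub> h \<in> W" using N.inv_op_closed1[of h w] h w by simp
   then have c: "inv h \<otimes> w \<otimes> h \<in> W" using h m_inv_consistent[OF W'] by simp
   have "snd X w (snd X h x) = snd X (h \<otimes> (inv h \<otimes> w \<otimes> h)) x"
    using hG wG group_action_mult[OF act wG hG xX] by (simp add: m_assoc[symmetric])
   also have "\<dots> = snd X h (snd X (inv h \<otimes> w \<otimes> h) x)"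
    using group_action_mult[OF act hG _ xX] c WW W'G by blast
   finally show ?thesis using x c by (simp add: fixed_points_def)
  qed
  then show ?thesis using group_action_closed[OF act hG xX] by (simp add: fixed_points_def)
 qed
 have aE: "group_action ?L ?E (\<lambda>h. restrict (snd X h) ?E)"
  by (rule group_action_sub[OF group_action_restrict_group[OF G W' act] EX]) (use cl in simp)
 interpret E: group_action ?L ?E "\<lambda>h. restrict (snd X h) ?E" by (rule aE)
 have "int l dvd int (card ?E) - int (card {x \<in> ?E. \<forall>h\<in>carrier ?L. restrict (snd X h) ?E x = x})"
 proof (rule card_orbits_cong[OF aE finite_subset[OF EX finX]])
  fix x assume x: "x \<in> ?E"
  let ?S = "stabilizer ?L (\<lambda>h. restrict (snd X h) ?E) x"
  have S: "subgroup ?S ?L" by (rule E.stabilizer_subgroup[OF x])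
  have "W \<subseteq> ?S" using x WW by (auto simp: stabilizer_def fixed_points_def)
  then have "card W dvd card ?S" using subgroup_index_dvd(2)[OF L _ S N.subgroup_axioms] finW by simp
  then obtain a where a: "card ?S = card W * a" by (rule dvdE)
  have "card (orbit ?L (\<lambda>h. restrict (snd X h) ?E) x) * card ?S = card W'"
   using E.orbit_stabilizer_theorem[OF x] by (simp add: order_def)
  moreover have "card W \<noteq> 0" using subgroup.one_closed[OF N.subgroup_axioms] finite_subset[OF WW finW] by auto
  ultimately have "card (orbit ?L (\<lambda>h. restrict (snd X h) ?E) x) dvd l"
   by (intro dvdI[of _ _ a]) (simp add: a idx mult.commute)
  then show "card (orbit ?L (\<lambda>h. restrict (snd X h) ?E) x) = 1 \<or> l dvd card (orbit ?L (\<lambda>h. restrict (snd X h) ?E) x)"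
   using l by (auto simp: prime_nat_iff)
 qed
 moreover have "{x \<in> ?E. \<forall>h\<in>carrier ?L. restrict (snd X h) ?E x = x} = fixed_points X W'"
  using WW by (auto simp: fixed_points_def)
 ultimately show ?thesis by simp
qed

section \<open>Coset spaces with a mark prime to l\<close>

context
 fixes G :: "('g, 'b) monoid_scheme" (structure)
 assumes G: "group G" and finG: "finite (carrier G)"
begin

interpretation group G by (rule G)

text \<open>The normaliser of \<open>W\<close>, although \<open>conj_into\<close> asks only for
  inclusion of the conjugate: finiteness of \<open>W\<close> turns inclusion into equality, and this
  gives closure under inverses.\<close>

lemma conj_into_self:
 assumes W: "subgroup W G"
 shows "subgroup (conj_into G W W) G" "W \<subseteq> conj_into G W W"
proof -
 have WG: "W \<subseteq> carrier G" by (rule subgroup.subset[OF W])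
 have finW: "finite W" by (rule finite_subset[OF WG finG])
 show sub: "W \<subseteq> conj_into G W W"
  using W WG subgroup.m_closed[OF W] subgroup.m_inv_closed[OF W] by (auto simp: conj_into_def)
 show "subgroup (conj_into G W W) G"
 proof (rule subgroupI)
  show "conj_into G W W \<noteq> {}" using sub subgroup.one_closed[OF W] by auto
  show "conj_into G W W \<subseteq> carrier G" by (auto simp: conj_into_def)
  fix a assume a: "a \<in> conj_into G W W"
  then have aG: "a \<in> carrier G" by (simp add: conj_into_def)
  show "inv a \<in> conj_into G W W" unfolding conj_into_def
  proof (intro CollectI conjI ballI)
   show "inv a \<in> carrier G" using aG by simp
   fix d assume d: "d \<in> W"
   have "inj_on (\<lambda>d. inv a \<otimes> d \<otimes> a) W" using aG WG by (auto simp: inj_on_def subset_iff)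
   moreover have "(\<lambda>d. inv a \<otimes> d \<otimes> a) ` W \<subseteq> W" using a by (auto simp: conj_into_def)
   ultimately have "(\<lambda>d. inv a \<otimes> d \<otimes> a) ` W = W" using endo_inj_surj[OF finW] by blast
   then obtain e where e: "e \<in> W" "d = inv a \<otimes> e \<otimes> a" using d by blast
   have eG: "e \<in> carrier G" using e WG by blast
   have "inv (inv a) \<otimes> d \<otimes> inv a = a \<otimes> (inv a \<otimes> e)" using aG eG by (simp add: e(2) m_assoc)
   also have "\<dots> = e" using aG eG by (simp add: m_assoc[symmetric])
   finally show "inv (inv a) \<otimes> d \<otimes> inv a \<in> W" using e by simp
  qed
  fix b assume b: "b \<in> conj_into G W W"
  then have bG: "b \<in> carrier G" by (simp add: conj_into_def)
  show "a \<otimes> b \<in> conj_into G W W" unfolding conj_into_def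
  proof (intro CollectI conjI ballI)
   show "a \<otimes> b \<in> carrier G" using aG bG by simp
   fix d assume d: "d \<in> W"
   then have dG: "d \<in> carrier G" using WG by blast
   have "inv (a \<otimes> b) \<otimes> d \<otimes> (a \<otimes> b) = inv b \<otimes> (inv a \<otimes> d \<otimes> a) \<otimes> b"
    using aG bG dG by (simp add: inv_mult_group m_assoc)
   then show "inv (a \<otimes> b) \<otimes> d \<otimes> (a \<otimes> b) \<in> W" using a b d by (simp add: conj_into_def)
  qed
 qed
qed

lemma normal_in_conj_into_self:
 assumes W: "subgroup W G" and V: "subgroup V G" "W \<subseteq> V" "V \<subseteq> conj_into G W W"
 shows "W \<lhd> (subgrp G V)"
proof -
 have L: "group (subgrp G V)" by (rule subgroup_imp_group[OF V(1)])
 have VG: "V \<subseteq> carrier G" by (rule subgroup.subset[OF V(1)])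
 show ?thesis unfolding group.normal_inv_iff[OF L]
 proof (intro conjI ballI)
  show "subgroup W (subgrp G V)" by (rule subgroup_incl[OF W V(1,2)])
  fix x h assume x: "x \<in> carrier (subgrp G V)" and h: "h \<in> W"
  then have xV: "x \<in> V" by simp
  have "inv x \<in> conj_into G W W" using subgroup.m_inv_closed[OF V(1) xV] V(3) by blast
  then have "inv (inv x) \<otimes> h \<otimes> inv x \<in> W" using h by (simp add: conj_into_def)
  then show "x \<otimes>\<^bsub>(subgrp G V)\<^esub> h \<otimes>\<^bsub>(subgrp G V)\<^esub> inv\<^bsub>(subgrp G V)\<^esub> x \<in> W"
   using xV VG m_inv_consistent[OF V(1) xV] by auto
 qed
qed

text \<open>The mark of \<open>G/W\<close> at \<open>W\<close> is the index of \<open>W\<close> in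
  its normaliser. If \<open>l\<close> divides it, the quotient has a subgroup of order
  \<open>l\<close> by Sylow's theorem, whose preimage is \<open>W'\<close>.\<close>

lemma subgroup_extension:
 assumes W: "subgroup W G" and l: "prime l" and dvd: "l dvd card (fixed_points (coset_gset G W) W)"
 obtains W' where "subgroup W' G" "W \<lhd> (subgrp G W')" "card W' = l * card W"
proof -
 let ?N = "conj_into G W W"
 let ?L = "subgrp G ?N"
 have N: "subgroup ?N G" "W \<subseteq> ?N" using conj_into_self[OF W] .
 have WG: "W \<subseteq> carrier G" by (rule subgroup.subset[OF W])
 have nW: "W \<lhd> ?L" by (rule normal_in_conj_into_self[OF W N order_refl])
 have L: "group ?L" by (rule subgroup_imp_group[OF N(1)])
 have finN: "finite ?N" by (rule finite_subset[OF subgroup.subset[OF N(1)] finG])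
 have cW: "card W > 0" using subgroup.one_closed[OF W] finite_subset[OF WG finG] card_gt_0_iff by blast
 have hom: "group_hom ?L (?L Mod W) (\<lambda>g. W #>\<^bsub>?L\<^esub> g)" by (rule Mod_hom[OF nW])
 then have Q: "group (?L Mod W)" by (simp add: group_hom_def)
 have "card (rcosets\<^bsub>?L\<^esub> W) * card W = card ?N"
  using group.lagrange[OF L normal_imp_subgroup[OF nW]] by (simp add: order_def)
 also have "\<dots> = card W * card (fixed_points (coset_gset G W) W)"
  using card_fixed_points_coset[OF G finG W WG] by simp
 finally have ord: "order (?L Mod W) = card (fixed_points (coset_gset G W) W)"
  using cW by (simp add: order_def FactGroup_def)
 then obtain a where a: "order (?L Mod W) = l ^ 1 * a" using dvd by (auto elim: dvdE)
 have "carrier (?L Mod W) = (\<lambda>g. W #>\<^bsub>?L\<^esub> g) ` ?N" by (auto simp: FactGroup_def RCOSETS_def)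
 then have "finite (carrier (?L Mod W))" using finN by simp
 then obtain H where H: "subgroup H (?L Mod W)" "card H = l" using sylow_thm[OF l Q a] by auto
 define W' where "W' = {g \<in> carrier ?L. W #>\<^bsub>?L\<^esub> g \<in> H}"
 have sL: "subgroup W' ?L" unfolding W'_def by (rule preimage_subgroup[OF nW H(1)])
 then have sG: "subgroup W' G" by (rule incl_subgroup[OF N(1)])
 have "card W' = card W * l"
  unfolding W'_def using coset_preimage_card[OF nW _ subgroup.subset[OF H(1)]] finN H(2) by simp
 moreover have "W \<lhd> (subgrp G W')"
 proof (rule normal_in_conj_into_self[OF W sG])
  show "W' \<subseteq> ?N" by (auto simp: W'_def)
  have "W #>\<^bsub>?L\<^esub> w = \<one>\<^bsub>?L Mod W\<^esub>" if "w \<in> W" for w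
   using group.coset_join2[OF L _ normal_imp_subgroup[OF nW] that] N(2) that by (auto simp: FactGroup_def)
  then show "W \<subseteq> W'" using N(2) subgroup.one_closed[OF H(1)] unfolding W'_def by auto
 qed
 ultimately show thesis using that[OF sG] by (simp add: mult.commute)
qed

text \<open>In the quotient of prime order \<open>l\<close>, the image of an element of
  \<open>P\<close> has order dividing both \<open>l\<close> and a power of \<open>p\<close>.\<close>

lemma p_subgroup_descends:
 assumes W': "subgroup W' G" and N: "W \<lhd> (subgrp G W')" and idx: "card W' = l * card W" and l: "prime l"
  and P: "subgroup P G" and cP: "card P = p ^ k" and p: "prime p" "l \<noteq> p" and PW: "P \<subseteq> W'"
 shows "P \<subseteq> W"
proof
 let ?L = "subgrp G W'"
 fix x assume x: "x \<in> P"
 have L: "group ?L" by (rule subgroup_imp_group[OF W'])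
 have finW: "finite W'" by (rule finite_subset[OF subgroup.subset[OF W'] finG])
 interpret h: group_hom ?L "?L Mod W" "\<lambda>g. W #>\<^bsub>?L\<^esub> g" by (rule Mod_hom[OF N])
 have xL: "x \<in> carrier ?L" using x PW by auto
 have WL: "subgroup W ?L" by (rule normal_imp_subgroup[OF N])
 have cW: "card W \<noteq> 0" using subgroup.one_closed[OF WL] finite_subset[OF subgroup.subset[OF WL]] finW by auto
 have "card (rcosets\<^bsub>?L\<^esub> W) * card W = l * card W" using group.lagrange[OF L WL] idx by (simp add: order_def)
 then have oQ: "order (?L Mod W) = l" using cW by (simp add: order_def FactGroup_def)
 let ?A = "W #>\<^bsub>?L\<^esub> x"
 have A: "?A \<in> carrier (?L Mod W)" using xL by (rule h.hom_closed)
 have "?A [^]\<^bsub>?L Mod W\<^esub> l = \<one>\<^bsub>?L Mod W\<^esub>" using h.H.pow_order_eq_1[OF A] by (simp add: oQ)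
 then have 1: "h.H.ord ?A dvd l" using h.H.pow_eq_id[OF A] by simp
 interpret P: group "subgrp G P" by (rule subgroup_imp_group[OF P])
 have "x [^]\<^bsub>(subgrp G P)\<^esub> (p ^ k) = \<one>" using P.pow_order_eq_1[of x] x cP by (simp add: order_def)
 then have "x [^]\<^bsub>?L\<^esub> (p ^ k) = \<one>\<^bsub>?L\<^esub>" by (simp add: nat_pow_consistent[symmetric])
 then have "?A [^]\<^bsub>?L Mod W\<^esub> (p ^ k) = \<one>\<^bsub>?L Mod W\<^esub>" using h.hom_nat_pow[OF xL, of "p ^ k"] h.hom_one by metis
 then have 2: "h.H.ord ?A dvd p ^ k" using h.H.pow_eq_id[OF A] by simp
 have "coprime l (p ^ k)" using l p by (simp add: primes_coprime)
 then have "h.H.ord ?A = 1" using coprime_common_divisor[OF _ 1 2] by simp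
 then have "?A = \<one>\<^bsub>?L Mod W\<^esub>" using h.H.ord_eq_1[OF A] by simp
 then have "?A = W" by (simp add: FactGroup_def)
 then show "x \<in> W" using group.rcos_self[OF L xL WL] by simp
qed

text \<open>Among the subgroups not containing \<open>P\<close> whose marks on all coset spaces
  agree with those at \<open>D\<close> modulo \<open>l\<close>, take a largest one \<open>W\<close>.
  If \<open>l\<close> divided the mark of \<open>G/W\<close> at \<open>W\<close>, then
  \<open>W\<close> could be enlarged by a step of index \<open>l\<close>, which creates no
  containment of \<open>P\<close>. So this mark is prime to \<open>l\<close>, and by the congruence
  so is that at \<open>D\<close>; take \<open>U = W\<close>. The argument is that of the prime
  ideals of the Burnside ring.\<close>

lemma exists_coset_mark_not_dvd:
 assumes P: "subgroup P G" and cP: "card P = p ^ k" and p: "prime p" and l: "prime l" "l \<noteq> p"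
  and D: "subgroup D G" "\<not> P \<subseteq> D"
 shows "\<exists>U. subgroup U G \<and> U \<noteq> carrier G \<and> \<not> int l dvd coset_mark G D U"
proof -
 define good where "good = (\<lambda>W. subgroup W G \<and> \<not> P \<subseteq> W \<and>
  (\<forall>U. subgroup U G \<longrightarrow> int l dvd coset_mark G D U - coset_mark G W U))"
 have good: "good D" using D by (simp add: good_def)
 have "card W < Suc (card (carrier G))" if "good W" for W
  using that card_mono[OF finG subgroup.subset[of W G]] by (simp add: good_def less_Suc_eq_le)
 then have bound: "\<forall>W. good W \<longrightarrow> card W < Suc (card (carrier G))" by blast
 obtain W where W: "good W" and max': "\<forall>W'. good W' \<longrightarrow> card W' \<le> card W"
  using ex_has_greatest_nat[OF good bound] by (elim exE conjE)
 note max = max'[rule_format]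
 have Ws: "subgroup W G" using W by (simp add: good_def)
 have "\<not> l dvd card (fixed_points (coset_gset G W) W)"
 proof
  assume "l dvd card (fixed_points (coset_gset G W) W)"
  then obtain W' where W': "subgroup W' G" "W \<lhd> (subgrp G W')" "card W' = l * card W"
   using subgroup_extension[OF Ws l(1)] by blast
  have "int l dvd coset_mark G W U - coset_mark G W' U" if "subgroup U G" for U
  proof (rule fixed_points_index_cong[OF G finG _ _ W' l(1)])
   show "group_action G (fst (coset_gset G U)) (snd (coset_gset G U))" by (rule coset_gset_action[OF G that])
   show "finite (fst (coset_gset G U))" using coset_gset_finite[OF G finG] that by simp
  qed
  then have "int l dvd coset_mark G D U - coset_mark G W' U" if "subgroup U G" for U
   using W that dvd_add[of "int l" "coset_mark G D U - coset_mark G W U" "coset_mark G W U - coset_mark G W' U"]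
   by (simp add: good_def)
  moreover have "\<not> P \<subseteq> W'" using p_subgroup_descends[OF W' l(1) P cP p l(2)] W by (auto simp: good_def)
  ultimately have "good W'" unfolding good_def using W'(1) by blast
  then have "card W' \<le> card W" by (rule max)
  moreover have "card W > 0"
   using subgroup.one_closed[OF Ws] finite_subset[OF subgroup.subset[OF Ws] finG] card_gt_0_iff by blast
  ultimately show False using W'(3) prime_gt_1_nat[OF l(1)] by simp
 qed
 then have "\<not> int l dvd coset_mark G W W" by simp
 moreover have "int l dvd coset_mark G D W - coset_mark G W W" using W Ws by (simp add: good_def)
 ultimately have "\<not> int l dvd coset_mark G D W" using dvd_diff[of "int l" "coset_mark G D W" "coset_mark G D W - coset_mark G W W"] by auto
 moreover have "W \<noteq> carrier G" using W subgroup.subset[OF P] by (auto simp: good_def)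
 ultimately show ?thesis using Ws by blast
qed

text \<open>The product \<open>\<Prod>(k\<^sub>s - [G/U\<^sub>s])\<close> in the Burnside ring.\<close>

lemma coset_mark_product:
 assumes "finite S" and U: "\<And>s. s \<in> S \<Longrightarrow> subgroup (U s) G \<and> U s \<noteq> carrier G"
 shows "\<exists>n\<in>subgroup_combs G. carrier G \<notin> supp n \<and>
  (\<forall>D. subgroup D G \<longrightarrow> (\<Prod>s\<in>S. k s - coset_mark G D (U s)) = (\<Prod>s\<in>S. k s) - mark D (coset_comb G n))"
 using assms
proof (induction S rule: finite_induct)
 case empty
 then show ?case by (intro bexI[of _ 0]) (simp_all add: subgroup_combs_closed)
next
 case (insert a S)
 then obtain n where n: "n \<in> subgroup_combs G" "carrier G \<notin> supp n"
  and eq: "\<And>D. subgroup D G \<Longrightarrow> (\<Prod>s\<in>S. k s - coset_mark G D (U s)) = (\<Prod>s\<in>S. k s) - mark D (coset_comb G n)"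
  by fastforce
 have Ua: "subgroup (U a) G" "U a \<noteq> carrier G" using insert.prems by auto
 obtain n' where n': "n' \<in> subgroup_combs ((subgrp G (U a)))"
  and m': "\<forall>D. subgroup D G \<longrightarrow> mark D (coset_comb G n') = coset_mark G D (U a) * mark D (coset_comb G n)"
  using restrict_induce[OF G finG coset_comb_keys'[OF G finG n(1)] Ua(1)] by (elim bexE conjE)
 note m' = m'[rule_format]
 have n'G: "n' \<in> subgroup_combs G" by (rule subgroup_combs_subgroup[OF G finG Ua(1) n'])
 have "carrier G \<notin> supp n'"
 proof
  assume "carrier G \<in> supp n'"
  then have "carrier G \<subseteq> U a" using n' subgroup.subset[of "carrier G" "(subgrp G (U a))"] by (auto simp: subgroup_combs_iff)
  then show False using Ua subgroup.subset[OF Ua(1)] by simp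
 qed
 \<comment> \<open>With \<open>K\<close> the product of the other constants and \<open>n'\<close>
   standing for \<open>[G/U a] n\<close>, this is the expansion
   \<open>(k a - [G/U a]) (K - n) = k a K - v\<close>.\<close>
 define v where "v = frag_cmul (k a) n + frag_cmul (\<Prod>s\<in>S. k s) (frag_of (U a)) - n'"
 have v: "v \<in> subgroup_combs G" using n n'G Ua by (simp add: v_def subgroup_combs_closed)
 have "supp v \<subseteq> - {carrier G}"
  unfolding v_def using n n'G \<open>carrier G \<notin> supp n'\<close> Ua
  by (intro keys_diff_le keys_add_le keys_cmul_le) (auto simp: keys_frag_of)
 moreover have "(\<Prod>s\<in>insert a S. k s - coset_mark G D (U s)) = (\<Prod>s\<in>insert a S. k s) - mark D (coset_comb G v)"
  if D: "subgroup D G" for D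
 proof -
  have "mark D (frag_of (gset_rep G (coset_gset G (U a)))) = coset_mark G D (U a)"
   using mark_coset_comb[OF G finG, of "frag_of (U a)" D] Ua subgroup.subset[OF D] by (simp add: subgroup_combs_closed)
  then have mv: "mark D (coset_comb G v) = k a * mark D (coset_comb G n) + (\<Prod>s\<in>S. k s) * coset_mark G D (U a) -
   coset_mark G D (U a) * mark D (coset_comb G n)"
   using m'[OF D] by (simp add: v_def)
  have "(\<Prod>s\<in>insert a S. k s - coset_mark G D (U s)) = (k a - coset_mark G D (U a)) * ((\<Prod>s\<in>S. k s) - mark D (coset_comb G n))"
   using insert.hyps eq[OF D] by simp
  then show ?thesis unfolding mv using insert.hyps by (simp add: algebra_simps)
 qed
 ultimately show ?case using v by blast
qed

end

text \<open>The generator is the power of \<open>x\<close> with the least positive exponent in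
  \<open>H\<close>, by division with remainder.\<close>

lemma cyclic_subgroup:
 fixes K (structure)
 assumes K: "group K" and finK: "finite (carrier K)" and x: "x \<in> carrier K" "generate K {x} = carrier K"
  and H: "subgroup H K"
 obtains y where "y \<in> H" "generate K {y} = H"
proof -
 interpret group K by (rule K)
 have "ord x \<noteq> 0" using ord_ge_1[OF finK x(1)] by simp
 then have K': "carrier K = range (\<lambda>k :: nat. x [^] k)" using generate_pow_nat[OF x(1)] x(2) by auto
 let ?Q = "\<lambda>k :: nat. 0 < k \<and> x [^] k \<in> H"
 have "?Q (ord x)" using \<open>ord x \<noteq> 0\<close> pow_ord_eq_1[OF x(1)] subgroup.one_closed[OF H] by simp
 define d where "d = (LEAST k. ?Q k)"
 have d: "?Q d" unfolding d_def by (rule LeastI[of ?Q, OF \<open>?Q (ord x)\<close>])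
 have min: "d \<le> k" if "?Q k" for k unfolding d_def by (rule Least_le[of ?Q, OF that])
 have dK: "x [^] d \<in> carrier K" using x(1) by simp
 have gen: "generate K {x [^] d} \<subseteq> H" by (rule generate_subgroup_incl[OF _ H]) (use d in simp)
 moreover have "H \<subseteq> generate K {x [^] d}"
 proof
  fix y assume y: "y \<in> H"
  then have "y \<in> carrier K" using subgroup.subset[OF H] by blast
  then obtain k :: nat where k: "y = x [^] k" unfolding K' by blast
  have G: "subgroup (generate K {x [^] d}) K" by (rule generate_is_subgroup) (use dK in simp)
  have xd: "x [^] d \<in> generate K {x [^] d}" by (rule generate.incl) simp
  have "(x [^] d) [^] j \<in> generate K {x [^] d}" for j :: nat
   by (induction j) (simp_all add: subgroup.one_closed[OF G] subgroup.m_closed[OF G] xd)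
  then have g: "x [^] (d * (k div d)) \<in> generate K {x [^] d}" using x(1) by (simp add: nat_pow_pow)
  have y': "y = x [^] (d * (k div d)) \<otimes> x [^] (k mod d)" using x(1) by (simp add: k nat_pow_mult)
  have "inv (x [^] (d * (k div d))) \<otimes> y = x [^] (k mod d)"
   unfolding y' using x(1) by (simp add: m_assoc[symmetric])
  moreover have "inv (x [^] (d * (k div d))) \<otimes> y \<in> H"
   using g gen y subgroup.m_closed[OF H] subgroup.m_inv_closed[OF H] by blast
  ultimately have "x [^] (k mod d) \<in> H" by simp
  then have "k mod d = 0" using min[of "k mod d"] d mod_less_divisor[of d k] by linarith
  then show "y \<in> generate K {x [^] d}" using y' g x(1) by simp
 qed
 ultimately show thesis using that d by blast
qed

lemma coset_mark_top:
 fixes G (structure)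
 assumes G: "group G" and finG: "finite (carrier G)" and D: "D \<subseteq> carrier G"
 shows "coset_mark G D (carrier G) = 1"
proof -
 interpret group G by (rule G)
 have "conj_into G D (carrier G) = carrier G"
 proof (intro equalityI subsetI)
  fix g assume "g \<in> carrier G"
  then show "g \<in> conj_into G D (carrier G)" using D by (auto simp: conj_into_def)
 qed (simp add: conj_into_def)
 then have "card (carrier G) * card (fixed_points (coset_gset G (carrier G)) D) = card (carrier G)"
  using card_fixed_points_coset[OF G finG subgroup_self D] by simp
 moreover have "card (carrier G) \<noteq> 0" using finG one_closed by auto
 ultimately show ?thesis by simp
qed

text \<open>The multipliers of \<open>c\<close> in the ghost ring: functions on subgroups whose
  product with the marks of \<open>c\<close> consists of the marks of an element of the span. This
  stands in for multiplication in the Burnside ring.\<close>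

definition mulspan :: "('f, 'c) ring_scheme \<Rightarrow> ('g, 'b) monoid_scheme \<Rightarrow> (('g, nat) gset \<Rightarrow>\<^sub>0 int) \<Rightarrow> ('g set \<Rightarrow> int) set" where
 "mulspan F G c = {f. \<exists>d\<in>imprim_span F G. \<forall>D. subgroup D G \<longrightarrow> mark D d = f D * mark D c}"

section \<open>Multipliers that carry a relation into the span\<close>

context
 fixes F :: "('f, 'c) ring_scheme" and G :: "('g, 'b) monoid_scheme" (structure)
 assumes F: "cring F" and G: "group G" and finG: "finite (carrier G)"
begin

interpretation group G by (rule G)

lemma mulspanI: "d \<in> imprim_span F G \<Longrightarrow> (\<And>D. subgroup D G \<Longrightarrow> mark D d = f D * mark D c) \<Longrightarrow> f \<in> mulspan F G c"
 by (auto simp: mulspan_def)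

lemma relation_over_restrict:
 assumes c: "relation_over F G c" and U: "subgroup U G"
 shows "relation_over F (subgrp G U) c"
proof -
 have "(\<lambda>g. g) \<in> hom (subgrp G U) G" using subgroup.subset[OF U] by (auto simp: hom_def)
 from relation_over_pull[OF F c finG subgroup_imp_group[OF U] G this]
 have "relation_over F (subgrp G U) (frag_pull (\<lambda>g. g) c)" .
 moreover have "frag_pull (\<lambda>g. g) c = c"
  using frag_expansion[of c] by (simp add: frag_pull_def gset_pull_def)
 ultimately show ?thesis by simp
qed

lemma mulspan_coset:
 assumes c: "relation_over F G c" and U: "subgroup U G" "U \<noteq> carrier G"
 shows "(\<lambda>D. coset_mark G D U) \<in> mulspan F G c"
proof -
 let ?L = "subgrp G U"
 have ck: "supp c \<subseteq> finite_gsets G" using c by (simp add: relation_over_def)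
 have L: "group ?L" by (rule subgroup_imp_group[OF U(1)])
 have finL: "finite (carrier ?L)" using finite_subset[OF subgroup.subset[OF U(1)] finG] by simp
 obtain n where n: "n \<in> subgroup_combs ?L" "c - coset_comb ?L n \<in> burnside_relations ?L"
  and m: "\<forall>D. subgroup D G \<longrightarrow> mark D (coset_comb G n) = coset_mark G D U * mark D c"
  using restrict_induce[OF G finG ck U(1)] by (elim bexE conjE)
 have "relation_over F ?L c" by (rule relation_over_restrict[OF c U(1)])
 then have "relation_over F ?L (coset_comb ?L n)"
  using relation_over_cong[OF F L _ coset_comb_keys'[OF L finL n(1)] n(2)] by blast
 then have "coset_comb G n \<in> imprim_span F G" by (rule imprim_span_induced[OF F G finG U n(1)])
 then show ?thesis by (rule mulspanI) (rule m[rule_format])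
qed

lemma mulspan_closed:
 "(\<lambda>D. 0) \<in> mulspan F G c"
 "f \<in> mulspan F G c \<Longrightarrow> h \<in> mulspan F G c \<Longrightarrow> (\<lambda>D. f D - h D) \<in> mulspan F G c"
proof -
 show "(\<lambda>D. 0) \<in> mulspan F G c" by (rule mulspanI[OF imprim_span_zero[OF F G finG]]) simp
 assume "f \<in> mulspan F G c" "h \<in> mulspan F G c"
 then obtain d e where "d \<in> imprim_span F G" "\<forall>D. subgroup D G \<longrightarrow> mark D d = f D * mark D c"
  "e \<in> imprim_span F G" "\<forall>D. subgroup D G \<longrightarrow> mark D e = h D * mark D c"
  by (auto simp: mulspan_def)
 then show "(\<lambda>D. f D - h D) \<in> mulspan F G c"
  by (intro mulspanI[OF imprim_span_diff[OF F G finG, of d e]]) (simp_all add: left_diff_distrib)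
qed

text \<open>Multipliers are closed under differences, so it suffices to treat the coset spaces in
  the support of \<open>n\<close>.\<close>

lemma mulspan_comb:
 assumes n: "n \<in> subgroup_combs G" and U: "\<And>U. U \<in> supp n \<Longrightarrow> (\<lambda>D. coset_mark G D U) \<in> mulspan F G c"
 shows "(\<lambda>D. mark D (coset_comb G n)) \<in> mulspan F G c"
proof -
 have "(\<lambda>D. frag_val (coset_mark G D) n) \<in> mulspan F G c"
 proof (rule frag_induction[of n "supp n"])
  fix a b assume "(\<lambda>D. frag_val (coset_mark G D) a) \<in> mulspan F G c" "(\<lambda>D. frag_val (coset_mark G D) b) \<in> mulspan F G c"
  from mulspan_closed(2)[OF this] show "(\<lambda>D. frag_val (coset_mark G D) (a - b)) \<in> mulspan F G c" by simp
 qed (simp_all add: mulspan_closed(1) U)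
 then obtain d where d: "d \<in> imprim_span F G" "\<forall>D. subgroup D G \<longrightarrow> mark D d = frag_val (coset_mark G D) n * mark D c"
  unfolding mulspan_def by blast
 show ?thesis
 proof (rule mulspanI[OF d(1)])
  fix D assume D: "subgroup D G"
  show "mark D d = mark D (coset_comb G n) * mark D c"
   using D d(2) mark_coset_comb[OF G finG n subgroup.subset[OF D]] by simp
 qed
qed

lemma mulspan_proper_comb:
 assumes c: "relation_over F G c" and n: "n \<in> subgroup_combs G" "carrier G \<notin> supp n"
 shows "(\<lambda>D. mark D (coset_comb G n)) \<in> mulspan F G c"
proof (rule mulspan_comb[OF n(1)])
 fix U assume "U \<in> supp n"
 then show "(\<lambda>D. coset_mark G D U) \<in> mulspan F G c"
  using mulspan_coset[OF c, of U] n by (auto simp: subgroup_combs_iff)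
qed

end

section \<open>Groups with a non-trivial normal Sylow p-subgroup\<close>

context
 fixes F :: "('f, 'c) ring_scheme" and G :: "('g, 'b) monoid_scheme" (structure) and m P p k
 assumes m: "residue_char_ideal F m p" and p: "prime p" and G: "group G" and finG: "finite (carrier G)"
  and P: "P \<lhd> G" and cP: "card P = p ^ k" and P1: "P \<noteq> {\<one>}" and idx: "\<not> p dvd card (carrier G) div card P"
begin

interpretation group G by (rule G)
interpretation pi: group_hom G "G Mod P" "\<lambda>g. P #> g" by (rule Mod_hom[OF P])

lemma Mod_facts:
 "carrier (G Mod P) = (\<lambda>g. P #> g) ` carrier G" "finite (carrier (G Mod P))"
 "\<not> p dvd card (carrier (G Mod P))" "x \<in> P \<Longrightarrow> P #> x = \<one>\<^bsub>G Mod P\<^esub>" "cring F" "P \<subseteq> carrier G"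
proof -
 show 1: "carrier (G Mod P) = (\<lambda>g. P #> g) ` carrier G" by (auto simp: FactGroup_def RCOSETS_def)
 show "finite (carrier (G Mod P))" using finG by (simp add: 1)
 have Ps: "subgroup P G" by (rule normal_imp_subgroup[OF P])
 show PG: "P \<subseteq> carrier G" by (rule subgroup.subset[OF Ps])
 have "card P \<noteq> 0" using cP prime_gt_0_nat[OF p] by simp
 then have "card (rcosets P) = card (carrier G) div card P"
  using lagrange[OF Ps] unfolding order_def by (metis nonzero_mult_div_cancel_right)
 then have "card (carrier (G Mod P)) = card (carrier G) div card P" by (simp add: FactGroup_def)
 then show "\<not> p dvd card (carrier (G Mod P))" using idx by simp
 show "P #> x = \<one>\<^bsub>G Mod P\<^esub>" if "x \<in> P"
  using coset_join2[OF _ Ps that] that PG by (auto simp: FactGroup_def)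
 show "cring F" using m by (simp add: residue_char_ideal_def)
qed

text \<open>The \<open>P\<close>-fixed points of a relation form a relation for \<open>G/P\<close>.\<close>

lemma fixed_part:
 assumes c: "relation_over F G c"
 obtains c' where "relation_over F (G Mod P) c'"
  and "\<And>D. subgroup D G \<Longrightarrow> P \<subseteq> D \<Longrightarrow> mark ((\<lambda>g. P #> g) ` D) c' = mark D c"
proof -
 let ?K = "G Mod P" and ?pi = "\<lambda>g. P #> g"
 note K = Mod_facts
 have ck: "supp c \<subseteq> finite_gsets G" using c by (simp add: relation_over_def)
 obtain n where n: "n \<in> subgroup_combs G" "c - coset_comb G n \<in> burnside_relations G"
  using burnside_decompose[OF G finG ck] by blast
 \<comment> \<open>As \<open>P\<close> is normal, the \<open>P\<close>-fixed points of
   \<open>G/U\<close> are everything if \<open>P\<close> lies in \<open>U\<close>, which then is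
   \<open>(G/P)/(U/P)\<close>, and nothing otherwise.\<close>
 define n' where "n' = frag_extend (\<lambda>U. if P \<subseteq> U then frag_of (?pi ` U) else 0) n"
 have piU: "subgroup (?pi ` U) ?K" if "subgroup U G" for U by (rule pi.subgroup_img_is_subgroup[OF that])
 have n': "n' \<in> subgroup_combs ?K"
  unfolding n'_def subgroup_combs_iff
 proof (rule order_trans[OF keys_frag_extend], rule UN_least)
  fix U assume "U \<in> supp n"
  then have "subgroup U G" using n by (auto simp: subgroup_combs_iff)
  then show "supp (if P \<subseteq> U then frag_of (?pi ` U) else 0) \<subseteq> {U. subgroup U ?K}" using piU by (simp add: keys_frag_of)
 qed
 have mk: "mark (?pi ` D) (coset_comb ?K n') = mark D c" if D: "D \<subseteq> carrier G" and PD: "P \<subseteq> D" for D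
 proof -
  have piD: "?pi ` D \<subseteq> carrier ?K" using D K(1) by blast
  have "mark (?pi ` D) (coset_comb ?K n') = frag_val (\<lambda>U. if P \<subseteq> U then coset_mark ?K (?pi ` D) (?pi ` U) else 0) n"
   unfolding mark_coset_comb[OF pi.H.is_group K(2) n' piD]
   unfolding n'_def frag_val_extend
   by (rule frag_val_cong) simp
  also have "\<dots> = frag_val (coset_mark G D) n"
  proof (rule frag_val_cong)
   fix U assume "U \<in> supp n"
   then have U: "subgroup U G" using n by (auto simp: subgroup_combs_iff)
   show "(if P \<subseteq> U then coset_mark ?K (?pi ` D) (?pi ` U) else 0) = coset_mark G D U"
   proof (cases "P \<subseteq> U")
    case True
    have "{g \<in> carrier G. P #> g \<in> ?pi ` U} = U"
    proof (intro equalityI subsetI)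
     fix g assume "g \<in> {g \<in> carrier G. P #> g \<in> ?pi ` U}"
     then obtain u where u: "g \<in> carrier G" "u \<in> U" "P #> g = P #> u" by auto
     have "g \<in> P #> u" using rcos_self[OF u(1) normal_imp_subgroup[OF P]] u(3) by simp
     then obtain x where "x \<in> P" "g = x \<otimes> u" by (auto simp: r_coset_def)
     then show "g \<in> U" using True u(2) subgroup.m_closed[OF U] by blast
    next
     fix g assume "g \<in> U"
     then show "g \<in> {g \<in> carrier G. P #> g \<in> ?pi ` U}" using subgroup.subset[OF U] by auto
    qed
    then show ?thesis using coset_mark_inflated[OF P finG piU[OF U] D] True by simp
   next
    \<comment> \<open>A fixed point of \<open>D\<close> would make some conjugate of
      \<open>P\<close>, which is \<open>P\<close> itself, lie in \<open>U\<close>.\<close>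
    case False
    have "conj_into G D U = {}"
    proof (rule ccontr)
     assume "conj_into G D U \<noteq> {}"
     then obtain g where g: "g \<in> carrier G" "\<forall>d\<in>D. inv g \<otimes> d \<otimes> g \<in> U" by (auto simp: conj_into_def)
     have "x \<in> U" if x: "x \<in> P" for x
     proof -
      have xG: "x \<in> carrier G" using x K(6) by blast
      have "g \<otimes> x \<otimes> inv g \<in> P" by (rule normal.inv_op_closed2[OF P g(1) x])
      then have "inv g \<otimes> (g \<otimes> x \<otimes> inv g) \<otimes> g \<in> U" using g(2) PD by blast
      moreover have "inv g \<otimes> (g \<otimes> x \<otimes> inv g) \<otimes> g = x"
       using g(1) xG by (simp add: m_assoc) (simp add: m_assoc[symmetric])
      ultimately show ?thesis by simp
     qed
     then show False using False by blast
    qed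
    then have "card U * card (fixed_points (coset_gset G U) D) = 0" using card_fixed_points_coset[OF G finG U D] by simp
    moreover have "card U \<noteq> 0"
     using subgroup.one_closed[OF U] finite_subset[OF subgroup.subset[OF U] finG] by auto
    ultimately show ?thesis using False by simp
   qed
  qed
  also have "\<dots> = mark D c"
   using mark_burnside_relations[OF n(2) D] mark_coset_comb[OF G finG n(1) D] by simp
  finally show ?thesis .
 qed
 have n'k: "supp (coset_comb ?K n') \<subseteq> finite_gsets ?K" by (rule coset_comb_keys'[OF pi.H.is_group K(2) n'])
 have "mark {x} (coset_comb ?K n') = 0" if x: "x \<in> carrier ?K" for x
 proof -
  obtain g where g: "g \<in> carrier G" "x = P #> g" using x unfolding K(1) by blast
  have one: "\<one> \<in> P" using subgroup.one_closed[OF normal_imp_subgroup[OF P]] .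
  have img: "?pi ` insert g P = {x, \<one>\<^bsub>?K\<^esub>}" using g(2) K(4) one by (simp only: image_insert) blast
  \<comment> \<open>The image of \<open>insert g P\<close> contains the identity besides
    \<open>x\<close>. The identity fixes all points, so the mark at \<open>{x}\<close> is a mark of
    \<open>c\<close> at \<open>insert g P\<close>, where \<open>relation_mark_eq_0\<close>
    applies.\<close>
  have "fixed_points X {x, \<one>\<^bsub>?K\<^esub>} = fixed_points X {x}" if "X \<in> finite_gsets ?K" for X
   using group_action_one[OF finite_gsetsD(2)[OF that]] by (auto simp: fixed_points_def)
  then have "mark {x} (coset_comb ?K n') = mark {x, \<one>\<^bsub>?K\<^esub>} (coset_comb ?K n')"
   unfolding mark_def using n'k by (intro frag_val_cong) auto
  also have "\<dots> = mark (insert g P) c" unfolding img[symmetric] by (rule mk) (use g K(6) in auto)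
  also have "\<dots> = 0" by (rule relation_mark_eq_0[OF m p G finG c P cP idx g(1)])
  finally show ?thesis .
 qed
 then have "relation_over F ?K (coset_comb ?K n')"
  by (rule relation_of_fixed[OF m p pi.H.is_group K(2,3) n'k])
 then show thesis using that mk subgroup.subset by blast
qed

text \<open>\<open>D\<close> is generated by \<open>h\<close> and the normal
  \<open>p\<close>-subgroup \<open>P \<inter> D\<close>, whose index in \<open>D\<close> divides the
  order of \<open>G/P\<close> and is prime to \<open>p\<close>. So \<open>relation_mark_eq_0\<close>
  applies to the restriction of \<open>c\<close> to \<open>D\<close>.\<close>

lemma cyclic_image_mark_eq_0:
 assumes c: "relation_over F G c" and D: "subgroup D G" and h: "h \<in> D"
  and gen: "generate (G Mod P) {P #> h} = (\<lambda>g. P #> g) ` D"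
 shows "mark D c = 0"
proof -
 let ?L = "subgrp G D" and ?K = "G Mod P" and ?Q = "P \<inter> D" and ?pi = "\<lambda>g. P #> g"
 note K = Mod_facts
 have Ps: "subgroup P G" by (rule normal_imp_subgroup[OF P])
 have DG: "D \<subseteq> carrier G" by (rule subgroup.subset[OF D])
 have L: "group ?L" by (rule subgroup_imp_group[OF D])
 have finL: "finite (carrier ?L)" using finite_subset[OF DG finG] by simp
 have Q: "?Q \<lhd> ?L" by (rule normal_Int_subgroup[OF D P])
 have Qs: "subgroup ?Q G" by (rule subgroups_Inter_pair[OF Ps D])
 have "card ?Q dvd p ^ k" using subgroup_index_dvd(2)[OF G finG Ps Qs] cP by simp
 then obtain j where j: "card ?Q = p ^ j" using divides_primepow_nat[OF p] by blast
 have hom: "?pi \<in> hom ?L ?K"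
 proof (rule homI)
  fix x y assume "x \<in> carrier ?L" "y \<in> carrier ?L"
  then have xy: "x \<in> carrier G" "y \<in> carrier G" using DG by auto
  show "?pi x \<in> carrier ?K" by (rule pi.hom_closed[OF xy(1)])
  show "?pi (x \<otimes>\<^bsub>?L\<^esub> y) = ?pi x \<otimes>\<^bsub>?K\<^esub> ?pi y" using pi.hom_mult[OF xy] by simp
 qed
 have piD: "subgroup (?pi ` D) ?K" by (rule pi.subgroup_img_is_subgroup[OF D])
 have "?pi \<in> hom ?L ((subgrp ?K (?pi ` D)))" using hom by (auto simp: hom_def)
 then interpret r: group_hom ?L "(subgrp ?K (?pi ` D))" ?pi
  using L pi.H.subgroup_imp_group[OF piD] by (simp add: group_hom_def group_hom_axioms_def)
 have ker: "kernel ?L ((subgrp ?K (?pi ` D))) ?pi = ?Q"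
 proof -
  have "x \<in> P \<longleftrightarrow> P #> x = \<one>\<^bsub>?K\<^esub>" if "x \<in> D" for x
  proof
   assume "P #> x = \<one>\<^bsub>?K\<^esub>"
   then have "P #> x = P" by (simp add: FactGroup_def)
   then show "x \<in> P" using rcos_self[OF _ Ps, of x] that DG by auto
  qed (rule K(4))
  then show ?thesis by (auto simp: kernel_def)
 qed
 have "card (carrier (?L Mod ?Q)) = card (?pi ` D)"
  using iso_same_card[OF r.FactGroup_iso] ker by simp
 then have "card (rcosets\<^bsub>?L\<^esub> ?Q) = card (?pi ` D)" by (simp add: FactGroup_def)
 moreover have "card (rcosets\<^bsub>?L\<^esub> ?Q) * card ?Q = card (carrier ?L)"
  using group.lagrange[OF L normal_imp_subgroup[OF Q]] by (simp add: order_def)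
 moreover have "card ?Q \<noteq> 0" using j prime_gt_0_nat[OF p] by simp
 ultimately have "card (carrier ?L) div card ?Q = card (?pi ` D)" by (metis nonzero_mult_div_cancel_right)
 moreover have "card (?pi ` D) dvd card (carrier ?K)"
  using pi.H.lagrange[OF piD] by (metis dvd_triv_right order_def)
 ultimately have idxL: "\<not> p dvd card (carrier ?L) div card ?Q" using K(3) dvd_trans by metis
 have cL: "relation_over F ?L c" by (rule relation_over_restrict[OF K(5) G finG c D])
 have z: "mark (insert h ?Q) c = 0"
  by (rule relation_mark_eq_0[OF m p L finL cL Q j idxL]) (use h in simp)
 have sub: "insert h ?Q \<subseteq> carrier ?L" using h by auto
 interpret piL: group_hom ?L ?K ?pi using hom L pi.H.is_group by (simp add: group_hom_def group_hom_axioms_def)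
 have g: "subgroup (generate ?L (insert h ?Q)) ?L" by (rule group.generate_is_subgroup[OF L sub])
 \<comment> \<open>An element of \<open>D\<close> agrees modulo \<open>P\<close> with an element of
   the group generated by \<open>h\<close>; the quotient of the two lies in
   \<open>P \<inter> D\<close>.\<close>
 have "generate ?L (insert h ?Q) = D"
 proof (intro equalityI subsetI)
  fix d assume "d \<in> generate ?L (insert h ?Q)"
  then show "d \<in> D" using subgroup.subset[OF g] by auto
 next
  fix d assume d: "d \<in> D"
  have "?pi ` generate ?L {h} = generate ?K {?pi h}" using piL.generate_img[of "{h}"] h by simp
  then have "?pi d \<in> ?pi ` generate ?L {h}" using gen d by auto
  then obtain e where e: "e \<in> generate ?L {h}" "P #> d = P #> e" by auto
  have eg: "e \<in> generate ?L (insert h ?Q)" using e(1) group.mono_generate[OF L, of "{h}" "insert h ?Q"] by auto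
  then have eD: "e \<in> D" using subgroup.subset[OF g] by auto
  have dG: "d \<in> carrier G" and eG: "e \<in> carrier G" using d eD DG by auto
  have "d \<in> P #> e" using rcos_self[OF dG Ps] e(2) by simp
  then obtain x where x: "x \<in> P" "d = x \<otimes> e" by (auto simp: r_coset_def)
  have "x = d \<otimes> inv e" using x K(6) eG by (auto simp: m_assoc)
  then have "x \<in> D" using subgroup.m_closed[OF D d subgroup.m_inv_closed[OF D eD]] by simp
  then have "x \<in> generate ?L (insert h ?Q)" using x(1) by (intro generate.incl) auto
  then show "d \<in> generate ?L (insert h ?Q)" using subgroup.m_closed[OF g _ eg] x(2) by simp
 qed
 then show ?thesis
  using mark_generate[of c ?L "insert h ?Q"] z sub cL by (simp add: relation_over_def)
qed

text \<open>Every subgroup of \<open>G\<close> has cyclic image in \<open>G/P\<close>, so all marks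
  of \<open>c\<close> vanish and \<open>c\<close> is zero in the Burnside ring.\<close>

lemma span_cyclic:
 assumes c: "relation_over F G c" and x: "x \<in> carrier (G Mod P)" "generate (G Mod P) {x} = carrier (G Mod P)"
 shows "c \<in> imprim_span F G"
proof (rule imprim_span_marks[OF Mod_facts(5) G finG imprim_span_zero[OF Mod_facts(5) G finG]])
 show "supp c \<subseteq> finite_gsets G" using c by (simp add: relation_over_def)
 fix D assume D: "subgroup D G"
 obtain y where y: "y \<in> (\<lambda>g. P #> g) ` D" "generate (G Mod P) {y} = (\<lambda>g. P #> g) ` D"
  using cyclic_subgroup[OF pi.H.is_group Mod_facts(2) x pi.subgroup_img_is_subgroup[OF D]] .
 then obtain h where "h \<in> D" "y = P #> h" by blast
 then have "mark D c = 0" using cyclic_image_mark_eq_0[OF c D, of h] y(2) by simp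
 then show "mark D 0 = mark D c" by simp
qed

text \<open>The product of \<open>|N(C) : C| - [K/C]\<close> over the cyclic subgroups \<open>C\<close> of \<open>K = G/P\<close> is a relation of \<open>K\<close>
 by \<open>relation_of_fixed\<close>, and the coefficient of \<open>[K/K]\<close> in it is prime to \<open>p\<close>.\<close>

lemma span_multiple_p:
 assumes c: "relation_over F G c" and noncyc: "\<And>x. x \<in> carrier (G Mod P) \<Longrightarrow> generate (G Mod P) {x} \<noteq> carrier (G Mod P)"
 shows "\<exists>a. \<not> int p dvd a \<and> frag_cmul a c \<in> imprim_span F G"
proof -
 let ?K = "G Mod P" and ?pi = "\<lambda>g. P #> g"
 note K = Mod_facts and F = Mod_facts(5)
 let ?U = "\<lambda>x. generate ?K {x}"
 \<comment> \<open>The index of the cyclic group in its normaliser: it makes the factor vanish at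
   that group and, as a divisor of the order of \<open>G/P\<close>, is prime to \<open>p\<close>.
   The product runs over elements instead of cyclic subgroups; repeated factors do no harm.\<close>
 let ?k = "\<lambda>x. coset_mark ?K (?U x) (?U x)"
 have Us: "subgroup (?U x) ?K" if "x \<in> carrier ?K" for x by (rule pi.H.generate_is_subgroup) (use that in simp)
 obtain n where n: "n \<in> subgroup_combs ?K" "carrier ?K \<notin> supp n"
  and prod: "\<And>D. subgroup D ?K \<Longrightarrow> (\<Prod>x\<in>carrier ?K. ?k x - coset_mark ?K D (?U x)) = (\<Prod>x\<in>carrier ?K. ?k x) - mark D (coset_comb ?K n)"
  using coset_mark_product[OF pi.H.is_group K(2,2), of ?U ?k] Us noncyc by blast
 define a where "a = (\<Prod>x\<in>carrier ?K. ?k x)"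
 have "\<not> int p dvd ?k x" if x: "x \<in> carrier ?K" for x
 proof
  assume "int p dvd ?k x"
  then have "p dvd card (?U x) * card (fixed_points (coset_gset ?K (?U x)) (?U x))" by simp
  also have "\<dots> = card (conj_into ?K (?U x) (?U x))"
   by (rule card_fixed_points_coset[OF pi.H.is_group K(2) Us[OF x] subgroup.subset[OF Us[OF x]]])
  also have "\<dots> dvd card (carrier ?K)"
   using pi.H.lagrange[OF conj_into_self(1)[OF pi.H.is_group K(2) Us[OF x]]] by (metis dvd_triv_right order_def)
  finally show False using K(3) by simp
 qed
 then have pa: "\<not> int p dvd a" unfolding a_def using prime_dvd_prod_iff[OF K(2), of "int p" ?k] p by auto
 \<comment> \<open>As \<open>G/P\<close> is not cyclic, all factors come from proper subgroups, so
   the top coefficient of the product is exactly \<open>a\<close>.\<close>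
 define v where "v = frag_cmul a (frag_of (carrier ?K)) - n"
 have sK: "subgroup (carrier ?K) ?K" by (rule pi.H.subgroup_self)
 have v: "v \<in> subgroup_combs ?K" unfolding v_def using n(1) sK by (simp add: subgroup_combs_closed)
 have mv: "mark D (coset_comb ?K v) = a - mark D (coset_comb ?K n)" if D: "subgroup D ?K" for D
 proof -
  note DK = subgroup.subset[OF D]
  have "coset_mark ?K D (carrier ?K) = 1" by (rule coset_mark_top[OF pi.H.is_group K(2) DK])
  moreover have "mark D (frag_of (gset_rep ?K (coset_gset ?K (carrier ?K)))) = coset_mark ?K D (carrier ?K)"
   using mark_coset_comb[OF pi.H.is_group K(2), of "frag_of (carrier ?K)" D] sK DK by (simp add: subgroup_combs_closed)
  ultimately show ?thesis by (simp add: v_def)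
 qed
 have vk: "supp (coset_comb ?K v) \<subseteq> finite_gsets ?K" by (rule coset_comb_keys'[OF pi.H.is_group K(2) v])
 have rel: "relation_over F ?K (coset_comb ?K v)"
 proof (rule relation_of_fixed[OF m p pi.H.is_group K(2,3) vk])
  fix x assume x: "x \<in> carrier ?K"
  have "mark {x} (coset_comb ?K v) = mark (?U x) (coset_comb ?K v)"
   using mark_generate[OF vk, of "{x}"] x by simp
  also have "\<dots> = (\<Prod>y\<in>carrier ?K. ?k y - coset_mark ?K (?U x) (?U y))"
   using mv[OF Us[OF x]] prod[OF Us[OF x]] by (simp add: a_def)
  also have "\<dots> = 0" by (rule prod_zero[OF K(2)]) (use x in auto)
  finally show "mark {x} (coset_comb ?K v) = 0" .
 qed
 define u where "u = frag_pull ?pi (coset_comb ?K v)"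
 have u: "u \<in> imprim_span F G" unfolding u_def by (rule imprim_span_inflated[OF F G finG P P1 rel])
 have ru: "relation_over F G u" by (rule imprim_span_relation[OF F G finG u])
 \<comment> \<open>In marks, the inflated relation is \<open>u = a - w\<close> with \<open>w\<close>
   a combination of proper coset spaces of \<open>G\<close>.\<close>
 define w where "w = inflated_comb G P n"
 have w: "w \<in> subgroup_combs G" unfolding w_def by (rule inflated_comb_closed[OF P n(1)])
 have mu: "mark D u = a - mark D (coset_comb G w)" if D: "subgroup D G" for D
  using mv[OF pi.subgroup_img_is_subgroup[OF D]]
  by (simp add: u_def mark_pull w_def mark_inflated[OF P finG n(1) subgroup.subset[OF D]])
 have wG: "carrier G \<notin> supp w"
 proof
  assume "carrier G \<in> supp w"
  then obtain V where V: "V \<in> supp n" "carrier G = {g \<in> carrier G. P #> g \<in> V}"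
   unfolding w_def inflated_comb_def using keys_frag_extend[of "\<lambda>U. frag_of {g \<in> carrier G. P #> g \<in> U}" n]
   by (auto simp: keys_frag_of)
  have "subgroup V ?K" using V(1) n(1) by (auto simp: subgroup_combs_iff)
  moreover have "carrier ?K \<subseteq> V" using V(2) K(1) by auto
  ultimately have "V = carrier ?K" using subgroup.subset by blast
  then show False using V(1) n(2) by simp
 qed
 obtain d where d: "d \<in> imprim_span F G" "\<forall>D. subgroup D G \<longrightarrow> mark D d = mark D (coset_comb G w) * mark D c"
  using mulspan_proper_comb[OF F G finG c w wG] unfolding mulspan_def by blast
 have ck: "supp c \<subseteq> finite_gsets G" using c by (simp add: relation_over_def)
 \<comment> \<open>\<open>c\<close> is now used as a multiplier of the relation \<open>u\<close>:
   expanded in coset spaces, its proper terms give elements of the span, and the top term gives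
   \<open>u\<close>, which is in the span already. The result follows from
   \<open>a c = w c + c u\<close>.\<close>
 obtain l where l: "l \<in> subgroup_combs G" "c - coset_comb G l \<in> burnside_relations G"
  using burnside_decompose[OF G finG ck] by blast
 have span: "(\<lambda>D. coset_mark G D U) \<in> mulspan F G u" if U: "U \<in> supp l" for U
 proof (cases "U = carrier G")
  case True
  show ?thesis
  proof (rule mulspanI[OF F G finG u])
   fix D assume D: "subgroup D G"
   show "mark D u = coset_mark G D U * mark D u" using coset_mark_top[OF G finG subgroup.subset[OF D]] True by simp
  qed
 next
  case False
  then show ?thesis using mulspan_coset[OF F G finG ru] U l(1) by (auto simp: subgroup_combs_iff)
 qed
 obtain e where e: "e \<in> imprim_span F G" "\<forall>D. subgroup D G \<longrightarrow> mark D e = mark D (coset_comb G l) * mark D u"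
  using mulspan_comb[OF F G finG l(1) span] unfolding mulspan_def by blast
 have "frag_cmul a c \<in> imprim_span F G"
 proof (rule imprim_span_marks[OF F G finG imprim_span_add[OF F G finG d(1) e(1)]])
  show "supp (frag_cmul a c) \<subseteq> finite_gsets G" using ck keys_cmul_le by blast
  fix D assume D: "subgroup D G"
  have "mark D (coset_comb G l) = mark D c" using mark_burnside_relations[OF l(2) subgroup.subset[OF D]] by simp
  then show "mark D (d + e) = mark D (frag_cmul a c)" using D d(2) e(2) by (simp add: mu[OF D] algebra_simps)
 qed
 then show ?thesis using pa by blast
qed

text \<open>The inflation \<open>e\<close> of the \<open>P\<close>-fixed part is in the span and
  agrees with \<open>c\<close> at all subgroups containing \<open>P\<close>. At all others the
  product \<open>a - n\<close> vanishes, so \<open>a (c - e) = n (c - e)\<close>, and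
  \<open>n\<close> has only proper terms.\<close>

lemma span_multiple_not_p:
 assumes c: "relation_over F G c" and l: "prime l" "l \<noteq> p"
 shows "\<exists>a. \<not> int l dvd a \<and> frag_cmul a c \<in> imprim_span F G"
proof -
 note K = Mod_facts and F = Mod_facts(5)
 have Ps: "subgroup P G" by (rule normal_imp_subgroup[OF P])
 let ?S = "{D. subgroup D G \<and> \<not> P \<subseteq> D}"
 have finS: "finite ?S" by (rule finite_subset[of _ "Pow (carrier G)"]) (use finG subgroup.subset in auto)
 obtain U where U: "\<And>D. D \<in> ?S \<Longrightarrow> subgroup (U D) G \<and> U D \<noteq> carrier G \<and> \<not> int l dvd coset_mark G D (U D)"
  using exists_coset_mark_not_dvd[OF G finG Ps cP p l] by (metis (no_types, lifting) mem_Collect_eq)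
 let ?k = "\<lambda>D. coset_mark G D (U D)"
 obtain n where n: "n \<in> subgroup_combs G" "carrier G \<notin> supp n"
  and prod: "\<And>D. subgroup D G \<Longrightarrow> (\<Prod>E\<in>?S. ?k E - coset_mark G D (U E)) = (\<Prod>E\<in>?S. ?k E) - mark D (coset_comb G n)"
  using coset_mark_product[OF G finG finS, of U ?k] U by blast
 define a where "a = (\<Prod>E\<in>?S. ?k E)"
 have la: "\<not> int l dvd a" unfolding a_def using prime_dvd_prod_iff[OF finS, of "int l" ?k] l(1) U by auto
 obtain c' where c': "relation_over F (G Mod P) c'" and mc': "\<And>D. subgroup D G \<Longrightarrow> P \<subseteq> D \<Longrightarrow> mark ((\<lambda>g. P #> g) ` D) c' = mark D c"
  using fixed_part[OF c] by blast
 define e where "e = frag_pull (\<lambda>g. P #> g) c'"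
 have e: "e \<in> imprim_span F G" unfolding e_def by (rule imprim_span_inflated[OF F G finG P P1 c'])
 have r: "relation_over F G (c - e)" by (rule relation_over_simps(3)[OF c imprim_span_relation[OF F G finG e]])
 obtain d where d: "d \<in> imprim_span F G" "\<forall>D. subgroup D G \<longrightarrow> mark D d = mark D (coset_comb G n) * mark D (c - e)"
  using mulspan_proper_comb[OF F G finG r n] unfolding mulspan_def by blast
 have "frag_cmul a (c - e) \<in> imprim_span F G"
 proof (rule imprim_span_marks[OF F G finG d(1)])
  show "supp (frag_cmul a (c - e)) \<subseteq> finite_gsets G" by (rule keys_cmul_le) (use r in \<open>simp only: relation_over_def\<close>)
  fix D assume D: "subgroup D G"
  \<comment> \<open>Either the second factor vanishes, or \<open>D\<close> is one of the subgroups
    for which the product has a factor vanishing at it.\<close>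
  have "(a - mark D (coset_comb G n)) * mark D (c - e) = 0"
  proof (cases "P \<subseteq> D")
   case True
   then have "mark D e = mark D c" using mc'[OF D] by (simp add: e_def mark_pull)
   then show ?thesis by simp
  next
   case False
   have "(\<Prod>E\<in>?S. ?k E - coset_mark G D (U E)) = 0" by (rule prod_zero[OF finS]) (use D False in auto)
   then show ?thesis using prod[OF D] by (simp add: a_def)
  qed
  then have "a * mark D (c - e) = mark D (coset_comb G n) * mark D (c - e)"
   by (simp only: left_diff_distrib right_minus_eq)
  then show "mark D d = mark D (frag_cmul a (c - e))" using d(2)[rule_format, OF D] by (simp only: mark_simps)
 qed
 then have "frag_cmul a (c - e) + frag_cmul a e \<in> imprim_span F G"
  using imprim_span_add[OF F G finG] imprim_span_cmul[OF F G finG e] by blast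
 moreover have "frag_cmul a (c - e) + frag_cmul a e = frag_cmul a c"
  by (simp add: frag_cmul_distrib2[symmetric])
 ultimately show ?thesis using la by auto
qed

text \<open>The integers \<open>a\<close> with \<open>a c\<close> in the span form an ideal. It is
  not contained in any prime ideal generated by a prime number \<open>l\<close>, so its positive
  generator is \<open>1\<close>.\<close>

lemma relation_in_imprim_span:
 assumes c: "relation_over F G c"
 shows "c \<in> imprim_span F G"
proof (cases "\<exists>x\<in>carrier (G Mod P). generate (G Mod P) {x} = carrier (G Mod P)")
 case True
 then show ?thesis using span_cyclic[OF c] by blast
next
 case False
 note F = Mod_facts(5)
 let ?I = "imprim_span F G"
 have mult: "\<exists>a. \<not> int l dvd a \<and> frag_cmul a c \<in> ?I" if "prime l" for l
  using span_multiple_p[OF c] span_multiple_not_p[OF c that] False by metis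
 let ?Q = "\<lambda>n :: nat. 0 < n \<and> frag_cmul (int n) c \<in> ?I"
 \<comment> \<open>The prime \<open>2\<close> only serves to produce some non-zero multiple:
   \<open>b\<close> is odd.\<close>
 obtain b where b: "\<not> int 2 dvd b" "frag_cmul b c \<in> ?I" using mult[OF two_is_prime_nat] by blast
 have "frag_cmul (int (nat \<bar>b\<bar>)) c \<in> ?I"
  using b(2) imprim_span_uminus[OF F G finG b(2)] by (cases "b \<ge> 0") (simp_all add: abs_if)
 then have "?Q (nat \<bar>b\<bar>)" using b(1) by auto
 define n where "n = (LEAST n. ?Q n)"
 have n: "?Q n" unfolding n_def by (rule LeastI[of ?Q, OF \<open>?Q (nat \<bar>b\<bar>)\<close>])
 have min: "n \<le> j" if "?Q j" for j unfolding n_def by (rule Least_le[of ?Q, OF that])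
 have dvd: "int n dvd a" if a: "frag_cmul a c \<in> ?I" for a
 proof -
  have "frag_cmul a c - frag_cmul (a div int n) (frag_cmul (int n) c) \<in> ?I"
   using imprim_span_diff[OF F G finG a] imprim_span_cmul[OF F G finG] n by blast
  moreover have "frag_cmul a c - frag_cmul (a div int n) (frag_cmul (int n) c) = frag_cmul (int (nat (a mod int n))) c"
  proof -
   have "frag_cmul a c = frag_cmul (a div int n * int n + a mod int n) c" by simp
   then show ?thesis using n by (simp only: frag_cmul_distrib frag_cmul_cmul) simp
  qed
  ultimately have j: "frag_cmul (int (nat (a mod int n))) c \<in> ?I" by simp
  have r: "0 \<le> a mod int n" "a mod int n < int n" using n by simp_all
  have "\<not> 0 < nat (a mod int n)"
  proof
   assume "0 < nat (a mod int n)"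
   then have "n \<le> nat (a mod int n)" using j by (intro min) simp
   then show False using r by linarith
  qed
  then have "a mod int n = 0" using r by simp
  then show ?thesis by (simp add: dvd_eq_mod_eq_0)
 qed
 have "n = 1"
 proof (rule ccontr)
  assume "n \<noteq> 1"
  then obtain l where l: "prime l" "l dvd n" using prime_factor_nat by blast
  obtain a where a: "\<not> int l dvd a" "frag_cmul a c \<in> ?I" using mult[OF l(1)] by blast
  then show False using dvd[OF a(2)] l(2) dvd_trans[of "int l" "int n" a] by simp
 qed
 then show ?thesis using n by simp
qed

end

section \<open>Local rings and Dress groups\<close>

text \<open>Zorn's lemma on the ideals that avoid \<open>1\<close>. \<open>local_ring\<close> speaks
  of a unique maximal ideal, and the existence of maximal ideals above a given one turns this into a
  statement on units.\<close>

lemma (in cring) exists_maximalideal: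
 assumes I: "ideal I R" "\<one> \<notin> I"
 obtains M where "maximalideal M R" "I \<subseteq> M"
proof -
 let ?A = "{J. ideal J R \<and> I \<subseteq> J \<and> \<one> \<notin> J}"
 have "\<exists>M\<in>?A. \<forall>J\<in>?A. M \<subseteq> J \<longrightarrow> J = M"
 proof (rule subset_Zorn_nonempty)
  show "?A \<noteq> {}" using I by blast
  fix C assume C: "C \<noteq> {}" "subset.chain ?A C"
  then have id: "J \<in> C \<Longrightarrow> ideal J R" and CA: "C \<subseteq> ?A" and ch: "J \<in> C \<Longrightarrow> J' \<in> C \<Longrightarrow> J \<subseteq> J' \<or> J' \<subseteq> J" for J J'
   by (auto simp: subset.chain_def)
  have ac: "J \<in> C \<Longrightarrow> additive_subgroup J R" for J using id ideal_def by blast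
  have "ideal (\<Union>C) R"
  proof (rule idealI[OF ring_axioms])
   show "subgroup (\<Union>C) (add_monoid R)"
   proof (rule add.subgroupI)
    show "\<Union>C \<subseteq> carrier R" using ac additive_subgroup.a_subset by blast
    show "\<Union>C \<noteq> {}" using C(1) ac additive_subgroup.zero_closed by blast
    show "\<ominus> x \<in> \<Union>C" if x: "x \<in> \<Union>C" for x
    proof -
     obtain J where J: "J \<in> C" "x \<in> J" using x by blast
     then have "\<ominus> x \<in> J" using additive_subgroup.a_inv_closed[OF ac[OF J(1)]] by simp
     then show ?thesis using J(1) by blast
    qed
    show "x \<oplus> y \<in> \<Union>C" if xy: "x \<in> \<Union>C" "y \<in> \<Union>C" for x y
    proof -
     obtain J J' where J: "x \<in> J" "J \<in> C" "y \<in> J'" "J' \<in> C" using xy by blast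
     then obtain L where L: "L \<in> C" "x \<in> L" "y \<in> L" using ch[OF J(2,4)] by blast
     then have "x \<oplus> y \<in> L" using additive_subgroup.a_closed[OF ac[OF L(1)]] by simp
     then show ?thesis using L(1) by blast
    qed
   qed
   fix z x assume z: "z \<in> \<Union>C" and x: "x \<in> carrier R"
   obtain J where J: "J \<in> C" "z \<in> J" using z by blast
   have "x \<otimes> z \<in> J" "z \<otimes> x \<in> J"
    using ideal.I_l_closed[OF id[OF J(1)] J(2) x] ideal.I_r_closed[OF id[OF J(1)] J(2) x] .
   then show "x \<otimes> z \<in> \<Union>C" "z \<otimes> x \<in> \<Union>C" using J(1) by blast+
  qed
  moreover have "I \<subseteq> \<Union>C" "\<one> \<notin> \<Union>C" using C(1) CA by blast+
  ultimately show "\<Union>C \<in> ?A" by blast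
 qed
 then obtain M where M: "M \<in> ?A" and max: "\<forall>J\<in>?A. M \<subseteq> J \<longrightarrow> J = M" by (elim bexE)
 have "maximalideal M R"
 proof (rule maximalidealI)
  show "ideal M R" "carrier R \<noteq> M" using M by auto
  fix J assume J: "ideal J R" "M \<subseteq> J" "J \<subseteq> carrier R"
  show "J = M \<or> J = carrier R"
  proof (cases "\<one> \<in> J")
   case True
   then show ?thesis using ideal.one_imp_carrier[OF J(1)] by simp
  next
   case False
   then have "J \<in> ?A" using J M by auto
   then show ?thesis using max J(2) by simp
  qed
 qed
 then show thesis using that M by simp
qed

lemma residue_char_ideal_field:
 assumes "field F" "ring_char F = p"
 shows "residue_char_ideal F {\<zero>\<^bsub>F\<^esub>} p"
proof -
 interpret field F by fact
 have "[n] \<cdot>\<^bsub>F\<^esub> \<one>\<^bsub>F\<^esub> = \<zero>\<^bsub>F\<^esub> \<longleftrightarrow> p dvd n" for n :: nat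
  using group.pow_eq_id[OF a_group, of "\<one>\<^bsub>F\<^esub>" n] assms(2) by (simp add: ring_char_def add_pow_def)
 then show ?thesis
  using is_cring zeroideal field_Units by (simp add: residue_char_ideal_def)
qed

text \<open>A non-unit generates a proper ideal, which lies in a maximal ideal and hence in
  \<open>m\<close>. The multiples of \<open>1\<close> that lie in \<open>m\<close> are those that
  vanish in the residue field, where the additive order of \<open>1\<close> is
  \<open>p\<close>.\<close>

lemma residue_char_ideal_local:
 assumes F: "local_ring F" and p: "ring_char (residue_field F) = p"
 obtains m where "residue_char_ideal F m p"
proof -
 interpret cring F using F by (simp add: local_ring_def)
 define m where "m = (THE m. maximalideal m F)"
 have ex: "\<exists>!m. maximalideal m F" using F by (simp add: local_ring_def)
 have m: "maximalideal m F" unfolding m_def by (rule theI'[OF ex])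
 interpret m: maximalideal m F by (rule m)
 have "a \<in> Units F" if a: "a \<in> carrier F" "a \<notin> m" for a
 proof (rule ccontr)
  assume na: "a \<notin> Units F"
  have "\<one>\<^bsub>F\<^esub> \<notin> PIdl\<^bsub>F\<^esub> a" using na a(1) m_comm unfolding cgenideal_def Units_def by fastforce
  then obtain M where "maximalideal M F" "PIdl\<^bsub>F\<^esub> a \<subseteq> M" using exists_maximalideal[OF cgenideal_ideal[OF a(1)]] by blast
  then have "a \<in> m" using ex m cgenideal_self[OF a(1)] by blast
  then show False using a(2) by simp
 qed
 moreover have "[n] \<cdot>\<^bsub>F\<^esub> \<one>\<^bsub>F\<^esub> \<in> m \<longleftrightarrow> p dvd n" for n :: nat
 proof -
  let ?Q = "F Quot m"
  interpret Q: ring ?Q by (rule m.quotient_is_ring)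
  have hom: "(+>\<^bsub>F\<^esub>) m \<in> ring_hom F ?Q" by (rule m.rcos_ring_hom)
  have one: "\<one>\<^bsub>?Q\<^esub> = m +>\<^bsub>F\<^esub> \<one>\<^bsub>F\<^esub>" and zero: "\<zero>\<^bsub>?Q\<^esub> = m" by (simp_all add: FactRing_def)
  have "[n] \<cdot>\<^bsub>?Q\<^esub> \<one>\<^bsub>?Q\<^esub> = m +>\<^bsub>F\<^esub> ([n] \<cdot>\<^bsub>F\<^esub> \<one>\<^bsub>F\<^esub>)"
  proof (induction n)
   case 0
   then show ?case using m.a_rcos_const[OF m.zero_closed] by (simp add: zero add_pow_def)
  next
   case (Suc n)
   have "[Suc n] \<cdot>\<^bsub>?Q\<^esub> \<one>\<^bsub>?Q\<^esub> = [n] \<cdot>\<^bsub>?Q\<^esub> \<one>\<^bsub>?Q\<^esub> \<oplus>\<^bsub>?Q\<^esub> \<one>\<^bsub>?Q\<^esub>" by (simp add: add_pow_def)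
   also have "\<dots> = m +>\<^bsub>F\<^esub> ([n] \<cdot>\<^bsub>F\<^esub> \<one>\<^bsub>F\<^esub> \<oplus>\<^bsub>F\<^esub> \<one>\<^bsub>F\<^esub>)"
    unfolding Suc.IH unfolding one by (rule ring_hom_add[OF hom, symmetric]) simp_all
   finally show ?case by (simp add: add_pow_def)
  qed
  moreover have "[n] \<cdot>\<^bsub>?Q\<^esub> \<one>\<^bsub>?Q\<^esub> = \<zero>\<^bsub>?Q\<^esub> \<longleftrightarrow> p dvd n"
   using group.pow_eq_id[OF Q.a_group, of "\<one>\<^bsub>?Q\<^esub>" n] p
   by (simp add: ring_char_def residue_field_def m_def[symmetric] add_pow_def)
  moreover have "m +>\<^bsub>F\<^esub> ([n] \<cdot>\<^bsub>F\<^esub> \<one>\<^bsub>F\<^esub>) = m \<longleftrightarrow> [n] \<cdot>\<^bsub>F\<^esub> \<one>\<^bsub>F\<^esub> \<in> m"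
   using m.a_rcos_const[of "[n] \<cdot>\<^bsub>F\<^esub> \<one>\<^bsub>F\<^esub>"] m.a_rcos_self[of "[n] \<cdot>\<^bsub>F\<^esub> \<one>\<^bsub>F\<^esub>"] by auto
  ultimately show ?thesis by (simp add: zero)
 qed
 ultimately show thesis
  using that[of m] is_cring m.is_ideal by (simp add: residue_char_ideal_def)
qed

text \<open>The cyclic normal subgroup \<open>C\<close> has index a power of \<open>q\<close>, so
  its Sylow \<open>p\<close>-subgroup, generated by \<open>y^r\<close>, is one of \<open>K\<close>.
  It consists of all elements of \<open>C\<close> killed by \<open>p^a\<close>, a description stable
  under conjugation, and is therefore normal in \<open>K\<close>.\<close>

lemma quasi_elementary_p_subgroup:
 fixes K (structure)
 assumes K: "quasi_elementary q K" and p: "prime p" and q: "prime q" "q \<noteq> p"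
 obtains H a where "H \<lhd> K" "card H = p ^ a" "\<not> p dvd card (carrier K) div card H"
proof -
 interpret group K using K by (simp add: quasi_elementary_def)
 have finK: "finite (carrier K)" using K by (simp add: quasi_elementary_def)
 obtain C k where C: "C \<lhd> K" "cyclic_group (subgrp K C)" "card (rcosets C) = q ^ k"
  using K by (auto simp: quasi_elementary_def)
 interpret C: normal C K by (rule C(1))
 have Cs: "subgroup C K" by (rule C.subgroup_axioms)
 let ?C = "subgrp K C"
 interpret CG: group ?C by (rule subgroup_imp_group[OF Cs])
 have finC: "finite C" by (rule finite_subset[OF C.subset finK])
 obtain y where y: "y \<in> C" "subgroup_generated ?C {y} = ?C" using C(2) by (auto simp: cyclic_group_def)
 have yK: "y \<in> carrier K" using y(1) C.subset by blast
 have genC: "generate K {y} = C"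
 proof -
  have "carrier (subgroup_generated ?C {y}) = C" using y(2) by simp
  then have "generate ?C {y} = C" using y(1) by (simp add: carrier_subgroup_generated)
  then show ?thesis using generate_consistent[of "{y}" C] y(1) Cs by simp
 qed
 have oy: "ord y = card C" using generate_pow_card[OF yK] genC by simp
 have "C \<noteq> {}" using subgroup.one_closed[OF Cs] by blast
 then have cC: "card C \<noteq> 0" using finC by simp
 define a where "a = multiplicity p (card C)"
 define r where "r = card C div p ^ a"
 have ar: "card C = p ^ a * r" unfolding r_def a_def by (simp add: multiplicity_dvd)
 have pr: "\<not> p dvd r"
  unfolding r_def a_def using multiplicity_decompose[of "card C" p] cC prime_gt_1_nat[OF p] by simp
 have r0: "r \<noteq> 0" using ar cC by auto
 define H where "H = generate K {y [^] r}"
 have yr: "y [^] r \<in> carrier K" using yK by simp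
 have H: "subgroup H K" unfolding H_def by (rule generate_is_subgroup) (use yr in simp)
 have cH: "card H = p ^ a"
 proof -
  have "ord (y [^] r) = card C div r" by (rule ord_pow[OF yK _ r0, unfolded oy]) (simp add: ar)
  then show ?thesis using generate_pow_card[OF yr] ar r0 by (simp add: H_def)
 qed
 have HC: "H \<subseteq> C"
 proof -
  have "y [^] r \<in> C" using C.subgroup_axioms y(1) by (induction r) (simp_all add: C.m_closed)
  then show ?thesis unfolding H_def by (intro generate_subgroup_incl[OF _ Cs]) simp
 qed
 \<comment> \<open>If \<open>y^i\<close> is killed by \<open>p^a\<close>, then the order
   \<open>p^a * r\<close> of \<open>y\<close> divides \<open>i * p^a\<close>, so \<open>r\<close>
   divides \<open>i\<close>.\<close>
 have Hx: "x \<in> H" if x: "x \<in> C" "x [^] (p ^ a) = \<one>" for x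
 proof -
  have "ord y \<noteq> 0" using oy cC by simp
  then obtain i :: nat where i: "x = y [^] i" using generate_pow_nat[OF yK] genC x(1) by auto
  then have "y [^] (i * p ^ a) = \<one>" using x(2) yK by (simp add: nat_pow_pow)
  then have "p ^ a * r dvd i * p ^ a" using pow_eq_id[OF yK] oy ar by simp
  then have "r dvd i" using p prime_gt_0_nat[OF p] by (simp add: mult.commute)
  then obtain j where "i = r * j" by (rule dvdE)
  then have xj: "x = (y [^] r) [^] j" using i yK by (simp add: nat_pow_pow)
  have "y [^] r \<in> H" unfolding H_def by (rule generate.incl) simp
  then have "(y [^] r) [^] n \<in> H" for n :: nat
   by (induction n) (simp_all add: subgroup.one_closed[OF H] subgroup.m_closed[OF H])
  then show ?thesis using xj by simp
 qed
 have "H \<lhd> K" unfolding normal_inv_iff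
 proof (intro conjI ballI H)
  fix g h assume g: "g \<in> carrier K" and h: "h \<in> H"
  have hK: "h \<in> carrier K" using h subgroup.subset[OF H] by blast
  have pw: "(g \<otimes> h \<otimes> inv g) [^] n = g \<otimes> h [^] n \<otimes> inv g" for n :: nat
  proof (induction n)
   case (Suc n)
   have "(g \<otimes> h \<otimes> inv g) [^] Suc n = (g \<otimes> h [^] n \<otimes> inv g) \<otimes> (g \<otimes> h \<otimes> inv g)" using Suc by simp
   also have "\<dots> = g \<otimes> h [^] n \<otimes> (inv g \<otimes> g) \<otimes> h \<otimes> inv g" using g hK by (simp only: m_assoc m_closed inv_closed nat_pow_closed)
   finally show ?case using g hK by (simp add: m_assoc)
  qed (use g in simp)
  interpret HG: group "subgrp K H" by (rule subgroup_imp_group[OF H])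
  have "h [^]\<^bsub>(subgrp K H)\<^esub> (p ^ a) = \<one>" using HG.pow_order_eq_1[of h] h cH by (simp add: order_def)
  then have "h [^] (p ^ a) = \<one>" by (simp add: nat_pow_consistent[symmetric])
  then have "(g \<otimes> h \<otimes> inv g) [^] (p ^ a) = \<one>" using g by (simp add: pw)
  moreover have "g \<otimes> h \<otimes> inv g \<in> C" using C.inv_op_closed2[OF g] h HC by blast
  ultimately show "g \<otimes> h \<otimes> inv g \<in> H" by (intro Hx)
 qed
 moreover have "card (carrier K) div card H = q ^ k * r"
 proof -
  have "card (carrier K) = q ^ k * (p ^ a * r)" using lagrange[OF Cs] C(3) ar by (simp add: order_def)
  then show ?thesis using prime_gt_0_nat[OF p] by (simp add: cH)
 qed
 then have "\<not> p dvd card (carrier K) div card H"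
  using pr p q prime_dvd_mult_iff[OF p] prime_dvd_power[OF p] primes_dvd_imp_eq[OF p q(1)] by auto
 ultimately show thesis using that cH by blast
qed

text \<open>The preimage of the normal Sylow \<open>p\<close>-subgroup of the quasi-elementary
  quotient is an extension of it by a \<open>p\<close>-group, hence the normal Sylow
  \<open>p\<close>-subgroup of \<open>G\<close>.\<close>

lemma dress_group_p_subgroup:
 fixes G (structure)
 assumes G: "dress_group p q G" and p: "prime p" and q: "prime q" "q \<noteq> p" and core: "p_core p G \<noteq> {\<one>}"
 obtains P k where "P \<lhd> G" "card P = p ^ k" "P \<noteq> {\<one>}" "\<not> p dvd card (carrier G) div card P"
proof -
 interpret group G using G by (simp add: dress_group_def)
 have finG: "finite (carrier G)" using G by (simp add: dress_group_def)
 obtain N j where N: "N \<lhd> G" "card N = p ^ j" "quasi_elementary q (G Mod N)" using G by (auto simp: dress_group_def)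
 obtain H a where H: "H \<lhd> G Mod N" "card H = p ^ a" "\<not> p dvd card (carrier (G Mod N)) div card H"
  using quasi_elementary_p_subgroup[OF N(3) p q] by blast
 interpret pi: group_hom G "G Mod N" "\<lambda>g. N #> g" by (rule Mod_hom[OF N(1)])
 interpret H: normal H "G Mod N" by (rule H(1))
 define P where "P = {g \<in> carrier G. N #> g \<in> H}"
 have Ps: "subgroup P G" unfolding P_def by (rule preimage_subgroup[OF N(1) H.subgroup_axioms])
 have "P \<lhd> G" unfolding normal_inv_iff
 proof (intro conjI ballI Ps)
  fix g h assume g: "g \<in> carrier G" and h: "h \<in> P"
  then have h': "h \<in> carrier G" "N #> h \<in> H" by (simp_all add: P_def)
  have "N #> (g \<otimes> h \<otimes> inv g) = (N #> g) \<otimes>\<^bsub>G Mod N\<^esub> (N #> h) \<otimes>\<^bsub>G Mod N\<^esub> inv\<^bsub>G Mod N\<^esub> (N #> g)"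
   using g h' pi.hom_mult pi.hom_inv by (metis inv_closed m_closed)
  also have "\<dots> \<in> H" by (rule H.inv_op_closed2[OF pi.hom_closed[OF g] h'(2)])
  finally show "g \<otimes> h \<otimes> inv g \<in> P" using g h' by (simp add: P_def)
 qed
 moreover have cP: "card P = p ^ (j + a)"
  unfolding P_def coset_preimage_card[OF N(1) finG H.subset] by (simp add: N(2) H(2) power_add)
 moreover have idx: "\<not> p dvd card (carrier G) div card P"
 proof -
  have "card (carrier G) = card (carrier (G Mod N)) * card N"
   using lagrange[OF normal_imp_subgroup[OF N(1)]] by (simp add: order_def FactGroup_def)
  then have "card (carrier G) div card P = card (carrier (G Mod N)) div card H"
   using prime_gt_0_nat[OF p] by (simp add: cP N(2) H(2) power_add)
  then show ?thesis using H(3) by simp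
 qed
 \<comment> \<open>If \<open>P\<close> were trivial, \<open>p\<close> would not divide the order of
   \<open>G\<close>; the trivial group would be the only Sylow \<open>p\<close>-subgroup, against
   the hypothesis on the core.\<close>
 moreover have "P \<noteq> {\<one>}"
 proof
  assume P1: "P = {\<one>}"
  then have "\<not> p dvd order G" using idx by (simp add: order_def)
  then have "multiplicity p (order G) = 0" by (simp add: not_dvd_imp_multiplicity_0)
  then have "sylow_subgroups p G = {{\<one>}}"
   using subgroup.one_closed triv_subgroup by (auto simp: sylow_subgroups_def card_1_singleton_iff)
  then show False using core by (simp add: p_core_def)
 qed
 ultimately show thesis using that by blast
qed

theorem theorem3p2:
 fixes F :: "('f, 'c) ring_scheme" and G :: "('g, 'b) monoid_scheme" and p q :: nat
 assumes "prime p"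
  and "(field F \<and> ring_char F = p) \<or>
     (local_ring F \<and> finite (carrier (residue_field F)) \<and> ring_char (residue_field F) = p)"
  and "prime q" and "q \<noteq> p"
  and "group G" and "finite (carrier G)"
  and "dress_group p q G"
  and "p_core p G \<noteq> {\<one>\<^bsub>G\<^esub>}"
 shows "trivial_group (prim_group F G)"
proof -
 obtain m where m: "residue_char_ideal F m p"
  using assms(2) residue_char_ideal_field[of F p] residue_char_ideal_local[of F p] by blast
 then have F: "cring F" by (simp add: residue_char_ideal_def)
 obtain P k where P: "P \<lhd> G" "card P = p ^ k" "P \<noteq> {\<one>\<^bsub>G\<^esub>}" "\<not> p dvd card (carrier G) div card P"
  using dress_group_p_subgroup[OF assms(7,1,3,4,8)] .
 show ?thesis
  by (rule prim_group_trivial[OF F assms(5,6) relation_in_imprim_span[OF m assms(1,5,6) P]])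
qed

end
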